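(* Let $F:M^n\to\mathbb R^{n+1}_1$ be a null $C^r$-wave front. If $F$ is complete, then it can be reparametrized as a normal form $\mathcal F^f_+$, where $f:\Sigma^{n-1}\to\mathbb R^n_0$ is an immersion defined on a compact $(n-1)$-manifold $\Sigma^{n-1}$ whose principal curvatures are non-zero and all of the same sign everywhere. In particular, if $n\ge3$, then $f$ is a compact convex hypersurface in $\mathbb R^n_0$. On the other hand, if $n=2$, then $f$ is a closed locally convex regular curve in $\mathbb R^2_0$.
   Context: Here $n\ge 2$, $r=\infty$ or $r=\omega$ ($C^\omega$ means real analytic), and $M^n$ is a $C^r$-differentiable $n$-manifold. $\mathbb R^{n+1}_1$ is $\mathbb R^{n+1}$ with coordinates $(t,x_1,\dots,x_n)$ and Lorentzian inner product $\langle v,w\rangle=-v_0w_0+\sum_{i=1}^n v_iw_i$; $|\cdot|_E$ is the standard Euclidean norm on the same space. A non-zero vector $v$ is light-like if $\langle v,v\rangle=0$, and points in the future direction if $v_0>0$. $\mathbb R^n_0$ is Euclidean $n$-space. A $C^r$-map $F:M^n\to\mathbb R^{n+1}$ is a (co-orientable) $C^r$-wave front if there is a $C^r$-map $\tilde\alpha:M^n\to(\mathbb R^{n+1})^*\setminus\{0\}$ with $\tilde\alpha_p(dF_p(v))=0$ for all $p\in M^n$, $v\in T_pM^n$, such that $(F,\pi\circ\tilde\alpha):M^n\to\mathbb R^{n+1}\times P^*(\mathbb R^{n+1})$ is an immersion, $\pi$ being the projection onto the projective space $P^*(\mathbb R^{n+1})$ of $(\mathbb R^{n+1})^*$. All wave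 fronts here are co-orientable. Such an $F$ is null if the vector field $\hat\xi$ along $F$ given by $\langle\hat\xi_p,x\rangle=\tilde\alpha_p(x)$ is light-like at every $p$. The $E$-normalized normal vector field $\hat\xi_E$ is the rescaling of $\hat\xi$ pointing in the future direction with $|\hat\xi_E|_E=\sqrt2$. The $E$-normalized null vector field $\xi_E$ is the unique $C^r$ vector field on $M^n$ with $dF(\xi_E)=\hat\xi_E$ whose integral curves are mapped by $F$ into light-like lines (it exists for every null wave front). $F$ is $L$-complete if for each $p\in M^n$ there is an integral curve $\gamma:\mathbb R\to M^n$ of $\xi_E$ through $p$ such that $F\circ\gamma(\mathbb R)$ is an entire light-like line. A singular point of $F$ is a point where $F$ is not an immersion. $F$ is complete if it is $L$-complete and its singular set is a non-empty compact subset of $M^n$. For a map $f:\Sigma^{n-1}\to\mathbb R^n_0$ with unit normal vector field $\nu$, the normal form is $\mathcal F^f_+(t,x):=(0,f(x))+t(1,\nu(x))$ on $\mathbb R\times\Sigma^{n-1}$. That $F$ can be reparametrized as the normal form $\mathcal F^f_+$ means that there is a diffeomorphism $\Phi:M^n\to\mathbb R\times\Sigma^{n-1}$ with $F\circ\Phi^{-1}=\mathcal F^f_+$. Principal curvatures of $f$ are taken with respect to $\nu$. A compact convex hypersurface is an embedded compact hypersurface that bounds a convex body (a compact convex set with non-empty interior). A closed regular plane curve is locally convex here if its curvature vanishes nowhere (it may have self-intersections).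
   Formalization: The normal form is that of F translated along the time axis by some c, with c = 0 if F has no singular point at t = 0 (for the light-cone F(t,x) = (t,tx) the literal claim forces f = 0, not an immersion); M^n is assumed connected, without which the claim fails. *)

theory Defs
  imports "HOL-Analysis.Analysis"
begin

section \<open>Smooth and real analytic maps between Euclidean spaces\<close>

datatype regularity = Cinf | Comega

text \<open>\<open>Ck_on k f U\<close> is only used on open \<open>U\<close>; on a finite-dimensional space, all iterated
  directional derivatives of order at most \<open>k\<close> being continuous is the usual notion.\<close>

primrec Ck_on :: "nat \<Rightarrow> ('a::real_normed_vector \<Rightarrow> 'b::real_normed_vector) \<Rightarrow> 'a set \<Rightarrow> bool" where
  "Ck_on 0 f U \<longleftrightarrow> continuous_on U f"
| "Ck_on (Suc k) f U \<longleftrightarrow>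
     (\<forall>x\<in>U. f differentiable (at x)) \<and> (\<forall>v. Ck_on k (\<lambda>x. frechet_derivative f (at x) v) U)"

text \<open>Multi-indices are the functions \<open>k \<in> Basis \<rightarrow>\<^sub>E UNIV\<close>, and \<open>has_sum\<close> is unconditional
  summation over them.\<close>

definition real_analytic_on ::
    "('a::euclidean_space \<Rightarrow> 'b::real_normed_vector) \<Rightarrow> 'a set \<Rightarrow> bool" where
  "real_analytic_on f U \<longleftrightarrow>
     (\<forall>a\<in>U. \<exists>\<rho>>0. \<exists>c :: ('a \<Rightarrow> nat) \<Rightarrow> 'b. \<forall>x\<in>ball a \<rho>.
        ((\<lambda>k. (\<Prod>i\<in>Basis. ((x - a) \<bullet> i) ^ k i) *\<^sub>R c k) has_sum f x) (Basis \<rightarrow>\<^sub>E (UNIV :: nat set)))"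

definition Cr_on ::
    "regularity \<Rightarrow> ('a::euclidean_space \<Rightarrow> 'b::real_normed_vector) \<Rightarrow> 'a set \<Rightarrow> bool" where
  "Cr_on r f U \<longleftrightarrow>
     (case r of Cinf \<Rightarrow> (\<forall>k. Ck_on k f U) | Comega \<Rightarrow> real_analytic_on f U)"

section \<open>Manifolds\<close>

text \<open>A manifold is a topology together with an atlas (not necessarily maximal). A chart is a pair
  of its domain and the coordinate map, with values in the model space \<open>'e\<close>; the dimension of the
  manifold is that of \<open>'e\<close>.\<close>

type_synonym ('m, 'e) chart = "'m set \<times> ('m \<Rightarrow> 'e)"

record ('m, 'e) mfd =
  mtop :: "'m topology"
  charts :: "('m, 'e) chart set"

definition chart_inv :: "('m, 'e) chart \<Rightarrow> 'e \<Rightarrow> 'm" where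
  "chart_inv c = inv_into (fst c) (snd c)"

definition charts_at :: "('m, 'e) mfd \<Rightarrow> 'm \<Rightarrow> ('m, 'e) chart set" where
  "charts_at M p = {c \<in> charts M. p \<in> fst c}"

text \<open>Manifolds are connected, as usual in global differential geometry.\<close>

definition Cr_manifold :: "regularity \<Rightarrow> ('m, 'e::euclidean_space) mfd \<Rightarrow> bool" where
  "Cr_manifold r M \<longleftrightarrow>
     Hausdorff_space (mtop M) \<and> second_countable (mtop M) \<and> connected_space (mtop M) \<and>
     \<Union> (fst ` charts M) = topspace (mtop M) \<and>
     (\<forall>c\<in>charts M. openin (mtop M) (fst c) \<and> open (snd c ` fst c) \<and>
        homeomorphic_map (subtopology (mtop M) (fst c)) (top_of_set (snd c ` fst c)) (snd c)) \<and>
     (\<forall>c\<in>charts M. \<forall>d\<in>charts M. Cr_on r (snd d \<circ> chart_inv c) (snd c ` (fst c \<inter> fst d)))"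

definition Cr_map :: "regularity \<Rightarrow> ('m, 'e::euclidean_space) mfd \<Rightarrow>
    ('q, 'f::real_normed_vector) mfd \<Rightarrow> ('m \<Rightarrow> 'q) \<Rightarrow> bool" where
  "Cr_map r M N G \<longleftrightarrow>
     continuous_map (mtop M) (mtop N) G \<and>
     (\<forall>c\<in>charts M. \<forall>d\<in>charts N.
        Cr_on r (snd d \<circ> G \<circ> chart_inv c) (snd c ` (fst c \<inter> G -` fst d)))"

definition Cr_diffeo :: "regularity \<Rightarrow> ('m, 'e::euclidean_space) mfd \<Rightarrow>
    ('q, 'f::euclidean_space) mfd \<Rightarrow> ('m \<Rightarrow> 'q) \<Rightarrow> bool" where
  "Cr_diffeo r M N \<Phi> \<longleftrightarrow>
     bij_betw \<Phi> (topspace (mtop M)) (topspace (mtop N)) \<and>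
     Cr_map r M N \<Phi> \<and> Cr_map r N M (inv_into (topspace (mtop M)) \<Phi>)"

definition flat :: "('b::topological_space, 'b) mfd" where
  "flat = \<lparr>mtop = euclidean, charts = {(UNIV, id)}\<rparr>"

definition mfd_prod :: "('m, 'e) mfd \<Rightarrow> ('q, 'f) mfd \<Rightarrow> ('m \<times> 'q, 'e \<times> 'f) mfd" where
  "mfd_prod M N =
     \<lparr>mtop = prod_topology (mtop M) (mtop N),
      charts = {(U \<times> V, map_prod \<phi> \<psi>) | U \<phi> V \<psi>. (U, \<phi>) \<in> charts M \<and> (V, \<psi>) \<in> charts N}\<rparr>"

section \<open>Tangent vectors\<close>

text \<open>Derivative of \<open>G\<close> at \<open>p\<close> read in the chart \<open>c\<close>.\<close>

definition chart_deriv :: "('m, 'e::real_normed_vector) chart \<Rightarrow>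
    ('m \<Rightarrow> 'b::real_normed_vector) \<Rightarrow> 'm \<Rightarrow> 'e \<Rightarrow> 'b" where
  "chart_deriv c G p = frechet_derivative (G \<circ> chart_inv c) (at (snd c p))"

text \<open>A tangent vector at \<open>p\<close> is the family of its components in the charts around \<open>p\<close>, which
  transform by the derivatives of the coordinate changes. Components in charts whose domain does
  not contain \<open>p\<close> are set to zero, so that tangent vectors with equal components are equal.\<close>

definition tangent_space :: "('m, 'e::real_normed_vector) mfd \<Rightarrow> 'm \<Rightarrow>
    (('m, 'e) chart \<Rightarrow> 'e) set" where
  "tangent_space M p =
     {v. (\<forall>c\<in>charts_at M p. \<forall>d\<in>charts_at M p. v d = chart_deriv c (snd d) p (v c)) \<and>
         (\<forall>c. c \<notin> charts_at M p \<longrightarrow> v c = 0)}"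

text \<open>On tangent vectors and for differentiable \<open>G\<close> the value does not depend on the chart.\<close>

definition differential :: "('m, 'e::real_normed_vector) mfd \<Rightarrow>
    ('m \<Rightarrow> 'b::real_normed_vector) \<Rightarrow> 'm \<Rightarrow> (('m, 'e) chart \<Rightarrow> 'e) \<Rightarrow> 'b" where
  "differential M G p v = (let c = SOME c. c \<in> charts_at M p in chart_deriv c G p (v c))"

definition immersion_at :: "('m, 'e::real_normed_vector) mfd \<Rightarrow>
    ('q, 'f::real_normed_vector) mfd \<Rightarrow> ('m \<Rightarrow> 'q) \<Rightarrow> 'm \<Rightarrow> bool" where
  "immersion_at M N G p \<longleftrightarrow>
     (\<forall>d\<in>charts_at N (G p). inj_on (differential M (snd d \<circ> G) p) (tangent_space M p))"

definition Cr_immersion :: "regularity \<Rightarrow> ('m, 'e::euclidean_space) mfd \<Rightarrow>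
    ('q, 'f::real_normed_vector) mfd \<Rightarrow> ('m \<Rightarrow> 'q) \<Rightarrow> bool" where
  "Cr_immersion r M N G \<longleftrightarrow>
     Cr_map r M N G \<and> (\<forall>p\<in>topspace (mtop M). immersion_at M N G p)"

definition Cr_vector_field :: "regularity \<Rightarrow> ('m, 'e::euclidean_space) mfd \<Rightarrow>
    ('m \<Rightarrow> ('m, 'e) chart \<Rightarrow> 'e) \<Rightarrow> bool" where
  "Cr_vector_field r M X \<longleftrightarrow>
     (\<forall>p\<in>topspace (mtop M). X p \<in> tangent_space M p) \<and>
     (\<forall>c\<in>charts M. Cr_on r (\<lambda>y. X (chart_inv c y) c) (snd c ` fst c))"

definition integral_curve :: "('m, 'e::real_normed_vector) mfd \<Rightarrow>
    ('m \<Rightarrow> ('m, 'e) chart \<Rightarrow> 'e) \<Rightarrow> real set \<Rightarrow> (real \<Rightarrow> 'm) \<Rightarrow> bool" where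
  "integral_curve M X J \<gamma> \<longleftrightarrow>
     open J \<and> is_interval J \<and> continuous_map (top_of_set J) (mtop M) \<gamma> \<and>
     (\<forall>s\<in>J. \<forall>c\<in>charts_at M (\<gamma> s). ((snd c \<circ> \<gamma>) has_vector_derivative X (\<gamma> s) c) (at s))"

section \<open>Projective spaces\<close>

text \<open>Points of the projective space of \<open>'d\<close> are the lines \<open>span {a}\<close> with \<open>a \<noteq> 0\<close>, with the
  quotient topology. Every linear isomorphism \<open>L : \<real> \<times> 'e \<rightarrow> 'd\<close> provides the affine chart whose
  inverse is \<open>y \<mapsto> [L (1, y)]\<close>.\<close>

definition proj_points :: "'d::real_normed_vector set set" where
  "proj_points = {span {a} | a. a \<noteq> 0}"

definition proj_open :: "'d::real_normed_vector set set \<Rightarrow> bool" where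
  "proj_open U \<longleftrightarrow> U \<subseteq> proj_points \<and> open {a. a \<noteq> 0 \<and> span {a} \<in> U}"

definition affine_point :: "(real \<times> 'e \<Rightarrow> 'd::real_normed_vector) \<Rightarrow> 'e \<Rightarrow> 'd set" where
  "affine_point L y = span {L (1, y)}"

definition proj_space :: "('d::real_normed_vector set, 'e::real_normed_vector) mfd" where
  "proj_space =
     \<lparr>mtop = topology proj_open,
      charts = {(range (affine_point L), inv (affine_point L)) | L. linear L \<and> bij L}\<rparr>"

lemma istopology_proj_open: "istopology (proj_open :: 'd::real_normed_vector set set \<Rightarrow> bool)"
  unfolding istopology_def
proof (intro conjI allI impI)
  fix S T :: "'d set set" assume "proj_open S" "proj_open T"
  moreover have "{a. a \<noteq> 0 \<and> span {a} \<in> S \<inter> T} =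
      {a. a \<noteq> 0 \<and> span {a} \<in> S} \<inter> {a. a \<noteq> 0 \<and> span {a} \<in> T}" by blast
  ultimately show "proj_open (S \<inter> T)" by (auto simp: proj_open_def intro: open_Int)
next
  fix \<K> :: "'d set set set" assume "\<forall>K\<in>\<K>. proj_open K"
  moreover have "{a. a \<noteq> 0 \<and> span {a} \<in> \<Union>\<K>} = (\<Union>K\<in>\<K>. {a. a \<noteq> 0 \<and> span {a} \<in> K})" by blast
  ultimately show "proj_open (\<Union>\<K>)" by (auto simp: proj_open_def)
qed

section \<open>Lorentz-Minkowski space\<close>

text \<open>\<open>real \<times> 'b\<close> with first coordinate the time; \<open>norm\<close> on it is the Euclidean norm.\<close>

definition lorentz :: "real \<times> 'b::real_inner \<Rightarrow> real \<times> 'b \<Rightarrow> real" where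
  "lorentz v w = - (fst v * fst w) + snd v \<bullet> snd w"

definition light_like :: "real \<times> 'b::real_inner \<Rightarrow> bool" where
  "light_like v \<longleftrightarrow> v \<noteq> 0 \<and> lorentz v v = 0"

definition light_like_line :: "(real \<times> 'b::real_inner) set \<Rightarrow> bool" where
  "light_like_line l \<longleftrightarrow> (\<exists>q v. light_like v \<and> l = {q + s *\<^sub>R v | s. True})"

section \<open>Null wave fronts\<close>

text \<open>\<open>F\<close> is a (co-orientable) wave front if \<open>wave_front r M F \<alpha>\<close> for some \<open>\<alpha>\<close>, which plays the
  role of the lift to the dual space without its origin. The projective space of the dual is given
  charts with values in \<open>'b\<close>.\<close>

definition wave_front :: "regularity \<Rightarrow> ('m, 'e::euclidean_space) mfd \<Rightarrow>
    ('m \<Rightarrow> real \<times> 'b::euclidean_space) \<Rightarrow> ('m \<Rightarrow> (real \<times> 'b) \<Rightarrow>\<^sub>L real) \<Rightarrow> bool" where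
  "wave_front r M F \<alpha> \<longleftrightarrow>
     Cr_map r M flat F \<and> Cr_map r M flat \<alpha> \<and>
     (\<forall>p\<in>topspace (mtop M). \<alpha> p \<noteq> 0) \<and>
     (\<forall>p\<in>topspace (mtop M). \<forall>v\<in>tangent_space M p. blinfun_apply (\<alpha> p) (differential M F p v) = 0) \<and>
     Cr_immersion r M
       (mfd_prod flat (proj_space :: (((real \<times> 'b) \<Rightarrow>\<^sub>L real) set, 'b) mfd))
       (\<lambda>p. (F p, span {\<alpha> p}))"

definition xi_hat :: "('m \<Rightarrow> (real \<times> 'b::euclidean_space) \<Rightarrow>\<^sub>L real) \<Rightarrow> 'm \<Rightarrow> real \<times> 'b" where
  "xi_hat \<alpha> p = (THE w. \<forall>x. lorentz w x = blinfun_apply (\<alpha> p) x)"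

definition null_wave_front :: "regularity \<Rightarrow> ('m, 'e::euclidean_space) mfd \<Rightarrow>
    ('m \<Rightarrow> real \<times> 'b::euclidean_space) \<Rightarrow> ('m \<Rightarrow> (real \<times> 'b) \<Rightarrow>\<^sub>L real) \<Rightarrow> bool" where
  "null_wave_front r M F \<alpha> \<longleftrightarrow>
     wave_front r M F \<alpha> \<and> (\<forall>p\<in>topspace (mtop M). light_like (xi_hat \<alpha> p))"

definition xi_hat_E :: "('m \<Rightarrow> (real \<times> 'b::euclidean_space) \<Rightarrow>\<^sub>L real) \<Rightarrow> 'm \<Rightarrow> real \<times> 'b" where
  "xi_hat_E \<alpha> p = (THE w. (\<exists>a. w = a *\<^sub>R xi_hat \<alpha> p) \<and> 0 < fst w \<and> norm w = sqrt 2)"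

definition E_normalized_null_field :: "regularity \<Rightarrow> ('m, 'e::euclidean_space) mfd \<Rightarrow>
    ('m \<Rightarrow> real \<times> 'b::euclidean_space) \<Rightarrow> ('m \<Rightarrow> (real \<times> 'b) \<Rightarrow>\<^sub>L real) \<Rightarrow>
    ('m \<Rightarrow> ('m, 'e) chart \<Rightarrow> 'e) \<Rightarrow> bool" where
  "E_normalized_null_field r M F \<alpha> \<xi> \<longleftrightarrow>
     Cr_vector_field r M \<xi> \<and>
     (\<forall>p\<in>topspace (mtop M). differential M F p (\<xi> p) = xi_hat_E \<alpha> p) \<and>
     (\<forall>J \<gamma>. integral_curve M \<xi> J \<gamma> \<longrightarrow> (\<exists>l. light_like_line l \<and> F ` \<gamma> ` J \<subseteq> l))"

definition L_complete :: "regularity \<Rightarrow> ('m, 'e::euclidean_space) mfd \<Rightarrow>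
    ('m \<Rightarrow> real \<times> 'b::euclidean_space) \<Rightarrow> ('m \<Rightarrow> (real \<times> 'b) \<Rightarrow>\<^sub>L real) \<Rightarrow> bool" where
  "L_complete r M F \<alpha> \<longleftrightarrow>
     (\<exists>\<xi>. E_normalized_null_field r M F \<alpha> \<xi> \<and>
        (\<forall>p\<in>topspace (mtop M). \<exists>\<gamma>. integral_curve M \<xi> UNIV \<gamma> \<and> p \<in> range \<gamma> \<and>
           light_like_line (F ` range \<gamma>)))"

definition singular_set :: "('m, 'e::real_normed_vector) mfd \<Rightarrow>
    ('m \<Rightarrow> 'b::real_normed_vector) \<Rightarrow> 'm set" where
  "singular_set M F = {p \<in> topspace (mtop M). \<not> immersion_at M flat F p}"

definition complete_front :: "regularity \<Rightarrow> ('m, 'e::euclidean_space) mfd \<Rightarrow>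
    ('m \<Rightarrow> real \<times> 'b::euclidean_space) \<Rightarrow> ('m \<Rightarrow> (real \<times> 'b) \<Rightarrow>\<^sub>L real) \<Rightarrow> bool" where
  "complete_front r M F \<alpha> \<longleftrightarrow>
     L_complete r M F \<alpha> \<and> singular_set M F \<noteq> {} \<and> compactin (mtop M) (singular_set M F)"

section \<open>Hypersurfaces of Euclidean space and normal forms\<close>

definition unit_normal :: "regularity \<Rightarrow> ('s, 'k::euclidean_space) mfd \<Rightarrow>
    ('s \<Rightarrow> 'b::euclidean_space) \<Rightarrow> ('s \<Rightarrow> 'b) \<Rightarrow> bool" where
  "unit_normal r S f \<nu> \<longleftrightarrow>
     Cr_map r S flat \<nu> \<and>
     (\<forall>x\<in>topspace (mtop S). norm (\<nu> x) = 1 \<and>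
        (\<forall>v\<in>tangent_space S x. differential S f x v \<bullet> \<nu> x = 0))"

text \<open>The light-cone \<open>F (t, x) = (t, t x)\<close> on \<open>\<real> \<times> S\<^sup>n\<^sup>-\<^sup>1\<close> is a normal form only with \<open>f = 0\<close>, which is not an
  immersion. A normal form of an immersion \<open>f\<close> is available after a translation in time that moves
  the singular points away from the slice \<open>t = 0\<close>; the theorem uses it for \<open>F - (c, 0)\<close>, with
  \<open>c = 0\<close> if \<open>F\<close> has no singular point in that slice.\<close>

definition normal_form :: "('s \<Rightarrow> 'b::real_vector) \<Rightarrow> ('s \<Rightarrow> 'b) \<Rightarrow> real \<times> 's \<Rightarrow> real \<times> 'b" where
  "normal_form f \<nu> = (\<lambda>(t, x). (0, f x) + t *\<^sub>R (1, \<nu> x))"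

definition reparametrized_as :: "regularity \<Rightarrow> ('m, 'e::euclidean_space) mfd \<Rightarrow>
    ('m \<Rightarrow> real \<times> 'b::euclidean_space) \<Rightarrow> ('s, 'k::euclidean_space) mfd \<Rightarrow>
    (real \<times> 's \<Rightarrow> real \<times> 'b) \<Rightarrow> bool" where
  "reparametrized_as r M F S H \<longleftrightarrow>
     (\<exists>\<Phi>. Cr_diffeo r M (mfd_prod flat S) \<Phi> \<and>
        (\<forall>z\<in>topspace (mtop (mfd_prod flat S)). F (inv_into (topspace (mtop M)) \<Phi> z) = H z))"

text \<open>The eigenvalues of the shape operator \<open>A\<close>, which is given by \<open>df (A v) = - d\<nu> v\<close>.\<close>

definition principal_curvature :: "('s, 'k::euclidean_space) mfd \<Rightarrow>
    ('s \<Rightarrow> 'b::euclidean_space) \<Rightarrow> ('s \<Rightarrow> 'b) \<Rightarrow> 's \<Rightarrow> real \<Rightarrow> bool" where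
  "principal_curvature S f \<nu> x \<kappa> \<longleftrightarrow>
     (\<exists>v\<in>tangent_space S x. v \<noteq> (\<lambda>_. 0) \<and>
        - differential S \<nu> x v = \<kappa> *\<^sub>R differential S f x v)"

definition compact_convex_hypersurface :: "regularity \<Rightarrow> ('s, 'k::euclidean_space) mfd \<Rightarrow>
    ('s \<Rightarrow> 'b::euclidean_space) \<Rightarrow> bool" where
  "compact_convex_hypersurface r S f \<longleftrightarrow>
     compact_space (mtop S) \<and> Cr_immersion r S flat f \<and> embedding_map (mtop S) euclidean f \<and>
     (\<exists>K. compact K \<and> convex K \<and> interior K \<noteq> {} \<and> f ` topspace (mtop S) = frontier K)"

text \<open>The closed curve is the \<open>T\<close>-periodic \<open>f \<circ> \<sigma>\<close>, where \<open>\<sigma>\<close> identifies \<open>\<real> / T \<int>\<close> with the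
  1-manifold \<open>S\<close>; its curvature is taken with respect to the unit normal \<open>\<nu>\<close>.\<close>

definition plane_curvature :: "(real \<Rightarrow> 'b::euclidean_space) \<Rightarrow> (real \<Rightarrow> 'b) \<Rightarrow> real \<Rightarrow> real" where
  "plane_curvature \<beta> \<nu> s =
     (vector_derivative (\<lambda>u. vector_derivative \<beta> (at u)) (at s) \<bullet> \<nu> s)
       / (norm (vector_derivative \<beta> (at s)))\<^sup>2"

definition closed_locally_convex_regular_curve :: "regularity \<Rightarrow> ('s, 'k::euclidean_space) mfd \<Rightarrow>
    ('s \<Rightarrow> 'b::euclidean_space) \<Rightarrow> ('s \<Rightarrow> 'b) \<Rightarrow> bool" where
  "closed_locally_convex_regular_curve r S f \<nu> \<longleftrightarrow>
     (\<exists>\<sigma> T. 0 < T \<and> Cr_map r (flat :: (real, real) mfd) S \<sigma> \<and> range \<sigma> = topspace (mtop S) \<and>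
        (\<forall>s u. \<sigma> s = \<sigma> u \<longleftrightarrow> (\<exists>k::int. u = s + of_int k * T)) \<and>
        Cr_map r flat flat (f \<circ> \<sigma>) \<and>
        (\<forall>s. vector_derivative (f \<circ> \<sigma>) (at s) \<noteq> 0 \<and> plane_curvature (f \<circ> \<sigma>) (\<nu> \<circ> \<sigma>) s \<noteq> 0))"

end

theory Submission
	imports Defs "HOL-Complex_Analysis.Complex_Analysis"
begin

text \<open>The front is ruled by its null lines. The time \<open>T\<close> and the data \<open>P\<close> of the null line through a
	point, its foot at time 0 and its direction \<open>\<nu>\<close>, form an immersion, so the flow of the null field
	identifies the front with the normal form of a slice \<open>T = a\<close>. The singular points on the line
	through \<open>x\<close> lie at the distances \<open>- 1 / \<kappa>\<close>, where \<open>\<kappa>\<close> runs over the non-zero principal curvatures of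
	the slice at \<open>x\<close>. As the singular set is compact, these curvatures stay away from 0 and, the slice
	being connected, every line meets the singular set; hence the slice is compact. Definiteness of the second
	fundamental form at a farthest point spreads over the slice by connectedness and the curvature gap.
	The Gauss map is thus a local homeomorphism into the sphere. For \<open>n \<ge> 3\<close> the sphere is simply
	connected, so the Gauss map is injective, height functions have only two critical points and
	the slice is convex; for \<open>n = 2\<close> the circle lifts to a closed curve.\<close>

text \<open>Two obstacles shape the proof. Smooth and real analytic maps are treated at once: for
  C^k maps, closure under composition and inversion goes by induction on k, while for power series
  it is obtained on a holomorphic extension to the complexified space, with a return to real series
  through Cauchy estimates in several variables. And no flow theorem on the front is invoked:
  completeness supplies a curve through each point, its uniqueness comes from the local injectivity
  of (F, \<nu>), and smooth dependence on the starting point comes from inverting coordinates (T, Q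
  o P) with Q linear. As P is defined everywhere and constant along null lines, linear functions of
  P serve as charts of the slices. The slice has to avoid the singular set, since
  \<open>snd o F\<close> fails to be an immersion of the slice at a singular point; hence the
  translation in time. A bound for the times of singular points bounds the reciprocals of the
  non-zero principal curvatures. This gap turns definiteness, an open condition, into a closed
  inequality, which is what a connectedness argument requires.\<close>

abbreviation (input) pts where "pts M \<equiv> topspace (mtop M)"
abbreviation (input) der where "der \<equiv> chart_deriv"
abbreviation (input) cod where "cod c \<equiv> snd c ` fst c"
abbreviation (input) Df where "Df f x \<equiv> frechet_derivative f (at x)"
abbreviation (input) scale (infixr "*." 75) where "a *. x \<equiv> a *\<^sub>R x"

section \<open>Calculus of \<open>C\<^sup>k\<close> maps\<close>

lemma frechet_derivative_cong_open:
	assumes "open U" "x \<in> U" "\<And>y. y \<in> U ==> f y = g y"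
	shows "Df f x = Df g x"
proof -
	have "(f has_derivative D) (at x) \<longleftrightarrow> (g has_derivative D) (at x)" for D
		using has_derivative_transform_within_open[OF _ assms(1,2), of f D UNIV g]
			has_derivative_transform_within_open[OF _ assms(1,2), of g D UNIV f] assms(3) by auto
	thus ?thesis by (simp add: frechet_derivative_def)
qed

lemma differentiable_cong_open:
	assumes "open U" "x \<in> U" "\<And>y. y \<in> U ==> f y = g y" "f differentiable (at x)"
	shows "g differentiable (at x)"
	using assms has_derivative_transform_within_open[OF _ assms(1,2), of f _ UNIV g]
	unfolding differentiable_def by blast

lemma Ck_on_cong:
	assumes "open U" "\<And>x. x \<in> U ==> f x = g x" "Ck_on k f U"
	shows "Ck_on k g U"
	using assms(2,3)
proof (induction k arbitrary: f g)
	case 0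
	thus ?case by (simp cong: continuous_on_cong)
next
	case (Suc k)
	have "g differentiable (at x)" if "x \<in> U" for x
		using differentiable_cong_open[OF assms(1) that, of f g] Suc.prems that by simp
	moreover have "Ck_on k (\<lambda>x. Df g x v) U" for v
		using Suc.IH[of "\<lambda>x. Df f x v"] Suc.prems
			frechet_derivative_cong_open[OF assms(1), of _ f g] by simp
	ultimately show ?case by simp
qed

lemma Ck_on_subset: "Ck_on k f U ==> V \<subseteq> U ==> Ck_on k f V"
	by (induction k arbitrary: f) (auto intro: continuous_on_subset)

lemma Ck_on_local:
	assumes "open U" "\<And>x. x \<in> U ==> \<exists>V. open V \<and> x \<in> V \<and> Ck_on k f V"
	shows "Ck_on k f U"
	using assms(2)
proof (induction k arbitrary: f)
	case 0
	thus ?case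
		by (simp add: continuous_at_imp_continuous_on) (metis continuous_at_imp_continuous_on continuous_on_eq_continuous_at)
next
	case (Suc k)
	thus ?case by (simp) meson
qed

lemma Ck_on_Suc_D: "Ck_on (Suc k) f U ==> Ck_on k f U"
	by (induction k arbitrary: f)
		 (auto simp: continuous_at_imp_continuous_on differentiable_imp_continuous_within)

text \<open>Any explicit derivative \<open>D\<close> may stand in for
  \<open>frechet_derivative\<close>, so the inductions below can use the terms that the
  differentiation rules produce.\<close>

lemma Ck_on_SucI:
	assumes "open U" "\<And>x. x \<in> U ==> (f has_derivative D x) (at x)"
		"\<And>v. Ck_on k (\<lambda>x. D x v) U"
	shows "Ck_on (Suc k) f U"
proof -
	have "Ck_on k (\<lambda>x. Df f x v) U" for v
		by (rule Ck_on_cong[OF assms(1) _ assms(3)[of v]]) (simp add: frechet_derivative_at[OF assms(2), symmetric])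
	moreover have "f differentiable (at x)" if "x \<in> U" for x
		using assms(2)[OF that] by (auto simp: differentiable_def)
	ultimately show ?thesis by simp
qed

lemma Ck_on_SucE:
	assumes "Ck_on (Suc k) f U" "x \<in> U"
	shows "(f has_derivative Df f x) (at x)"
	using assms by (simp add: frechet_derivative_works[symmetric])

lemma Ck_on_const: "Ck_on k (\<lambda>x. c) U"
	by (induction k arbitrary: c) (auto simp: frechet_derivative_const)

lemma Ck_on_bounded_linear:
	assumes "open U" "bounded_linear L" "Ck_on k f U"
	shows "Ck_on k (\<lambda>x. L (f x)) U"
	using assms(3)
proof (induction k arbitrary: f)
	case 0
	thus ?case using assms(2) by (simp add: bounded_linear.continuous_on)
next
	case (Suc k)
	show ?case
		by (rule Ck_on_SucI[OF assms(1) bounded_linear.has_derivative[OF assms(2) Ck_on_SucE[OF Suc.prems]]])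
			 (use Suc in auto)
qed

lemma Ck_on_linear_fun:
	assumes "open U" "bounded_linear L"
	shows "Ck_on k L U"
proof (cases k)
	case 0
	thus ?thesis using assms(2) by (simp add: linear_continuous_on)
next
	case (Suc n)
	show ?thesis unfolding Suc
		by (rule Ck_on_SucI[OF assms(1) bounded_linear_imp_has_derivative[OF assms(2)] Ck_on_const])
qed

lemma Ck_on_add:
	assumes "open U" "Ck_on k f U" "Ck_on k g U"
	shows "Ck_on k (\<lambda>x. f x + g x) U"
	using assms(2,3)
proof (induction k arbitrary: f g)
	case 0
	thus ?case by (simp add: continuous_on_add)
next
	case (Suc k)
	show ?case
		by (rule Ck_on_SucI[OF assms(1) has_derivative_add[OF Ck_on_SucE[OF Suc.prems(1)] Ck_on_SucE[OF Suc.prems(2)]]])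
			 (use Suc in auto)
qed

lemma Ck_on_sum:
	assumes "open U" "\<And>i. i \<in> I ==> Ck_on k (f i) U"
	shows "Ck_on k (\<lambda>x. \<Sum>i\<in>I. f i x) U"
	using assms(2)
	by (induction I rule: infinite_finite_induct) (auto intro: Ck_on_const Ck_on_add[OF assms(1)])

lemma Ck_on_bilinear:
	assumes "open U" "bounded_bilinear B" "Ck_on k f U" "Ck_on k g U"
	shows "Ck_on k (\<lambda>x. B (f x) (g x)) U"
	using assms(3,4)
proof (induction k arbitrary: f g)
	case 0
	thus ?case using bounded_bilinear.continuous_on[OF assms(2)] by simp
next
	case (Suc k)
	show ?case
	proof (rule Ck_on_SucI[OF assms(1)])
		show "((\<lambda>x. B (f x) (g x)) has_derivative
			(\<lambda>h. B (f x) (Df g x h) + B (Df f x h) (g x))) (at x)"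
			if "x \<in> U" for x
			by (rule bounded_bilinear.FDERIV[OF assms(2) Ck_on_SucE[OF Suc.prems(1) that] Ck_on_SucE[OF Suc.prems(2) that]])
		show "Ck_on k (\<lambda>x. B (f x) (Df g x v) + B (Df f x v) (g x)) U" for v
			using Suc.IH[OF Ck_on_Suc_D] Suc.IH[OF _ Ck_on_Suc_D] Suc.prems
			by (intro Ck_on_add[OF assms(1)]) (auto simp del: Ck_on.simps(2) simp: Ck_on.simps(2)[of k f] Ck_on.simps(2)[of k g])
	qed
qed

lemma Ck_on_prod:
	fixes f :: "'i => 'a::real_normed_vector => real"
	assumes "open U" "\<And>i. i \<in> I ==> Ck_on k (f i) U"
	shows "Ck_on k (\<lambda>x. \<Prod>i\<in>I. f i x) U"
	using assms(2)
	by (induction I rule: infinite_finite_induct)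
		 (auto intro: Ck_on_const Ck_on_bilinear[OF assms(1) bounded_bilinear_mult])

lemma Ck_on_inverse_real:
	fixes f :: "'a::real_normed_vector => real"
	assumes "open U" "Ck_on k f U" "\<And>x. x \<in> U ==> f x \<noteq> 0"
	shows "Ck_on k (\<lambda>x. inverse (f x)) U"
	using assms(2)
proof (induction k)
	case 0
	thus ?case using assms(3) by (auto intro!: continuous_intros)
next
	case (Suc k)
	have IH: "Ck_on k (\<lambda>x. inverse (f x)) U" using Suc Ck_on_Suc_D by blast
	show ?case
	proof (rule Ck_on_SucI[OF assms(1)])
		show "((\<lambda>x. inverse (f x)) has_derivative
			 (\<lambda>h. - (inverse (f x) * Df f x h * inverse (f x)))) (at x)" if "x \<in> U" for x
			by (rule Deriv.has_derivative_inverse[OF assms(3)[OF that] Ck_on_SucE[OF Suc.prems that]])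
		have "Ck_on k (\<lambda>x. inverse (f x) * Df f x v * inverse (f x)) U" for v
			using Suc.prems by (intro Ck_on_bilinear[OF assms(1) bounded_bilinear_mult] IH) auto
		thus "Ck_on k (\<lambda>x. - (inverse (f x) * Df f x v * inverse (f x))) U" for v
			by (rule Ck_on_bounded_linear[OF assms(1) bounded_linear_minus[OF bounded_linear_ident]])
	qed
qed

lemma Ck_on_Pair:
	assumes "open U" "Ck_on k f U" "Ck_on k g U"
	shows "Ck_on k (\<lambda>x. (f x, g x)) U"
proof -
	have "Ck_on k (\<lambda>x. (f x, 0) + (0, g x)) U"
		by (intro Ck_on_add[OF assms(1)] Ck_on_bounded_linear[OF assms(1) _ assms(2)]
				Ck_on_bounded_linear[OF assms(1) _ assms(3)] bounded_linear_Pair bounded_linear_ident bounded_linear_zero)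
	thus ?thesis by simp
qed

lemma linear_euclidean_expand:
	fixes L :: "'a::euclidean_space => 'b::real_vector"
	assumes "linear L"
	shows "L v = (\<Sum>i\<in>Basis. (v \<bullet> i) *. L i)"
	using linear_sum[OF assms, of "\<lambda>i. (v \<bullet> i) *. i" Basis]
	by (simp add: euclidean_representation linear_scale[OF assms])

lemma Ck_on_compose:
	fixes f :: "'a::real_normed_vector => 'b::euclidean_space"
	assumes "open U" "open V" "f ` U \<subseteq> V" "Ck_on k f U" "Ck_on k g V"
	shows "Ck_on k (\<lambda>x. g (f x)) U"
	using assms(4,5)
proof (induction k arbitrary: g)
	case 0
	thus ?case using assms(3) continuous_on_compose2[of V g U f] by simp
next
	case (Suc k)
	have fx: "f x \<in> V" if "x \<in> U" for x using that assms(3) by auto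
	show ?case
	proof (rule Ck_on_SucI[OF assms(1)])
		show "((\<lambda>x. g (f x)) has_derivative
			(\<lambda>v. Df g (f x) (Df f x v))) (at x)" if "x \<in> U" for x
			using has_derivative_compose[OF Ck_on_SucE[OF Suc.prems(1) that] Ck_on_SucE[OF Suc.prems(2) fx[OF that]]] .
		fix v
		\<comment> \<open>The direction \<open>Df f x v\<close> varies with \<open>x\<close>, whereas
		  \<open>Ck_on\<close> speaks of derivatives in fixed directions; expanding it in the basis leaves
		  sums of products of C^k maps.\<close>
		have "Ck_on k (\<lambda>x. \<Sum>i\<in>Basis. (Df f x v \<bullet> i) *. Df g (f x) i) U"
		proof (rule Ck_on_sum[OF assms(1)], rule Ck_on_bilinear[OF assms(1) bounded_bilinear_scaleR])
			fix i :: 'b assume "i \<in> Basis"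
			show "Ck_on k (\<lambda>x. Df f x v \<bullet> i) U"
				using Suc.prems by (intro Ck_on_bounded_linear[OF assms(1) bounded_linear_inner_left]) auto
			show "Ck_on k (\<lambda>x. Df g (f x) i) U"
				using Suc.IH[of "\<lambda>y. Df g y i"] Suc.prems Ck_on_Suc_D by auto
		qed
		moreover have "(\<Sum>i\<in>Basis. (Df f x v \<bullet> i) *. Df g (f x) i)
			 = Df g (f x) (Df f x v)" if "x \<in> U" for x
			using linear_euclidean_expand[OF has_derivative_linear[OF Ck_on_SucE[OF Suc.prems(2) fx[OF that]]]]
			by metis
		ultimately show "Ck_on k (\<lambda>x. Df g (f x) (Df f x v)) U"
			by (rule Ck_on_cong[OF assms(1), rotated])
	qed
qed

lemma Ck_on_det:
	fixes A :: "'a::real_normed_vector => real ^ 'n ^ 'n"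
	assumes "open U" "\<And>i j. Ck_on k (\<lambda>x. A x $ i $ j) U"
	shows "Ck_on k (\<lambda>x. det (A x)) U"
	unfolding det_def
	by (intro Ck_on_sum[OF assms(1)] Ck_on_bilinear[OF assms(1) bounded_bilinear_mult] Ck_on_const
			Ck_on_prod[OF assms(1)] assms(2))

lemma Ck_on_vec:
	fixes f :: "'a::real_normed_vector => real ^ 'n"
	assumes "open U" "\<And>i. Ck_on k (\<lambda>x. f x $ i) U"
	shows "Ck_on k f U"
proof -
	have "Ck_on k (\<lambda>x. \<Sum>i\<in>UNIV. (f x $ i) *. axis i (1::real)) U"
		by (intro Ck_on_sum[OF assms(1)] Ck_on_bilinear[OF assms(1) bounded_bilinear_scaleR] Ck_on_const assms(2))
	moreover have "(\<Sum>i\<in>UNIV. (f x $ i) *. axis i (1::real)) = f x" for x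
		using basis_expansion[of "f x"] by (simp add: scalar_mult_eq_scaleR)
	ultimately show ?thesis by simp
qed

text \<open>By Cramer's rule the derivative of the inverse is a rational expression in the partial
	derivatives of \<open>h\<close>, evaluated along the inverse.\<close>

lemma Ck_on_inverse_map_vec:
	fixes h :: "real ^ 'n => real ^ 'n"
	assumes U: "open U" and V: "open V" and gV: "g ` V \<subseteq> U" and contg: "continuous_on V g"
		and hg: "\<And>y. y \<in> V ==> h (g y) = y"
		and h: "\<And>k. Ck_on k h U" and inj: "\<And>x. x \<in> U ==> inj (Df h x)"
	shows "Ck_on k g V"
proof (induction k)
	case 0
	thus ?case using contg by simp
next
	case (Suc k)
	let ?D = "\<lambda>x. Df h x"
	have hD: "(h has_derivative ?D x) (at x)" if "x \<in> U" for x
		using Ck_on_SucE[OF h[of "Suc 0"] that] .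
	have lin: "linear (?D x)" if "x \<in> U" for x using has_derivative_linear[OF hD[OF that]] .
	have gy: "g y \<in> U" if "y \<in> V" for y using that gV by auto
	define G where "G = (\<lambda>y w. inv (?D (g y)) w)"
	have linG: "linear (G y)" and GD: "G y \<circ> ?D (g y) = id" and DG: "?D (g y) (G y w) = w" if "y \<in> V" for y w
	proof -
		have bij: "bij (?D (g y))"
			using inj[OF gy[OF that]] linear_injective_imp_surjective[OF lin[OF gy[OF that]]] by (auto simp: bij_def)
		show "linear (G y)" unfolding G_def
			using inj_linear_imp_inv_linear[OF lin[OF gy[OF that]] inj[OF gy[OF that]]] by (simp add: eta_contract_eq)
		show "G y \<circ> ?D (g y) = id" using bij by (auto simp: G_def bij_def fun_eq_iff)
		show "?D (g y) (G y w) = w" using bij by (auto simp: G_def bij_def surj_f_inv_f)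
	qed
	have gD: "(g has_derivative G y) (at y)" if "y \<in> V" for y
	proof (rule has_derivative_inverse_basic[where f=h and f'="?D (g y)" and T=V])
		show "bounded_linear (G y)" using linG[OF that] linear_conv_bounded_linear by blast
		show "continuous (at y) g" using contg V that continuous_on_eq_continuous_at by blast
	qed (use that hD gy GD V hg in auto)
	show ?case
	proof (rule Ck_on_SucI[OF V gD])
		fix w :: "real ^ 'n"
		define N where "N = (\<lambda>y. matrix (?D (g y)))"
		have Nk: "Ck_on k (\<lambda>y. N y $ i $ j) V" for i j
		proof -
			have "Ck_on k (\<lambda>y. ?D (g y) (axis j 1)) V"
				using Ck_on_compose[OF V U gV Suc.IH, of "\<lambda>x. ?D x (axis j 1)"] h[of "Suc k"] by simp
			hence "Ck_on k (\<lambda>y. ?D (g y) (axis j 1) $ i) V"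
				by (rule Ck_on_bounded_linear[OF V bounded_linear_vec_nth])
			thus ?thesis by (simp add: N_def matrix_def)
		qed
		have Nv: "N y *v x = ?D (g y) x" if "y \<in> V" for x y
			using matrix_works[of "?D (g y)"] lin[OF gy[OF that]] by (simp add: N_def)
		have detN: "det (N y) \<noteq> 0" if "y \<in> V" for y
			using det_nz_iff_inj[of "?D (g y)"] lin[OF gy[OF that]] inj[OF gy[OF that]]
			by (simp add: N_def)
		have eq: "(\<chi> m. det (\<chi> i j. if j = m then w $ i else N y $ i $ j) * inverse (det (N y))) = G y w"
			if "y \<in> V" for y
			using cramer[OF detN[OF that], of "G y w" w] Nv[OF that] DG[OF that] by (simp add: divide_inverse)
		have "Ck_on k (\<lambda>y. (\<chi> m. det (\<chi> i j. if j = m then w $ i else N y $ i $ j) * inverse (det (N y)))) V"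
		proof (rule Ck_on_vec[OF V], simp, rule Ck_on_bilinear[OF V bounded_bilinear_mult])
			fix m :: 'n
			show "Ck_on k (\<lambda>y. det (\<chi> i j. if j = m then w $ i else N y $ i $ j)) V"
			proof (rule Ck_on_det[OF V])
				fix i j show "Ck_on k (\<lambda>y. (\<chi> i j. if j = m then w $ i else N y $ i $ j) $ i $ j) V"
					using Nk[of i j] by (cases "j = m") (auto intro: Ck_on_const)
			qed
			show "Ck_on k (\<lambda>y. inverse (det (N y))) V"
				by (rule Ck_on_inverse_real[OF V Ck_on_det[OF V Nk] detN])
		qed
		thus "Ck_on k (\<lambda>y. G y w) V"
			by (rule Ck_on_cong[OF V, rotated]) (rule eq)
	qed
qed

text \<open>Determinants need the same index type on both sides, so the target is identified with
  \<open>real ^ 'n\<close> by a linear isomorphism \<open>J\<close>.\<close>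

lemma Ck_on_inverse_map:
	fixes h :: "real ^ 'n => 'b::euclidean_space"
	assumes dim: "DIM('b) = CARD('n)"
		and U: "open U" and V: "open V" and gV: "g ` V \<subseteq> U" and contg: "continuous_on V g"
		and hg: "\<And>y. y \<in> V ==> h (g y) = y"
		and h: "\<And>k. Ck_on k h U" and inj: "\<And>x. x \<in> U ==> inj (Df h x)"
	shows "Ck_on k g V"
proof -
	have "DIM('b) = DIM(real ^ 'n)" using dim by simp
	then obtain J :: "'b => real ^ 'n" and K where J: "linear J" "linear K" "\<And>x. K (J x) = x" "\<And>x. J (K x) = x"
		by (metis isomorphisms_UNIV_UNIV)
	have bl: "bounded_linear J" "bounded_linear K" using J linear_conv_bounded_linear by blast+
	have openKV: "open (K -` V)"
		using V bl(2) open_vimage linear_continuous_on by blast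
	have "Ck_on k (\<lambda>y. g (K y)) (K -` V)" for k
	proof (rule Ck_on_inverse_map_vec[OF U openKV, where h="\<lambda>x. J (h x)"])
		show "continuous_on (K -` V) (\<lambda>y. g (K y))"
			using continuous_on_compose2[OF contg linear_continuous_on[OF bl(2)]] by blast
		show "Ck_on k (\<lambda>x. J (h x)) U" for k by (rule Ck_on_bounded_linear[OF U bl(1) h])
		fix x assume "x \<in> U"
		have "Df (\<lambda>x. J (h x)) x = (\<lambda>v. J (Df h x v))"
			by (rule frechet_derivative_at[symmetric, OF bounded_linear.has_derivative[OF bl(1) Ck_on_SucE[OF h[of "Suc 0"] \<open>x \<in> U\<close>]]])
		thus "inj (Df (\<lambda>x. J (h x)) x)"
			using inj[OF \<open>x \<in> U\<close>] J(3) by (metis (no_types, lifting) injD injI)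
	qed (use gV hg J in auto)
	hence "Ck_on k (\<lambda>y. g (K (J y))) V"
		using J by (intro Ck_on_compose[OF V openKV _ Ck_on_linear_fun[OF V bl(1)]]) auto
	thus ?thesis by (simp add: J)
qed


text \<open>Expanding \<open>v\<close> in the basis upgrades the continuity of each
  \<open>D x v\<close> to continuity in the operator norm. The linear injection \<open>D a\<close>
  is bounded below by some \<open>m\<close>; a perturbation of size \<open>m / 2\<close> leaves
  \<open>D x\<close> injective. Source and target may have different dimensions.\<close>

lemma C1_locally_injective:
	fixes f :: "'a::euclidean_space => 'b::euclidean_space"
	assumes U: "open U" "a \<in> U" and D: "\<And>x. x \<in> U ==> (f has_derivative D x) (at x)"
		and cont: "\<And>v. continuous_on U (\<lambda>x. D x v)" and inj: "inj (D a)"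
	obtains r where "r > 0" "ball a r \<subseteq> U" "inj_on f (ball a r)" "\<And>x. x \<in> ball a r ==> inj (D x)"
proof -
	have lin: "linear (D x)" if "x \<in> U" for x using has_derivative_linear[OF D[OF that]] .
	obtain g where g: "linear g" "g \<circ> D a = id"
		using linear_injective_left_inverse[OF lin[OF U(2)] inj] by blast
	have small: "\<exists>d>0. ball a d \<subseteq> U \<and> (\<forall>x\<in>ball a d. \<forall>v. norm (D x v - D a v) \<le> e * norm v)" if "e > 0" for e
	proof -
		let ?S = "\<lambda>x. \<Sum>i\<in>Basis. norm (D x i - D a i)"
		have "continuous_on U ?S" by (intro continuous_intros cont)
		hence "isCont ?S a" using U continuous_on_eq_continuous_at by blast
		hence "\<exists>d1>0. \<forall>x. dist x a < d1 --> dist (?S x) (?S a) < e"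
			unfolding continuous_at_eps_delta using that by blast
		then obtain d1 where d1: "d1 > 0" "\<And>x. dist x a < d1 ==> dist (?S x) (?S a) < e" by blast
		obtain d2 where d2: "d2 > 0" "ball a d2 \<subseteq> U" using U openE by blast
		have "norm (D x v - D a v) \<le> e * norm v" if x: "x \<in> ball a (min d1 d2)" for x v
		proof -
			have xU: "x \<in> U" using x d2 by auto
			have S: "?S x < e" using d1(2)[of x] x by (auto simp: dist_commute dist_real_def)
			have "D x v - D a v = (\<Sum>i\<in>Basis. (v \<bullet> i) *. (D x i - D a i))"
				using linear_euclidean_expand[OF lin[OF xU], of v] linear_euclidean_expand[OF lin[OF U(2)], of v]
				by (simp add: scaleR_diff_right sum_subtractf)
			also have "norm \<dots> \<le> (\<Sum>i\<in>Basis. norm v * norm (D x i - D a i))"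
				by (rule sum_norm_le) (simp add: Basis_le_norm mult_right_mono)
			also have "\<dots> = ?S x * norm v" by (simp add: sum_distrib_left mult.commute)
			also have "\<dots> \<le> e * norm v" using S by (simp add: mult_right_mono)
			finally show ?thesis .
		qed
		thus ?thesis using d1(1) d2 by (intro exI[of _ "min d1 d2"]) auto
	qed
	have "\<exists>d>0. \<forall>x. dist a x < d --> onorm (\<lambda>v. D x v - D a v) < e" if "e > 0" for e
	proof -
		have "e / 2 > 0" using that by simp
		then obtain d where d: "d > 0" "\<forall>x\<in>ball a d. \<forall>v. norm (D x v - D a v) \<le> (e/2) * norm v"
			using small by blast
		have "onorm (\<lambda>v. D x v - D a v) < e" if "dist a x < d" for x
		proof -
			have "onorm (\<lambda>v. D x v - D a v) \<le> e/2"
				using d(2) that by (intro onorm_le) (auto simp: )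
			thus ?thesis using \<open>e > 0\<close> by simp
		qed
		thus ?thesis using d(1) by blast
	qed
	then obtain r1 where r1: "r1 > 0" "ball a r1 \<subseteq> U" "inj_on f (ball a r1)"
		using has_derivative_locally_injective[of a U g D f] U g D linear_conv_bounded_linear by blast
	obtain m where m: "m > 0" "\<And>v. m * norm v \<le> norm (D a v)"
		using linear_inj_bounded_below_pos[OF lin[OF U(2)] inj] by (auto simp: mult.commute)
	obtain d where d: "d > 0" "ball a d \<subseteq> U" "\<And>x v. x \<in> ball a d ==> norm (D x v - D a v) \<le> (m/2) * norm v"
		using small[of "m/2"] m by (metis half_gt_zero)
	have "inj (D x)" if "x \<in> ball a d" for x
	proof -
		have xU: "x \<in> U" using that d by auto
		have "v = 0" if "D x v = 0" for v
		proof (rule ccontr)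
			assume "v \<noteq> 0"
			hence "m * norm v \<le> (m/2) * norm v"
				using m(2)[of v] d(3)[OF \<open>x \<in> ball a d\<close>, of v] that by simp
			thus False using m(1) \<open>v \<noteq> 0\<close> by simp
		qed
		thus ?thesis using linear_injective_0[OF lin[OF xU]] by blast
	qed
	thus ?thesis using r1 d
		by (intro that[of "min r1 d"]) (auto intro: inj_on_subset)
qed

section \<open>Separately holomorphic functions\<close>

text \<open>Cauchy's inequality is applied on the circle of radius \<open>r / 2\<close>, whose
  closed disc lies in the open domain; the price is the factor \<open>2 ^ m\<close>.\<close>

lemma higher_deriv_bound_half:
	assumes "h holomorphic_on ball 0 r" "0 < r" "\<And>w. w \<in> ball 0 r ==> norm (h w) \<le> B"
	shows "norm ((deriv ^^ m) h 0 / fact m) \<le> B * (2 / r) ^ m"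
proof -
	have "norm ((deriv ^^ m) h 0) \<le> fact m * B / (r/2) ^ m"
	proof (rule Cauchy_inequality)
		show "h holomorphic_on ball 0 (r / 2)" by (rule holomorphic_on_subset[OF assms(1)]) (use assms in auto)
		show "continuous_on (cball 0 (r / 2)) h"
			by (rule continuous_on_subset[OF holomorphic_on_imp_continuous_on[OF assms(1)]]) (use assms in auto)
	qed (use assms in auto)
	thus ?thesis by (simp add: norm_divide field_simps power_divide)
qed

text \<open>For \<open>norm w \<le> r / 4\<close> the ratio of the majorizing geometric series is at
  most 1/2, so its tail is at most twice its first term.\<close>

lemma taylor_remainder_bound:
	assumes "h holomorphic_on ball 0 r" "0 < r" "\<And>w. w \<in> ball 0 r ==> norm (h w) \<le> B" "norm w \<le> r / 4"
	shows "norm (h w - (\<Sum>j\<le>m. (deriv ^^ j) h 0 / fact j * w ^ j)) \<le> 2 * B * (2 * norm w / r) ^ Suc m"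
proof -
	let ?a = "\<lambda>j. (deriv ^^ j) h 0 / fact j * w ^ j" and ?q = "2 * norm w / r"
	have B: "0 \<le> B" using assms(2) assms(3)[of 0] norm_ge_zero[of "h 0"] by (simp del: norm_ge_zero)
	have q: "0 \<le> ?q" "?q \<le> 1/2" using assms by (auto simp: field_simps)
	have "w \<in> ball 0 r" using assms by auto
	hence s: "?a sums h w" using holomorphic_power_series[OF assms(1)] by simp
	have 1: "(\<lambda>i. ?a (i + Suc m)) sums (h w - (\<Sum>j<Suc m. ?a j))"
		by (rule sums_split_initial_segment[OF s])
	have "(\<lambda>i. B * c ^ (i + Suc m)) sums (B * c ^ Suc m * (1 / (1 - c)))" if "0 \<le> c" "c \<le> 1/2" for c
		using sums_mult[OF geometric_sums[of c], of "B * c ^ Suc m"] that by (simp add: power_add mult_ac)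
	hence 2: "(\<lambda>i. B * ?q ^ (i + Suc m)) sums (B * ?q ^ Suc m * (1 / (1 - ?q)))" using q by blast
	have "norm (?a j) \<le> B * ?q ^ j" for j
	proof -
		have "norm (?a j) = norm ((deriv ^^ j) h 0 / fact j) * norm w ^ j" by (simp only: norm_mult norm_power)
		also have "\<dots> \<le> B * (2 / r) ^ j * norm w ^ j"
			by (intro mult_right_mono higher_deriv_bound_half assms(1-3)) auto
		finally show ?thesis by (simp add: power_mult_distrib power_divide)
	qed
	hence "norm (h w - (\<Sum>j<Suc m. ?a j)) \<le> B * ?q ^ Suc m * (1 / (1 - ?q))"
		by (intro norm_sums_le[OF 1 2])
	also have "\<dots> \<le> B * ?q ^ Suc m * 2"
	proof (intro mult_left_mono mult_nonneg_nonneg B zero_le_power q)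
		have "1 / (1 - c) \<le> 2" if "c \<le> 1/2" for c :: real using that by (simp add: field_simps)
		thus "1 / (1 - ?q) \<le> 2" by this (rule q(2))
	qed
	finally show ?thesis by (simp only: lessThan_Suc_atMost mult_ac)
qed

text \<open>Taylor coefficients in one variable depend holomorphically on the parameter, because they are
	uniform limits of divided Taylor remainders.\<close>

lemma taylor_coeff_holomorphic:
	fixes K :: "complex => complex => complex"
	assumes D: "open D" and r: "0 < r"
		and K1: "\<And>u. u \<in> D ==> K u holomorphic_on ball 0 r"
		and K2: "\<And>w. w \<in> ball 0 r ==> (\<lambda>u. K u w) holomorphic_on D"
		and bd: "\<And>u w. u \<in> D ==> w \<in> ball 0 r ==> norm (K u w) \<le> B"
	shows "(\<lambda>u. (deriv ^^ m) (K u) 0 / fact m) holomorphic_on D"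
proof (induction m rule: less_induct)
	case (less m)
	let ?a = "\<lambda>j u. (deriv ^^ j) (K u) 0 / fact j"
	\<comment> \<open>Non-zero points tending to 0 inside the disc of radius \<open>r / 4\<close> on
	  which the remainder estimate holds.\<close>
	define w where "w = (\<lambda>N. complex_of_real (r / 4 / real (Suc N)))"
	have nw: "norm (w N) = r / 4 / real (Suc N)" for N
		using r unfolding w_def norm_of_real by auto
	have "norm (w N) > 0" for N unfolding nw using r by simp
	hence w0: "w N \<noteq> 0" for N by force
	have "r / 4 / real (Suc N) \<le> r / 4 / 1" for N by (rule divide_left_mono) (use r in auto)
	hence wle: "norm (w N) \<le> r / 4" for N unfolding nw by simp
	define f where "f = (\<lambda>N u. (K u (w N) - (\<Sum>j<m. ?a j u * w N ^ j)) / w N ^ m)"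
	\<comment> \<open>The remainder carries one more power of \<open>w N\<close> than the divisor, so
	  the error is linear in \<open>norm (w N)\<close>, uniformly in \<open>u\<close>.\<close>
	have err: "norm (f N u - ?a m u) \<le> 2 * B * (2 / r) ^ Suc m * norm (w N)" if "u \<in> D" for N u
	proof -
		have "f N u - ?a m u = (K u (w N) - (\<Sum>j\<le>m. ?a j u * w N ^ j)) / w N ^ m"
			using w0[of N] by (simp add: f_def diff_divide_distrib lessThan_Suc_atMost[symmetric] add_divide_distrib)
		also have "norm \<dots> \<le> 2 * B * (2 * norm (w N) / r) ^ Suc m / norm (w N) ^ m"
			unfolding norm_divide norm_power
			by (intro divide_right_mono taylor_remainder_bound[OF K1[OF that] r bd[OF that] wle]) auto
		also have "\<dots> = 2 * B * (2 / r) ^ Suc m * norm (w N)"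
			using w0[of N] by (simp add: power_mult_distrib power_divide field_simps)
		finally show ?thesis .
	qed
	have lim: "(\<lambda>N. 2 * B * (2 / r) ^ Suc m * norm (w N)) \<longlonglongrightarrow> 0"
		unfolding nw by (intro tendsto_mult_right_zero LIMSEQ_Suc lim_const_over_n)
	have ulim: "uniform_limit D f (?a m) sequentially"
		unfolding uniform_limit_iff
	proof (intro allI impI)
		fix e :: real assume "e > 0"
		with lim have "\<forall>\<^sub>F N in sequentially. 2 * B * (2 / r) ^ Suc m * norm (w N) < e"
			by (rule order_tendstoD(2))
		thus "\<forall>\<^sub>F N in sequentially. \<forall>u\<in>D. dist (f N u) (?a m u) < e"
			by eventually_elim (use err in \<open>auto simp: dist_norm intro: order.strict_trans1\<close>)
	qed
	have hol: "f N holomorphic_on D" for N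
		unfolding f_def
	proof (rule holomorphic_on_divide[OF holomorphic_on_diff[OF K2 holomorphic_on_sum] holomorphic_on_const])
		show "w N \<in> ball 0 r" using wle[of N] r by auto
		show "(\<lambda>u. ?a j u * w N ^ j) holomorphic_on D" if "j \<in> {..<m}" for j
			by (rule holomorphic_on_mult[OF less holomorphic_on_const]) (use that in auto)
	qed (use w0[of N] in auto)
	show ?case
	proof (rule holomorphic_uniform_sequence[OF D hol])
		fix x assume "x \<in> D"
		then obtain d where "d > 0" "cball x d \<subseteq> D" using D open_contains_cball by blast
		thus "\<exists>d>0. cball x d \<subseteq> D \<and> uniform_limit (cball x d) f (?a m) sequentially"
			using uniform_limit_on_subset[OF ulim] by blast
	qed
qed

text \<open>Points are functions on the whole index type; the first clause makes \<open>H\<close>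
  depend on the coordinates in \<open>I\<close> alone, which permits induction on \<open>I\<close>.
  The uniform bound takes the place of joint continuity: together with holomorphy in each variable
  it yields a power series, as in Osgood's lemma.\<close>

definition sep_hol :: "'i set => real => real => (('i => complex) => complex) => bool" where
	"sep_hol I r B H \<longleftrightarrow>
		 (\<forall>z z'. (\<forall>i\<in>I. z i = z' i) --> H z = H z') \<and>
		 (\<forall>z. (\<forall>i\<in>I. norm (z i) < r) --> norm (H z) \<le> B) \<and>
		 (\<forall>z. \<forall>i\<in>I. (\<forall>j\<in>I. norm (z j) < r) --> (\<lambda>w. H (z(i := w))) holomorphic_on ball 0 r)"

text \<open>The majorant for multi-index series. In the induction a multi-index on
  \<open>insert i I\<close> is split into its value at \<open>i\<close> and its restriction to
  \<open>I\<close>.\<close>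

lemma has_sum_prod_geometric:
	assumes "finite I" "0 \<le> (q::real)" "q < 1"
	shows "((\<lambda>k. \<Prod>i\<in>I. q ^ k i) has_sum (1 / (1 - q)) ^ card I) (I \<rightarrow>\<^sub>E (UNIV :: nat set))"
	using assms(1)
proof (induction I)
	case empty
	thus ?case by (simp add: has_sum_finite_iff)
next
	case (insert i I)
	let ?f = "\<lambda>(m, k). q ^ m * (\<Prod>j\<in>I. q ^ k j)" and ?P = "I \<rightarrow>\<^sub>E (UNIV :: nat set)"
	have g: "((\<lambda>m. q ^ m) has_sum 1 / (1 - q)) UNIV"
		using norm_summable_imp_has_sum[of "\<lambda>m. q ^ m" "1 / (1-q)"] geometric_sums[of q] summable_geometric[of q] assms
		by (simp add: norm_power)
	have 1: "((\<lambda>k. ?f (m, k)) has_sum q ^ m * (1 / (1 - q)) ^ card I) ?P" for m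
		using has_sum_cmult_right[OF insert.IH] by simp
	have 2: "((\<lambda>m. q ^ m * (1 / (1 - q)) ^ card I) has_sum (1 / (1 - q)) * (1 / (1 - q)) ^ card I) UNIV"
		by (rule has_sum_cmult_left[OF g])
	have "?f summable_on UNIV \<times> ?P"
		by (rule summable_on_SigmaI[OF 1])
			(use 2 assms in \<open>auto simp: summable_on_def intro!: prod_nonneg mult_nonneg_nonneg\<close>)
	hence "(?f has_sum (1 / (1 - q)) * (1 / (1 - q)) ^ card I) (UNIV \<times> ?P)"
		by (intro has_sum_SigmaI[OF 1 2])
	moreover have "(?f has_sum s) (UNIV \<times> ?P) \<longleftrightarrow>
		 ((\<lambda>k. \<Prod>j\<in>insert i I. q ^ k j) has_sum s) (insert i I \<rightarrow>\<^sub>E (UNIV :: nat set))" for s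
	proof (rule has_sum_reindex_bij_witness[where j="\<lambda>(m, k). k(i := m)" and i="\<lambda>k. (k i, restrict k I)"])
		fix a assume a: "a \<in> (UNIV :: nat set) \<times> ?P"
		obtain m k where mk: "a = (m, k)" "k \<in> ?P" using a by auto
		show "(\<lambda>k. (k i, restrict k I)) ((\<lambda>(m, k). k(i := m)) a) = a"
			using mk insert.hyps by (auto simp: restrict_def PiE_def extensional_def fun_eq_iff)
		show "(\<lambda>(m, k). k(i := m)) a \<in> insert i I \<rightarrow>\<^sub>E UNIV" using mk by (auto simp: PiE_def extensional_def)
		have "(\<Prod>j\<in>I. q ^ (k(i := m)) j) = (\<Prod>j\<in>I. q ^ k j)"
			by (rule prod.cong) (use insert.hyps in auto)
		thus "(\<Prod>j\<in>insert i I. q ^ ((\<lambda>(m, k). k(i := m)) a) j) = ?f a"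
			using mk insert.hyps by (simp del: fun_upd_apply) simp
	next
		fix b assume b: "b \<in> insert i I \<rightarrow>\<^sub>E (UNIV :: nat set)"
		show "(\<lambda>(m, k). k(i := m)) (b i, restrict b I) = b"
			using b by (auto simp: restrict_def PiE_def extensional_def fun_eq_iff)
		show "(b i, restrict b I) \<in> UNIV \<times> ?P" by auto
	qed simp
	ultimately show ?case using insert.hyps by simp
qed

text \<open>Induction on the variables: the Taylor coefficients in the variable \<open>i\<close> are
  again separately holomorphic in the others, with the bound \<open>B * (2 / r) ^ m\<close>, and
  their expansions are assembled into one series over all multi-indices.\<close>

lemma sep_hol_power_series:
	assumes "finite I" "0 < r" "0 \<le> B" "sep_hol I r B H"
	shows "\<exists>c. (\<forall>k. norm (c k) \<le> B * (2 / r) ^ (\<Sum>i\<in>I. k i)) \<and>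
		 (\<forall>z. (\<forall>i\<in>I. norm (z i) \<le> r / 4) -->
				((\<lambda>k. (\<Prod>i\<in>I. z i ^ k i) * c k) has_sum H z) (I \<rightarrow>\<^sub>E (UNIV :: nat set)))"
	using assms(1,3,4)
proof (induction I arbitrary: H B)
	case empty
	have "norm (H undefined) \<le> B" "H z = H undefined" for z using empty by (auto simp: sep_hol_def)
	thus ?case by (intro exI[of _ "\<lambda>k. H undefined"]) (auto simp: has_sum_finite_iff)
next
	case (insert i I)
	let ?P = "I \<rightarrow>\<^sub>E (UNIV :: nat set)"
	define a where "a = (\<lambda>m z. (deriv ^^ m) (\<lambda>w. H (z(i := w))) 0 / fact m)"
	have dep: "H z = H z'" if "\<And>j. j \<in> insert i I ==> z j = z' j" for z z'
		using insert.prems(2) that unfolding sep_hol_def by blast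
	have bd: "norm (H z) \<le> B" if "\<And>j. j \<in> insert i I ==> norm (z j) < r" for z
		using insert.prems(2) that unfolding sep_hol_def by blast
	have hol: "(\<lambda>w. H (z(l := w))) holomorphic_on ball 0 r"
		if "l \<in> insert i I" "\<And>j. j \<in> insert i I ==> norm (z j) < r" for z l
		using insert.prems(2) that unfolding sep_hol_def by blast
	have holi: "(\<lambda>w. H (z(i := w))) holomorphic_on ball 0 r" if "\<And>j. j \<in> I ==> norm (z j) < r" for z
	proof -
		have "(\<lambda>w. H (z(i := 0, i := w))) holomorphic_on ball 0 r" by (rule hol) (use that assms(2) in auto)
		thus ?thesis by simp
	qed
	have bdi: "norm (H (z(i := w))) \<le> B" if "\<And>j. j \<in> I ==> norm (z j) < r" "w \<in> ball 0 r" for z w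
		by (rule bd) (use that in auto)
	have aB: "norm (a m z) \<le> B * (2 / r) ^ m" if "\<And>j. j \<in> I ==> norm (z j) < r" for m z
		unfolding a_def by (rule higher_deriv_bound_half[OF holi assms(2) bdi]) (use that in auto)
	have "sep_hol I r (B * (2 / r) ^ m) (a m)" for m
		unfolding sep_hol_def
	proof (intro conjI allI ballI impI)
		fix z z' :: "'a => complex" assume "\<forall>i\<in>I. z i = z' i"
		hence "(\<lambda>w. H (z(i := w))) = (\<lambda>w. H (z'(i := w)))" by (intro ext dep) auto
		thus "a m z = a m z'" by (simp add: a_def)
	next
		fix z :: "'a => complex" assume "\<forall>i\<in>I. norm (z i) < r"
		thus "norm (a m z) \<le> B * (2 / r) ^ m" by (intro aB) auto
	next
		fix z :: "'a => complex" and l assume l: "l \<in> I" and z: "\<forall>j\<in>I. norm (z j) < r"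
		have li: "l \<noteq> i" using l insert.hyps by auto
		have "(\<lambda>u. (deriv ^^ m) (\<lambda>w. H (z(l := u, i := w))) 0 / fact m) holomorphic_on ball 0 r"
		proof (rule taylor_coeff_holomorphic[OF open_ball assms(2), where B=B])
			fix u :: complex assume "u \<in> ball 0 r"
			thus "(\<lambda>w. H (z(l := u, i := w))) holomorphic_on ball 0 r"
				using z by (intro holi) auto
		next
			fix w :: complex assume "w \<in> ball 0 r"
			hence "(\<lambda>u. H (z(i := w, l := u))) holomorphic_on ball 0 r" using z l by (intro hol) auto
			thus "(\<lambda>u. H (z(l := u, i := w))) holomorphic_on ball 0 r" by (simp add: fun_upd_twist[OF li])
		next
			fix u w :: complex assume "u \<in> ball 0 r" "w \<in> ball 0 r"
			thus "norm (H (z(l := u, i := w))) \<le> B" using z by (intro bdi) auto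
		qed
		thus "(\<lambda>w. a m (z(l := w))) holomorphic_on ball 0 r" by (simp add: a_def)
	qed
	hence "\<exists>c. (\<forall>k. norm (c k) \<le> B * (2 / r) ^ m * (2 / r) ^ (\<Sum>i\<in>I. k i)) \<and>
		 (\<forall>z. (\<forall>i\<in>I. norm (z i) \<le> r / 4) -->
				((\<lambda>k. (\<Prod>i\<in>I. z i ^ k i) * c k) has_sum a m z) ?P)" for m
		using insert.prems(1) assms(2) by (intro insert.IH) auto
	hence "\<exists>C. \<forall>m. (\<forall>k. norm (C m k) \<le> B * (2 / r) ^ m * (2 / r) ^ (\<Sum>i\<in>I. k i)) \<and>
		 (\<forall>z. (\<forall>i\<in>I. norm (z i) \<le> r / 4) -->
				((\<lambda>k. (\<Prod>i\<in>I. z i ^ k i) * C m k) has_sum a m z) ?P)"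
		by (intro choice allI)
	then obtain C where Cb: "\<And>m k. norm (C m k) \<le> B * (2 / r) ^ m * (2 / r) ^ (\<Sum>i\<in>I. k i)"
		and Cs: "\<And>m z. \<forall>i\<in>I. norm (z i) \<le> r / 4 ==> ((\<lambda>k. (\<Prod>i\<in>I. z i ^ k i) * C m k) has_sum a m z) ?P"
		by blast
	define c where "c = (\<lambda>k. C (k i) (restrict k I))"
	show ?case
	proof (intro exI[of _ c] conjI allI impI)
		fix k :: "'a => nat"
		show "norm (c k) \<le> B * (2 / r) ^ (\<Sum>i\<in>insert i I. k i)"
			using Cb[of "k i" "restrict k I"] insert.hyps by (simp add: c_def power_add mult_ac)
	next
		fix z :: "'a => complex" assume z: "\<forall>j\<in>insert i I. norm (z j) \<le> r / 4"
		let ?f = "\<lambda>(m, k). z i ^ m * ((\<Prod>j\<in>I. z j ^ k j) * C m k)"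
		have zr: "norm (z j) < r" if "j \<in> I" for j using z that assms(2) by force
		have 1: "((\<lambda>k. ?f (m, k)) has_sum z i ^ m * a m z) ?P" for m
			using has_sum_cmult_right[OF Cs[of z m]] z by simp
		have zi: "z i \<in> ball 0 r" "norm (z i) \<le> r / 4" using z assms(2) by auto
		have "(\<lambda>m. a m z * z i ^ m) sums H (z(i := z i))"
			using holomorphic_power_series[OF holi[of z] zi(1)] zr by (simp add: a_def)
		hence s: "(\<lambda>m. z i ^ m * a m z) sums H z" by (simp add: mult.commute)
		have q: "norm (z i) * (2 / r) \<le> 1 / 2" using zi assms(2) by (simp add: field_simps)
		have "norm (z i ^ m * a m z) \<le> B * (1 / 2) ^ m" for m
		proof -
			have "norm (z i ^ m * a m z) \<le> norm (z i) ^ m * (B * (2 / r) ^ m)"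
				unfolding norm_mult norm_power by (intro mult_left_mono aB zr) auto
			also have "\<dots> = B * (norm (z i) * (2 / r)) ^ m" by (simp only: power_mult_distrib mult_ac)
			also have "\<dots> \<le> B * (1 / 2) ^ m"
				using assms(2) insert.prems q by (intro mult_left_mono power_mono) auto
			finally show ?thesis .
		qed
		hence "summable (\<lambda>m. norm (z i ^ m * a m z))"
			by (intro summable_comparison_test'[of "\<lambda>m. B * (1 / 2) ^ m" 0, OF summable_mult[OF summable_geometric]]) auto
		hence 2: "((\<lambda>m. z i ^ m * a m z) has_sum H z) UNIV"
			using s by (rule norm_summable_imp_has_sum)
		\<comment> \<open>Every factor \<open>norm (z j) * (2 / r)\<close> is at most 1/2, so the double
		  family has a geometric majorant and the iterated sum may be read as one unordered sum.\<close>
		have fb: "norm (?f (m, k)) \<le> B * ((1/2) ^ m * (\<Prod>j\<in>I. (1/2) ^ k j))" for m k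
		proof -
			have "norm (?f (m, k)) \<le> norm (z i) ^ m * ((\<Prod>j\<in>I. norm (z j) ^ k j) * (B * (2 / r) ^ m * (2 / r) ^ (\<Sum>i\<in>I. k i)))"
				unfolding prod.case norm_mult norm_power prod_norm[symmetric]
				by (intro mult_left_mono Cb) (auto intro: prod_nonneg)
			also have "\<dots> = B * ((norm (z i) * (2 / r)) ^ m * (\<Prod>j\<in>I. (norm (z j) * (2 / r)) ^ k j))"
				by (simp only: power_mult_distrib prod.distrib power_sum mult_ac)
			also have "\<dots> \<le> B * ((1/2) ^ m * (\<Prod>j\<in>I. (1/2) ^ k j))"
				using z assms(2) insert.prems(1)
				by (intro mult_left_mono mult_mono prod_mono power_mono conjI)
					 (auto simp: field_simps intro!: prod_nonneg)
			finally show ?thesis .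
		qed
		have gm: "(\<lambda>m. (1/2::real) ^ m) summable_on UNIV"
			by (simp add: summable_on_UNIV_nonneg_real_iff)
		have "(\<lambda>(m, k). (1/2::real) ^ m * (\<Prod>j\<in>I. (1/2) ^ k j)) summable_on UNIV \<times> ?P"
		proof (rule summable_on_SigmaI)
			show "((\<lambda>k. (\<lambda>(m, k). (1/2::real) ^ m * (\<Prod>j\<in>I. (1/2) ^ k j)) (m, k)) has_sum (1/2) ^ m * 2 ^ card I) ?P" for m
				using has_sum_cmult_right[OF has_sum_prod_geometric[of I "1/2"], of "(1/2)^m"] insert.hyps by simp
			show "(\<lambda>m. (1/2::real) ^ m * 2 ^ card I) summable_on UNIV"
				by (rule summable_on_cmult_left[OF gm])
		qed (auto intro!: prod_nonneg mult_nonneg_nonneg)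
		hence "(\<lambda>x. B * (case x of (m, k) => (1/2::real) ^ m * (\<Prod>j\<in>I. (1/2) ^ k j))) summable_on UNIV \<times> ?P"
			by (rule summable_on_cmult_right)
		hence "(\<lambda>x. norm (?f x)) summable_on UNIV \<times> ?P"
			by (rule summable_on_comparison_test) (use fb in auto)
		hence "?f summable_on UNIV \<times> ?P" by (rule abs_summable_summable)
		hence "(?f has_sum H z) (UNIV \<times> ?P)" by (rule has_sum_SigmaI[OF 1 2])
		moreover have "(?f has_sum H z) (UNIV \<times> ?P) \<longleftrightarrow>
			((\<lambda>k. (\<Prod>j\<in>insert i I. z j ^ k j) * c k) has_sum H z) (insert i I \<rightarrow>\<^sub>E (UNIV :: nat set))"
		proof (rule has_sum_reindex_bij_witness[where j="\<lambda>(m, k). k(i := m)" and i="\<lambda>k. (k i, restrict k I)"])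
			fix a assume a: "a \<in> (UNIV :: nat set) \<times> ?P"
			obtain m k where mk: "a = (m, k)" "k \<in> ?P" using a by auto
			show r: "(\<lambda>k. (k i, restrict k I)) ((\<lambda>(m, k). k(i := m)) a) = a"
				using mk insert.hyps by (auto simp: restrict_def PiE_def extensional_def fun_eq_iff)
			show "(\<lambda>(m, k). k(i := m)) a \<in> insert i I \<rightarrow>\<^sub>E UNIV" using mk by (auto simp: PiE_def extensional_def)
			have "(\<Prod>j\<in>I. z j ^ (k(i := m)) j) = (\<Prod>j\<in>I. z j ^ k j)"
				by (rule prod.cong) (use insert.hyps in auto)
			moreover have "c (k(i := m)) = C m k" using r mk by (simp add: c_def)
			ultimately show "(\<Prod>j\<in>insert i I. z j ^ ((\<lambda>(m, k). k(i := m)) a) j) * c ((\<lambda>(m, k). k(i := m)) a) = ?f a"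
				using mk insert.hyps by (simp del: fun_upd_apply) simp
		next
			fix b assume b: "b \<in> insert i I \<rightarrow>\<^sub>E (UNIV :: nat set)"
			show "(\<lambda>(m, k). k(i := m)) (b i, restrict b I) = b"
				using b by (auto simp: restrict_def PiE_def extensional_def fun_eq_iff)
			show "(b i, restrict b I) \<in> UNIV \<times> ?P" by auto
		qed simp
		ultimately show "((\<lambda>k. (\<Prod>j\<in>insert i I. z j ^ k j) * c k) has_sum H z) (insert i I \<rightarrow>\<^sub>E (UNIV :: nat set))"
			by simp
	qed
qed

text \<open>The partial derivative is the first Taylor coefficient of \<open>H\<close> shifted to
  \<open>z i\<close>. The shifted disc has radius \<open>r / 2\<close>, and Cauchy's estimate there
  gives \<open>B * (2 / (r / 2))\<close>.\<close>

lemma sep_hol_partial: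
	assumes r: "0 < r" and H: "sep_hol I r B H" and i: "i \<in> I"
	shows "sep_hol I (r / 2) (B * (4 / r)) (\<lambda>z. deriv (\<lambda>w. H (z(i := w))) (z i))"
proof -
	have dep: "H z = H z'" if "\<And>j. j \<in> I ==> z j = z' j" for z z'
		using H that unfolding sep_hol_def by blast
	have bd: "norm (H z) \<le> B" if "\<And>j. j \<in> I ==> norm (z j) < r" for z
		using H that unfolding sep_hol_def by blast
	have hol: "(\<lambda>w. H (z(l := w))) holomorphic_on ball 0 r"
		if "l \<in> I" "\<And>j. j \<in> I ==> norm (z j) < r" for z l
		using H that unfolding sep_hol_def by blast
	have shift: "(\<lambda>w. H (z(i := z i + w))) holomorphic_on ball 0 (r / 2)"
		and sb: "w \<in> ball 0 (r / 2) ==> norm (H (z(i := z i + w))) \<le> B"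
		and sd: "deriv (\<lambda>w. H (z(i := w))) (z i) = deriv (\<lambda>w. H (z(i := z i + w))) 0"
		if z: "\<And>j. j \<in> I ==> norm (z j) < r / 2" for z w
	proof -
		have zr: "norm (z j) < r" if "j \<in> I" for j using z[OF that] r by simp
		have hz: "(\<lambda>w. H (z(i := w))) holomorphic_on ball 0 r" by (rule hol[OF i zr])
		have sub: "z i + w \<in> ball 0 r" if "w \<in> ball 0 (r / 2)" for w
			using norm_triangle_ineq[of "z i" w] z[OF i] that by auto
		have "((\<lambda>w. H (z(i := w))) \<circ> (\<lambda>w. z i + w)) holomorphic_on ball 0 (r / 2)"
			by (rule holomorphic_on_compose_gen[OF _ hz image_subsetI[OF sub]]) (auto intro!: holomorphic_intros)
		thus "(\<lambda>w. H (z(i := z i + w))) holomorphic_on ball 0 (r / 2)" by (simp add: o_def)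
		show "norm (H (z(i := z i + w))) \<le> B" if "w \<in> ball 0 (r / 2)"
			using sub[OF that] zr by (intro bd) auto
		have "(\<lambda>w. H (z(i := w))) field_differentiable at (z i)"
			using hz zr[OF i] by (simp add: holomorphic_on_open field_differentiable_def)
		thus "deriv (\<lambda>w. H (z(i := w))) (z i) = deriv (\<lambda>w. H (z(i := z i + w))) 0"
			using deriv_shift_0[of "\<lambda>w. H (z(i := w))" "z i"] by (simp add: o_def)
	qed
	show ?thesis
		unfolding sep_hol_def
	proof (intro conjI allI ballI impI)
		fix z z' :: "'a => complex" assume "\<forall>i\<in>I. z i = z' i"
		hence "(\<lambda>w. H (z(i := w))) = (\<lambda>w. H (z'(i := w)))" "z i = z' i" using i by (auto intro!: dep)
		thus "deriv (\<lambda>w. H (z(i := w))) (z i) = deriv (\<lambda>w. H (z'(i := w))) (z' i)" by simp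
	next
		fix z :: "'a => complex" assume z: "\<forall>i\<in>I. norm (z i) < r / 2"
		show "norm (deriv (\<lambda>w. H (z(i := w))) (z i)) \<le> B * (4 / r)"
			using higher_deriv_bound_half[OF shift _ sb, of z 1] z sd[of z] r by simp
	next
		fix z :: "'a => complex" and l assume l: "l \<in> I" and z: "\<forall>j\<in>I. norm (z j) < r / 2"
		have zr: "norm (z j) < r" if "j \<in> I" for j using z that r by force
		show "(\<lambda>w. deriv (\<lambda>w'. H (z(l := w, i := w'))) ((z(l := w)) i)) holomorphic_on ball 0 (r / 2)"
		proof (cases "l = i")
			case True
			have "deriv (\<lambda>w'. H (z(i := w'))) holomorphic_on ball 0 (r / 2)"
				by (rule holomorphic_on_subset[OF holomorphic_deriv[OF hol[OF i zr] open_ball]]) (use r in auto)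
			thus ?thesis using True by simp
		next
			case False
			have "(\<lambda>u. (deriv ^^ 1) (\<lambda>w. H (z(l := u, i := z i + w))) 0 / fact 1) holomorphic_on ball 0 (r / 2)"
			proof (rule taylor_coeff_holomorphic[OF open_ball, where B=B and r="r/2"])
				fix u :: complex assume u: "u \<in> ball 0 (r / 2)"
				show "(\<lambda>w. H (z(l := u, i := z i + w))) holomorphic_on ball 0 (r / 2)"
					using shift[of "z(l := u)"] z u False by auto
				fix w :: complex assume w: "w \<in> ball 0 (r / 2)"
				show "norm (H (z(l := u, i := z i + w))) \<le> B"
					using sb[of "z(l := u)" w] z u w False by auto
			next
				fix w :: complex assume w: "w \<in> ball 0 (r / 2)"
				have "norm (z i + w) < r" using norm_triangle_ineq[of "z i" w] z i w by force
				hence "(\<lambda>u. H (z(i := z i + w, l := u))) holomorphic_on ball 0 r"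
					using zr l by (intro hol) auto
				hence "(\<lambda>u. H (z(i := z i + w, l := u))) holomorphic_on ball 0 (r / 2)"
					by (rule holomorphic_on_subset) (use r in auto)
				thus "(\<lambda>u. H (z(l := u, i := z i + w))) holomorphic_on ball 0 (r / 2)"
					by (simp add: fun_upd_twist[OF False])
			qed (use r in auto)
			moreover have "deriv (\<lambda>w'. H (z(l := w, i := w'))) ((z(l := w)) i) =
					(deriv ^^ 1) (\<lambda>w'. H (z(l := w, i := z i + w'))) 0 / fact 1" if "w \<in> ball 0 (r / 2)" for w
				using sd[of "z(l := w)"] z that False by auto
			ultimately show ?thesis by (rule holomorphic_transform[OF _ sym])
		qed
	qed
qed

section \<open>Real analytic maps as restrictions of holomorphic maps\<close>

text \<open>The complexification of \<open>'a\<close> is \<open>'a \<times> 'a\<close>, with multiplication by the imaginary unit \<open>cJ\<close>.\<close>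

definition cJ :: "'a::real_vector \<times> 'a => 'a \<times> 'a" where
	"cJ v = (- snd v, fst v)"

text \<open>Holomorphy is real differentiability with a derivative commuting with the complex
  structures, the Cauchy-Riemann equations without coordinates. The derivative \<open>D\<close> is
  carried along so that its continuity can be stated separately.\<close>

definition hol_extension ::
		"('a::real_normed_vector => 'b::real_normed_vector) => ('a \<times> 'a => 'b \<times> 'b) =>
			('a \<times> 'a => 'a \<times> 'a => 'b \<times> 'b) => 'a => real => bool" where
	"hol_extension f G D a e \<longleftrightarrow> 0 < e \<and>
		 (\<forall>z\<in>ball (a, 0) e. (G has_derivative D z) (at z) \<and> (\<forall>v. D z (cJ v) = cJ (D z v))) \<and>
		 (\<forall>x\<in>ball a e. G (x, 0) = (f x, 0))"

definition hol_ext :: "('a::real_normed_vector => 'b::real_normed_vector) => 'a => bool" where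
	"hol_ext f a \<longleftrightarrow> (\<exists>G D e. hol_extension f G D a e)"

lemma pair_zero_ball: "(x, 0) \<in> ball (a, 0) e \<longleftrightarrow> x \<in> ball a e"
	by (simp add: dist_Pair_Pair)

lemma hol_extension_shrink:
	assumes "hol_extension f G D a e" "0 < d" "d \<le> e"
	shows "hol_extension f G D a d"
	using assms subset_ball[OF assms(3), of a] subset_ball[OF assms(3), of "(a, 0::'a)"]
	unfolding hol_extension_def by blast

lemma hol_extension_has_derivative:
	assumes "hol_extension f G D a e" "x \<in> ball a e"
	shows "(f has_derivative (\<lambda>v. fst (D (x, 0) (v, 0)))) (at x)"
proof -
	have G: "(G has_derivative D (x, 0)) (at (x, 0))" and r: "\<forall>x\<in>ball a e. G (x, 0) = (f x, 0)"
		using assms by (auto simp: hol_extension_def pair_zero_ball simp del: mem_ball)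
	have "((\<lambda>x. fst (G (x, 0))) has_derivative (\<lambda>v. fst (D (x, 0) (v, 0)))) (at x)"
		by (rule has_derivative_fst[OF has_derivative_compose[OF has_derivative_Pair[OF has_derivative_ident has_derivative_const] G]])
	thus ?thesis
		by (rule has_derivative_transform_within_open[OF _ open_ball assms(2)]) (use r in auto)
qed

text \<open>Here the extension pays off: substitution of one power series into another is replaced
  by the chain rule for complex linear derivatives.\<close>

lemma hol_ext_compose:
	assumes "hol_ext f a" "hol_ext g (f a)"
	shows "hol_ext (\<lambda>x. g (f x)) a"
proof -
	obtain F D e where F: "hol_extension f F D a e" using assms by (auto simp: hol_ext_def)
	obtain G E d where G: "hol_extension g G E (f a) d" using assms by (auto simp: hol_ext_def)
	have "(F has_derivative D (a, 0)) (at (a, 0))" and Fa: "F (a, 0) = (f a, 0)" and "e > 0" "d > 0"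
		using F G by (auto simp: hol_extension_def)
	hence "isCont F (a, 0)" using has_derivative_continuous by blast
	then obtain r where r: "r > 0" "\<And>z. dist z (a, 0) < r ==> dist (F z) (f a, 0) < d"
		using \<open>d > 0\<close> unfolding continuous_at_eps_delta Fa by blast
	have "hol_extension (\<lambda>x. g (f x)) (\<lambda>z. G (F z)) (\<lambda>z v. E (F z) (D z v)) a (min e r)"
		unfolding hol_extension_def
	proof (intro conjI ballI allI)
		fix z assume z: "z \<in> ball (a, 0::'a) (min e r)"
		hence Fz: "F z \<in> ball (f a, 0) d" using r(2)[of z] by (auto simp: dist_commute)
		have 1: "(F has_derivative D z) (at z)" "\<And>v. D z (cJ v) = cJ (D z v)"
			using F z by (auto simp: hol_extension_def)
		have 2: "(G has_derivative E (F z)) (at (F z))" "\<And>v. E (F z) (cJ v) = cJ (E (F z) v)"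
			using G Fz by (auto simp: hol_extension_def)
		show "((\<lambda>z. G (F z)) has_derivative (\<lambda>v. E (F z) (D z v))) (at z)"
			by (rule has_derivative_compose[OF 1(1) 2(1)])
		show "E (F z) (D z (cJ v)) = cJ (E (F z) (D z v))" for v by (simp add: 1 2)
	next
		fix x assume x: "x \<in> ball a (min e r)"
		hence Fx: "F (x, 0) = (f x, 0)" using F by (auto simp: hol_extension_def)
		hence "dist (f x) (f a) < d" using r(2)[of "(x, 0)"] x by (auto simp: dist_Pair_Pair dist_commute)
		thus "G (F (x, 0)) = (g (f x), 0)"
			using G Fx by (auto simp: hol_extension_def dist_commute)
	qed (use \<open>e > 0\<close> r in auto)
	thus ?thesis by (auto simp: hol_ext_def)
qed

lemma hol_ext_bounded_linear:
	assumes "bounded_linear L"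
	shows "hol_ext L a"
proof -
	interpret L: bounded_linear L by fact
	have bl: "bounded_linear (\<lambda>z. (L (fst z), L (snd z)))"
		by (intro bounded_linear_Pair L.bounded_linear_axioms bounded_linear_compose[OF assms] bounded_linear_fst bounded_linear_snd)
	have "hol_extension L (\<lambda>z. (L (fst z), L (snd z))) (\<lambda>_ z. (L (fst z), L (snd z))) a 1"
		using bounded_linear_imp_has_derivative[OF bl] by (auto simp: hol_extension_def cJ_def L.neg)
	thus ?thesis by (auto simp: hol_ext_def)
qed

lemma hol_ext_Pair:
	assumes "hol_ext f a" "hol_ext g a"
	shows "hol_ext (\<lambda>x. (f x, g x)) a"
proof -
	obtain F D e where F: "hol_extension f F D a e" using assms by (auto simp: hol_ext_def)
	obtain G E d where G: "hol_extension g G E a d" using assms by (auto simp: hol_ext_def)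
	have ed: "e > 0" "d > 0" using F G by (auto simp: hol_extension_def)
	have F': "hol_extension f F D a (min e d)" and G': "hol_extension g G E a (min e d)"
		using hol_extension_shrink[OF F] hol_extension_shrink[OF G] ed by auto
	let ?H = "\<lambda>F G. ((fst F, fst G), (snd F, snd G))"
	have "hol_extension (\<lambda>x. (f x, g x)) (\<lambda>z. ?H (F z) (G z)) (\<lambda>z v. ?H (D z v) (E z v)) a (min e d)"
		using F' G' unfolding hol_extension_def
		by (auto intro!: has_derivative_Pair has_derivative_fst has_derivative_snd simp: cJ_def zero_prod_def simp del: mem_ball)
	thus ?thesis by (auto simp: hol_ext_def)
qed

text \<open>The extension is the complex product (u + i u') (v + i v'), written with real and
  imaginary parts.\<close>

lemma hol_ext_scaleR:
	"hol_ext (\<lambda>p :: real \<times> 'b::real_normed_vector. fst p *. snd p) a"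
proof -
	let ?u = "\<lambda>z :: (real \<times> 'b) \<times> (real \<times> 'b). fst (fst z)" and ?v = "\<lambda>z :: (real \<times> 'b) \<times> (real \<times> 'b). snd (fst z)"
	let ?u' = "\<lambda>z :: (real \<times> 'b) \<times> (real \<times> 'b). fst (snd z)" and ?v' = "\<lambda>z :: (real \<times> 'b) \<times> (real \<times> 'b). snd (snd z)"
	have "hol_extension (\<lambda>p :: real \<times> 'b. fst p *. snd p)
			(\<lambda>z. (?u z *. ?v z - ?u' z *. ?v' z, ?u z *. ?v' z + ?u' z *. ?v z))
			(\<lambda>z h. (?u z *. ?v h + ?u h *. ?v z - (?u' z *. ?v' h + ?u' h *. ?v' z),
				?u z *. ?v' h + ?u h *. ?v' z + (?u' z *. ?v h + ?u' h *. ?v z))) a 1"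
		unfolding hol_extension_def
		by (intro conjI ballI allI has_derivative_Pair has_derivative_diff has_derivative_add has_derivative_scaleR
					has_derivative_fst has_derivative_snd has_derivative_ident) (simp_all add: cJ_def algebra_simps)
	thus ?thesis by (auto simp: hol_ext_def)
qed

lemma finite_sum_has_sum:
	fixes f :: "'i => 'x => 'b::real_normed_vector"
	assumes "finite I" "\<And>i. i \<in> I ==> (f i has_sum s i) A"
	shows "((\<lambda>x. \<Sum>i\<in>I. f i x) has_sum (\<Sum>i\<in>I. s i)) A"
	using assms
proof (induction I rule: finite_induct)
	case (insert i I)
	hence "((\<lambda>x. f i x + (\<Sum>i\<in>I. f i x)) has_sum (s i + (\<Sum>i\<in>I. s i))) A"
		by (intro has_sum_add) auto
	thus ?case using insert.hyps by simp
qed simp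

abbreviation (input) midx :: "('a::euclidean_space => nat) set" where "midx \<equiv> Basis \<rightarrow>\<^sub>E UNIV"
abbreviation (input) mpow :: "'a::euclidean_space => ('a => nat) => real" where "mpow z k \<equiv> \<Prod>i\<in>Basis. (z \<bullet> i) ^ k i"

text \<open>At real points the monomials are real, so taking the real parts of the complex
  coefficients gives a real power series for each component of \<open>f\<close>.\<close>

lemma real_analytic_on_sep_hol:
	fixes f :: "'a::euclidean_space => 'b::euclidean_space"
	assumes "\<And>a. a \<in> U ==> \<exists>r B H. 0 < r \<and> 0 \<le> B \<and> (\<forall>b\<in>Basis. sep_hol (Basis :: 'a set) r B (H b)) \<and>
			(\<forall>x\<in>ball a r. \<forall>b\<in>Basis. Re (H b (\<lambda>i. of_real ((x - a) \<bullet> i))) = f x \<bullet> b)"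
	shows "real_analytic_on f U"
	unfolding real_analytic_on_def
proof
	fix a assume "a \<in> U"
	from assms[OF this] obtain r B H where r: "r > 0" "B \<ge> 0" and H: "\<And>b. b \<in> Basis ==> sep_hol (Basis :: 'a set) r B (H b)"
		and f: "\<And>x b. x \<in> ball a r ==> b \<in> Basis ==> Re (H b (\<lambda>i. of_real ((x - a) \<bullet> i))) = f x \<bullet> b"
		by blast
	have "\<forall>b\<in>Basis. \<exists>c. \<forall>z. (\<forall>i\<in>(Basis :: 'a set). norm (z i) \<le> r / 4) -->
				((\<lambda>k. (\<Prod>i\<in>Basis. z i ^ k i) * c k) has_sum H b z) midx"
		using sep_hol_power_series[OF finite_Basis r H] by blast
	hence "\<exists>C. \<forall>b\<in>Basis. \<forall>z. (\<forall>i\<in>(Basis :: 'a set). norm (z i) \<le> r / 4) -->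
				((\<lambda>k. (\<Prod>i\<in>Basis. z i ^ k i) * C b k) has_sum H b z) midx"
		by (rule bchoice)
	then obtain C where C: "\<And>b z. b \<in> Basis ==> \<forall>i\<in>(Basis :: 'a set). norm (z i) \<le> r / 4 ==>
				((\<lambda>k. (\<Prod>i\<in>Basis. z i ^ k i) * C b k) has_sum H b z) midx"
		by blast
	define c where "c = (\<lambda>k. \<Sum>b\<in>(Basis :: 'b set). Re (C b k) *. b)"
	show "\<exists>\<rho>>0. \<exists>c :: ('a => nat) => 'b. \<forall>x\<in>ball a \<rho>.
				((\<lambda>k. mpow (x - a) k *. c k) has_sum f x) midx"
	proof (intro exI[of _ "r/4"] exI[of _ c] conjI ballI)
		fix x assume x: "x \<in> ball a (r / 4)"
		define z :: "'a => complex" where "z = (\<lambda>i. of_real ((x - a) \<bullet> i))"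
		have z: "\<forall>i\<in>Basis. norm (z i) \<le> r / 4"
		proof
			fix i :: 'a assume "i \<in> Basis"
			thus "norm (z i) \<le> r / 4"
				using Basis_le_norm[of i "x - a"] x by (simp add: z_def dist_norm norm_minus_commute)
		qed
		have pz: "(\<Prod>i\<in>Basis. z i ^ k i) = of_real (mpow (x - a) k)" for k
			by (simp add: z_def)
		have "((\<lambda>k. (mpow (x - a) k * Re (C b k)) *. b) has_sum (f x \<bullet> b) *. b) midx"
			if "b \<in> Basis" for b
		proof -
			have "((\<lambda>k. Re ((\<Prod>i\<in>Basis. z i ^ k i) * C b k)) has_sum Re (H b z)) midx"
				by (rule has_sum_Re[OF C[OF that z]])
			moreover have "Re (H b z) = f x \<bullet> b" using f[of x b] x that r by (simp add: z_def)
			moreover have "Re ((\<Prod>i\<in>Basis. z i ^ k i) * C b k) = mpow (x - a) k * Re (C b k)" for k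
				unfolding pz by (simp only: Re_complex_of_real Im_complex_of_real times_complex.simps mult_zero_left diff_zero)
			ultimately have "((\<lambda>k. mpow (x - a) k * Re (C b k)) has_sum f x \<bullet> b) midx"
				by simp
			thus ?thesis by (rule has_sum_bounded_linear[OF bounded_linear_scaleR_left])
		qed
		hence "((\<lambda>k. \<Sum>b\<in>Basis. (mpow (x - a) k * Re (C b k)) *. b) has_sum (\<Sum>b\<in>Basis. (f x \<bullet> b) *. b)) midx"
			by (intro finite_sum_has_sum) auto
		thus "((\<lambda>k. mpow (x - a) k *. c k) has_sum f x) midx"
			by (simp add: euclidean_representation c_def scaleR_sum_right)
	qed (use r in auto)
qed

lemma sep_hol_mono:
	assumes "sep_hol I r B H" "r' \<le> r"
	shows "sep_hol I r' B H"
	unfolding sep_hol_def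
proof (intro conjI allI ballI impI)
	fix z z' :: "'a => complex" assume "\<forall>i\<in>I. z i = z' i"
	thus "H z = H z'" using assms(1) unfolding sep_hol_def by blast
next
	fix z :: "'a => complex" assume "\<forall>i\<in>I. norm (z i) < r'"
	hence "\<forall>i\<in>I. norm (z i) < r" using assms(2) by force
	thus "norm (H z) \<le> B" using assms(1) unfolding sep_hol_def by blast
next
	fix z :: "'a => complex" and i assume "i \<in> I" "\<forall>i\<in>I. norm (z i) < r'"
	hence "\<forall>i\<in>I. norm (z i) < r" using assms(2) by force
	hence "(\<lambda>w. H (z(i := w))) holomorphic_on ball 0 r"
		using assms(1) \<open>i \<in> I\<close> unfolding sep_hol_def by blast
	thus "(\<lambda>w. H (z(i := w))) holomorphic_on ball 0 r'"
		by (rule holomorphic_on_subset) (use assms(2) in auto)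
qed

text \<open>The \<open>b\<close>-component of \<open>G\<close> as a function of the complex coordinates relative to \<open>a\<close>.\<close>

definition cpoint :: "'a::euclidean_space => ('a => complex) => 'a \<times> 'a" where
	"cpoint a z = (a + (\<Sum>i\<in>Basis. Re (z i) *. i), \<Sum>i\<in>Basis. Im (z i) *. i)"

definition ccomp :: "('b::euclidean_space \<times> 'b) => 'b => complex" where
	"ccomp p b = Complex (fst p \<bullet> b) (snd p \<bullet> b)"

lemma bounded_linear_ccomp: "bounded_linear (\<lambda>p. ccomp p b)"
proof -
	have "bounded_linear (\<lambda>p. complex_of_real (fst p \<bullet> b) + \<i> * complex_of_real (snd p \<bullet> b))"
		by (intro bounded_linear_add bounded_linear_mult_const bounded_linear_const_mult
				bounded_linear_compose[OF bounded_linear_of_real] bounded_linear_compose[OF bounded_linear_inner_left]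
				bounded_linear_fst bounded_linear_snd)
	thus ?thesis by (simp add: ccomp_def Complex_eq mult.commute)
qed

lemma ccomp_cJ: "ccomp (cJ p) b = \<i> * ccomp p b"
	by (auto simp: ccomp_def cJ_def complex_eq_iff)

lemma cpoint_dist:
	fixes a :: "'a::euclidean_space"
	assumes "\<forall>i\<in>Basis. norm (z i) \<le> r"
	shows "dist (a, 0) (cpoint a z) \<le> 2 * real DIM('a) * r"
proof -
	have "dist (a, 0) (cpoint a z) = norm (\<Sum>i\<in>Basis. (Re (z i) *. i, Im (z i) *. i :: 'a::euclidean_space))"
		by (simp add: cpoint_def dist_norm norm_Pair sum_prod norm_minus_commute)
	also have "\<dots> \<le> (\<Sum>i\<in>(Basis :: 'a set). 2 * r)"
	proof (rule sum_norm_le)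
		fix i :: 'a assume i: "i \<in> Basis"
		have "norm (Re (z i) *. i, Im (z i) *. i) \<le> norm (Re (z i) *. i) + norm (Im (z i) *. i)"
			by (simp add: norm_Pair sqrt_sum_squares_le_sum)
		also have "\<dots> \<le> 2 * norm (z i)" using abs_Re_le_cmod[of "z i"] abs_Im_le_cmod[of "z i"] i by simp
		finally show "norm (Re (z i) *. i, Im (z i) *. i) \<le> 2 * r" using assms i by force
	qed
	finally show ?thesis by simp
qed

lemma cpoint_has_derivative:
	assumes "i \<in> Basis"
	shows "((\<lambda>w. cpoint a (z(i := w))) has_derivative (\<lambda>h. (Re h *. i, Im h *. i))) (at w)"
proof -
	define c where "c = cpoint a (z(i := 0))"
	have "cpoint a (z(i := w)) = c + (Re w *. i, Im w *. i)" for w :: complex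
	proof -
		have R: "(\<Sum>j\<in>Basis. Re ((z(i := w)) j) *. j) = Re w *. i + (\<Sum>j\<in>Basis - {i}. Re (z j) *. j)" for w
			by (subst sum.remove[OF finite_Basis assms]) (auto intro!: sum.cong)
		have I: "(\<Sum>j\<in>Basis. Im ((z(i := w)) j) *. j) = Im w *. i + (\<Sum>j\<in>Basis - {i}. Im (z j) *. j)" for w
			by (subst sum.remove[OF finite_Basis assms]) (auto intro!: sum.cong)
		show ?thesis unfolding c_def cpoint_def R I by simp
	qed
	moreover have "((\<lambda>w. c + (Re w *. i, Im w *. i)) has_derivative (\<lambda>h. 0 + (Re h *. i, Im h *. i))) (at w)"
		by (intro has_derivative_add has_derivative_const has_derivative_Pair has_derivative_scaleR_left has_derivative_Re
				has_derivative_Im has_derivative_ident)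
	ultimately show ?thesis by simp
qed

text \<open>Commutation with \<open>cJ\<close> turns the real derivative in one complex coordinate
  into multiplication by a complex number.\<close>

lemma ccomp_has_field_derivative:
	assumes G: "hol_extension f G D a e" and z: "cpoint a (z(i := w)) \<in> ball (a, 0) e" and i: "i \<in> Basis"
	shows "((\<lambda>w. ccomp (G (cpoint a (z(i := w)))) b) has_field_derivative
			ccomp (D (cpoint a (z(i := w))) (i, 0)) b) (at w)"
proof -
	let ?p = "cpoint a (z(i := w))"
	have D: "(G has_derivative D ?p) (at ?p)" "\<And>v. D ?p (cJ v) = cJ (D ?p v)"
		using G z by (auto simp: hol_extension_def)
	interpret D: bounded_linear "D ?p" using has_derivative_bounded_linear[OF D(1)] .
	interpret c: bounded_linear "\<lambda>p. ccomp p b" by (rule bounded_linear_ccomp)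
	have "((\<lambda>w. ccomp (G (cpoint a (z(i := w)))) b) has_derivative (\<lambda>h. ccomp (D ?p (Re h *. i, Im h *. i)) b)) (at w)"
		by (rule c.has_derivative[OF has_derivative_compose[OF cpoint_has_derivative[OF i] D(1)]])
	moreover have "ccomp (D ?p (Re h *. i, Im h *. i)) b = ccomp (D ?p (i, 0)) b * h" for h
	proof -
		have "(Re h *. i, Im h *. i) = Re h *. (i, 0) + Im h *. cJ (i, 0)" by (simp add: cJ_def)
		hence "ccomp (D ?p (Re h *. i, Im h *. i)) b = Re h *. ccomp (D ?p (i, 0)) b + Im h *. (\<i> * ccomp (D ?p (i, 0)) b)"
			by (simp only: D.add D.scale c.add c.scale D(2) ccomp_cJ)
		also have "\<dots> = ccomp (D ?p (i, 0)) b * h" by (simp add: complex_eq_iff algebra_simps)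
		finally show ?thesis .
	qed
	ultimately show ?thesis by (simp add: has_field_derivative_def)
qed

lemma hol_extension_sep_hol:
	fixes f :: "'a::euclidean_space => 'b::euclidean_space"
	assumes G: "hol_extension f G D a e"
	shows "\<exists>r B. 0 < r \<and> 0 \<le> B \<and> (\<forall>b\<in>Basis. sep_hol Basis r B (\<lambda>z. ccomp (G (cpoint a z)) b))"
proof -
	have e: "e > 0" using G by (simp add: hol_extension_def)
	\<comment> \<open>By \<open>cpoint_dist\<close> the polydisc of this radius lies in the closed ball
	  of radius \<open>e / 2\<close>, on which compactness bounds \<open>G\<close>.\<close>
	define r where "r = e / (4 * real DIM('a))"
	have r: "r > 0" using e by (simp add: r_def)
	have pz: "cpoint a z \<in> cball (a, 0) (e / 2)" if "\<forall>i\<in>Basis. norm (z i) < r" for z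
	proof -
		have "dist (a, 0) (cpoint a z) \<le> 2 * real DIM('a) * r" by (rule cpoint_dist) (use that in \<open>auto simp: less_imp_le\<close>)
		moreover have "2 * real DIM('a) * r = e / 2" by (simp add: r_def)
		ultimately show ?thesis by simp
	qed
	have "continuous_on (cball (a, 0) (e / 2)) G"
	proof (rule continuous_at_imp_continuous_on, rule ballI)
		fix z assume "z \<in> cball (a, 0::'a) (e / 2)"
		hence "z \<in> ball (a, 0) e" using e by auto
		hence "(G has_derivative D z) (at z)" using G unfolding hol_extension_def by blast
		thus "isCont G z" by (rule has_derivative_continuous)
	qed
	hence "bounded (G ` cball (a, 0) (e / 2))"
		by (intro compact_imp_bounded compact_continuous_image compact_cball)
	then obtain B where B: "\<And>z. z \<in> cball (a, 0) (e / 2) ==> norm (G z) \<le> B" "B > 0"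
		unfolding bounded_pos by blast
	have bd: "norm (ccomp p b) \<le> 2 * norm p" if "b \<in> Basis" for b and p :: "'b \<times> 'b"
	proof -
		have "norm (ccomp p b) \<le> \<bar>fst p \<bullet> b\<bar> + \<bar>snd p \<bullet> b\<bar>"
			using cmod_le[of "ccomp p b"] by (simp add: ccomp_def)
		also have "\<dots> \<le> norm (fst p) + norm (snd p)" by (intro add_mono Basis_le_norm that)
		also have "\<dots> \<le> 2 * norm p" using norm_fst_le[of "fst p" "snd p"] norm_snd_le[of "snd p" "fst p"] by simp
		finally show ?thesis .
	qed
	have "sep_hol Basis r (2 * B) (\<lambda>z. ccomp (G (cpoint a z)) b)" if b: "b \<in> Basis" for b
		unfolding sep_hol_def
	proof (intro conjI allI ballI impI)
		fix z z' :: "'a => complex" assume "\<forall>i\<in>Basis. z i = z' i"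
		hence "cpoint a z = cpoint a z'" unfolding cpoint_def by (simp cong: sum.cong)
		thus "ccomp (G (cpoint a z)) b = ccomp (G (cpoint a z')) b" by simp
	next
		fix z :: "'a => complex" assume "\<forall>i\<in>Basis. norm (z i) < r"
		hence "norm (G (cpoint a z)) \<le> B" by (intro B pz) auto
		thus "norm (ccomp (G (cpoint a z)) b) \<le> 2 * B"
			using bd[OF b, of "G (cpoint a z)"] by simp
	next
		fix z :: "'a => complex" and i :: 'a assume i: "i \<in> Basis" and z: "\<forall>i\<in>Basis. norm (z i) < r"
		have "cpoint a (z(i := w)) \<in> ball (a, 0) e" if "w \<in> ball 0 r" for w
		proof -
			have "cpoint a (z(i := w)) \<in> cball (a, 0) (e / 2)" by (rule pz) (use z that in auto)
			thus ?thesis using e by auto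
		qed
		thus "(\<lambda>w. ccomp (G (cpoint a (z(i := w)))) b) holomorphic_on ball 0 r"
			unfolding holomorphic_on_open[OF open_ball]
			by (intro ballI exI) (rule ccomp_has_field_derivative[OF G _ i])
	qed
	thus ?thesis using r B(2) by (intro exI[of _ r] exI[of _ "2 * B"]) simp
qed

lemma cpoint_real: "cpoint a (\<lambda>i. of_real ((x - a) \<bullet> i)) = (x, 0)"
	by (simp add: cpoint_def euclidean_representation)

lemma hol_ext_imp_real_analytic:
	fixes f :: "'a::euclidean_space => 'b::euclidean_space"
	assumes "\<And>a. a \<in> U ==> hol_ext f a"
	shows "real_analytic_on f U"
proof (rule real_analytic_on_sep_hol)
	fix a assume "a \<in> U"
	then obtain G D e where G: "hol_extension f G D a e" using assms unfolding hol_ext_def by blast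
	then obtain r B where r: "0 < r" "0 \<le> B" "\<And>b. b \<in> Basis ==> sep_hol Basis r B (\<lambda>z. ccomp (G (cpoint a z)) b)"
		using hol_extension_sep_hol by blast
	have e: "e > 0" using G by (simp add: hol_extension_def)
	have mono: "sep_hol Basis (min r e) B H" if "sep_hol (Basis :: 'a set) r B H" for H
		using sep_hol_mono[OF that] by simp
	show "\<exists>r B H. 0 < r \<and> 0 \<le> B \<and> (\<forall>b\<in>Basis. sep_hol Basis r B (H b)) \<and>
			(\<forall>x\<in>ball a r. \<forall>b\<in>Basis. Re (H b (\<lambda>i. of_real ((x - a) \<bullet> i))) = f x \<bullet> b)"
	proof (rule exI[of _ "min r e"], rule exI[of _ B], rule exI[of _ "\<lambda>b z. ccomp (G (cpoint a z)) b"], intro conjI ballI)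
		fix x b assume "x \<in> ball a (min r e)"
		hence "G (x, 0) = (f x, 0)" using G by (auto simp: hol_extension_def)
		thus "Re (ccomp (G (cpoint a (\<lambda>i. of_real ((x - a) \<bullet> i)))) b) = f x \<bullet> b"
			unfolding cpoint_real by (simp add: ccomp_def)
	next
		show "sep_hol Basis (min r e) B (\<lambda>z. ccomp (G (cpoint a z)) b)" if "b \<in> Basis" for b
			by (rule mono[OF r(3)[OF that]])
	qed (use r e in auto)
qed

text \<open>At this point the derivative of an extension is not known to be differentiable, so no
  extension of the derivative is exhibited. Instead its coordinate expressions are complex partial
  derivatives, which are separately holomorphic by \<open>sep_hol_partial\<close>, and this suffices
  for a power series.\<close>

lemma hol_ext_derivative_real_analytic:
	fixes f :: "'a::euclidean_space => 'b::euclidean_space"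
	assumes f: "\<And>a. a \<in> U ==> hol_ext f a"
	shows "real_analytic_on (\<lambda>x. Df f x v) U"
proof (rule real_analytic_on_sep_hol)
	fix a assume "a \<in> U"
	then obtain G D e where G: "hol_extension f G D a e" using f unfolding hol_ext_def by blast
	then obtain r B where r: "0 < r" "0 \<le> B" and H: "\<And>b. b \<in> Basis ==> sep_hol Basis r B (\<lambda>z. ccomp (G (cpoint a z)) b)"
		using hol_extension_sep_hol by blast
	define K where "K = (\<lambda>b z. \<Sum>i\<in>Basis. of_real (v \<bullet> i) * deriv (\<lambda>w. ccomp (G (cpoint a (z(i := w)))) b) (z i))"
	define B' where "B' = (\<Sum>i\<in>Basis. \<bar>v \<bullet> i\<bar> * (B * (4 / r)))"
	have K: "sep_hol Basis (r / 2) B' (K b)" if b: "b \<in> Basis" for b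
	proof -
		have s: "sep_hol Basis (r / 2) (B * (4 / r)) (\<lambda>z. deriv (\<lambda>w. ccomp (G (cpoint a (z(i := w)))) b) (z i))" if "i \<in> Basis" for i
			by (rule sep_hol_partial[OF r(1) H[OF b] that])
		show ?thesis
			unfolding sep_hol_def K_def B'_def
		proof (intro conjI allI ballI impI)
			fix z z' :: "'a => complex" assume "\<forall>i\<in>Basis. z i = z' i"
			hence "deriv (\<lambda>w. ccomp (G (cpoint a (z(i := w)))) b) (z i) = deriv (\<lambda>w. ccomp (G (cpoint a (z'(i := w)))) b) (z' i)"
				if "i \<in> Basis" for i using s[OF that] unfolding sep_hol_def by blast
			thus "(\<Sum>i\<in>Basis. of_real (v \<bullet> i) * deriv (\<lambda>w. ccomp (G (cpoint a (z(i := w)))) b) (z i)) =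
				 (\<Sum>i\<in>Basis. of_real (v \<bullet> i) * deriv (\<lambda>w. ccomp (G (cpoint a (z'(i := w)))) b) (z' i))" by simp
		next
			fix z :: "'a => complex" assume z: "\<forall>i\<in>Basis. norm (z i) < r / 2"
			show "norm (\<Sum>i\<in>Basis. of_real (v \<bullet> i) * deriv (\<lambda>w. ccomp (G (cpoint a (z(i := w)))) b) (z i)) \<le> (\<Sum>i\<in>Basis. \<bar>v \<bullet> i\<bar> * (B * (4 / r)))"
			proof (rule sum_norm_le)
				fix i :: 'a assume "i \<in> Basis"
				hence "norm (deriv (\<lambda>w. ccomp (G (cpoint a (z(i := w)))) b) (z i)) \<le> B * (4 / r)"
					using s z unfolding sep_hol_def by blast
				thus "norm (of_real (v \<bullet> i) * deriv (\<lambda>w. ccomp (G (cpoint a (z(i := w)))) b) (z i)) \<le> \<bar>v \<bullet> i\<bar> * (B * (4 / r))"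
					unfolding norm_mult norm_of_real by (rule mult_left_mono) simp
			qed
		next
			fix z :: "'a => complex" and j :: 'a assume "j \<in> Basis" "\<forall>i\<in>Basis. norm (z i) < r / 2"
			hence "(\<lambda>w'. deriv (\<lambda>w. ccomp (G (cpoint a ((z(j := w'))(i := w)))) b) ((z(j := w')) i)) holomorphic_on ball 0 (r / 2)"
				if "i \<in> Basis" for i using s[OF that] unfolding sep_hol_def by blast
			thus "(\<lambda>w'. \<Sum>i\<in>Basis. of_real (v \<bullet> i) * deriv (\<lambda>w. ccomp (G (cpoint a ((z(j := w'))(i := w)))) b) ((z(j := w')) i)) holomorphic_on ball 0 (r / 2)"
				by (intro holomorphic_on_sum holomorphic_on_mult holomorphic_on_const)
		qed
	qed
	have e: "e > 0" using G by (simp add: hol_extension_def)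
	have "Re (K b (\<lambda>i. of_real ((x - a) \<bullet> i))) = Df f x v \<bullet> b"
		if x: "x \<in> ball a (min (r / 2) e)" and b: "b \<in> Basis" for x b
	proof -
		let ?z = "\<lambda>i. complex_of_real ((x - a) \<bullet> i)"
		have fd: "Df f x = (\<lambda>v. fst (D (x, 0) (v, 0)))"
			using frechet_derivative_at[OF hol_extension_has_derivative[OF G, of x]] x by simp
		have xe: "(x, 0) \<in> ball (a, 0) e" using x unfolding pair_zero_ball by simp
		have lin: "linear (\<lambda>v. fst (D (x, 0) (v, 0)))"
			using has_derivative_linear[OF hol_extension_has_derivative[OF G, of x]] x by simp
		have "deriv (\<lambda>w. ccomp (G (cpoint a (?z(i := w)))) b) (?z i) = ccomp (D (x, 0) (i, 0)) b" if i: "i \<in> Basis" for i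
		proof -
			have "cpoint a (?z(i := ?z i)) = (x, 0)" by (subst fun_upd_idem) (simp_all add: cpoint_real)
			thus ?thesis
				using DERIV_imp_deriv[OF ccomp_has_field_derivative[OF G _ i, of ?z "?z i" b]] xe by simp
		qed
		hence "Re (K b ?z) = (\<Sum>i\<in>Basis. (v \<bullet> i) * (fst (D (x, 0) (i, 0)) \<bullet> b))"
			by (simp add: K_def ccomp_def)
		also have "\<dots> = (\<Sum>i\<in>Basis. (v \<bullet> i) *. fst (D (x, 0) (i, 0))) \<bullet> b"
			by (simp add: inner_sum_left)
		also have "\<dots> = fst (D (x, 0) (v, 0)) \<bullet> b" using linear_euclidean_expand[OF lin, of v] by simp
		finally show ?thesis by (simp add: fd)
	qed
	moreover have "sep_hol Basis (min (r / 2) e) B' (K b)" if "b \<in> Basis" for b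
		using sep_hol_mono[OF K[OF that]] by simp
	moreover have "B' \<ge> 0" unfolding B'_def using r by (intro sum_nonneg) auto
	ultimately show "\<exists>r B H. 0 < r \<and> 0 \<le> B \<and> (\<forall>b\<in>Basis. sep_hol Basis r B (H b)) \<and>
			(\<forall>x\<in>ball a r. \<forall>b\<in>Basis. Re (H b (\<lambda>i. of_real ((x - a) \<bullet> i))) = Df f x v \<bullet> b)"
		using r e by - (rule exI[of _ "min (r / 2) e"], rule exI[of _ B'], rule exI[of _ K], auto)
qed

lemma norm_ccomp_le:
	assumes "b \<in> Basis"
	shows "norm (ccomp p b) \<le> norm p"
proof -
	have "(fst p \<bullet> b)\<^sup>2 \<le> (norm (fst p))\<^sup>2" "(snd p \<bullet> b)\<^sup>2 \<le> (norm (snd p))\<^sup>2"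
		using Basis_le_norm[OF assms] by (simp_all add: abs_le_square_iff[symmetric])
	hence "(fst p \<bullet> b)\<^sup>2 + (snd p \<bullet> b)\<^sup>2 \<le> (norm (fst p))\<^sup>2 + (norm (snd p))\<^sup>2" by (rule add_mono)
	thus ?thesis by (simp add: ccomp_def cmod_def norm_prod_def)
qed

lemma hol_extension_derivative_real:
	assumes "hol_extension f G D a e" "x \<in> ball a e"
	shows "D (x, 0) (v, 0) = (Df f x v, 0)"
proof -
	have G: "(G has_derivative D (x, 0)) (at (x, 0))" and r: "\<forall>x\<in>ball a e. G (x, 0) = (f x, 0)"
		using assms by (auto simp: hol_extension_def pair_zero_ball simp del: mem_ball)
	have "((\<lambda>x. G (x, 0)) has_derivative (\<lambda>v. D (x, 0) (v, 0))) (at x)"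
		by (rule has_derivative_compose[OF has_derivative_Pair[OF has_derivative_ident has_derivative_const] G])
	hence 1: "((\<lambda>x. (f x, 0)) has_derivative (\<lambda>v. D (x, 0) (v, 0))) (at x)"
		by (rule has_derivative_transform_within_open[OF _ open_ball assms(2)]) (use r in auto)
	have "((\<lambda>x. (f x, 0)) has_derivative (\<lambda>v. (fst (D (x, 0) (v, 0)), 0))) (at x)"
		by (intro has_derivative_Pair has_derivative_const hol_extension_has_derivative[OF assms])
	hence "(\<lambda>v. D (x, 0) (v, 0)) = (\<lambda>v. (fst (D (x, 0) (v, 0)), 0))"
		using has_derivative_unique[OF 1] by blast
	moreover have "Df f x = (\<lambda>v. fst (D (x, 0) (v, 0)))"
		using frechet_derivative_at[OF hol_extension_has_derivative[OF assms]] by simp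
	ultimately show ?thesis by metis
qed

lemma norm_Re_Im_scaleR: "norm (Re t *. c, Im t *. c) = norm t * norm c"
proof -
	have "(norm (Re t *. c))\<^sup>2 + (norm (Im t *. c))\<^sup>2 = (norm t * norm c)\<^sup>2"
		by (simp add: power_mult_distrib cmod_power2 distrib_right)
	thus ?thesis by (simp add: norm_Pair)
qed

text \<open>The crude bound of \<open>k\<close> by \<open>2 ^ k\<close> absorbs the factor that
  termwise differentiation produces into a doubled radius.\<close>

lemma nat_pow_bound:
	assumes "0 < (r::real)" "0 \<le> x" "x \<le> r"
	shows "real k * x ^ (k - 1) \<le> (2 * r) ^ k / r"
proof (cases k)
	case (Suc m)
	have "real k \<le> 2 ^ k" by (metis of_nat_less_two_power less_imp_le)
	moreover have "x ^ m \<le> r ^ m" using assms by (intro power_mono) auto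
	ultimately have "real k * x ^ (k - 1) \<le> 2 ^ k * r ^ m"
		using Suc assms by (intro mult_mono) auto
	also have "\<dots> = (2 * r) ^ k / r" using Suc assms by (simp add: power_mult_distrib)
	finally show ?thesis .
qed (use assms in auto)

text \<open>Termwise differentiation of the complexified power series.\<close>

lemma real_analytic_imp_hol_extension:
	fixes f :: "'a::euclidean_space => 'b::banach"
	assumes "real_analytic_on f U" "a \<in> U"
	shows "\<exists>G D e. hol_extension f G D a e \<and> (\<forall>h. continuous_on (ball (a, 0) e) (\<lambda>z. D z h))"
proof -
	let ?P = "Basis \<rightarrow>\<^sub>E (UNIV :: nat set) :: ('a => nat) set"
	obtain \<rho> c where \<rho>: "\<rho> > 0" and c: "\<And>x. x \<in> ball a \<rho> ==>
			((\<lambda>k. mpow (x - a) k *. c k) has_sum f x) ?P"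
		using assms unfolding real_analytic_on_def by blast
	\<comment> \<open>The multi-indices are enumerated by the natural numbers, because the theorem on
	  differentiating a series speaks of sequences.\<close>
	have "infinite ?P"
	proof
		assume "finite ?P"
		moreover have "(\<lambda>n. restrict (\<lambda>_. n) Basis) ` (UNIV :: nat set) \<subseteq> ?P" by auto
		ultimately have "finite ((\<lambda>n. restrict (\<lambda>_. n) (Basis :: 'a set)) ` (UNIV :: nat set))"
			using finite_subset by blast
		moreover have "inj (\<lambda>n::nat. restrict (\<lambda>_. n) (Basis :: 'a set))"
		proof (rule injI)
			fix m n :: nat assume "restrict (\<lambda>_. m) (Basis :: 'a set) = restrict (\<lambda>_. n) Basis"
			thus "m = n" using nonempty_Basis by (metis ex_in_conv restrict_apply')
		qed
		ultimately show False using finite_imageD infinite_UNIV_nat by blast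
	qed
	moreover have "countable ?P" by (intro countable_PiE) auto
	ultimately have bij: "bij_betw (from_nat_into ?P) UNIV ?P" by (rule bij_betw_from_nat_into[rotated])
	define E where "E = from_nat_into ?P"
	have E: "bij_betw E UNIV ?P" using bij by (simp add: E_def)
	\<comment> \<open>The point \<open>a\<close> plus \<open>s\<close> times the sum of the basis
	  vectors still lies in the ball of convergence. The terms of the series at this point are bounded,
	  which yields the coefficient bound \<open>C\<close>.\<close>
	define s where "s = \<rho> / (2 * real DIM('a))"
	have s: "s > 0" using \<rho> by (simp add: s_def)
	\<comment> \<open>Then \<open>2 * r = s / 2\<close>: the differentiated terms on the ball of radius
	  \<open>r\<close> are dominated by a multiple of 1/2 to the total degree.\<close>
	define r where "r = s / 4"
	have r: "r > 0" using s by (simp add: r_def)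
	have "\<exists>C. \<forall>k\<in>?P. norm (c k) * (\<Prod>i\<in>Basis. s ^ k i) \<le> C"
	proof -
		define x where "x = a + s *. (\<Sum>i\<in>Basis. i)"
		have "norm (x - a) \<le> s * real DIM('a)"
			using sum_norm_bound[of "Basis :: 'a set" "\<lambda>i. i" 1] s by (simp add: x_def)
		also have "\<dots> < \<rho>" using \<rho> by (simp add: s_def)
		finally have "x \<in> ball a \<rho>" by (simp add: dist_norm norm_minus_commute)
		from c[OF this] have "((\<lambda>n. mpow (x - a) (E n) *. c (E n)) has_sum f x) UNIV"
			using has_sum_reindex_bij_betw[OF E, of "\<lambda>k. mpow (x - a) k *. c k"] by simp
		hence "summable (\<lambda>n. mpow (x - a) (E n) *. c (E n))"
			using has_sum_imp_sums sums_summable by blast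
		hence "Bseq (\<lambda>n. mpow (x - a) (E n) *. c (E n))"
			using summable_LIMSEQ_zero convergent_imp_Bseq convergent_def by blast
		then obtain C where C: "\<And>n. norm (mpow (x - a) (E n) *. c (E n)) \<le> C"
			unfolding Bseq_def by blast
		have xi: "(x - a) \<bullet> i = s" if "i \<in> Basis" for i
			using that by (simp add: x_def inner_sum_left inner_Basis sum.delta if_distrib cong: if_cong)
		have "norm (c k) * (\<Prod>i\<in>Basis. s ^ k i) \<le> C" if k: "k \<in> ?P" for k
		proof -
			have "k \<in> range E" using E k unfolding bij_betw_def by simp
			then obtain n where n: "k = E n" by blast
			have "mpow (x - a) (E n) = (\<Prod>i\<in>Basis. s ^ k i)"
				unfolding n by (rule prod.cong) (use xi in auto)
			moreover have "(\<Prod>i\<in>(Basis :: 'a set). s ^ k i) \<ge> 0" using s by (intro prod_nonneg) auto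
			ultimately show ?thesis using C[of n] unfolding n by (simp add: mult.commute)
		qed
		thus ?thesis by blast
	qed
	then obtain C where C: "\<And>k. k \<in> ?P ==> norm (c k) * (\<Prod>i\<in>Basis. s ^ k i) \<le> C" by blast
	define w :: "'a => 'a \<times> 'a => complex" where "w = (\<lambda>i z. ccomp (z - (a, 0)) i)"
	define T :: "('a => nat) => 'a \<times> 'a => complex" where "T = (\<lambda>k z. \<Prod>i\<in>Basis. w i z ^ k i)"
	define dT :: "('a => nat) => 'a \<times> 'a => 'a \<times> 'a => complex" where
		"dT = (\<lambda>k z h. \<Sum>i\<in>Basis. of_nat (k i) * ccomp h i * w i z ^ (k i - 1) * (\<Prod>j\<in>Basis - {i}. w j z ^ k j))"
	define F where "F = (\<lambda>n z. (Re (T (E n) z) *. c (E n), Im (T (E n) z) *. c (E n)))"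
	define F' where "F' = (\<lambda>n z h. (Re (dT (E n) z h) *. c (E n), Im (dT (E n) z h) *. c (E n)))"
	let ?S = "ball (a, 0::'a) r"
	have wd: "(w i has_derivative (\<lambda>h. ccomp h i)) (at z)" for i z
	proof -
		have "((\<lambda>z. ccomp (z - (a, 0)) i) has_derivative (\<lambda>h. ccomp (h - 0) i)) (at z)"
			by (intro bounded_linear.has_derivative[OF bounded_linear_ccomp] has_derivative_diff
					has_derivative_ident has_derivative_const)
		thus ?thesis by (simp add: w_def)
	qed
	have Td: "(T k has_derivative dT k z) (at z)" for k z
	proof -
		have "((\<lambda>z. \<Prod>i\<in>Basis. w i z ^ k i) has_derivative
			 (\<lambda>h. \<Sum>i\<in>Basis. (of_nat (k i) * ccomp h i * w i z ^ (k i - 1)) * (\<Prod>j\<in>Basis - {i}. w j z ^ k j))) (at z)"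
			by (rule has_derivative_prod[OF has_derivative_power[OF wd]])
		thus ?thesis by (simp add: T_def dT_def)
	qed
	have Fd: "(F n has_derivative F' n z) (at z)" for n z
		unfolding F_def F'_def
		by (intro has_derivative_Pair has_derivative_scaleR_left has_derivative_Re has_derivative_Im Td)
	have dT_J: "dT k z (cJ h) = \<i> * dT k z h" for k z h
		by (simp add: dT_def ccomp_cJ sum_distrib_left mult_ac)
	have F'_J: "F' n z (cJ h) = cJ (F' n z h)" for n z h
		unfolding F'_def dT_J by (simp add: cJ_def)
	define K where "K = real DIM('a) / r * C"
	define M where "M = (\<lambda>n. K * (\<Prod>i\<in>Basis. (1/2) ^ E n i))"
	have "(\<lambda>k. \<Prod>i\<in>Basis. (1/2::real) ^ k i) summable_on ?P"
		using has_sum_prod_geometric[of "Basis :: 'a set" "1/2"] by (auto simp: summable_on_def)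
	hence "(\<lambda>n. \<Prod>i\<in>Basis. (1/2::real) ^ E n i) summable_on UNIV"
		using summable_on_reindex_bij_betw[OF E, of "\<lambda>k. \<Prod>i\<in>Basis. (1/2::real) ^ k i"] by simp
	hence M: "summable M"
		unfolding M_def by (intro summable_mult summable_on_imp_summable)
	have bound: "norm (F' n z h) \<le> M n * norm h" if z: "z \<in> ?S" for n z h
	proof -
		let ?k = "E n"
		have kP: "?k \<in> ?P" using E unfolding bij_betw_def by auto
		have wr: "norm (w i z) \<le> r" if "i \<in> Basis" for i
			using norm_ccomp_le[OF that, of "z - (a, 0)"] z by (simp add: w_def dist_norm norm_minus_commute)
		have "norm (dT ?k z h) \<le> (\<Sum>i\<in>(Basis :: 'a set). norm h * ((\<Prod>j\<in>Basis. (2 * r) ^ ?k j) / r))"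
			unfolding dT_def
		proof (rule sum_norm_le)
			fix i :: 'a assume i: "i \<in> Basis"
			have 1: "real (?k i) * norm (w i z) ^ (?k i - 1) \<le> (2 * r) ^ ?k i / r"
				by (rule nat_pow_bound[OF r _ wr[OF i]]) simp
			have 2: "(\<Prod>j\<in>Basis - {i}. norm (w j z) ^ ?k j) \<le> (\<Prod>j\<in>Basis - {i}. (2 * r) ^ ?k j)"
			proof (intro prod_mono conjI power_mono)
				fix j assume "j \<in> Basis - {i}"
				thus "norm (w j z) \<le> 2 * r" using wr[of j] r by auto
			qed auto
			have 3: "(\<Prod>j\<in>Basis. (2 * r) ^ ?k j) = (2 * r) ^ ?k i * (\<Prod>j\<in>Basis - {i}. (2 * r) ^ ?k j)"
				by (rule prod.remove[OF finite_Basis i])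
			have "norm (of_nat (?k i) * ccomp h i * w i z ^ (?k i - 1) * (\<Prod>j\<in>Basis - {i}. w j z ^ ?k j)) =
					norm (ccomp h i) * ((real (?k i) * norm (w i z) ^ (?k i - 1)) * (\<Prod>j\<in>Basis - {i}. norm (w j z) ^ ?k j))"
				by (simp add: norm_mult norm_power prod_norm[symmetric])
			also have "\<dots> \<le> norm h * ((2 * r) ^ ?k i / r * (\<Prod>j\<in>Basis - {i}. (2 * r) ^ ?k j))"
				using r by (intro mult_mono norm_ccomp_le[OF i] 1 2 mult_nonneg_nonneg prod_nonneg) auto
			also have "\<dots> = norm h * ((\<Prod>j\<in>Basis. (2 * r) ^ ?k j) / r)" using 3 by simp
			finally show "norm (of_nat (?k i) * ccomp h i * w i z ^ (?k i - 1) * (\<Prod>j\<in>Basis - {i}. w j z ^ ?k j))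
				 \<le> norm h * ((\<Prod>j\<in>Basis. (2 * r) ^ ?k j) / r)" .
		qed
		hence dTb: "norm (dT ?k z h) \<le> real DIM('a) / r * norm h * (\<Prod>j\<in>Basis. (2 * r) ^ ?k j)"
			by (simp add: mult_ac)
		have "norm (F' n z h) = norm (dT ?k z h) * norm (c ?k)"
			by (simp add: F'_def norm_Re_Im_scaleR)
		also have "\<dots> \<le> real DIM('a) / r * norm h * (\<Prod>j\<in>Basis. (2 * r) ^ ?k j) * norm (c ?k)"
			by (intro mult_right_mono dTb) auto
		also have "(\<Prod>j\<in>Basis. (2 * r) ^ ?k j) = (\<Prod>j\<in>Basis. (1/2) ^ ?k j) * (\<Prod>j\<in>Basis. s ^ ?k j)"
		proof -
			have "2 * r = (1 / 2) * s" by (simp add: r_def)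
			thus ?thesis by (simp only: power_mult_distrib prod.distrib)
		qed
		also have "real DIM('a) / r * norm h * ((\<Prod>j\<in>Basis. (1/2) ^ ?k j) * (\<Prod>j\<in>Basis. s ^ ?k j)) * norm (c ?k) =
			 (real DIM('a) / r * norm h * (\<Prod>j\<in>Basis. (1/2) ^ ?k j)) * (norm (c ?k) * (\<Prod>j\<in>Basis. s ^ ?k j))"
			by (simp add: mult_ac)
		also have "\<dots> \<le> (real DIM('a) / r * norm h * (\<Prod>j\<in>Basis. (1/2) ^ ?k j)) * C"
			using r by (intro mult_left_mono C kP mult_nonneg_nonneg prod_nonneg) auto
		finally show ?thesis by (simp add: M_def K_def mult_ac)
	qed
	have sF': "summable (\<lambda>n. F' n z h)" if "z \<in> ?S" for z h
		by (rule summable_comparison_test'[OF summable_mult2[OF M], of 0 _ "norm h"]) (rule bound[OF that])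
	define g' where "g' = (\<lambda>z h. \<Sum>n. F' n z h)"
	\<comment> \<open>Uniform convergence of the derivatives as operators, the hypothesis of
	  \<open>has_derivative_series\<close>; it follows from the summable majorant
	  \<open>M\<close>.\<close>
	have tail: "\<forall>\<^sub>F n in sequentially. \<forall>z\<in>?S. \<forall>h. norm ((\<Sum>i<n. F' i z h) - g' z h) \<le> e * norm h" if "e > 0" for e
	proof -
		obtain N where N: "\<And>n. n \<ge> N ==> norm (\<Sum>i. M (i + n)) < e"
			using suminf_exist_split[OF \<open>e > 0\<close> M] by blast
		have "norm ((\<Sum>i<n. F' i z h) - g' z h) \<le> e * norm h" if "n \<ge> N" "z \<in> ?S" for n z h
		proof -
			have Mn: "summable (\<lambda>i. M (i + n))" using M by (simp add: summable_iff_shift)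
			have "g' z h - (\<Sum>i<n. F' i z h) = (\<Sum>i. F' (i + n) z h)"
				unfolding g'_def by (simp add: suminf_minus_initial_segment[OF sF'[OF that(2)]])
			also have "norm \<dots> \<le> (\<Sum>i. M (i + n) * norm h)"
				by (rule norm_suminf_le[OF bound[OF that(2)] summable_mult2[OF Mn]])
			also have "\<dots> = (\<Sum>i. M (i + n)) * norm h" by (rule suminf_mult2[OF Mn, symmetric])
			also have "\<dots> \<le> e * norm h" using N[OF that(1)] by (intro mult_right_mono) auto
			finally show ?thesis by (simp add: norm_minus_commute)
		qed
		thus ?thesis unfolding eventually_sequentially by blast
	qed
	have real_sums: "(\<lambda>n. F n (x, 0)) sums (f x, 0)" if x: "x \<in> ball a \<rho>" for x
	proof -
		have "((\<lambda>n. mpow (x - a) (E n) *. c (E n)) has_sum f x) UNIV"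
			using c[OF x] has_sum_reindex_bij_betw[OF E, of "\<lambda>k. mpow (x - a) k *. c k"] by simp
		hence 1: "(\<lambda>n. mpow (x - a) (E n) *. c (E n)) sums f x" by (rule has_sum_imp_sums)
		have "w i (x, 0) = of_real ((x - a) \<bullet> i)" for i
			by (simp add: w_def ccomp_def complex_eq_iff)
		hence "T k (x, 0) = of_real (mpow (x - a) k)" for k
			by (simp add: T_def)
		hence "F n (x, 0) = (mpow (x - a) (E n) *. c (E n), 0)" for n
			by (simp add: F_def del: of_real_prod)
		moreover have "(\<lambda>n. (mpow (x - a) (E n) *. c (E n), 0 :: 'b)) sums (f x, 0)"
			by (rule bounded_linear.sums[OF bounded_linear_Pair[OF bounded_linear_ident bounded_linear_zero] 1])
		ultimately show ?thesis by simp
	qed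
	have rr: "r \<le> \<rho>"
	proof -
		have "1 \<le> 2 * real DIM('a)" using DIM_positive[where 'a='a] by linarith
		from divide_left_mono[OF this, of \<rho>] have "\<rho> / (2 * real DIM('a)) \<le> \<rho> / 1" using \<rho> by simp
		thus ?thesis using \<rho> by (simp add: r_def s_def)
	qed
	have a0: "(a, 0) \<in> ?S" using r by simp
	have "\<exists>g. \<forall>z\<in>?S. (\<lambda>n. F n z) sums (g z) \<and> (g has_derivative g' z) (at z within ?S)"
		by (rule has_derivative_series[OF convex_ball has_derivative_at_withinI[OF Fd] tail a0 real_sums]) (use \<rho> in auto)
	then obtain g where g: "\<And>z. z \<in> ?S ==> (\<lambda>n. F n z) sums (g z)"
		"\<And>z. z \<in> ?S ==> (g has_derivative g' z) (at z within ?S)" by blast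
	have "hol_extension f g g' a r"
		unfolding hol_extension_def
	proof (intro conjI ballI allI)
		fix z assume z: "z \<in> ?S"
		show "(g has_derivative g' z) (at z)" using g(2)[OF z] z by (simp add: at_within_open[OF _ open_ball])
		have "bounded_linear (cJ :: 'b \<times> 'b => _)"
			unfolding cJ_def by (intro bounded_linear_Pair bounded_linear_minus bounded_linear_fst bounded_linear_snd)
		from bounded_linear.suminf[OF this sF'[OF z]] show "g' z (cJ v) = cJ (g' z v)" for v
			by (simp add: g'_def F'_J)
	next
		fix x assume x: "x \<in> ball a r"
		show "g (x, 0) = (f x, 0)"
		proof (rule sums_unique2[OF g(1) real_sums])
			show "(x, 0) \<in> ?S" using x pair_zero_ball by blast
			show "x \<in> ball a \<rho>" using x rr by auto
		qed
	qed (use r in auto)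
	moreover have "continuous_on ?S (\<lambda>z. g' z h)" for h
	proof -
		have ul: "uniform_limit ?S (\<lambda>n z. \<Sum>i<n. F' i z h) (\<lambda>z. \<Sum>i. F' i z h) sequentially"
			by (rule Weierstrass_m_test[OF bound summable_mult2[OF M]])
		have "continuous_on ?S (w i)" for i
			using has_derivative_continuous[OF wd] continuous_at_imp_continuous_on by blast
		hence "continuous_on ?S (\<lambda>z. F' i z h)" for i
			unfolding F'_def dT_def by (intro continuous_intros)
		thus ?thesis unfolding g'_def
			by (intro uniform_limit_theorem[OF _ ul] always_eventually allI continuous_on_sum) auto
	qed
	ultimately show ?thesis by blast
qed

lemma linear_injective_surj:
	fixes f :: "'a::euclidean_space => 'b::euclidean_space"
	assumes "linear f" "inj f" "DIM('a) = DIM('b)"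
	shows "surj f"
proof -
	have "dim (range f) = DIM('b)" using dim_image_eq[OF assms(1), of UNIV] assms by (simp add: inj_on_subset)
	hence "span (range f) = UNIV" by (simp add: dim_eq_full)
	thus ?thesis using linear_subspace_image[OF assms(1) subspace_UNIV] by (metis span_eq_iff)
qed

text \<open>At a real point the derivative of the extension acts as the real derivative on real and
  imaginary parts separately, hence is injective. The extension is then injective near this point
  and open by invariance of domain, and the inverse of a derivative commuting with \<open>cJ\<close>
  commutes with \<open>cJ\<close> as well.\<close>

lemma hol_ext_inverse:
	fixes h :: "'a::euclidean_space => 'b::euclidean_space"
	assumes dim: "DIM('a) = DIM('b)" and h: "hol_extension h H D a e"
		and cont: "\<And>v. continuous_on (ball (a, 0) e) (\<lambda>z. D z v)" and inj: "inj (Df h a)"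
		and V: "open V" "h a \<in> V" and g: "g (h a) = a" "isCont g (h a)" "\<And>y. y \<in> V ==> h (g y) = y"
	shows "hol_ext g (h a)"
proof -
	have e: "e > 0" using h by (simp add: hol_extension_def)
	have HD: "(H has_derivative D z) (at z)" "D z (cJ v) = cJ (D z v)" if "z \<in> ball (a, 0) e" for z v
		using h that unfolding hol_extension_def by blast+
	have a0: "(a, 0) \<in> ball (a, 0::'a) e" using e by simp
	let ?A = "Df h a"
	have linD: "linear (D z)" if "z \<in> ball (a, 0) e" for z using has_derivative_linear[OF HD(1)[OF that]] .
	have linA: "linear ?A"
	proof -
		have "(h has_derivative (\<lambda>v. fst (D (a, 0) (v, 0)))) (at a)"
			using hol_extension_has_derivative[OF h] e by simp
		thus ?thesis using has_derivative_linear frechet_derivative_at by metis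
	qed
	have D0: "D (a, 0) (v, w) = (?A v, ?A w)" for v w
	proof -
		have r: "D (a, 0) (v, 0) = (?A v, 0)" for v
			using hol_extension_derivative_real[OF h] e by simp
		have "(v, w) = (v, 0) + cJ (w, 0)" by (simp add: cJ_def)
		hence "D (a, 0) (v, w) = D (a, 0) (v, 0) + cJ (D (a, 0) (w, 0))"
			using linear_add[OF linD[OF a0]] HD(2)[OF a0] by metis
		thus ?thesis by (simp add: r cJ_def)
	qed
	have inj0: "inj (D (a, 0))"
	proof -
		have "p = 0" if "D (a, 0) p = 0" for p
		proof -
			obtain v w where p: "p = (v, w)" by (cases p)
			have "?A v = 0" "?A w = 0" using that D0[of v w] by (auto simp: p zero_prod_def)
			thus ?thesis using linear_injective_0[OF linA] inj by (auto simp: p zero_prod_def)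
		qed
		thus ?thesis using linear_injective_0[OF linD[OF a0]] by blast
	qed
	obtain r where r: "r > 0" "ball (a, 0) r \<subseteq> ball (a, 0::'a) e" "inj_on H (ball (a, 0) r)"
		"\<And>z. z \<in> ball (a, 0) r ==> inj (D z)"
		using C1_locally_injective[of "ball (a, 0) e" "(a, 0)" H D, OF open_ball a0 HD(1) cont inj0] by blast
	let ?B = "ball (a, 0::'a) r"
	define W where "W = H ` ?B"
	have cH: "continuous_on ?B H"
	proof (rule continuous_at_imp_continuous_on, rule ballI)
		fix z assume "z \<in> ?B"
		hence "z \<in> ball (a, 0) e" using r(2) by blast
		from has_derivative_continuous[OF HD(1)[OF this]] show "isCont H z" .
	qed
	have openW: "open W"
		unfolding W_def by (rule invariance_of_domain_gen[OF open_ball cH r(3)]) (simp add: dim)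
	define G where "G = inv_into ?B H"
	have GH: "G (H z) = z" if "z \<in> ?B" for z using inv_into_f_f[OF r(3) that] by (simp add: G_def)
	have GB: "G y \<in> ?B" and HG: "H (G y) = y" if "y \<in> W" for y
		using that inv_into_into[of y H ?B] f_inv_into_f[of y H ?B] by (auto simp: G_def W_def)
	have cG: "continuous_on W G"
		unfolding W_def by (rule continuous_on_inverse_open[OF open_ball cH _ GH]) (simp_all add: dim)
	have "\<forall>z\<in>?B. \<exists>L. linear L \<and> L \<circ> D z = id"
	proof
		fix z assume z: "z \<in> ?B"
		hence "z \<in> ball (a, 0) e" using r(2) by blast
		from linear_injective_left_inverse[OF linD[OF this] r(4)[OF z]] show "\<exists>L. linear L \<and> L \<circ> D z = id" .
	qed
	hence "\<exists>L. \<forall>z\<in>?B. linear (L z) \<and> L z \<circ> D z = id" by (rule bchoice)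
	then obtain L where L: "\<And>z. z \<in> ?B ==> linear (L z)" "\<And>z. z \<in> ?B ==> L z \<circ> D z = id" by blast
	have Ha: "H (a, 0) = (h a, 0)" and aB: "(a, 0) \<in> ?B" using h e r(1) by (auto simp: hol_extension_def)
	have "(h a, 0) \<in> W" unfolding W_def using image_eqI[of "(h a, 0)" H "(a, 0)" ?B] Ha aB by simp
	then obtain d1 where d1: "d1 > 0" "ball (h a, 0) d1 \<subseteq> W" using openW openE by blast
	obtain d2 where d2: "d2 > 0" "ball (h a) d2 \<subseteq> V" using V openE by blast
	obtain d3 where d3: "d3 > 0" "\<And>y. dist y (h a) < d3 ==> dist (g y) a < r"
		using g(2) r(1) unfolding continuous_at_eps_delta g(1) by blast
	\<comment> \<open>\<open>d1\<close> keeps \<open>y\<close> in the domain of \<open>G\<close>,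
	  \<open>d2\<close> in \<open>V\<close>, and \<open>d3\<close> keeps \<open>g y\<close> in the ball
	  on which \<open>H\<close> is injective; so \<open>G\<close> extends \<open>g\<close> on real
	  points.\<close>
	define d where "d = min d1 (min d2 d3)"
	have "hol_extension g G (\<lambda>y. L (G y)) (h a) d"
		unfolding hol_extension_def
	proof (intro conjI ballI allI)
		show "0 < d" using d1 d2 d3 by (simp add: d_def)
		fix y assume "y \<in> ball (h a, 0::'b) d"
		hence y: "y \<in> W" using d1 by (auto simp: d_def)
		note GB[OF y]
		hence Ge: "G y \<in> ball (a, 0) e" using r(2) by blast
		show "(G has_derivative L (G y)) (at y)"
		proof (rule has_derivative_inverse_basic[where f=H and f'="D (G y)" and T=W])
			show "bounded_linear (L (G y))" using L(1)[OF GB[OF y]] linear_conv_bounded_linear by blast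
			show "isCont G y" using cG openW y continuous_on_eq_continuous_at by blast
		qed (use HD(1)[OF Ge] L(2)[OF GB[OF y]] openW y HG in auto)
		fix v :: "'b \<times> 'b"
		have "surj (D (G y))"
			by (rule linear_injective_surj[OF linD[OF Ge] r(4)[OF GB[OF y]]]) (simp add: dim)
		then obtain u where u: "v = D (G y) u" by (metis surjD)
		have Lu: "L (G y) (D (G y) u) = u" for u using L(2)[OF GB[OF y]] by (metis comp_apply id_apply)
		show "L (G y) (cJ v) = cJ (L (G y) v)"
			unfolding u HD(2)[OF Ge, symmetric] Lu ..
	next
		fix y assume y: "y \<in> ball (h a) d"
		hence gy: "(g y, 0) \<in> ?B" unfolding pair_zero_ball using d3(2)[of y] by (auto simp: d_def dist_commute)
		hence "g y \<in> ball a e" using r(2) pair_zero_ball by blast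
		hence "H (g y, 0) = (h (g y), 0)" using h unfolding hol_extension_def by blast
		also have "h (g y) = y" using y d2 by (intro g(3)) (auto simp: d_def)
		finally show "G (y, 0) = (g y, 0)" using GH[OF gy] by simp
	qed
	thus ?thesis unfolding hol_ext_def by blast
qed

lemma real_analytic_on_hol_ext:
	fixes f :: "'a::euclidean_space => 'b::euclidean_space"
	shows "real_analytic_on f U \<longleftrightarrow> (\<forall>a\<in>U. hol_ext f a)"
	using real_analytic_imp_hol_extension[of f U] hol_ext_imp_real_analytic[of U f] unfolding hol_ext_def by blast

text \<open>The induction stays within the analytic class because directional derivatives are
  analytic again.\<close>

lemma real_analytic_imp_Ck:
	fixes f :: "'a::euclidean_space => 'b::euclidean_space"
	assumes "real_analytic_on f U"
	shows "Ck_on k f U"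
	using assms
proof (induction k arbitrary: f)
	case 0
	have "isCont f x" if x: "x \<in> U" for x
	proof -
		obtain G D e where G: "hol_extension f G D x e"
			using 0 x unfolding real_analytic_on_hol_ext hol_ext_def by blast
		hence "x \<in> ball x e" by (simp add: hol_extension_def)
		from has_derivative_continuous[OF hol_extension_has_derivative[OF G this]] show ?thesis .
	qed
	thus ?case by (simp add: continuous_at_imp_continuous_on)
next
	case (Suc k)
	have "f differentiable (at x)" if x: "x \<in> U" for x
	proof -
		obtain G D e where G: "hol_extension f G D x e"
			using Suc.prems x unfolding real_analytic_on_hol_ext hol_ext_def by blast
		hence "x \<in> ball x e" by (simp add: hol_extension_def)
		from hol_extension_has_derivative[OF G this] show ?thesis unfolding differentiable_def by blast
	qed
	moreover have "real_analytic_on (\<lambda>x. Df f x v) U" for v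
		using hol_ext_derivative_real_analytic[of U f v] Suc.prems unfolding real_analytic_on_hol_ext by blast
	ultimately show ?case using Suc.IH by simp
qed

section \<open>Closure properties of \<open>C\<^sup>r\<close> maps\<close>

lemma Cr_on_imp_Ck:
	fixes f :: "'a::euclidean_space => 'b::euclidean_space"
	shows "Cr_on r f U ==> Ck_on k f U"
	by (cases r) (auto simp: Cr_on_def real_analytic_imp_Ck)

lemma Cr_on_continuous:
	fixes f :: "'a::euclidean_space => 'b::euclidean_space"
	shows "Cr_on r f U ==> continuous_on U f"
	using Cr_on_imp_Ck[of r f U 0] by simp

lemma Cr_on_has_derivative:
	fixes f :: "'a::euclidean_space => 'b::euclidean_space"
	shows "Cr_on r f U ==> x \<in> U ==> (f has_derivative Df f x) (at x)"
	using Ck_on_SucE[OF Cr_on_imp_Ck[of r f U "Suc 0"]] by blast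

lemma Cr_on_derivative_continuous:
	fixes f :: "'a::euclidean_space => 'b::euclidean_space"
	shows "Cr_on r f U ==> continuous_on U (\<lambda>x. Df f x v)"
	using Cr_on_imp_Ck[of r f U "Suc 0"] by simp

lemma Cr_on_subset: "Cr_on r f U ==> V \<subseteq> U ==> Cr_on r f V"
	by (cases r) (auto simp: Cr_on_def real_analytic_on_def intro: Ck_on_subset)

lemma Cr_on_local:
	assumes "open U" "\<And>x. x \<in> U ==> \<exists>V. open V \<and> x \<in> V \<and> Cr_on r f V"
	shows "Cr_on r f U"
proof (cases r)
	case Cinf
	have "Ck_on k f U" for k
		by (rule Ck_on_local[OF assms(1)]) (use assms(2) Cinf in \<open>fastforce simp: Cr_on_def\<close>)
	thus ?thesis using Cinf by (simp add: Cr_on_def)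
next
	case Comega
	thus ?thesis using assms(2) by (auto simp: Cr_on_def real_analytic_on_def)
qed

lemma Cr_on_cong:
	assumes "open U" "\<And>x. x \<in> U ==> f x = g x" "Cr_on r f U"
	shows "Cr_on r g U"
proof (cases r)
	case Cinf
	thus ?thesis using assms Ck_on_cong[OF assms(1), of f g] by (simp add: Cr_on_def)
next
	case Comega
	hence an: "real_analytic_on f U" using assms(3) by (simp add: Cr_on_def)
	have "real_analytic_on g U"
		unfolding real_analytic_on_def
	proof
		fix a assume a: "a \<in> U"
		obtain d where d: "d > 0" "ball a d \<subseteq> U" using assms(1) a openE by blast
		obtain \<rho> c where \<rho>: "\<rho> > 0" "\<And>x. x \<in> ball a \<rho> ==>
				((\<lambda>k. mpow (x - a) k *. c k) has_sum f x) midx"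
			using an a unfolding real_analytic_on_def by blast
		have "((\<lambda>k. mpow (x - a) k *. c k) has_sum g x) midx"
			if x: "x \<in> ball a (min \<rho> d)" for x
		proof -
			have "x \<in> U" using x d(2) by auto
			thus ?thesis using \<rho>(2)[of x] x assms(2) by simp
		qed
		thus "\<exists>\<rho>>0. \<exists>c. \<forall>x\<in>ball a \<rho>. ((\<lambda>k. mpow (x - a) k *. c k) has_sum g x) midx"
			using \<rho>(1) d(1) by (intro exI[of _ "min \<rho> d"] conjI exI[of _ c]) auto
	qed
	thus ?thesis using Comega by (simp add: Cr_on_def)
qed

lemma Cr_on_compose:
	fixes f :: "'a::euclidean_space => 'b::euclidean_space" and g :: "'b => 'c::euclidean_space"
	assumes "open U" "open V" "f ` U \<subseteq> V" "Cr_on r f U" "Cr_on r g V"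
	shows "Cr_on r (\<lambda>x. g (f x)) U"
proof (cases r)
	case Cinf
	thus ?thesis using assms(4,5) Ck_on_compose[OF assms(1-3), of _ g] by (simp add: Cr_on_def)
next
	case Comega
	have "hol_ext (\<lambda>x. g (f x)) a" if "a \<in> U" for a
	proof (rule hol_ext_compose[of f _ g])
		show "hol_ext f a" using assms(4) that Comega by (simp add: Cr_on_def real_analytic_on_hol_ext)
		show "hol_ext g (f a)" using assms(3,5) that Comega by (auto simp: Cr_on_def real_analytic_on_hol_ext)
	qed
	thus ?thesis using Comega by (simp add: Cr_on_def real_analytic_on_hol_ext)
qed

lemma Cr_on_bounded_linear:
	fixes f :: "'a::euclidean_space => 'b::euclidean_space"
	assumes "open U" "bounded_linear f"
	shows "Cr_on r f U"
	by (cases r) (auto simp: Cr_on_def real_analytic_on_hol_ext assms hol_ext_bounded_linear Ck_on_linear_fun)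

lemma Cr_on_Pair:
	fixes f :: "'a::euclidean_space => 'b::euclidean_space" and g :: "'a => 'c::euclidean_space"
	assumes "open U" "Cr_on r f U" "Cr_on r g U"
	shows "Cr_on r (\<lambda>x. (f x, g x)) U"
	using assms by (cases r) (auto simp: Cr_on_def real_analytic_on_hol_ext hol_ext_Pair Ck_on_Pair)

lemma Cr_on_linear_compose:
	fixes f :: "'a::euclidean_space => 'b::euclidean_space" and L :: "'b => 'c::euclidean_space"
	assumes "open U" "bounded_linear L" "Cr_on r f U"
	shows "Cr_on r (\<lambda>x. L (f x)) U"
	by (rule Cr_on_compose[OF assms(1) open_UNIV subset_UNIV assms(3) Cr_on_bounded_linear[OF open_UNIV assms(2)]])

lemma Cr_on_scaleR:
	fixes u :: "'a::euclidean_space => real" and f :: "'a => 'b::euclidean_space"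
	assumes "open U" "Cr_on r u U" "Cr_on r f U"
	shows "Cr_on r (\<lambda>x. u x *. f x) U"
proof -
	have "Ck_on k (\<lambda>p :: real \<times> 'b. fst p *. snd p) UNIV" for k
		by (rule Ck_on_bilinear[OF open_UNIV bounded_bilinear_scaleR
					Ck_on_linear_fun[OF open_UNIV bounded_linear_fst] Ck_on_linear_fun[OF open_UNIV bounded_linear_snd]])
	hence "Cr_on r (\<lambda>p :: real \<times> 'b. fst p *. snd p) UNIV"
		by (cases r) (simp_all add: Cr_on_def real_analytic_on_hol_ext hol_ext_scaleR)
	from Cr_on_compose[OF assms(1) open_UNIV subset_UNIV Cr_on_Pair[OF assms] this]
	show ?thesis unfolding fst_conv snd_conv .
qed

lemma Cr_on_add:
	fixes f g :: "'a::euclidean_space => 'b::euclidean_space"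
	assumes "open U" "Cr_on r f U" "Cr_on r g U"
	shows "Cr_on r (\<lambda>x. f x + g x) U"
proof -
	have "bounded_linear (\<lambda>p :: 'b \<times> 'b. fst p + snd p)"
		by (intro bounded_linear_add bounded_linear_fst bounded_linear_snd)
	from Cr_on_linear_compose[OF assms(1) this Cr_on_Pair[OF assms]] show ?thesis by simp
qed

lemma Cr_on_const:
	fixes c :: "'b::euclidean_space"
	assumes "open (U :: 'a::euclidean_space set)"
	shows "Cr_on r (\<lambda>x. c) U"
proof (cases r)
	case Comega
	have "cJ (0 :: 'b \<times> 'b) = 0" by (simp add: cJ_def zero_prod_def)
	hence "hol_extension (\<lambda>x :: 'a. c) (\<lambda>z. (c, 0)) (\<lambda>z v. 0) a 1" for a
		by (simp add: hol_extension_def)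
	hence "hol_ext (\<lambda>x :: 'a. c) a" for a unfolding hol_ext_def by blast
	thus ?thesis using Comega by (simp add: Cr_on_def real_analytic_on_hol_ext)
qed (simp add: Cr_on_def Ck_on_const)

lemma Cr_on_inverse_map:
	fixes h :: "real ^ 'n => 'b::euclidean_space"
	assumes dim: "DIM('b) = CARD('n)"
		and U: "open U" and V: "open V" and gV: "g ` V \<subseteq> U" and contg: "continuous_on V g"
		and hg: "\<And>y. y \<in> V ==> h (g y) = y"
		and h: "Cr_on r h U" and inj: "\<And>x. x \<in> U ==> inj (Df h x)"
		and gh: "\<And>x. x \<in> U ==> h x \<in> V ==> g (h x) = x"
	shows "Cr_on r g V"
proof (cases r)
	case Cinf
	thus ?thesis using h
		by (auto simp: Cr_on_def intro: Ck_on_inverse_map[OF dim U V gV contg hg _ inj])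
next
	case Comega
	have "hol_ext g y" if y: "y \<in> V" for y
	proof -
		have gy: "g y \<in> U" using gV y by auto
		obtain G D e where G: "hol_extension h G D (g y) e" "\<And>v. continuous_on (ball (g y, 0) e) (\<lambda>z. D z v)"
			using real_analytic_imp_hol_extension[of h U "g y"] h gy Comega by (auto simp: Cr_on_def)
		have "isCont g y" using contg V y continuous_on_eq_continuous_at by blast
		hence "hol_ext g (h (g y))"
			using hg[OF y] y dim by (intro hol_ext_inverse[OF _ G inj[OF gy] V]) (auto simp: hg)
		thus ?thesis by (simp add: hg y)
	qed
	thus ?thesis using Comega by (simp add: Cr_on_def real_analytic_on_hol_ext)
qed

text \<open>For entire functions that are real on the real line; it makes \<open>cos\<close> and
  \<open>sin\<close>, and with them the parametrized circle of the plane case, analytic.\<close>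

lemma hol_ext_of_complex:
	assumes "\<And>w. (g has_field_derivative g' w) (at w)" "\<And>x. g (complex_of_real x) = of_real (f x)"
	shows "hol_ext f a"
proof -
	let ?C = "\<lambda>z. Complex (fst z) (snd z)"
	have C: "(?C has_derivative ?C) (at z)" for z
	proof -
		have "bounded_linear (\<lambda>z :: real \<times> real. of_real (fst z) + \<i> * of_real (snd z))"
			by (intro bounded_linear_add bounded_linear_const_mult bounded_linear_compose[OF bounded_linear_of_real]
					bounded_linear_fst bounded_linear_snd)
		hence "bounded_linear ?C" by (simp add: Complex_eq)
		thus ?thesis by (rule bounded_linear_imp_has_derivative)
	qed
	have "((\<lambda>z. g (?C z)) has_derivative (\<lambda>v. g' (?C z) * ?C v)) (at z)" for z
		using has_derivative_compose[OF C, of g "\<lambda>v. g' (?C z) * v"] assms(1)[of "?C z"]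
		by (simp add: has_field_derivative_def)
	hence "((\<lambda>z. (Re (g (?C z)), Im (g (?C z)))) has_derivative
			(\<lambda>v. (Re (g' (?C z) * ?C v), Im (g' (?C z) * ?C v)))) (at z)" for z
		by (intro has_derivative_Pair has_derivative_Re has_derivative_Im)
	hence "hol_extension f (\<lambda>z. (Re (g (?C z)), Im (g (?C z))))
		 (\<lambda>z v. (Re (g' (?C z) * ?C v), Im (g' (?C z) * ?C v))) a 1"
		using assms(2) by (auto simp: hol_extension_def cJ_def complex_of_real_def)
	thus ?thesis unfolding hol_ext_def by blast
qed

lemma real_analytic_imp_Cr:
	fixes f :: "'a::euclidean_space => 'b::euclidean_space"
	shows "real_analytic_on f U ==> Cr_on r f U"
	by (cases r) (auto simp: Cr_on_def real_analytic_imp_Ck)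

lemma Cr_on_cos: "Cr_on r (cos :: real => real) U"
	using hol_ext_of_complex[of cos "\<lambda>w. - sin w" cos] DERIV_cos
	by (intro real_analytic_imp_Cr) (auto simp: real_analytic_on_hol_ext cos_of_real)

lemma Cr_on_sin: "Cr_on r (sin :: real => real) U"
	using hol_ext_of_complex[of sin cos sin] DERIV_sin
	by (intro real_analytic_imp_Cr) (auto simp: real_analytic_on_hol_ext sin_of_real)

section \<open>Charts and differentials\<close>

text \<open>For Euclidean values the continuity that \<open>Cr_map\<close> demands in addition
  follows from the charts, so only the chart expressions are recorded.\<close>

definition cr_fun :: "regularity => ('m, 'e::euclidean_space) mfd => ('m => 'b::euclidean_space) => bool" where
	"cr_fun r M G \<longleftrightarrow> (\<forall>c\<in>charts M. Cr_on r (G \<circ> chart_inv c) (cod c))"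

locale cr_manifold =
	fixes r :: regularity and M :: "('m, 'e::euclidean_space) mfd"
	assumes manifold: "Cr_manifold r M"
begin

lemma hausdorff: "Hausdorff_space (mtop M)" and connected: "connected_space (mtop M)"
	and second_countable: "second_countable (mtop M)"
	using manifold by (auto simp: Cr_manifold_def)

lemma chart_openin: "c \<in> charts M ==> openin (mtop M) (fst c)"
	and chart_open: "c \<in> charts M ==> open (cod c)"
	and chart_homeo: "c \<in> charts M ==>
		homeomorphic_map (subtopology (mtop M) (fst c)) (top_of_set (cod c)) (snd c)"
	using manifold by (auto simp: Cr_manifold_def)

lemma transition: "c \<in> charts M ==> d \<in> charts M ==> Cr_on r (snd d \<circ> chart_inv c) (snd c ` (fst c \<inter> fst d))"
	using manifold by (auto simp: Cr_manifold_def)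

lemma ex_chart: "p \<in> pts M ==> \<exists>c. c \<in> charts_at M p"
	using manifold unfolding Cr_manifold_def charts_at_def by blast

lemma chart_subset: "c \<in> charts M ==> fst c \<subseteq> pts M"
	using chart_openin openin_subset by blast

lemma charts_atD: "c \<in> charts_at M p ==> c \<in> charts M" "c \<in> charts_at M p ==> p \<in> fst c"
	by (auto simp: charts_at_def)

lemma charts_at_topspace: "c \<in> charts_at M p ==> p \<in> pts M"
	using charts_atD chart_subset by blast

lemma chart_inj: "c \<in> charts M ==> inj_on (snd c) (fst c)"
	using homeomorphic_imp_injective_map[OF chart_homeo] chart_subset by (metis topspace_subtopology_subset)

lemma chart_inv_left [simp]: "c \<in> charts M ==> p \<in> fst c ==> chart_inv c (snd c p) = p"
	unfolding chart_inv_def by (rule inv_into_f_f[OF chart_inj])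

lemma chart_inv_in: "y \<in> cod c ==> chart_inv c y \<in> fst c"
	and chart_inv_right: "y \<in> cod c ==> snd c (chart_inv c y) = y"
	unfolding chart_inv_def by (auto intro: inv_into_into f_inv_into_f)

lemma chart_continuous: "c \<in> charts M ==> continuous_map (subtopology (mtop M) (fst c)) euclidean (snd c)"
	using homeomorphic_imp_continuous_map[OF chart_homeo] by (simp add: continuous_map_in_subtopology)

lemma chart_image_open:
	assumes "c \<in> charts M" "openin (mtop M) N"
	shows "open (snd c ` (fst c \<inter> N))"
proof -
	have "openin (subtopology (mtop M) (fst c)) (fst c \<inter> N)"
		using assms(2) by (auto simp: openin_subtopology)
	hence "openin (top_of_set (cod c)) (snd c ` (fst c \<inter> N))"
		using homeomorphic_imp_open_map[OF chart_homeo[OF assms(1)]] unfolding open_map_def by blast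
	thus ?thesis using chart_open[OF assms(1)] openin_open_eq by blast
qed

lemma chart_preimage_openin:
	assumes "c \<in> charts M" "open W"
	shows "openin (mtop M) {p \<in> fst c. snd c p \<in> W}"
proof -
	have "openin (subtopology (mtop M) (fst c)) {p \<in> topspace (subtopology (mtop M) (fst c)). snd c p \<in> W}"
		using chart_continuous[OF assms(1)] assms(2) unfolding continuous_map_def by auto
	hence "openin (subtopology (mtop M) (fst c)) {p \<in> fst c. snd c p \<in> W}"
		using chart_subset[OF assms(1)] by (simp add: Int_absorb1)
	thus ?thesis using chart_openin[OF assms(1)] openin_trans_full by blast
qed

lemma chart_inv_continuous:
	assumes c: "c \<in> charts M"
	shows "continuous_map (top_of_set (cod c)) (mtop M) (chart_inv c)"
proof (rule continuous_map_into_fulltopology[of _ _ "fst c"], unfold continuous_map_def, intro conjI allI impI)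
	show "chart_inv c \<in> topspace (top_of_set (cod c)) \<rightarrow> topspace (subtopology (mtop M) (fst c))"
		using chart_inv_left[OF c] chart_subset[OF c] by auto
next
	fix N assume "openin (subtopology (mtop M) (fst c)) N"
	then obtain N' where N': "openin (mtop M) N'" "N = N' \<inter> fst c" by (auto simp: openin_subtopology)
	have "{y \<in> topspace (top_of_set (cod c)). chart_inv c y \<in> N} = snd c ` (fst c \<inter> N')"
		using N'(2) chart_inv_left[OF c] by (auto simp: image_iff)
	moreover have "open (snd c ` (fst c \<inter> N'))" by (rule chart_image_open[OF c N'(1)])
	ultimately show "openin (top_of_set (cod c)) {y \<in> topspace (top_of_set (cod c)). chart_inv c y \<in> N}"
		by (auto intro: open_subset)
qed

lemma cr_fun_Cr_on: "cr_fun r M G ==> c \<in> charts M ==> Cr_on r (\<lambda>y. G (chart_inv c y)) (cod c)"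
	by (simp add: cr_fun_def o_def)

lemma Cr_map_flat_iff:
	fixes G :: "'m => 'b::euclidean_space"
	shows "Cr_map r M flat G \<longleftrightarrow> cr_fun r M G"
proof
	assume "Cr_map r M flat G"
	thus "cr_fun r M G" by (simp add: Cr_map_def flat_def cr_fun_def)
next
	assume G: "cr_fun r M G"
	have "continuous_map (mtop M) euclidean G"
		unfolding continuous_map_def
	proof (intro conjI allI impI)
		fix W :: "'b set" assume "openin euclidean W"
		hence W: "open W" by simp
		have "openin (mtop M) {p \<in> fst c. G p \<in> W}" if c: "c \<in> charts M" for c
		proof -
			have "continuous_on (cod c) (\<lambda>y. G (chart_inv c y))"
				by (rule Cr_on_continuous[OF cr_fun_Cr_on[OF G c]])
			hence "open {y \<in> cod c. G (chart_inv c y) \<in> W}"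
				using continuous_open_preimage[OF _ chart_open[OF c] W] by (simp add: vimage_def Int_def)
			from chart_preimage_openin[OF c this] show ?thesis
				by (rule back_subst[of "openin (mtop M)"], intro Collect_cong)
					(metis (mono_tags, lifting) chart_inv_left[OF c] image_eqI mem_Collect_eq)
		qed
		hence "openin (mtop M) (\<Union>c\<in>charts M. {p \<in> fst c. G p \<in> W})" by blast
		moreover have "(\<Union>c\<in>charts M. {p \<in> fst c. G p \<in> W}) = {p \<in> pts M. G p \<in> W}"
			using manifold unfolding Cr_manifold_def by blast
		ultimately show "openin (mtop M) {p \<in> pts M. G p \<in> W}" by simp
	qed auto
	thus "Cr_map r M flat G" using G by (simp add: Cr_map_def flat_def cr_fun_def)
qed

lemma cr_fun_continuous:
	fixes G :: "'m => 'b::euclidean_space"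
	shows "cr_fun r M G ==> continuous_map (mtop M) euclidean G"
	using Cr_map_flat_iff[of G] by (simp add: Cr_map_def flat_def)

lemma cr_fun_compose:
	fixes G :: "'m => 'b::euclidean_space" and L :: "'b => 'c::euclidean_space"
	assumes "cr_fun r M G" "Cr_on r L UNIV"
	shows "cr_fun r M (\<lambda>p. L (G p))"
	unfolding cr_fun_def o_def
proof
	fix c assume c: "c \<in> charts M"
	show "Cr_on r (\<lambda>y. L (G (chart_inv c y))) (cod c)"
		by (rule Cr_on_compose[OF chart_open[OF c] open_UNIV subset_UNIV cr_fun_Cr_on[OF assms(1) c] assms(2)])
qed

lemma cr_fun_linear:
	fixes G :: "'m => 'b::euclidean_space" and L :: "'b => 'c::euclidean_space"
	assumes "cr_fun r M G" "bounded_linear L"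
	shows "cr_fun r M (\<lambda>p. L (G p))"
	by (rule cr_fun_compose[OF assms(1) Cr_on_bounded_linear[OF open_UNIV assms(2)]])

lemma cr_fun_Pair:
	fixes G :: "'m => 'b::euclidean_space" and H :: "'m => 'c::euclidean_space"
	assumes "cr_fun r M G" "cr_fun r M H"
	shows "cr_fun r M (\<lambda>p. (G p, H p))"
	unfolding cr_fun_def o_def
	by (intro ballI Cr_on_Pair chart_open cr_fun_Cr_on assms)

lemma cr_fun_add:
	fixes G H :: "'m => 'b::euclidean_space"
	assumes "cr_fun r M G" "cr_fun r M H"
	shows "cr_fun r M (\<lambda>p. G p + H p)"
	unfolding cr_fun_def o_def
	by (intro ballI Cr_on_add chart_open cr_fun_Cr_on assms)

lemma cr_fun_scaleR:
	fixes G :: "'m => 'b::euclidean_space"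
	assumes "cr_fun r M u" "cr_fun r M G"
	shows "cr_fun r M (\<lambda>p. u p *. G p)"
	unfolding cr_fun_def o_def
	by (intro ballI Cr_on_scaleR chart_open cr_fun_Cr_on assms)

lemma cr_fun_const: "cr_fun r M (\<lambda>p. a :: 'b::euclidean_space)"
	unfolding cr_fun_def o_def by (auto intro!: Cr_on_const chart_open)

lemma chart_deriv_works:
	fixes G :: "'m => 'b::euclidean_space"
	assumes "cr_fun r M G" "c \<in> charts_at M p"
	shows "((\<lambda>y. G (chart_inv c y)) has_derivative der c G p) (at (snd c p))"
proof -
	have "snd c p \<in> cod c" using charts_atD(2)[OF assms(2)] by blast
	from Cr_on_has_derivative[OF cr_fun_Cr_on[OF assms(1) charts_atD(1)[OF assms(2)]] this]
	show ?thesis by (simp add: chart_deriv_def o_def)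
qed

lemma chart_deriv_linear:
	fixes G :: "'m => 'b::euclidean_space"
	assumes "cr_fun r M G" "c \<in> charts_at M p"
	shows "linear (der c G p)"
	using has_derivative_linear[OF chart_deriv_works[OF assms]] .

lemma chart_deriv_eqI:
	assumes "((\<lambda>y. G (chart_inv c y)) has_derivative D) (at (snd c p))"
	shows "der c G p = D"
	using frechet_derivative_at[OF assms] by (simp add: chart_deriv_def o_def)

lemma transition_deriv:
	assumes "c \<in> charts_at M p" "d \<in> charts_at M p"
	shows "((\<lambda>y. snd d (chart_inv c y)) has_derivative der c (snd d) p) (at (snd c p))"
proof -
	have c: "c \<in> charts M" "p \<in> fst c" and d: "d \<in> charts M" "p \<in> fst d"
		using assms charts_atD by blast+
	have "snd c p \<in> snd c ` (fst c \<inter> fst d)" using c d by blast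
	from Cr_on_has_derivative[OF transition[OF c(1) d(1)] this]
	show ?thesis by (simp add: chart_deriv_def o_def)
qed

lemma transition_deriv_linear:
	assumes "c \<in> charts_at M p" "d \<in> charts_at M p"
	shows "linear (der c (snd d) p)"
	using has_derivative_linear[OF transition_deriv[OF assms]] .

lemma chart_deriv_change:
	assumes c: "c \<in> charts_at M p" and d: "d \<in> charts_at M p"
		and G: "((\<lambda>y. G (chart_inv d y)) has_derivative D) (at (snd d p))"
	shows "((\<lambda>y. G (chart_inv c y)) has_derivative (\<lambda>u. D (der c (snd d) p u))) (at (snd c p))"
proof -
	have c': "c \<in> charts M" "p \<in> fst c" and d': "d \<in> charts M" "p \<in> fst d"
		using assms charts_atD by blast+
	have eq: "snd d p = snd d (chart_inv c (snd c p))" using c' by simp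
	have "((\<lambda>y. G (chart_inv d (snd d (chart_inv c y)))) has_derivative (\<lambda>u. D (der c (snd d) p u))) (at (snd c p))"
		using has_derivative_compose[OF transition_deriv[OF c d], of "\<lambda>y. G (chart_inv d y)" D] G eq by simp
	moreover have "open (snd c ` (fst c \<inter> fst d))" by (rule chart_image_open[OF c'(1) chart_openin[OF d'(1)]])
	moreover have "snd c p \<in> snd c ` (fst c \<inter> fst d)" using c' d' by blast
	ultimately show ?thesis
		by (rule has_derivative_transform_within_open) (use c'(1) d'(1) in auto)
qed

lemma transition_deriv_trans:
	assumes "c \<in> charts_at M p" "d \<in> charts_at M p" "e \<in> charts_at M p"
	shows "der d (snd e) p (der c (snd d) p u) = der c (snd e) p u"
	using chart_deriv_eqI[OF chart_deriv_change[OF assms(1,2) transition_deriv[OF assms(2,3)]]] by simp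

lemma chart_deriv_transition:
	fixes G :: "'m => 'b::euclidean_space"
	assumes "cr_fun r M G" "c \<in> charts_at M p" "d \<in> charts_at M p"
	shows "der c G p u = der d G p (der c (snd d) p u)"
	using chart_deriv_eqI[OF chart_deriv_change[OF assms(2,3) chart_deriv_works[OF assms(1,3)]]] by simp

lemma tangent_change:
	assumes "v \<in> tangent_space M p" "c \<in> charts_at M p" "d \<in> charts_at M p"
	shows "v d = der c (snd d) p (v c)"
	using assms unfolding tangent_space_def by blast

lemma tangent_outside: "v \<in> tangent_space M p ==> d \<notin> charts_at M p ==> v d = 0"
	unfolding tangent_space_def by blast

lemma differential_chart:
	fixes G :: "'m => 'b::euclidean_space"
	assumes "cr_fun r M G" "v \<in> tangent_space M p" "c \<in> charts_at M p"
	shows "differential M G p v = der c G p (v c)"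
proof -
	have d: "(SOME c. c \<in> charts_at M p) \<in> charts_at M p" using assms(3) by (rule someI)
	show ?thesis
		unfolding differential_def Let_def
		using chart_deriv_transition[OF assms(1) d assms(3)] tangent_change[OF assms(2) d assms(3)] by simp
qed

text \<open>The other components are forced to be the images of \<open>u\<close> under the
  transition derivatives; they are compatible by the cocycle rule
  \<open>transition_deriv_trans\<close>.\<close>

lemma ex_tangent:
	assumes c: "c \<in> charts_at M p"
	shows "\<exists>v\<in>tangent_space M p. v c = u"
proof -
	let ?v = "\<lambda>d. if d \<in> charts_at M p then der c (snd d) p u else 0"
	have "((\<lambda>y. snd c (chart_inv c y)) has_derivative (\<lambda>u. u)) (at (snd c p))"
	proof (rule has_derivative_transform_within_open[OF has_derivative_ident chart_open[OF charts_atD(1)[OF c]]])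
		show "snd c p \<in> cod c" using charts_atD(2)[OF c] by blast
		show "y = snd c (chart_inv c y)" if "y \<in> cod c" for y using chart_inv_right[OF that] by simp
	qed
	hence "der c (snd c) p = (\<lambda>u. u)" by (rule chart_deriv_eqI[of "snd c" c "\<lambda>u. u" p])
	hence vc: "?v c = u" using c by simp
	have vT: "?v \<in> tangent_space M p"
		unfolding tangent_space_def
	proof (intro CollectI conjI ballI allI impI)
		fix d e assume d: "d \<in> charts_at M p" and e: "e \<in> charts_at M p"
		show "?v e = der d (snd e) p (?v d)"
			using transition_deriv_trans[OF c d e] d e by simp
	qed simp
	show ?thesis by (rule bexI[of "\<lambda>v. v c = u" ?v, OF vc vT])
qed

lemma tangent_zero:
	assumes "v \<in> tangent_space M p" "c \<in> charts_at M p" "v c = 0"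
	shows "v = (\<lambda>_. 0)"
proof
	fix d show "v d = 0"
	proof (cases "d \<in> charts_at M p")
		case True
		thus ?thesis
			using tangent_change[OF assms(1,2) True] linear_0[OF transition_deriv_linear[OF assms(2) True]] assms(3) by simp
	next
		case False thus ?thesis using tangent_outside[OF assms(1)] by simp
	qed
qed

text \<open>This allows immersions to be tested on coordinate vectors in a single chart instead of
  on families of components.\<close>

lemma inj_on_differential_iff:
	fixes G :: "'m => 'b::euclidean_space"
	assumes G: "cr_fun r M G" and c: "c \<in> charts_at M p"
	shows "inj_on (differential M G p) (tangent_space M p) \<longleftrightarrow> inj (der c G p)"
proof
	assume I: "inj_on (differential M G p) (tangent_space M p)"
	show "inj (der c G p)"
	proof (rule injI)
		fix u u' assume eq: "der c G p u = der c G p u'"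
		obtain v v' where v: "v \<in> tangent_space M p" "v c = u" "v' \<in> tangent_space M p" "v' c = u'"
			using ex_tangent[OF c, of u] ex_tangent[OF c, of u'] by blast
		have "differential M G p v = differential M G p v'"
			using eq differential_chart[OF G v(1) c] differential_chart[OF G v(3) c] v(2,4) by simp
		from inj_onD[OF I this v(1,3)] have "v = v'" .
		thus "u = u'" using v by simp
	qed
next
	assume I: "inj (der c G p)"
	show "inj_on (differential M G p) (tangent_space M p)"
	proof (rule inj_onI)
		fix v v' assume v: "v \<in> tangent_space M p" "v' \<in> tangent_space M p" "differential M G p v = differential M G p v'"
		hence "der c G p (v c) = der c G p (v' c)"
			using differential_chart[OF G v(1) c] differential_chart[OF G v(2) c] by simp
		hence vc: "v c = v' c" by (rule injD[OF I])
		show "v = v'"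
		proof
			fix d show "v d = v' d"
				using tangent_change[OF v(1) c, of d] tangent_change[OF v(2) c, of d] vc
					tangent_outside[OF v(1), of d] tangent_outside[OF v(2), of d]
				by (cases "d \<in> charts_at M p") simp_all
		qed
	qed
qed

lemma immersion_at_flat_iff:
	fixes G :: "'m => 'b::euclidean_space"
	assumes G: "cr_fun r M G" and c: "c \<in> charts_at M p"
	shows "immersion_at M flat G p \<longleftrightarrow> inj (der c G p)"
proof -
	have "charts_at flat (G p) = {(UNIV, id)}" by (auto simp: charts_at_def flat_def)
	thus ?thesis unfolding immersion_at_def using inj_on_differential_iff[OF assms] by simp
qed

end

lemma Cr_on_locally_injective:
	fixes f :: "'a::euclidean_space => 'b::euclidean_space"
	assumes "open U" "a \<in> U" "Cr_on r f U" "inj (Df f a)"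
	shows "\<exists>s>0. ball a s \<subseteq> U \<and> inj_on f (ball a s) \<and> (\<forall>x\<in>ball a s. inj (Df f x))"
proof (rule C1_locally_injective[of U a f "\<lambda>x. Df f x"])
	fix s assume "s > 0" "ball a s \<subseteq> U" "inj_on f (ball a s)" "\<And>x. x \<in> ball a s ==> inj (Df f x)"
	thus ?thesis by (intro exI[of _ s]) simp
qed (use assms Cr_on_has_derivative[OF assms(3)] Cr_on_derivative_continuous[OF assms(3)] in simp_all)

section \<open>The flow of the null field\<close>

text \<open>The set where the lifts agree is closed since \<open>Y\<close> is Hausdorff and open
  since \<open>p\<close> is locally injective. The lemma is used for null lines, for lifted paths
  and for sections over the sphere.\<close>

lemma lift_unique:
	assumes Z: "connected_space Z" and Y: "Hausdorff_space Y"
		and a: "continuous_map Z Y a" and b: "continuous_map Z Y b"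
		and inj: "\<And>y. y \<in> topspace Y ==> \<exists>N. openin Y N \<and> y \<in> N \<and> inj_on p N"
		and eq: "\<And>z. z \<in> topspace Z ==> p (a z) = p (b z)"
		and z0: "z0 \<in> topspace Z" "a z0 = b z0" and z: "z \<in> topspace Z"
	shows "a z = b z"
proof -
	let ?E = "{z \<in> topspace Z. a z = b z}"
	have "openin Z ?E"
	proof (subst openin_subopen, rule ballI)
		fix z assume z: "z \<in> ?E"
		hence "a z \<in> topspace Y" using continuous_map_image_subset_topspace[OF a] by blast
		then obtain N where N: "openin Y N" "a z \<in> N" "inj_on p N" using inj by blast
		let ?T = "{z \<in> topspace Z. a z \<in> N} \<inter> {z \<in> topspace Z. b z \<in> N}"
		have "openin Z ?T"
			using openin_continuous_map_preimage[OF a N(1)] openin_continuous_map_preimage[OF b N(1)] by (rule openin_Int)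
		moreover have "z \<in> ?T" using z N(2) by auto
		moreover have "?T \<subseteq> ?E" using N(3) eq by (auto dest: inj_onD)
		ultimately show "\<exists>T. openin Z T \<and> z \<in> T \<and> T \<subseteq> ?E" by blast
	qed
	moreover have "closedin Z ?E" by (rule closedin_continuous_maps_eq[OF Y a b])
	ultimately have "?E = {} \<or> ?E = topspace Z" using Z unfolding connected_space_clopen_in by blast
	thus ?thesis using z0 z by auto
qed

lemma continuous_map_local:
	assumes "\<And>x. x \<in> topspace X ==> \<exists>U. openin X U \<and> x \<in> U \<and> continuous_map (subtopology X U) Y f"
	shows "continuous_map X Y f"
	unfolding continuous_map_def
proof (intro conjI allI impI)
	show "f \<in> topspace X \<rightarrow> topspace Y"
	proof
		fix x assume x: "x \<in> topspace X"
		then obtain U where "openin X U" "x \<in> U" "continuous_map (subtopology X U) Y f" using assms by blast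
		thus "f x \<in> topspace Y" using x by (auto simp: continuous_map_def Pi_iff)
	qed
next
	fix W assume W: "openin Y W"
	show "openin X {x \<in> topspace X. f x \<in> W}"
	proof (subst openin_subopen, rule ballI)
		fix x assume x: "x \<in> {x \<in> topspace X. f x \<in> W}"
		then obtain U where U: "openin X U" "x \<in> U" "continuous_map (subtopology X U) Y f" using assms by blast
		have "openin (subtopology X U) {x \<in> topspace (subtopology X U). f x \<in> W}"
			by (rule openin_continuous_map_preimage[OF U(3) W])
		hence "openin X {x \<in> topspace (subtopology X U). f x \<in> W}"
			using U(1) openin_trans_full by blast
		moreover have "x \<in> {x \<in> topspace (subtopology X U). f x \<in> W}" using x U(2) by simp
		moreover have "{x \<in> topspace (subtopology X U). f x \<in> W} \<subseteq> {x \<in> topspace X. f x \<in> W}" by auto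
		ultimately show "\<exists>T. openin X T \<and> x \<in> T \<and> T \<subseteq> {x \<in> topspace X. f x \<in> W}" by blast
	qed
qed

text \<open>The front after replacing its covector by a unit vector field \<nu> for which (1, \<nu>)
  is the normalized normal. \<open>contact\<close> is Lorentz orthogonality of (1, \<nu>) to the
  image of dF, and \<open>immersed\<close> is the immersion of the lift. \<open>kdim\<close> fixes
  the index type for the dimension of the slices.\<close>

locale null_front = cr_manifold r M
	for r :: regularity and M :: "('m, real ^ 'n) mfd" +
	fixes F :: "'m => real \<times> (real ^ 'n)" and \<nu> :: "'m => real ^ 'n" and kdim :: "'k::finite itself"
	assumes card_n: "2 \<le> CARD('n)" and card_k: "CARD('k) = CARD('n) - 1"
		and F: "cr_fun r M F" and nu: "cr_fun r M \<nu>"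
		and norm_nu: "p \<in> pts M ==> norm (\<nu> p) = 1"
		and contact: "c \<in> charts_at M p ==> fst (der c F p u) = \<nu> p \<bullet> snd (der c F p u)"
		and immersed: "c \<in> charts_at M p ==> der c F p u = 0 ==> der c \<nu> p u = 0 ==> u = 0"
		and ex_curve: "p \<in> pts M ==> \<exists>\<gamma>. \<gamma> 0 = p \<and> continuous_map euclidean (mtop M) \<gamma> \<and>
				(\<forall>s. F (\<gamma> s) = F p + s *. (1, \<nu> p)) \<and> (\<forall>s. \<nu> (\<gamma> s) = \<nu> p)"
		and ex_direction: "c \<in> charts_at M p ==>
				\<exists>X. der c F p X = (1, \<nu> p) \<and> der c \<nu> p X = 0"
begin

definition T :: "'m => real" where "T p = fst (F p)"

text \<open>The first integrals of the null field: \<open>P\<close> separates nearby null lines.\<close>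

definition P :: "'m => (real ^ 'n) \<times> (real ^ 'n)" where
	"P p = (snd (F p) - T p *. \<nu> p, \<nu> p)"

lemma cr_T: "cr_fun r M T"
	unfolding T_def by (rule cr_fun_linear[OF F bounded_linear_fst])

lemma cr_fhat: "cr_fun r M (\<lambda>p. snd (F p) - (T p + a) *. \<nu> p)"
proof -
	have "cr_fun r M (\<lambda>p. snd (F p) + (- (T p + a)) *. \<nu> p)"
		by (intro cr_fun_add cr_fun_scaleR cr_fun_linear[OF F bounded_linear_snd] nu
				cr_fun_linear[OF cr_fun_add[OF cr_T cr_fun_const] bounded_linear_minus[OF bounded_linear_ident]])
	thus ?thesis by (simp only: scaleR_minus_left add_uminus_conv_diff)
qed

lemma cr_P: "cr_fun r M P"
	unfolding P_def using cr_fun_Pair[OF cr_fhat[of 0] nu] by simp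

lemma T_deriv: "c \<in> charts_at M p ==> der c T p u = fst (der c F p u)"
proof -
	assume c: "c \<in> charts_at M p"
	have "((\<lambda>y. T (chart_inv c y)) has_derivative (\<lambda>u. fst (der c F p u))) (at (snd c p))"
		unfolding T_def by (rule has_derivative_fst[OF chart_deriv_works[OF F c]])
	from chart_deriv_eqI[of T c _ p, OF this] show ?thesis by simp
qed

lemma fhat_deriv:
	assumes c: "c \<in> charts_at M p"
	shows "der c (\<lambda>p. snd (F p) - (T p + a) *. \<nu> p) p u =
			snd (der c F p u) - fst (der c F p u) *. \<nu> p - (T p + a) *. der c \<nu> p u"
proof -
	have p: "chart_inv c (snd c p) = p" using charts_atD[OF c] by simp
	have dT: "((\<lambda>y. T (chart_inv c y)) has_derivative (\<lambda>u. fst (der c F p u))) (at (snd c p))"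
		unfolding T_def by (rule has_derivative_fst[OF chart_deriv_works[OF F c]])
	have "((\<lambda>y. snd (F (chart_inv c y)) - (T (chart_inv c y) + a) *. \<nu> (chart_inv c y)) has_derivative
			(\<lambda>u. snd (der c F p u) - ((T (chart_inv c (snd c p)) + a) *. der c \<nu> p u +
				(fst (der c F p u) + 0) *. \<nu> (chart_inv c (snd c p))))) (at (snd c p))"
		by (rule has_derivative_diff[OF has_derivative_snd[OF chart_deriv_works[OF F c]]
					has_derivative_scaleR[OF has_derivative_add[OF dT has_derivative_const] chart_deriv_works[OF nu c]]])
	from chart_deriv_eqI[of "\<lambda>p. snd (F p) - (T p + a) *. \<nu> p" c _ p, OF this]
	show ?thesis by (simp add: p)
qed

lemma P_deriv:
	assumes c: "c \<in> charts_at M p"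
	shows "der c P p u =
		(snd (der c F p u) - fst (der c F p u) *. \<nu> p - T p *. der c \<nu> p u, der c \<nu> p u)"
proof -
	have "((\<lambda>y. P (chart_inv c y)) has_derivative (\<lambda>u. (der c (\<lambda>p. snd (F p) - (T p + 0) *. \<nu> p) p u, der c \<nu> p u))) (at (snd c p))"
		unfolding P_def using has_derivative_Pair[OF chart_deriv_works[OF cr_fhat[of 0] c] chart_deriv_works[OF nu c]] by simp
	from chart_deriv_eqI[of P c _ p, OF this] show ?thesis using fhat_deriv[OF c, of 0] by simp
qed

text \<open>If dP kills \<open>u\<close>, then dF and d\<nu> both kill \<open>u\<close> minus its
  dT-multiple of the null vector, which therefore vanishes because the lift is immersed. So the
  kernel of dP is the null direction.\<close>

lemma ex_null_vector:
	assumes c: "c \<in> charts_at M p"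
	obtains X where "der c T p X = 1" "der c P p X = 0"
		"\<And>u. der c P p u = 0 ==> u = der c T p u *. X"
proof -
	obtain X where X: "der c F p X = (1, \<nu> p)" "der c \<nu> p X = 0"
		using ex_direction[OF c] by blast
	have 1: "der c T p X = 1" using T_deriv[OF c] X by simp
	have 2: "der c P p X = 0" using P_deriv[OF c] X by (simp add: zero_prod_def)
	have 3: "u = der c T p u *. X" if u: "der c P p u = 0" for u
	proof -
		let ?w = "u - der c T p u *. X"
		have n: "der c \<nu> p u = 0" and g: "snd (der c F p u) = fst (der c F p u) *. \<nu> p"
			using u P_deriv[OF c, of u] by (auto simp: zero_prod_def)
		have "der c F p ?w = der c F p u - der c T p u *. (1, \<nu> p)"
			using chart_deriv_linear[OF F c] X(1) by (simp add: linear_diff linear_scale)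
		also have "\<dots> = 0" using g T_deriv[OF c, of u] by (simp add: prod_eq_iff)
		finally have "der c F p ?w = 0" .
		moreover have "der c \<nu> p ?w = 0"
			using chart_deriv_linear[OF nu c] X(2) n by (simp add: linear_diff linear_scale)
		ultimately have "?w = 0" by (rule immersed[OF c])
		thus ?thesis by simp
	qed
	show thesis by (rule that[OF 1 2 3])
qed

definition L :: "'m => (real \<times> (real ^ 'n)) \<times> (real ^ 'n)" where "L p = (F p, \<nu> p)"

text \<open>This takes the place of uniqueness for ordinary differential equations: curves with
  prescribed values of \<open>L\<close> are determined by one point.\<close>

lemma L_locally_injective:
	assumes "p \<in> pts M"
	shows "\<exists>N. openin (mtop M) N \<and> p \<in> N \<and> inj_on L N"
proof -
	obtain c where c: "c \<in> charts_at M p" using ex_chart[OF assms] by blast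
	hence c': "c \<in> charts M" "p \<in> fst c" using charts_atD by blast+
	let ?h = "\<lambda>y. L (chart_inv c y)" and ?U = "cod c"
	have crL: "cr_fun r M L" unfolding L_def by (rule cr_fun_Pair[OF F nu])
	have h: "Cr_on r ?h ?U" by (rule cr_fun_Cr_on[OF crL c'(1)])
	have d: "Df ?h (snd c p) = der c L p" by (simp add: chart_deriv_def o_def)
	have dL: "der c L p u = (der c F p u, der c \<nu> p u)" for u
	proof -
		have "((\<lambda>y. L (chart_inv c y)) has_derivative (\<lambda>u. (der c F p u, der c \<nu> p u))) (at (snd c p))"
			unfolding L_def by (rule has_derivative_Pair[OF chart_deriv_works[OF F c] chart_deriv_works[OF nu c]])
		from chart_deriv_eqI[of L c _ p, OF this] show ?thesis by simp
	qed
	have "u = 0" if "der c L p u = 0" for u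
	proof (rule immersed[OF c])
		show "der c F p u = 0" "der c \<nu> p u = 0"
			using that unfolding dL zero_prod_def by simp_all
	qed
	hence "inj (Df ?h (snd c p))"
		unfolding d linear_injective_0[OF chart_deriv_linear[OF crL c]] by blast
	from Cr_on_locally_injective[OF chart_open[OF c'(1)] imageI[OF c'(2)] h this]
	obtain s where s: "s > 0" "ball (snd c p) s \<subseteq> ?U" "inj_on ?h (ball (snd c p) s)" by auto
	let ?N = "{q \<in> fst c. snd c q \<in> ball (snd c p) s}"
	have "openin (mtop M) ?N" by (rule chart_preimage_openin[OF c'(1) open_ball])
	moreover have "p \<in> ?N" using c' s by simp
	moreover have "inj_on L ?N"
	proof (rule inj_onI)
		fix q q' assume q: "q \<in> ?N" "q' \<in> ?N" "L q = L q'"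
		hence qc: "q \<in> fst c" "q' \<in> fst c" "snd c q \<in> ball (snd c p) s" "snd c q' \<in> ball (snd c p) s" by auto
		have "L (chart_inv c (snd c q)) = L (chart_inv c (snd c q'))"
			using q(3) chart_inv_left[OF c'(1) qc(1)] chart_inv_left[OF c'(1) qc(2)] by simp
		from inj_onD[OF s(3) this qc(3,4)] have "snd c q = snd c q'" .
		from inj_onD[OF chart_inj[OF c'(1)] this qc(1,2)] show "q = q'" .
	qed
	ultimately show ?thesis by blast
qed

definition flow :: "'m => real => 'm" where
	"flow p = (SOME \<gamma>. \<gamma> 0 = p \<and> continuous_map euclidean (mtop M) \<gamma> \<and>
				(\<forall>s. F (\<gamma> s) = F p + s *. (1, \<nu> p)) \<and> (\<forall>s. \<nu> (\<gamma> s) = \<nu> p))"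

context
	fixes p assumes p: "p \<in> pts M"
begin

lemma flow_spec: "flow p 0 = p \<and> continuous_map euclidean (mtop M) (flow p) \<and>
				(\<forall>s. F (flow p s) = F p + s *. (1, \<nu> p)) \<and> (\<forall>s. \<nu> (flow p s) = \<nu> p)"
	unfolding flow_def by (rule someI_ex[OF ex_curve[OF p]])

lemma flow_0 [simp]: "flow p 0 = p"
	and flow_continuous: "continuous_map euclidean (mtop M) (flow p)"
	and flow_F: "F (flow p s) = F p + s *. (1, \<nu> p)"
	and flow_nu: "\<nu> (flow p s) = \<nu> p"
	using flow_spec by blast+

lemma flow_topspace: "flow p s \<in> pts M"
	using flow_continuous by (auto simp: continuous_map_def Pi_iff)

lemma flow_T: "T (flow p s) = T p + s"
	by (simp add: T_def flow_F)

lemma flow_P: "P (flow p s) = P p"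
	by (simp add: P_def flow_T flow_nu flow_F algebra_simps)

text \<open>\<open>T\<close> and \<open>P\<close> together determine \<open>L\<close>, so both
  curves lift the same data through a locally injective map.\<close>

lemma flow_unique:
	assumes "connected J" "0 \<in> J" "continuous_map (top_of_set J) (mtop M) \<gamma>" "\<gamma> 0 = p"
		"\<And>s. s \<in> J ==> T (\<gamma> s) = T p + s" "\<And>s. s \<in> J ==> P (\<gamma> s) = P p" "s \<in> J"
	shows "\<gamma> s = flow p s"
proof (rule lift_unique[where Z="top_of_set J" and Y="mtop M" and p=L and ?z0.0=0])
	show "connected_space (top_of_set J)" using assms(1) connectedin_iff_connected[of J] by (simp add: connectedin_def)
	show "\<exists>N. openin (mtop M) N \<and> y \<in> N \<and> inj_on L N" if "y \<in> pts M" for y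
		by (rule L_locally_injective[OF that])
	show "continuous_map (top_of_set J) (mtop M) (flow p)"
		using flow_continuous by (rule continuous_map_from_subtopology)
	fix s assume "s \<in> topspace (top_of_set J)"
	hence s: "s \<in> J" by simp
	have P: "P (\<gamma> s) = P (flow p s)" and T: "T (\<gamma> s) = T (flow p s)"
		using assms(5,6)[OF s] flow_P flow_T by simp_all
	hence "\<nu> (\<gamma> s) = \<nu> (flow p s)" "snd (F (\<gamma> s)) = snd (F (flow p s))" by (auto simp: P_def)
	thus "L (\<gamma> s) = L (flow p s)" using T by (simp add: L_def T_def prod_eq_iff)
qed (use assms(2,4,7) flow_0 in \<open>simp_all add: hausdorff assms(3)\<close>)

end

lemma flow_add:
	assumes p: "p \<in> pts M"
	shows "flow (flow p s) s' = flow p (s + s')"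
proof -
	have "flow p (s + s') = flow (flow p s) s'"
	proof (rule flow_unique[OF flow_topspace[OF p] connected_UNIV UNIV_I, where \<gamma>="\<lambda>s'. flow p (s + s')"])
		have "continuous_map euclidean euclidean (\<lambda>s'. s + s')" by (simp add: continuous_on_add)
		from continuous_map_compose[OF this flow_continuous[OF p]]
		show "continuous_map (top_of_set UNIV) (mtop M) (\<lambda>s'. flow p (s + s'))" by (simp add: o_def)
	qed (auto simp: flow_T flow_P p flow_topspace)
	thus ?thesis by simp
qed


text \<open>The tangent space of the family of null lines, consisting of pairs of infinitesimal
  changes of foot and direction. It will turn out to be constant along each line, so conditions on
  \<open>Rg\<close> can be moved along the flow.\<close>

definition Rg :: "'m => ((real ^ 'n) \<times> (real ^ 'n)) set" where
	"Rg p = {w. \<exists>c\<in>charts_at M p. \<exists>u. w = der c P p u}"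

lemma Rg_chart:
	assumes c: "c \<in> charts_at M p"
	shows "Rg p = range (der c P p)"
proof -
	have "der d P p u \<in> range (der c P p)" if d: "d \<in> charts_at M p" for d u
		unfolding chart_deriv_transition[OF cr_P d c] by (rule rangeI)
	hence "Rg p \<subseteq> range (der c P p)" unfolding Rg_def by auto
	moreover have "range (der c P p) \<subseteq> Rg p" unfolding Rg_def using c by auto
	ultimately show ?thesis by (rule subset_antisym)
qed

abbreviation (input) transversal where "transversal Q p \<equiv> \<forall>w\<in>Rg p. Q w = 0 --> w = 0"

text \<open>A linear function of the first integrals completing \<open>T\<close> to local coordinates.\<close>

lemma ex_transversal_coordinates:
	assumes c: "c \<in> charts_at M p"
	shows "\<exists>Q :: (real ^ 'n) \<times> (real ^ 'n) => real ^ 'k. linear Q \<and>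
		(\<forall>u. der c T p u = 0 --> Q (der c P p u) = 0 --> u = 0)"
proof -
	obtain X where X: "der c T p X = 1" "\<And>u. der c P p u = 0 ==> u = der c T p u *. X"
		by (rule ex_null_vector[OF c]) (rule that)
	let ?W = "{u. der c T p u = 0}"
	have linT: "linear (der c T p)" and linP: "linear (der c P p)"
		by (rule chart_deriv_linear[OF cr_T c], rule chart_deriv_linear[OF cr_P c])
	\<comment> \<open>The vector representing dT, so that the kernel of dT is a hyperplane and its
	  dimension is known.\<close>
	define a where "a = (\<Sum>b\<in>Basis. der c T p b *. b)"
	have aT: "a \<bullet> u = der c T p u" for u
	proof -
		have "a \<bullet> u = (\<Sum>b\<in>Basis. der c T p b * (b \<bullet> u))"
			unfolding a_def inner_sum_left by simp
		also have "\<dots> = (\<Sum>b\<in>Basis. (u \<bullet> b) *. der c T p b)"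
			by (intro sum.cong refl) (simp add: inner_commute)
		finally show ?thesis using linear_euclidean_expand[OF linT, of u] by simp
	qed
	have "a \<noteq> 0" using X(1) aT[of X] by auto
	hence "dim ?W = CARD('k)" using dim_hyperplane[of a] card_k by (simp add: aT)
	hence "dim (UNIV :: (real ^ 'k) set) = dim ?W" by simp
	from subspace_isomorphism[OF subspace_UNIV linear_subspace_kernel[OF linT] this]
	obtain i :: "real ^ 'k => real ^ 'n" where i: "linear i" "i ` UNIV = ?W" "inj_on i UNIV" by (elim exE conjE) (rule that)
	have lin: "linear (der c P p \<circ> i)" by (rule linear_compose[OF i(1) linP])
	have "inj (der c P p \<circ> i)"
		unfolding linear_injective_0[OF lin]
	proof (intro allI impI)
		fix v assume "(der c P p \<circ> i) v = 0"
		hence 1: "i v = der c T p (i v) *. X" unfolding o_def by (rule X(2))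
		have "i v \<in> ?W" using i(2) by blast
		hence 0: "der c T p (i v) = 0" by simp
		have "i v = 0 *. X" using 1 unfolding 0 .
		hence "i v = i 0" unfolding linear_0[OF i(1)] by simp
		thus "v = 0" by (rule injD[OF i(3)])
	qed
	\<comment> \<open>dP is injective on the kernel of dT, which \<open>i\<close> identifies with
	  \<open>real ^ 'k\<close>; a left inverse of the composition is the required
	  \<open>Q\<close>.\<close>
	from linear_injective_left_inverse[OF lin this]
	obtain Q where Q: "linear Q" "Q \<circ> (der c P p \<circ> i) = id" by (elim exE conjE)
	have uz: "u = 0" if "der c T p u = 0" "Q (der c P p u) = 0" for u
	proof -
		have "u \<in> range i" using that(1) unfolding i(2) by simp
		then obtain v where v: "u = i v" by (rule rangeE)
		have 1: "Q (der c P p (i v)) = v" using fun_cong[OF Q(2), of v] by simp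
		have "v = 0" using that(2) unfolding v 1 .
		thus ?thesis unfolding v by (simp add: linear_0[OF i(1)])
	qed
	show ?thesis by (rule exI[of _ Q], intro conjI allI impI Q(1), rule uz)
qed

definition coord :: "((real ^ 'n) \<times> (real ^ 'n) => real ^ 'k) => 'm => real \<times> (real ^ 'k)" where
	"coord Q p = (T p, Q (P p))"

lemma coord_cr: "linear Q ==> cr_fun r M (coord Q)"
	unfolding coord_def by (intro cr_fun_Pair cr_T cr_fun_linear[OF cr_P]) (simp add: linear_conv_bounded_linear)

abbreviation (input) crd where "crd Q c \<equiv> \<lambda>y. coord Q (chart_inv c y)"

lemma coord_deriv:
	assumes "linear Q" "c \<in> charts_at M p"
	shows "der c (coord Q) p u = (der c T p u, Q (der c P p u))"
proof -
	have "bounded_linear Q" using assms(1) by (simp add: linear_conv_bounded_linear)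
	hence "((crd Q c) has_derivative (\<lambda>u. (der c T p u, Q (der c P p u)))) (at (snd c p))"
		unfolding coord_def
		by (intro has_derivative_Pair chart_deriv_works[OF cr_T assms(2)]
				bounded_linear.has_derivative[OF _ chart_deriv_works[OF cr_P assms(2)]])
	from chart_deriv_eqI[of "coord Q" c _ p, OF this] show ?thesis by simp
qed

text \<open>Whether (T, Q o P) is a local coordinate system depends on \<open>Rg\<close> alone, and
  thus on the null line rather than on the point of it.\<close>

lemma coord_inj_iff:
	assumes "linear Q" "c \<in> charts_at M p"
	shows "inj (der c (coord Q) p) \<longleftrightarrow> transversal Q p"
proof -
	obtain X where X: "der c T p X = 1" "der c P p X = 0"
		 "\<And>u. der c P p u = 0 ==> u = der c T p u *. X"
		by (rule ex_null_vector[OF assms(2)]) (rule that)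
	have linT: "linear (der c T p)" and linP: "linear (der c P p)"
		by (rule chart_deriv_linear[OF cr_T assms(2)], rule chart_deriv_linear[OF cr_P assms(2)])
	have "(\<forall>u. der c (coord Q) p u = 0 --> u = 0) \<longleftrightarrow> transversal Q p"
	proof
		assume I: "\<forall>u. der c (coord Q) p u = 0 --> u = 0"
		show "transversal Q p"
			unfolding Rg_chart[OF assms(2)]
		proof (intro ballI impI)
			fix w assume "w \<in> range (der c P p)" "Q w = 0"
			then obtain u where u: "w = der c P p u" by blast
			let ?v = "u - der c T p u *. X"
			have v: "der c P p ?v = w" "der c T p ?v = 0"
				using X(1,2) u by (simp_all add: linear_diff[OF linP] linear_diff[OF linT] linear_scale[OF linP] linear_scale[OF linT])
			hence "der c (coord Q) p ?v = 0"
				unfolding coord_deriv[OF assms] using \<open>Q w = 0\<close> by (simp add: zero_prod_def)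
			hence "?v = 0" by (rule I[rule_format])
			thus "w = 0" using v(1) linear_0[OF linP] by simp
		qed
	next
		assume I: "transversal Q p"
		show "\<forall>u. der c (coord Q) p u = 0 --> u = 0"
		proof (intro allI impI)
			fix u assume "der c (coord Q) p u = 0"
			hence u: "der c T p u = 0" "Q (der c P p u) = 0"
				unfolding coord_deriv[OF assms] by (simp_all add: zero_prod_def)
			have "der c P p u \<in> Rg p" unfolding Rg_chart[OF assms(2)] by blast
			hence "der c P p u = 0" using u(2) by (rule I[rule_format])
			from X(3)[OF this] have "u = 0 *. X" unfolding u(1) .
			thus "u = 0" by simp
		qed
	qed
	thus ?thesis unfolding linear_injective_0[OF chart_deriv_linear[OF coord_cr[OF assms(1)] assms(2)]] .
qed

lemma dim_coord: "DIM(real \<times> (real ^ 'k)) = CARD('n)"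
	using card_n card_k by simp

lemma dim_coord_le: "DIM(real \<times> (real ^ 'k)) \<le> DIM(real ^ 'n)"
	using card_n card_k by simp

text \<open>On an open set where \<open>coord Q\<close> is an injective local diffeomorphism, its inverse is \<open>C\<^sup>r\<close>.\<close>

lemma coord_local_inverse:
	assumes Q: "linear Q" and c: "c \<in> charts M" and U: "open U" "U \<subseteq> cod c"
		and inj: "inj_on (crd Q c) U"
		and D: "\<And>y. y \<in> U ==> inj (Df (crd Q c) y)"
	defines "h \<equiv> \<lambda>y. coord Q (chart_inv c y)"
	shows "open (h ` U)" "Cr_on r (inv_into U h) (h ` U)"
proof -
	have h: "Cr_on r h U"
		unfolding h_def by (rule Cr_on_subset[OF cr_fun_Cr_on[OF coord_cr[OF Q] c] U(2)])
	have ch: "continuous_on U h" by (rule Cr_on_continuous[OF h])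
	have inj': "inj_on h U" using inj by (simp add: h_def)
	show o: "open (h ` U)"
		by (rule invariance_of_domain_gen[OF U(1) ch inj' dim_coord_le])
	show "Cr_on r (inv_into U h) (h ` U)"
	proof (rule Cr_on_inverse_map[OF dim_coord U(1) o _ _ _ h])
		show "inv_into U h ` h ` U \<subseteq> U" by (rule image_subsetI, rule inv_into_into)
		show "continuous_on (h ` U) (inv_into U h)"
			by (rule continuous_on_inverse_open[OF U(1) ch dim_coord_le inv_into_f_f[OF inj']])
		show "h (inv_into U h y) = y" if "y \<in> h ` U" for y using f_inv_into_f[OF that] .
		show "inj (Df h y)" if "y \<in> U" for y using D[OF that] by (simp add: h_def)
		show "inv_into U h (h y) = y" if "y \<in> U" for y using inv_into_f_f[OF inj' that] .
	qed
qed

definition box_at where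
	"box_at q c Q B \<longleftrightarrow> c \<in> charts_at M q \<and> linear Q \<and> open B \<and> snd c q \<in> B \<and> B \<subseteq> cod c \<and>
		inj_on (crd Q c) B \<and>
		(\<forall>y\<in>B. inj (Df (crd Q c) y))"

lemma coord_box:
	assumes q: "q \<in> pts M"
	shows "\<exists>c Q B. box_at q c Q B"
proof -
	obtain c where c: "c \<in> charts_at M q" using ex_chart[OF q] by blast
	hence c': "c \<in> charts M" "q \<in> fst c" using charts_atD by blast+
	obtain Q :: "(real ^ 'n) \<times> (real ^ 'n) => real ^ 'k" where Q: "linear Q"
		and inj: "\<And>u. der c T q u = 0 ==> Q (der c P q u) = 0 ==> u = 0"
		using ex_transversal_coordinates[OF c] by blast
	let ?h = "crd Q c"
	have "u = 0" if "der c (coord Q) q u = 0" for u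
		by (rule inj) (use that coord_deriv[OF Q c, of u] in \<open>simp_all add: zero_prod_def\<close>)
	hence "inj (der c (coord Q) q)"
		unfolding linear_injective_0[OF chart_deriv_linear[OF coord_cr[OF Q] c]] by blast
	hence "inj (Df ?h (snd c q))" by (simp add: chart_deriv_def o_def)
	from Cr_on_locally_injective[OF chart_open[OF c'(1)] imageI[OF c'(2)] cr_fun_Cr_on[OF coord_cr[OF Q] c'(1)] this]
	obtain s where s: "s > 0" "ball (snd c q) s \<subseteq> cod c" "inj_on ?h (ball (snd c q) s)"
		"\<forall>y\<in>ball (snd c q) s. inj (Df ?h y)" by auto
	show ?thesis
		by (rule exI[of _ c], rule exI[of _ Q], rule exI[of _ "ball (snd c q) s"]) (use c Q s in \<open>simp add: box_at_def\<close>)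
qed

lemma chart_deriv_at:
	assumes "c \<in> charts M" "y \<in> cod c"
	shows "c \<in> charts_at M (chart_inv c y)"
		"Df (\<lambda>y. G (chart_inv c y)) y = der c G (chart_inv c y)"
	using chart_inv_in[OF assms(2)] chart_inv_right[OF assms(2)] assms(1)
	by (simp_all add: charts_at_def chart_deriv_def o_def)

text \<open>In the coordinates \<open>(T, Q \<circ> P)\<close> the map \<open>P\<close> does not depend on \<open>T\<close>.\<close>

lemma P_local_invariant:
	assumes Q: "linear Q" and c: "c \<in> charts M" and B: "open B" "B \<subseteq> cod c"
		and inj: "inj_on (crd Q c) B"
		and D: "\<And>y. y \<in> B ==> inj (Df (crd Q c) y)"
	defines "h \<equiv> \<lambda>y. coord Q (chart_inv c y)"
	assumes box: "{a<..<b} \<times> {z} \<subseteq> h ` B" and t: "t \<in> {a<..<b}" "t' \<in> {a<..<b}"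
	shows "P (chart_inv c (inv_into B h (t, z))) = P (chart_inv c (inv_into B h (t', z)))"
proof -
	let ?g = "inv_into B h"
	have o: "open (h ` B)" and g: "Cr_on r ?g (h ` B)"
		using coord_local_inverse[OF Q c B inj D] by (simp_all add: h_def)
	have hg: "h (?g w) = w" and gB: "?g w \<in> B" if "w \<in> h ` B" for w
		using f_inv_into_f[OF that] inv_into_into[OF that] by simp_all
	have zero: "((\<lambda>t. P (chart_inv c (?g (t, z)))) has_derivative (\<lambda>_. 0)) (at t)" if t: "t \<in> {a<..<b}" for t
	proof -
		have tz: "(t, z) \<in> h ` B" using box t by blast
		let ?y = "?g (t, z)" and ?p = "chart_inv c (?g (t, z))"
		have yU: "?y \<in> cod c" using gB[OF tz] B(2) by blast
		have cp: "c \<in> charts_at M ?p" by (rule chart_deriv_at(1)[OF c yU])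
		have ny: "snd c ?p = ?y" by (rule chart_inv_right[OF yU])
		define Dg where "Dg = Df ?g (t, z)"
		have dg: "(?g has_derivative Dg) (at (t, z))" unfolding Dg_def by (rule Cr_on_has_derivative[OF g tz])
		have dh: "(h has_derivative der c (coord Q) ?p) (at ?y)"
			using chart_deriv_works[OF coord_cr[OF Q] cp, folded h_def] unfolding ny .
		have "((\<lambda>w. h (?g w)) has_derivative (\<lambda>w. der c (coord Q) ?p (Dg w))) (at (t, z))"
			by (rule has_derivative_compose[OF dg dh])
		hence "((\<lambda>w. w) has_derivative (\<lambda>w. der c (coord Q) ?p (Dg w))) (at (t, z))"
			by (rule has_derivative_transform_within_open[OF _ o tz]) (simp add: hg)
		hence "(\<lambda>w. der c (coord Q) ?p (Dg w)) = (\<lambda>w. w)"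
			by (rule has_derivative_unique) (rule has_derivative_ident)
		from fun_cong[OF this] have hDg: "der c (coord Q) ?p (Dg w) = w" for w .
		obtain X where X: "der c T ?p X = 1" "der c P ?p X = 0"
			by (rule ex_null_vector[OF cp]) (rule that)
		have "der c (coord Q) ?p X = (1, 0)" using X coord_deriv[OF Q cp, of X] linear_0[OF Q] by simp
		moreover have "inj (der c (coord Q) ?p)"
			using D[OF gB[OF tz]] chart_deriv_at(2)[OF c yU, of "coord Q"] by simp
		\<comment> \<open>Moving in the time coordinate alone means moving in the null direction
		  \<open>X\<close>, which dP annihilates.\<close>
		ultimately have DX: "Dg (1, 0) = X" using hDg[of "(1, 0)"] by (intro injD[of "der c (coord Q) ?p"]) simp_all
		have "((\<lambda>y. P (chart_inv c y)) has_derivative der c P ?p) (at ?y)"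
			using chart_deriv_works[OF cr_P cp] by (simp add: ny)
		from has_derivative_compose[OF has_derivative_compose[OF has_derivative_Pair[OF has_derivative_ident has_derivative_const] dg] this]
		have 1: "((\<lambda>t. P (chart_inv c (?g (t, z)))) has_derivative (\<lambda>s. der c P ?p (Dg (s, 0)))) (at t)" .
		have "der c P ?p (Dg (s, 0)) = 0" for s
		proof -
			have "Dg (s, 0) = s *. Dg (1, 0)" using linear_scale[OF has_derivative_linear[OF dg], of s "(1, 0)"] by simp
			thus ?thesis using DX X(2) linear_scale[OF chart_deriv_linear[OF cr_P cp]] by simp
		qed
		with 1 show ?thesis by simp
	qed
	have "\<exists>C. \<forall>t\<in>{a<..<b}. P (chart_inv c (?g (t, z))) = C"
		by (rule has_derivative_zero_constant[OF convex_real_interval(8)]) (rule has_derivative_at_withinI[OF zero])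
	then obtain C where "\<forall>t\<in>{a<..<b}. P (chart_inv c (?g (t, z))) = C" by (elim exE)
	thus ?thesis using t by simp
qed

text \<open>In coordinates (T, Q o P) the flow is a translation of the first coordinate, by
  \<open>P_local_invariant\<close> and \<open>flow_unique\<close>. The time may be a continuous
  function of the point, as the projection to a slice requires.\<close>

lemma flow_box:
	assumes q: "q \<in> pts M"
	shows "\<exists>\<epsilon>>0. \<exists>N. openin (mtop M) N \<and> q \<in> N \<and>
		(\<forall>\<tau>. continuous_map (subtopology (mtop M) N) euclidean \<tau> --> (\<forall>p\<in>N. \<bar>\<tau> p\<bar> < \<epsilon>) -->
			 continuous_map (subtopology (mtop M) N) (mtop M) (\<lambda>p. flow p (\<tau> p))) \<and>
		(\<forall>p\<in>N. \<forall>s. \<bar>s\<bar> < \<epsilon> --> Rg (flow p s) = Rg p)"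
proof -
	obtain c Q B where cb: "box_at q c Q B" using coord_box[OF q] by blast
	have c: "c \<in> charts_at M q" and Q: "linear Q" and B: "open B" "snd c q \<in> B" "B \<subseteq> cod c"
		and inj: "inj_on (crd Q c) B"
		using cb by (simp_all add: box_at_def)
	have D: "inj (Df (crd Q c) y)" if "y \<in> B" for y
		using cb that unfolding box_at_def by blast
	note c' = charts_atD[OF c]
	define h where "h = (crd Q c)"
	define g where "g = inv_into B h"
	have oh: "open (h ` B)" and gC: "Cr_on r g (h ` B)"
		using coord_local_inverse[OF Q c'(1) B(1,3) inj D] by (simp_all add: h_def g_def)
	have hg: "h (g w) = w" and gB: "g w \<in> B" if "w \<in> h ` B" for w
		using f_inv_into_f[OF that] inv_into_into[OF that] by (simp_all add: g_def)
	have gh: "g (h y) = y" if "y \<in> B" for y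
		using inv_into_f_f[OF inj[folded h_def] that] by (simp add: g_def)
	have hq: "h (snd c q) = coord Q q" using c' by (simp add: h_def)
	have "coord Q q \<in> h ` B" using B(2) hq by (metis imageI)
	then obtain \<delta> where \<delta>: "\<delta> > 0" "ball (coord Q q) \<delta> \<subseteq> h ` B" using oh openE by blast
	\<comment> \<open>A box of half-width \<open>2 * \<epsilon>\<close> in time and radius
	  \<open>\<epsilon>\<close> in the other coordinates fits into the ball of radius
	  \<open>\<delta>\<close>; starting within \<open>\<epsilon>\<close> of \<open>T q\<close>, a time
	  below \<open>\<epsilon>\<close> does not leave it.\<close>
	define \<epsilon> where "\<epsilon> = \<delta> / 4"
	have \<epsilon>: "\<epsilon> > 0" using \<delta> by (simp add: \<epsilon>_def)
	define Box where "Box = {T q - 2 * \<epsilon><..<T q + 2 * \<epsilon>} \<times> ball (Q (P q)) \<epsilon>"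
	have Boxh: "Box \<subseteq> h ` B"
	proof -
		have "w \<in> ball (coord Q q) \<delta>" if "w \<in> Box" for w
		proof -
			have "dist (coord Q q) w \<le> dist (T q) (fst w) + dist (Q (P q)) (snd w)"
				by (simp add: coord_def dist_prod_def sqrt_sum_squares_le_sum)
			also have "\<dots> < 2 * \<epsilon> + \<epsilon>"
				using that by (intro add_strict_mono) (auto simp: Box_def dist_real_def)
			finally show ?thesis using \<epsilon> by (simp add: \<epsilon>_def)
		qed
		thus ?thesis using \<delta>(2) by blast
	qed
	define N where "N = {p \<in> fst c. snd c p \<in> B \<inter> h -` ({T q - \<epsilon><..<T q + \<epsilon>} \<times> ball (Q (P q)) \<epsilon>)}"
	have hc: "continuous_on B h"
		using Cr_on_continuous[OF cr_fun_Cr_on[OF coord_cr[OF Q] c'(1)]] B(3) continuous_on_subset by (auto simp: h_def)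
	have "open (B \<inter> h -` ({T q - \<epsilon><..<T q + \<epsilon>} \<times> ball (Q (P q)) \<epsilon>))"
		by (rule continuous_open_preimage[OF hc B(1)]) (intro open_Times open_greaterThanLessThan open_ball)
	from chart_preimage_openin[OF c'(1) this] have N: "openin (mtop M) N" by (simp add: N_def)
	have qN: "q \<in> N" using c' B(2) \<epsilon> hq by (simp add: N_def coord_def)
	have Np: "p \<in> fst c" "snd c p \<in> B" "h (snd c p) = coord Q p" "\<bar>T p - T q\<bar> < \<epsilon>" "Q (P p) \<in> ball (Q (P q)) \<epsilon>"
		"p \<in> pts M" if "p \<in> N" for p
		using that c'(1) chart_subset[OF c'(1)] unfolding N_def
		by (auto simp: h_def coord_def abs_less_iff)
	have box: "(T p + s, Q (P p)) \<in> Box" if "p \<in> N" "\<bar>s\<bar> < \<epsilon>" for p s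
		using Np(4,5)[OF that(1)] that(2) by (auto simp: Box_def)
	have cg: "continuous_on (h ` B) g" by (rule Cr_on_continuous[OF gC])
	have flow_eq: "flow p s = chart_inv c (g (T p + s, Q (P p)))" if p: "p \<in> N" and s: "\<bar>s\<bar> < \<epsilon>" for p s
	proof -
		let ?J = "{- \<epsilon><..<\<epsilon>}" and ?\<gamma> = "\<lambda>s. chart_inv c (g (T p + s, Q (P p)))"
		have im: "(T p + s, Q (P p)) \<in> h ` B" if "s \<in> ?J" for s
			using box[OF p, of s] that Boxh by auto
		have "g (h (snd c p)) = snd c p" by (rule gh[OF Np(2)[OF p]])
		hence \<gamma>0: "?\<gamma> 0 = p" using Np(1,3)[OF p] c'(1) by (simp add: coord_def)
		have "?\<gamma> s = flow p s"
		proof (rule flow_unique[OF Np(6)[OF p], of ?J])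
			have "continuous_on ?J (\<lambda>s. g (T p + s, Q (P p)))"
				by (rule continuous_on_compose2[OF cg]) (use im in \<open>auto intro!: continuous_intros\<close>)
			moreover have "g (T p + s, Q (P p)) \<in> cod c" if "s \<in> ?J" for s
				using gB[OF im[OF that]] B(3) by blast
			ultimately have "continuous_map (top_of_set ?J) (top_of_set (cod c)) (\<lambda>s. g (T p + s, Q (P p)))"
				by (auto simp: continuous_map_in_subtopology)
			from continuous_map_compose[OF this chart_inv_continuous[OF c'(1)]]
			show "continuous_map (top_of_set ?J) (mtop M) ?\<gamma>" by (simp add: o_def)
			fix s assume s: "s \<in> ?J"
			have "coord Q (?\<gamma> s) = (T p + s, Q (P p))" using hg[OF im[OF s]] by (simp add: h_def)
			thus "T (?\<gamma> s) = T p + s" by (simp add: coord_def)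
			have "P (chart_inv c (inv_into B h (T p + s, Q (P p)))) = P (chart_inv c (inv_into B h (T p + 0, Q (P p))))"
			proof (unfold h_def, rule P_local_invariant[OF Q c'(1) B(1,3) inj D, of "T p - \<epsilon>" "T p + \<epsilon>"])
				show "{T p - \<epsilon><..<T p + \<epsilon>} \<times> {Q (P p)} \<subseteq> (crd Q c) ` B"
				proof (clarify)
					fix t assume "t \<in> {T p - \<epsilon><..<T p + \<epsilon>}"
					thus "(t, Q (P p)) \<in> (crd Q c) ` B"
						using im[of "t - T p"] by (simp add: h_def)
				qed
			qed (use s \<epsilon> in auto)
			thus "P (?\<gamma> s) = P p" using \<gamma>0 by (simp add: g_def)
		qed (use \<gamma>0 s \<epsilon> in auto)
		thus ?thesis by simp
	qed
	have cont: "continuous_map (subtopology (mtop M) N) (mtop M) (\<lambda>p. flow p (\<tau> p))"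
		if \<tau>: "continuous_map (subtopology (mtop M) N) euclidean \<tau>" "\<And>p. p \<in> N ==> \<bar>\<tau> p\<bar> < \<epsilon>" for \<tau>
	proof -
		have topN: "topspace (subtopology (mtop M) N) = N" using openin_subset[OF N] by (simp add: Int_absorb1)
		have cT: "continuous_map (subtopology (mtop M) N) euclidean T"
			using cr_fun_continuous[OF cr_T] by (rule continuous_map_from_subtopology)
		have "bounded_linear Q" using Q by (simp add: linear_conv_bounded_linear)
		from cr_fun_continuous[OF cr_fun_linear[OF cr_P this]]
		have cL: "continuous_map (subtopology (mtop M) N) euclidean (\<lambda>p. Q (P p))"
			by (rule continuous_map_from_subtopology)
		have "continuous_map (subtopology (mtop M) N) (prod_topology euclidean euclidean) (\<lambda>p. (T p + \<tau> p, Q (P p)))"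
			unfolding continuous_map_paired by (rule conjI[OF continuous_map_add[OF cT \<tau>(1)] cL])
		hence "continuous_map (subtopology (mtop M) N) (top_of_set (h ` B)) (\<lambda>p. (T p + \<tau> p, Q (P p)))"
			using box[OF _ \<tau>(2)] Boxh by (auto simp: continuous_map_in_subtopology euclidean_product_topology topN)
		moreover have "continuous_map (top_of_set (h ` B)) (top_of_set (cod c)) g"
			using cg gB B(3) by (auto simp: continuous_map_in_subtopology)
		ultimately have "continuous_map (subtopology (mtop M) N) (top_of_set (cod c)) (g \<circ> (\<lambda>p. (T p + \<tau> p, Q (P p))))"
			by (rule continuous_map_compose)
		from continuous_map_compose[OF this chart_inv_continuous[OF c'(1)]]
		have "continuous_map (subtopology (mtop M) N) (mtop M) (\<lambda>p. chart_inv c (g (T p + \<tau> p, Q (P p))))"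
			by (simp add: o_def)
		thus ?thesis
			by (rule continuous_map_eq) (use flow_eq \<tau>(2) topN in auto)
	qed
	define K where "K = (\<lambda>w. P (chart_inv c (g w)))"
	have RgK: "Rg (chart_inv c (g w)) = range (Df K w)" if w: "w \<in> h ` B" for w
	proof -
		let ?y = "g w" and ?p = "chart_inv c (g w)"
		have yU: "?y \<in> cod c" using gB[OF w] B(3) by blast
		have cp: "c \<in> charts_at M ?p" by (rule chart_deriv_at(1)[OF c'(1) yU])
		have ny: "snd c ?p = ?y" by (rule chart_inv_right[OF yU])
		have dg: "(g has_derivative Df g w) (at w)" by (rule Cr_on_has_derivative[OF gC w])
		have dP: "((\<lambda>y. P (chart_inv c y)) has_derivative der c P ?p) (at ?y)"
			using chart_deriv_works[OF cr_P cp] by (simp add: ny)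
		have dh: "(h has_derivative der c (coord Q) ?p) (at ?y)"
			using chart_deriv_works[OF coord_cr[OF Q] cp, folded h_def] unfolding ny .
		have K: "Df K w = (\<lambda>v. der c P ?p (Df g w v))"
			unfolding K_def by (rule frechet_derivative_at[OF has_derivative_compose[OF dg dP], symmetric])
		have "((\<lambda>y. g (h y)) has_derivative (\<lambda>u. Df g w (der c (coord Q) ?p u))) (at ?y)"
			using has_derivative_compose[OF dh, of g "Df g w"] dg hg[OF w] by simp
		hence "((\<lambda>y. y) has_derivative (\<lambda>u. Df g w (der c (coord Q) ?p u))) (at ?y)"
			by (rule has_derivative_transform_within_open[OF _ B(1) gB[OF w]]) (simp add: gh)
		hence "(\<lambda>u. Df g w (der c (coord Q) ?p u)) = (\<lambda>u. u)"
			by (rule has_derivative_unique) (rule has_derivative_ident)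
		from fun_cong[OF this] have "Df g w (der c (coord Q) ?p u) = u" for u .
		hence "surj (Df g w)" by (rule surjI)
		hence "range (Df K w) = range (der c P ?p)"
			unfolding K by (simp add: image_image[symmetric])
		thus ?thesis by (simp add: Rg_chart[OF cp])
	qed
	have Rgc: "Rg (flow p s) = Rg p" if p: "p \<in> N" and s: "\<bar>s\<bar> < \<epsilon>" for p s
	proof -
		let ?w = "(T p, Q (P p))"
		have w: "?w \<in> h ` B" and ws: "?w + (s, 0) \<in> h ` B"
			using box[OF p, of 0] box[OF p s] Boxh \<epsilon> by auto
		have "\<bar>t + s - T q\<bar> < 2 * \<epsilon>" if "\<bar>t - T q\<bar> < \<epsilon>" for t using that s by linarith
		let ?V = "{T q - \<epsilon><..<T q + \<epsilon>} \<times> ball (Q (P q)) \<epsilon>"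
		have V: "open ?V" by (intro open_Times open_greaterThanLessThan open_ball)
		have wV: "?w \<in> ?V" using Np(4,5)[OF p] by (auto simp: abs_less_iff)
		\<comment> \<open>\<open>K\<close> is \<open>P\<close> in these coordinates and does not see the
		  time. Its derivatives at the two points therefore agree, and their ranges are the two spaces
		  \<open>Rg\<close>.\<close>
		have Keq: "K (w + (s, 0)) = K w" if "w \<in> ?V" for w
		proof -
			obtain t z where tz: "w = (t, z)" by (cases w)
			have z: "z \<in> ball (Q (P q)) \<epsilon>" and t: "t \<in> {T q - \<epsilon><..<T q + \<epsilon>}" using that tz by auto
			have "P (chart_inv c (inv_into B h (t + s, z))) = P (chart_inv c (inv_into B h (t, z)))"
				unfolding h_def
			proof (rule P_local_invariant[OF Q c'(1) B(1,3) inj D, of "T q - 2 * \<epsilon>" "T q + 2 * \<epsilon>"])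
				show "{T q - 2 * \<epsilon><..<T q + 2 * \<epsilon>} \<times> {z} \<subseteq> (crd Q c) ` B"
					using Boxh z by (auto simp: Box_def h_def)
			qed (use t s in \<open>auto simp: abs_less_iff\<close>)
			thus ?thesis by (simp add: K_def g_def tz)
		qed
		have K: "(K has_derivative Df K w) (at w)" if w: "w \<in> h ` B" for w
		proof -
			have yU: "g w \<in> cod c" using gB[OF w] B(3) by blast
			have "((\<lambda>y. P (chart_inv c y)) has_derivative der c P (chart_inv c (g w))) (at (g w))"
				using chart_deriv_works[OF cr_P chart_deriv_at(1)[OF c'(1) yU]] by (simp add: chart_inv_right[OF yU])
			from has_derivative_compose[OF Cr_on_has_derivative[OF gC w] this]
			have dK: "(K has_derivative (\<lambda>v. der c P (chart_inv c (g w)) (Df g w v))) (at w)"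
				unfolding K_def .
			show ?thesis unfolding frechet_derivative_at[OF dK, symmetric] by (rule dK)
		qed
		have "((\<lambda>w. w + (s, 0)) has_derivative (\<lambda>v. v + 0)) (at ?w)"
			by (intro has_derivative_add has_derivative_ident has_derivative_const)
		from has_derivative_compose[OF this, of K] K[OF ws]
		have "((\<lambda>w. K (w + (s, 0))) has_derivative Df K (?w + (s, 0))) (at ?w)" by simp
		hence "(K has_derivative Df K (?w + (s, 0))) (at ?w)"
			by (rule has_derivative_transform_within_open[OF _ V wV]) (use Keq in auto)
		hence "Df K (?w + (s, 0)) = Df K ?w"
			by (rule frechet_derivative_at)
		hence "Rg (chart_inv c (g (?w + (s, 0)))) = Rg (chart_inv c (g ?w))"
			using RgK[OF w] RgK[OF ws] by simp
		moreover have "chart_inv c (g (?w + (s, 0))) = flow p s" using flow_eq[OF p s] by simp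
		moreover have "chart_inv c (g ?w) = p" using flow_eq[OF p, of 0] \<epsilon> flow_0[OF Np(6)[OF p]] by simp
		ultimately show ?thesis by simp
	qed
	show ?thesis
		by (rule exI[of _ \<epsilon>], intro conjI \<epsilon> exI[of _ N] N qN allI impI ballI cont Rgc) auto
qed

end

text \<open>A continuation principle: applied to a predicate, it carries a property along the whole
  line once neighbouring parameters are known to share it.\<close>

lemma locally_constant_real:
	fixes f :: "real => 'b"
	assumes "\<And>s. \<exists>d>0. \<forall>s'. \<bar>s' - s\<bar> < d --> f s' = f s"
	shows "f s = f a"
proof -
	have op: "open {s. Q (f s)}" for Q :: "'b => bool"
		unfolding open_dist
	proof
		fix s assume s: "s \<in> {s. Q (f s)}"
		from assms[of s] obtain d where d: "d > 0" "\<forall>s'. \<bar>s' - s\<bar> < d --> f s' = f s" by (elim exE conjE)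
		show "\<exists>e>0. \<forall>y. dist y s < e --> y \<in> {s. Q (f s)}"
		proof (rule exI[of _ d], rule conjI[OF d(1)], intro allI impI)
			fix y assume "dist y s < d"
			hence "f y = f s" unfolding dist_real_def by (rule d(2)[rule_format])
			thus "y \<in> {s. Q (f s)}" using s by simp
		qed
	qed
	let ?U = "{s. f s = f a}" and ?V = "{s. f s \<noteq> f a}"
	have "?U \<inter> UNIV = {} \<or> ?V \<inter> UNIV = {}"
	proof (rule connectedD[OF connected_UNIV op[of "\<lambda>v. v = f a"] op[of "\<lambda>v. v \<noteq> f a"]])
		show "?U \<inter> ?V \<inter> UNIV = {}" by blast
		show "UNIV \<subseteq> ?U \<union> ?V" by blast
	qed
	moreover have "a \<in> ?U" by simp
	ultimately have "?V = {}" by blast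
	thus ?thesis by blast
qed

context null_front
begin

lemma Rg_flow:
	assumes p: "p \<in> pts M"
	shows "Rg (flow p s) = Rg p"
proof -
	have "\<exists>d>0. \<forall>s'. \<bar>s' - s\<bar> < d --> Rg (flow p s') = Rg (flow p s)" for s
	proof -
		obtain \<epsilon> N where \<epsilon>: "\<epsilon> > 0" and N: "flow p s \<in> N" "\<forall>q\<in>N. \<forall>s. \<bar>s\<bar> < \<epsilon> --> Rg (flow q s) = Rg q"
			using flow_box[OF flow_topspace[OF p, of s]] by (elim exE conjE)
		have "Rg (flow p s') = Rg (flow p s)" if "\<bar>s' - s\<bar> < \<epsilon>" for s'
			using N(2)[rule_format, OF N(1) that] flow_add[OF p, of s "s' - s"] by simp
		with \<epsilon> show ?thesis by (intro exI[of _ \<epsilon>] conjI allI impI)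
	qed
	from locally_constant_real[of "\<lambda>s. Rg (flow p s)", OF this, of s 0] show ?thesis by (simp add: p)
qed

section \<open>The slices \<open>T = c\<close> and the normal form\<close>

definition slc :: "real => 'm set" where "slc a = {p \<in> pts M. T p = a}"

definition proj :: "real => 'm => 'm" where "proj a p = flow p (a - T p)"

lemma proj_slc: "p \<in> pts M ==> proj a p \<in> slc a"
	by (simp add: slc_def proj_def flow_T flow_topspace)

lemma proj_P: "p \<in> pts M ==> P (proj a p) = P p"
	by (simp add: proj_def flow_P)

lemma proj_Rg: "p \<in> pts M ==> Rg (proj a p) = Rg p"
	by (simp add: proj_def Rg_flow)

lemma proj_id: "p \<in> slc a ==> proj a p = p"
	by (simp add: slc_def proj_def)

lemma proj_flow: "p \<in> pts M ==> proj a (flow p s) = proj a p"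
	by (simp add: proj_def flow_T flow_add)

lemma flow_proj: "p \<in> pts M ==> flow (proj a p) (T p - a) = p"
	by (simp add: proj_def flow_add)

lemma slc_topspace: "p \<in> slc a ==> p \<in> pts M"
	by (simp add: slc_def)

lemma slc_T: "p \<in> slc a ==> T p = a"
	by (simp add: slc_def)

text \<open>Near the slice the projection is a flow by a small variable time, hence continuous. From
  there continuity is continued along the null line, each step composing with the flow by a small
  constant time.\<close>

lemma proj_continuous: "continuous_map (mtop M) (mtop M) (proj a)"
proof (rule continuous_map_local)
	fix p assume p: "p \<in> pts M"
	let ?A = "\<lambda>q. \<exists>N. openin (mtop M) N \<and> q \<in> N \<and> continuous_map (subtopology (mtop M) N) (mtop M) (proj a)"
	define x where "x = proj a p"
	have x: "x \<in> pts M" "T x = a"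
		using proj_slc[OF p, of a] by (simp_all add: x_def slc_def)
	have cT: "continuous_map (mtop M) euclidean T" by (rule cr_fun_continuous[OF cr_T])
	have A0: "?A (flow x 0)"
	proof -
		obtain \<epsilon> N where \<epsilon>: "\<epsilon> > 0" and N: "openin (mtop M) N" "x \<in> N"
			and c: "\<forall>\<tau>. continuous_map (subtopology (mtop M) N) euclidean \<tau> --> (\<forall>p\<in>N. \<bar>\<tau> p\<bar> < \<epsilon>) -->
			 continuous_map (subtopology (mtop M) N) (mtop M) (\<lambda>p. flow p (\<tau> p))"
			using flow_box[OF x(1)] by (elim exE conjE)
		let ?N' = "N \<inter> {q \<in> pts M. T q \<in> {a - \<epsilon><..<a + \<epsilon>}}"
		\<comment> \<open>The time is cut off at \<open>\<epsilon> / 2\<close> so that it is small on all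
		  of \<open>N\<close>; on \<open>?N2\<close> the cut-off is inactive.\<close>
		let ?\<tau> = "\<lambda>q. max (- \<epsilon> / 2) (min (\<epsilon> / 2) (a - T q))"
		let ?N2 = "N \<inter> {q \<in> pts M. T q \<in> {a - \<epsilon> / 2<..<a + \<epsilon> / 2}}"
		have o: "openin (mtop M) ?N2"
			by (intro openin_Int N openin_continuous_map_preimage[OF cT]) simp
		have t1: "continuous_map (subtopology (mtop M) N) euclidean ?\<tau>"
			by (intro continuous_map_real_max continuous_map_real_min continuous_map_diff continuous_map_const[THEN iffD2]
					continuous_map_from_subtopology[OF cT]) auto
		have t2: "\<forall>q\<in>N. \<bar>?\<tau> q\<bar> < \<epsilon>" using \<epsilon> by auto
		have "continuous_map (subtopology (mtop M) N) (mtop M) (\<lambda>q. flow q (?\<tau> q))"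
			by (rule c[THEN spec, THEN mp, THEN mp, OF t1 t2])
		from continuous_map_from_subtopology_mono[OF this, of ?N2]
		have "continuous_map (subtopology (mtop M) ?N2) (mtop M) (\<lambda>q. flow q (?\<tau> q))" by simp
		hence "continuous_map (subtopology (mtop M) ?N2) (mtop M) (proj a)"
			by (rule continuous_map_eq) (auto simp: proj_def max_def min_def)
		moreover have "x \<in> ?N2" using N x \<epsilon> by auto
		ultimately show ?thesis using o flow_0[OF x(1)] by (intro exI[of _ ?N2] conjI) simp_all
	qed
	have "\<exists>d>0. \<forall>s'. \<bar>s' - s\<bar> < d --> ?A (flow x s') = ?A (flow x s)" for s
	proof -
		obtain \<epsilon> N where \<epsilon>: "\<epsilon> > 0" and N: "openin (mtop M) N" "flow x s \<in> N"
			and c: "\<forall>\<tau>. continuous_map (subtopology (mtop M) N) euclidean \<tau> --> (\<forall>p\<in>N. \<bar>\<tau> p\<bar> < \<epsilon>) -->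
			 continuous_map (subtopology (mtop M) N) (mtop M) (\<lambda>p. flow p (\<tau> p))"
			using flow_box[OF flow_topspace[OF x(1), of s]] by (elim exE conjE)
		have "openin euclidean {s' \<in> topspace euclidean. flow x s' \<in> N}"
			by (rule openin_continuous_map_preimage[OF flow_continuous[OF x(1)] N(1)])
		hence "open {s'. flow x s' \<in> N}" by simp
		then obtain d where d: "d > 0" "ball s d \<subseteq> {s'. flow x s' \<in> N}" using N(2) openE by (metis mem_Collect_eq)
		\<comment> \<open>Since \<open>proj a\<close> is constant along null lines, near
		  \<open>flow x s2\<close> it equals the flow by \<open>s1 - s2\<close> followed by
		  \<open>proj a\<close> near \<open>flow x s1\<close>.\<close>
		have step: "?A (flow x s2)" if A1: "?A (flow x s1)" and s1: "\<bar>s1 - s\<bar> < min d (\<epsilon> / 2)" and s2: "\<bar>s2 - s\<bar> < min d (\<epsilon> / 2)" for s1 s2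
		proof -
			from A1 obtain N1 where N1: "openin (mtop M) N1" "flow x s1 \<in> N1" "continuous_map (subtopology (mtop M) N1) (mtop M) (proj a)"
				by (elim exE conjE)
			have lt: "\<bar>s1 - s2\<bar> < \<epsilon>" using s1 s2 by linarith
			have "continuous_map (subtopology (mtop M) N) (mtop M) (\<lambda>p. flow p (s1 - s2))"
				by (rule c[rule_format]) (use lt in auto)
			hence "openin (subtopology (mtop M) N) {q \<in> topspace (subtopology (mtop M) N). flow q (s1 - s2) \<in> N1}" and
				fc: "continuous_map (subtopology (mtop M) N) (mtop M) (\<lambda>p. flow p (s1 - s2))"
				using openin_continuous_map_preimage[OF _ N1(1)] by blast+
			hence o: "openin (mtop M) {q \<in> topspace (subtopology (mtop M) N). flow q (s1 - s2) \<in> N1}" (is "openin _ ?N2")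
				using openin_trans_full N(1) by blast
			have "s2 \<in> ball s d" using s2 by (simp add: dist_real_def abs_minus_commute)
			hence fN: "flow x s2 \<in> N" using d(2) by blast
			have mem: "flow x s2 \<in> ?N2" using fN N1(2) flow_topspace[OF x(1)] by (simp add: flow_add[OF x(1)])
			have "continuous_map (subtopology (mtop M) ?N2) (subtopology (mtop M) N1) (\<lambda>p. flow p (s1 - s2))"
				using continuous_map_from_subtopology_mono[OF fc, of ?N2] by (auto simp: continuous_map_in_subtopology)
			from continuous_map_compose[OF this N1(3)]
			have "continuous_map (subtopology (mtop M) ?N2) (mtop M) (\<lambda>q. proj a (flow q (s1 - s2)))" by (simp add: o_def)
			hence "continuous_map (subtopology (mtop M) ?N2) (mtop M) (proj a)"
				by (rule continuous_map_eq) (simp add: proj_flow)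
			with o mem show ?thesis by (intro exI[of _ ?N2] conjI)
		qed
		show ?thesis
		proof (intro exI[of _ "min d (\<epsilon> / 2)"] conjI allI impI)
			fix s' assume s': "\<bar>s' - s\<bar> < min d (\<epsilon> / 2)"
			have s0: "\<bar>s - s\<bar> < min d (\<epsilon> / 2)" using d \<epsilon> by simp
			show "?A (flow x s') = ?A (flow x s)"
				by (rule iffI[OF step[OF _ s' s0] step[OF _ s0 s']])
		qed (use d \<epsilon> in simp)
	qed
	from locally_constant_real[of "\<lambda>s. ?A (flow x s)", OF this, of "T p - a" 0] A0
	have "?A (flow x (T p - a))" by blast
	thus "?A p" unfolding x_def flow_proj[OF p] .
qed

text \<open>The charts are restrictions of linear functions of the globally defined
  \<open>P\<close>. With this choice a coordinate change is a special case of restricting a smooth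
  function on \<open>M\<close> to the slice, which \<open>slice_fun\<close> handles.\<close>

definition slice :: "real => ('m, real ^ 'k) mfd" where
	"slice a = \<lparr>mtop = subtopology (mtop M) (slc a),
		 charts = {(U, \<psi>). openin (subtopology (mtop M) (slc a)) U \<and> inj_on \<psi> U \<and>
			 (\<exists>Q. linear Q \<and> \<psi> = (\<lambda>p. Q (P p)) \<and> (\<forall>p\<in>U. transversal Q p))}\<rparr>"

lemma slice_topspace: "topspace (mtop (slice a)) = slc a"
	by (auto simp: slice_def slc_def)

lemma slice_chartE:
	assumes "(U, \<psi>) \<in> charts (slice a)"
	obtains Q where "openin (subtopology (mtop M) (slc a)) U" "inj_on \<psi> U" "linear Q" "\<psi> = (\<lambda>p. Q (P p))"
		"\<forall>p\<in>U. transversal Q p" "U \<subseteq> slc a"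
proof -
	have U: "openin (subtopology (mtop M) (slc a)) U" "inj_on \<psi> U" and
		ex: "\<exists>Q. linear Q \<and> \<psi> = (\<lambda>p. Q (P p)) \<and> (\<forall>p\<in>U. transversal Q p)"
		using assms by (simp_all add: slice_def)
	have "U \<subseteq> slc a" using openin_subset[OF U(1)] by simp
	with U ex show thesis by (elim exE conjE) (rule that)
qed

lemma proj_preimage_openin:
	assumes "openin (subtopology (mtop M) (slc a)) U"
	shows "openin (mtop M) {p \<in> pts M. proj a p \<in> U}"
proof -
	have "continuous_map (mtop M) (subtopology (mtop M) (slc a)) (proj a)"
		using proj_continuous proj_slc by (auto simp: continuous_map_in_subtopology)
	from openin_continuous_map_preimage[OF this assms] show ?thesis .
qed

text \<open>In the chart \<open>c\<close>, the region swept out by the null lines through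
  \<open>U\<close>; it need not lie near the slice.\<close>

definition tube :: "real => 'm set => ('m, real ^ 'n) chart => (real ^ 'n) set" where
	"tube a U c = snd c ` (fst c \<inter> {p \<in> pts M. proj a p \<in> U})"

text \<open>A point of the tube is recovered from its time and from the point of \<open>U\<close> on
  its null line, whence injectivity far from the slice too. Transversality travels along the line by
  \<open>proj_Rg\<close>.\<close>

lemma tube_coord:
	assumes U: "(U, \<psi>) \<in> charts (slice a)" and Q: "linear Q" "\<psi> = (\<lambda>p. Q (P p))"
		"\<forall>p\<in>U. transversal Q p" and c: "c \<in> charts M"
	defines "h \<equiv> \<lambda>y. coord Q (chart_inv c y)"
	shows "open (tube a U c)" "tube a U c \<subseteq> cod c" "inj_on h (tube a U c)"
		"\<And>y. y \<in> tube a U c ==> inj (Df h y)"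
		"open (h ` tube a U c)" "Cr_on r (inv_into (tube a U c) h) (h ` tube a U c)"
proof -
	have oU: "openin (subtopology (mtop M) (slc a)) U" and inj: "inj_on \<psi> U"
		by (rule slice_chartE[OF U], assumption)+
	show o: "open (tube a U c)"
		unfolding tube_def by (rule chart_image_open[OF c proj_preimage_openin[OF oU]])
	show sub: "tube a U c \<subseteq> cod c" unfolding tube_def by blast
	have tubeE: "chart_inv c y \<in> pts M" "proj a (chart_inv c y) \<in> U" if y: "y \<in> tube a U c" for y
	proof -
		obtain p where "y = snd c p" "p \<in> fst c" "p \<in> pts M" "proj a p \<in> U"
			using y unfolding tube_def by blast
		thus "chart_inv c y \<in> pts M" "proj a (chart_inv c y) \<in> U"
			using chart_inv_left[OF c] by simp_all
	qed
	show i: "inj_on h (tube a U c)"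
	proof (rule inj_onI)
		fix y y' assume y: "y \<in> tube a U c" "y' \<in> tube a U c" and eq: "h y = h y'"
		let ?p = "chart_inv c y" and ?p' = "chart_inv c y'"
		have T: "T ?p = T ?p'" and "Q (P ?p) = Q (P ?p')" using eq by (simp_all add: h_def coord_def)
		hence "\<psi> (proj a ?p) = \<psi> (proj a ?p')"
			unfolding Q(2) proj_P[OF tubeE(1)[OF y(1)]] proj_P[OF tubeE(1)[OF y(2)]] by simp
		from inj_onD[OF inj this tubeE(2)[OF y(1)] tubeE(2)[OF y(2)]] have "proj a ?p = proj a ?p'" .
		hence "flow (proj a ?p) (T ?p - a) = flow (proj a ?p') (T ?p' - a)" by (simp only: T)
		hence "?p = ?p'" unfolding flow_proj[OF tubeE(1)[OF y(1)]] flow_proj[OF tubeE(1)[OF y(2)]] .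
		hence "snd c ?p = snd c ?p'" by (rule arg_cong)
		thus "y = y'" unfolding chart_inv_right[OF subsetD[OF sub y(1)]] chart_inv_right[OF subsetD[OF sub y(2)]] .
	qed
	show D: "inj (Df h y)" if y: "y \<in> tube a U c" for y
	proof -
		have yU: "y \<in> cod c" using y sub by blast
		have "transversal Q (chart_inv c y)"
			using bspec[OF Q(3) tubeE(2)[OF y]] unfolding proj_Rg[OF tubeE(1)[OF y]] .
		hence "inj (der c (coord Q) (chart_inv c y))"
			unfolding coord_inj_iff[OF Q(1) chart_deriv_at(1)[OF c yU]] .
		thus ?thesis using chart_deriv_at(2)[OF c yU, of "coord Q"] by (simp only: h_def)
	qed
	show "open (h ` tube a U c)"
		unfolding h_def by (rule coord_local_inverse(1)[OF Q(1) c o sub i[unfolded h_def]]) (rule D[unfolded h_def])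
	show "Cr_on r (inv_into (tube a U c) h) (h ` tube a U c)"
		unfolding h_def by (rule coord_local_inverse(2)[OF Q(1) c o sub i[unfolded h_def]]) (rule D[unfolded h_def])
qed

text \<open>The inverse of (T, Q o P) on a tube is the flow started from the slice. Smoothness of
  the flow is thereby read off from that of a coordinate inverse.\<close>

lemma tube_inverse:
	assumes U: "(U, \<psi>) \<in> charts (slice a)" and Q: "linear Q" "\<psi> = (\<lambda>p. Q (P p))"
		"\<forall>p\<in>U. transversal Q p" and c: "c \<in> charts M"
	defines "h \<equiv> \<lambda>y. coord Q (chart_inv c y)"
	shows "(t, y) \<in> h ` tube a U c \<longleftrightarrow> y \<in> \<psi> ` U \<and> flow (inv_into U \<psi> y) (t - a) \<in> fst c"
		and "(t, y) \<in> h ` tube a U c ==> chart_inv c (inv_into (tube a U c) h (t, y)) = flow (inv_into U \<psi> y) (t - a)"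
proof -
	have inj: "inj_on \<psi> U" and Us: "U \<subseteq> slc a"
		by (rule slice_chartE[OF U], assumption)+
	have main: "y \<in> \<psi> ` U \<and> flow (inv_into U \<psi> y) (t - a) = chart_inv c z \<and> chart_inv c z \<in> fst c"
		if z: "z \<in> tube a U c" and hz: "h z = (t, y)" for z
	proof -
		have zc: "chart_inv c z \<in> fst c" "chart_inv c z \<in> pts M" "proj a (chart_inv c z) \<in> U"
		proof -
			obtain p where "z = snd c p" "p \<in> fst c" "p \<in> pts M" "proj a p \<in> U"
				using z unfolding tube_def by blast
			thus "chart_inv c z \<in> fst c" "chart_inv c z \<in> pts M" "proj a (chart_inv c z) \<in> U"
				using chart_inv_left[OF c] by simp_all
		qed
		have "coord Q (chart_inv c z) = (t, y)" using hz unfolding h_def .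
		hence ty: "T (chart_inv c z) = t" "y = \<psi> (proj a (chart_inv c z))"
			unfolding coord_def Q(2) proj_P[OF zc(2)] by simp_all
		have "inv_into U \<psi> y = proj a (chart_inv c z)" unfolding ty(2) by (rule inv_into_f_f[OF inj zc(3)])
		hence "flow (inv_into U \<psi> y) (t - a) = chart_inv c z" using flow_proj[OF zc(2), of a] unfolding ty(1) by simp
		thus ?thesis using zc(1) imageI[OF zc(3), of \<psi>] unfolding ty(2) by simp
	qed
	show "(t, y) \<in> h ` tube a U c \<longleftrightarrow> y \<in> \<psi> ` U \<and> flow (inv_into U \<psi> y) (t - a) \<in> fst c"
	proof
		assume "(t, y) \<in> h ` tube a U c"
		then obtain z where "z \<in> tube a U c" "h z = (t, y)" by (elim imageE) (rule that, assumption, rule sym)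
		from main[OF this] show "y \<in> \<psi> ` U \<and> flow (inv_into U \<psi> y) (t - a) \<in> fst c" by simp
	next
		assume y: "y \<in> \<psi> ` U \<and> flow (inv_into U \<psi> y) (t - a) \<in> fst c"
		let ?x = "inv_into U \<psi> y" and ?p = "flow (inv_into U \<psi> y) (t - a)"
		have x: "?x \<in> U" "\<psi> ?x = y"
			by (rule inv_into_into[OF conjunct1[OF y]], rule f_inv_into_f[OF conjunct1[OF y]])
		have xs: "?x \<in> slc a" "?x \<in> pts M"
			using subsetD[OF Us x(1)] slc_topspace by simp_all
		have pc: "?p \<in> fst c" using y by (rule conjunct2)
		have px: "proj a ?p = ?x" unfolding proj_flow[OF xs(2)] by (rule proj_id[OF xs(1)])
		have "?p \<in> fst c \<inter> {p \<in> pts M. proj a p \<in> U}"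
			using pc x(1) flow_topspace[OF xs(2), of "t - a"] px by simp
		hence 1: "snd c ?p \<in> tube a U c" unfolding tube_def by (rule imageI)
		have "coord Q ?p = (t, Q (P ?x))"
			using slc_T[OF xs(1)] by (simp add: coord_def flow_T[OF xs(2)] flow_P[OF xs(2)])
		moreover have "Q (P ?x) = y" using x(2) unfolding Q(2) .
		ultimately have 2: "h (snd c ?p) = (t, y)" unfolding h_def chart_inv_left[OF c pc] by simp
		show "(t, y) \<in> h ` tube a U c" using imageI[OF 1, of h] unfolding 2 .
	qed
	assume ty: "(t, y) \<in> h ` tube a U c"
	show "chart_inv c (inv_into (tube a U c) h (t, y)) = flow (inv_into U \<psi> y) (t - a)"
		using main[OF inv_into_into[OF ty] f_inv_into_f[OF ty]] by simp
qed

text \<open>The inverse of a slice chart is the smooth inverse of (T, Q o P) restricted to the first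
  coordinate \<open>a\<close>.\<close>

lemma slice_fun:
	fixes G :: "'m => 'b::euclidean_space"
	assumes U: "(U, \<psi>) \<in> charts (slice a)" and G: "cr_fun r M G"
	shows "open (\<psi> ` U)" "Cr_on r (\<lambda>y. G (inv_into U \<psi> y)) (\<psi> ` U)"
proof -
	obtain Q where oU: "openin (subtopology (mtop M) (slc a)) U" and inj: "inj_on \<psi> U"
		and Q: "linear Q" "\<psi> = (\<lambda>p. Q (P p))" "\<forall>p\<in>U. transversal Q p" and Us: "U \<subseteq> slc a"
		by (rule slice_chartE[OF U]) (rule that)
	have loc: "\<exists>V. open V \<and> y \<in> V \<and> V \<subseteq> \<psi> ` U \<and> Cr_on r (\<lambda>y. G (inv_into U \<psi> y)) V" if y: "y \<in> \<psi> ` U" for y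
	proof -
		obtain x where x: "x \<in> U" "y = \<psi> x" using y by blast
		hence xs: "x \<in> slc a" "x \<in> pts M" using Us slc_topspace by blast+
		obtain c where c: "c \<in> charts_at M x" using ex_chart[OF xs(2)] by blast
		hence c': "c \<in> charts M" "x \<in> fst c" using charts_atD by blast+
		define h where "h = (crd Q c)"
		let ?V = "(\<lambda>y. (a, y)) -` (h ` tube a U c)"
		note tc = tube_coord[OF U Q c'(1), folded h_def] and ti = tube_inverse[OF U Q c'(1), folded h_def]
		have cont: "continuous_on UNIV (\<lambda>y :: real ^ 'k. (a, y))" by (intro continuous_intros)
		have oV: "open ?V" using open_vimage[OF tc(5) cont] .
		have yV: "y \<in> ?V" using ti(1)[of a y] x c'(2) inv_into_f_f[OF inj x(1)] flow_0[OF xs(2)] y by simp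
		have sub: "?V \<subseteq> \<psi> ` U"
		proof
			fix y assume "y \<in> ?V"
			hence "(a, y) \<in> h ` tube a U c" by (rule vimageD)
			thus "y \<in> \<psi> ` U" using ti(1)[of a y] by simp
		qed
		have inU: "inv_into U \<psi> y \<in> pts M" if "y \<in> ?V" for y
			using that sub inv_into_into[of y \<psi> U] Us slc_topspace by blast
		have eq: "G (chart_inv c (inv_into (tube a U c) h (a, y))) = G (inv_into U \<psi> y)" if "y \<in> ?V" for y
			using ti(2)[of a y] that inU[OF that] by simp
		have 1: "Cr_on r (\<lambda>y. (a, y)) ?V"
			by (intro Cr_on_Pair[OF oV] Cr_on_const[OF oV] Cr_on_bounded_linear[OF oV] bounded_linear_ident)
		have 2: "Cr_on r (\<lambda>y. inv_into (tube a U c) h (a, y)) ?V"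
			by (rule Cr_on_compose[OF oV tc(5) _ 1 tc(6)]) auto
		have 3: "Cr_on r (\<lambda>y. G (chart_inv c (inv_into (tube a U c) h (a, y)))) ?V"
		proof (rule Cr_on_compose[OF oV chart_open[OF c'(1)] _ 2 cr_fun_Cr_on[OF G c'(1)]])
			show "(\<lambda>y. inv_into (tube a U c) h (a, y)) ` ?V \<subseteq> cod c"
				using inv_into_into[of _ h "tube a U c"] tc(2) by blast
		qed
		from Cr_on_cong[OF oV eq 3] oV yV sub show ?thesis by (intro exI[of _ ?V] conjI)
	qed
	show o: "open (\<psi> ` U)"
	proof (subst open_subopen, rule ballI)
		fix y assume "y \<in> \<psi> ` U"
		from loc[OF this] obtain V where "open V" "y \<in> V" "V \<subseteq> \<psi> ` U" by (elim exE conjE)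
		thus "\<exists>T. open T \<and> y \<in> T \<and> T \<subseteq> \<psi> ` U" by (intro exI[of _ V] conjI)
	qed
	show "Cr_on r (\<lambda>y. G (inv_into U \<psi> y)) (\<psi> ` U)"
	proof (rule Cr_on_local[OF o])
		fix y assume "y \<in> \<psi> ` U"
		from loc[OF this] obtain V where "open V" "y \<in> V" "Cr_on r (\<lambda>y. G (inv_into U \<psi> y)) V" by (elim exE conjE)
		thus "\<exists>V. open V \<and> y \<in> V \<and> Cr_on r (\<lambda>y. G (inv_into U \<psi> y)) V" by (intro exI[of _ V] conjI)
	qed
qed


lemma ex_slice_chart:
	assumes x: "x \<in> slc a"
	shows "\<exists>U \<psi>. (U, \<psi>) \<in> charts (slice a) \<and> x \<in> U"
proof -
	have xM: "x \<in> pts M" by (rule slc_topspace[OF x])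
	obtain c Q B where cb: "box_at x c Q B" using coord_box[OF xM] by (elim exE)
	have c: "c \<in> charts_at M x" and Q: "linear Q" and B: "open B" "snd c x \<in> B" "B \<subseteq> cod c"
		and inj: "inj_on (crd Q c) B"
		using cb by (simp_all add: box_at_def)
	have D: "inj (Df (crd Q c) y)" if "y \<in> B" for y
		using cb that unfolding box_at_def by blast
	note c' = charts_atD[OF c]
	define U where "U = slc a \<inter> {p \<in> fst c. snd c p \<in> B}"
	have oU: "openin (subtopology (mtop M) (slc a)) U"
		unfolding U_def by (rule openin_subtopology_Int2[OF chart_preimage_openin[OF c'(1) B(1)]])
	have UE: "p \<in> slc a" "p \<in> fst c" "snd c p \<in> B" if "p \<in> U" for p
		using that by (simp_all add: U_def)
	have injU: "inj_on (\<lambda>p. Q (P p)) U"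
	proof (rule inj_onI)
		fix p p' assume p: "p \<in> U" and p': "p' \<in> U" and eq: "Q (P p) = Q (P p')"
		have "coord Q p = coord Q p'"
			unfolding coord_def slc_T[OF UE(1)[OF p]] slc_T[OF UE(1)[OF p']] eq ..
		hence "coord Q (chart_inv c (snd c p)) = coord Q (chart_inv c (snd c p'))"
			unfolding chart_inv_left[OF c'(1) UE(2)[OF p]] chart_inv_left[OF c'(1) UE(2)[OF p']] .
		from inj_onD[OF inj this UE(3)[OF p] UE(3)[OF p']] have "snd c p = snd c p'" .
		from inj_onD[OF chart_inj[OF c'(1)] this UE(2)[OF p] UE(2)[OF p']] show "p = p'" .
	qed
	have RgU: "transversal Q p" if p: "p \<in> U" for p
	proof -
		have cp: "c \<in> charts_at M p" using c'(1) UE(2)[OF p] by (simp add: charts_at_def)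
		have "snd c p \<in> cod c" using UE(2)[OF p] by (rule imageI)
		from chart_deriv_at(2)[OF c'(1) this, of "coord Q"] D[OF UE(3)[OF p]]
		have "inj (der c (coord Q) p)" unfolding chart_inv_left[OF c'(1) UE(2)[OF p]] by simp
		thus ?thesis unfolding coord_inj_iff[OF Q cp] .
	qed
	have "(U, \<lambda>p. Q (P p)) \<in> charts (slice a)"
		unfolding slice_def mfd.simps mem_Collect_eq prod.case
		by (intro conjI oU injU exI[of _ Q] Q refl ballI RgU)
	moreover have "x \<in> U" using x c'(2) B(2) by (simp add: U_def)
	ultimately show ?thesis by (intro exI[of _ U] exI[of _ "\<lambda>p. Q (P p)"] conjI)
qed

lemma slice_chart_subset:
	assumes "(U, \<psi>) \<in> charts (slice a)" "openin (subtopology (mtop M) (slc a)) V" "V \<subseteq> U"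
	shows "(V, \<psi>) \<in> charts (slice a)"
proof (rule slice_chartE[OF assms(1)])
	fix Q assume Q: "inj_on \<psi> U" "linear Q" "\<psi> = (\<lambda>p. Q (P p))" "\<forall>p\<in>U. transversal Q p"
	show ?thesis
		unfolding slice_def mfd.simps mem_Collect_eq prod.case
		by (intro conjI assms(2) inj_on_subset[OF Q(1) assms(3)] exI[of _ Q] Q(2,3) ballI
				bspec[OF bspec[OF Q(4) subsetD[OF assms(3)]]])
qed

lemma slice_chart_cr: "(U, \<psi>) \<in> charts (slice a) ==> cr_fun r M \<psi>"
proof (erule slice_chartE)
	fix Q :: "(real ^ 'n) \<times> (real ^ 'n) => real ^ 'k"
	assume Q: "linear Q" "\<psi> = (\<lambda>p. Q (P p))"
	have "bounded_linear Q" using Q(1) by (simp add: linear_conv_bounded_linear)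
	from cr_fun_linear[OF cr_P this] show "cr_fun r M \<psi>" unfolding Q(2) .
qed

lemma slice_chart_homeo:
	assumes U: "(U, \<psi>) \<in> charts (slice a)"
	shows "homeomorphic_map (subtopology (mtop (slice a)) U) (top_of_set (\<psi> ` U)) \<psi>"
proof -
	have oU: "openin (subtopology (mtop M) (slc a)) U" and inj: "inj_on \<psi> U" and Us: "U \<subseteq> slc a"
		by (rule slice_chartE[OF U], assumption)+
	have top: "mtop (slice a) = subtopology (mtop M) (slc a)" by (simp add: slice_def)
	have topU: "topspace (subtopology (mtop (slice a)) U) = U"
		using openin_subset[OF oU] by (simp add: top Int_absorb1)
	show ?thesis
	proof (rule bijective_open_imp_homeomorphic_map)
		have "continuous_map (subtopology (mtop (slice a)) U) euclidean \<psi>"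
			unfolding top by (intro continuous_map_from_subtopology cr_fun_continuous slice_chart_cr[OF U])
		thus "continuous_map (subtopology (mtop (slice a)) U) (top_of_set (\<psi> ` U)) \<psi>"
			unfolding continuous_map_in_subtopology topU by simp
		show "open_map (subtopology (mtop (slice a)) U) (top_of_set (\<psi> ` U)) \<psi>"
			unfolding open_map_def
		proof (intro allI impI)
			fix V assume V: "openin (subtopology (mtop (slice a)) U) V"
			have VU: "V \<subseteq> U" using openin_subset[OF V] topU by simp
			have "openin (subtopology (mtop M) (slc a)) V"
				using V oU unfolding top by (rule openin_trans_full)
			from slice_fun(1)[OF slice_chart_subset[OF U this VU] cr_T] have "open (\<psi> ` V)" .
			thus "openin (top_of_set (\<psi> ` U)) (\<psi> ` V)" by (rule open_subset[rotated]) (use VU in blast)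
		qed
		show "\<psi> ` topspace (subtopology (mtop (slice a)) U) = topspace (top_of_set (\<psi> ` U))"
			unfolding topU by simp
		show "inj_on \<psi> (topspace (subtopology (mtop (slice a)) U))" unfolding topU by (rule inj)
	qed
qed

text \<open>The slice is the image of the connected space \<open>M\<close> under the continuous map
  \<open>proj a\<close>.\<close>

lemma slice_nonempty_connected:
	"connected_space (mtop (slice a))"
proof -
	have "connectedin (mtop M) (proj a ` pts M)"
		by (rule connectedin_continuous_map_image[OF proj_continuous]) (simp add: connectedin_topspace connected)
	moreover have "proj a ` pts M = slc a"
	proof
		show "proj a ` pts M \<subseteq> slc a" using proj_slc by blast
		show "slc a \<subseteq> proj a ` pts M"
		proof
			fix x assume x: "x \<in> slc a"
			from imageI[OF slc_topspace[OF x], of "proj a"] show "x \<in> proj a ` pts M"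
				unfolding proj_id[OF x] .
		qed
	qed
	ultimately show ?thesis by (simp add: slice_def connectedin_def)
qed

lemma slice_manifold: "Cr_manifold r (slice a)"
	unfolding Cr_manifold_def
proof (intro conjI ballI)
	show "Hausdorff_space (mtop (slice a))" by (simp add: slice_def Hausdorff_space_subtopology hausdorff)
	show "second_countable (mtop (slice a))" by (simp add: slice_def second_countable_subtopology second_countable)
	show "connected_space (mtop (slice a))" by (rule slice_nonempty_connected)
	show "\<Union> (fst ` charts (slice a)) = topspace (mtop (slice a))"
		unfolding slice_topspace
	proof
		show "\<Union> (fst ` charts (slice a)) \<subseteq> slc a"
		proof (rule Union_least, elim imageE)
			fix X d assume X: "X = fst d" and d: "d \<in> charts (slice a)"
			have "(fst d, snd d) \<in> charts (slice a)" using d by simp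
			thus "X \<subseteq> slc a" unfolding X by (rule slice_chartE)
		qed
		show "slc a \<subseteq> \<Union> (fst ` charts (slice a))"
		proof
			fix x assume "x \<in> slc a"
			from ex_slice_chart[OF this] obtain U \<psi> where "(U, \<psi>) \<in> charts (slice a)" "x \<in> U" by (elim exE conjE)
			thus "x \<in> \<Union> (fst ` charts (slice a))" by (intro UnionI[of U]) force+
		qed
	qed
	fix c assume c: "c \<in> charts (slice a)"
	obtain U \<psi> where cU: "c = (U, \<psi>)" by (cases c)
	have U: "(U, \<psi>) \<in> charts (slice a)" using c cU by simp
	have oU: "openin (subtopology (mtop M) (slc a)) U" and inj: "inj_on \<psi> U"
		by (rule slice_chartE[OF U], assumption)+
	show "openin (mtop (slice a)) (fst c)" using oU by (simp add: cU slice_def)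
	show "open (cod c)" using slice_fun(1)[OF U cr_T] by (simp add: cU)
	show "homeomorphic_map (subtopology (mtop (slice a)) (fst c)) (top_of_set (cod c)) (snd c)"
		using slice_chart_homeo[OF U] by (simp add: cU)
	fix d assume d: "d \<in> charts (slice a)"
	obtain V \<phi> where dV: "d = (V, \<phi>)" by (cases d)
	have V: "(V, \<phi>) \<in> charts (slice a)" using d dV by simp
	have "Cr_on r (\<lambda>y. \<phi> (inv_into U \<psi> y)) (\<psi> ` U)" by (rule slice_fun(2)[OF U slice_chart_cr[OF V]])
	hence "Cr_on r (\<lambda>y. \<phi> (inv_into U \<psi> y)) (\<psi> ` (U \<inter> V))" by (rule Cr_on_subset) blast
	thus "Cr_on r (snd d \<circ> chart_inv c) (snd c ` (fst c \<inter> fst d))"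
		by (simp add: cU dV chart_inv_def o_def)
qed

lemma slice_cr_manifold: "cr_manifold r (slice a)"
	by (unfold_locales, rule slice_manifold)

lemma slice_cr_fun:
	fixes G :: "'m => 'b::euclidean_space"
	assumes "cr_fun r M G"
	shows "cr_fun r (slice a) G"
	unfolding cr_fun_def
proof
	fix c assume c: "c \<in> charts (slice a)"
	obtain U \<psi> where cU: "c = (U, \<psi>)" by (cases c)
	hence "(U, \<psi>) \<in> charts (slice a)" using c by simp
	from slice_fun(2)[OF this assms] show "Cr_on r (G \<circ> chart_inv c) (cod c)"
		by (simp add: cU chart_inv_def o_def)
qed

definition nform :: "real => 'm => real \<times> 'm" where
	"nform a p = (T p - a, proj a p)"

lemma nform_inverse:
	assumes "x \<in> slc a"
	shows "nform a (flow x s) = (s, x)"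
	using assms slc_topspace[OF assms] by (simp add: nform_def flow_T slc_T proj_flow proj_id)

lemma prod_topspace: "topspace (mtop (mfd_prod flat (slice a))) = UNIV \<times> slc a"
	by (simp add: mfd_prod_def flat_def slice_topspace)

lemma nform_bij: "bij_betw (nform a) (pts M) (UNIV \<times> slc a)"
proof (rule bij_betwI[where g="\<lambda>(s, x). flow x s"])
	show "nform a \<in> pts M \<rightarrow> UNIV \<times> slc a" by (simp add: nform_def proj_slc)
	show "(\<lambda>(s, x). flow x s) \<in> UNIV \<times> slc a \<rightarrow> pts M"
		using flow_topspace slc_topspace by auto
	show "(\<lambda>(s, x). flow x s) (nform a p) = p" if "p \<in> pts M" for p
		using flow_proj[OF that, of a] by (simp add: nform_def)
	show "nform a ((\<lambda>(s, x). flow x s) y) = y" if "y \<in> UNIV \<times> slc a" for y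
		using that nform_inverse by auto
qed

lemma nform_inv_into:
	assumes "x \<in> slc a"
	shows "inv_into (pts M) (nform a) (s, x) = flow x s"
	by (rule inv_into_f_eq[OF bij_betw_imp_inj_on[OF nform_bij] flow_topspace[OF slc_topspace[OF assms]] nform_inverse[OF assms]])

lemma prod_charts: "d \<in> charts (mfd_prod (flat :: (real, real) mfd) (slice a)) \<longleftrightarrow>
		(\<exists>U \<psi>. d = (UNIV \<times> U, map_prod id \<psi>) \<and> (U, \<psi>) \<in> charts (slice a))"
	by (auto simp: mfd_prod_def flat_def)

text \<open>As \<open>proj a\<close> preserves \<open>P\<close>, the map reads (T - a, Q o P) in
  charts, so its smoothness is that of \<open>T\<close> and \<open>P\<close>.\<close>

lemma nform_Cr_map: "Cr_map r M (mfd_prod flat (slice a)) (nform a)"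
	unfolding Cr_map_def
proof (intro conjI ballI)
	have "continuous_map (mtop M) (subtopology (mtop M) (slc a)) (proj a)"
		using proj_continuous proj_slc by (auto simp: continuous_map_in_subtopology)
	moreover have "continuous_map (mtop M) euclidean (\<lambda>p. T p - a)"
		by (intro continuous_map_diff cr_fun_continuous[OF cr_T]) simp
	ultimately show "continuous_map (mtop M) (mtop (mfd_prod flat (slice a))) (nform a)"
		unfolding nform_def mfd_prod_def flat_def slice_def mfd.simps continuous_map_paired by (rule conjI[rotated])
	fix c d assume c: "c \<in> charts M" and d: "d \<in> charts (mfd_prod (flat :: (real, real) mfd) (slice a))"
	obtain U \<psi> where dU: "d = (UNIV \<times> U, map_prod id \<psi>)" and U: "(U, \<psi>) \<in> charts (slice a)"
		using d unfolding prod_charts by (elim exE conjE)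
	obtain Q where oU: "openin (subtopology (mtop M) (slc a)) U" and \<psi>: "\<psi> = (\<lambda>p. Q (P p))"
		by (rule slice_chartE[OF U]) (rule that)
	let ?W = "snd c ` (fst c \<inter> nform a -` fst d)"
	have W: "?W = tube a U c"
		unfolding tube_def dU nform_def using chart_subset[OF c] by auto
	have oW: "open ?W" unfolding W tube_def by (rule chart_image_open[OF c proj_preimage_openin[OF oU]])
	have sub: "?W \<subseteq> cod c" by blast
	have "cr_fun r M (\<lambda>p. T p + (- a))" by (intro cr_fun_add cr_T cr_fun_const)
	from cr_fun_Cr_on[OF cr_fun_Pair[OF this slice_chart_cr[OF U]] c]
	have 1: "Cr_on r (\<lambda>y. (T (chart_inv c y) + (- a), \<psi> (chart_inv c y))) ?W" by (rule Cr_on_subset[OF _ sub])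
	have "(T (chart_inv c y) + (- a), \<psi> (chart_inv c y)) = (snd d \<circ> nform a \<circ> chart_inv c) y" if "y \<in> ?W" for y
	proof -
		have "chart_inv c y \<in> pts M" using chart_inv_in[OF subsetD[OF sub that]] chart_subset[OF c] by blast
		thus ?thesis unfolding dU \<psi> by (simp add: nform_def proj_P)
	qed
	from Cr_on_cong[OF oW this 1] show "Cr_on r (snd d \<circ> nform a \<circ> chart_inv c) ?W" .
qed

lemma nform_inv_Cr_map: "Cr_map r (mfd_prod flat (slice a)) M (inv_into (pts M) (nform a))"
	(is "Cr_map r ?N M ?\<Psi>")
proof -
	text \<open>In charts the inverse is \<open>(s, y) \<mapsto> h\<^sup>-\<^sup>1 (a + s, y)\<close> with \<open>h = (T, Q \<circ> P)\<close>.\<close>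
	have loc: "open {z. (a + fst z, snd z) \<in> (crd Q c) ` tube a U c}"
			(is "open ?V")
			"Cr_on r (\<lambda>z. inv_into (tube a U c) (crd Q c) (a + fst z, snd z))
				{z. (a + fst z, snd z) \<in> (crd Q c) ` tube a U c}"
		if U: "(U, \<psi>) \<in> charts (slice a)" and Q: "linear Q" "\<psi> = (\<lambda>p. Q (P p))"
			"\<forall>p\<in>U. transversal Q p" and c: "c \<in> charts M" for U \<psi> Q c
	proof -
		let ?h = "crd Q c" and ?s = "\<lambda>z :: real \<times> (real ^ 'k). (a + fst z, snd z)"
		note tc = tube_coord[OF U Q c]
		have "continuous_on UNIV ?s" by (intro continuous_intros)
		from open_vimage[OF tc(5) this] show o: "open {z. ?s z \<in> ?h ` tube a U c}" by (simp add: vimage_def)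
		have 1: "Cr_on r ?s {z. ?s z \<in> ?h ` tube a U c}"
			by (intro Cr_on_Pair[OF o] Cr_on_add[OF o] Cr_on_const[OF o] Cr_on_bounded_linear[OF o]
					bounded_linear_fst bounded_linear_snd)
		show "Cr_on r (\<lambda>z. inv_into (tube a U c) ?h (?s z)) {z. ?s z \<in> ?h ` tube a U c}"
			by (rule Cr_on_compose[OF o tc(5) _ 1 tc(6)]) blast
	qed
	show ?thesis
		unfolding Cr_map_def
	proof (intro conjI ballI)
		show "continuous_map (mtop ?N) (mtop M) ?\<Psi>"
		proof (rule continuous_map_local)
			fix z assume "z \<in> topspace (mtop ?N)"
			then obtain s x where z: "z = (s, x)" and x: "x \<in> slc a" unfolding prod_topspace by blast
			obtain U \<psi> where U: "(U, \<psi>) \<in> charts (slice a)" and xU: "x \<in> U"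
				using ex_slice_chart[OF x] by (elim exE conjE)
			obtain Q where oU: "openin (subtopology (mtop M) (slc a)) U" and inj: "inj_on \<psi> U" and Q: "linear Q" "\<psi> = (\<lambda>p. Q (P p))"
				"\<forall>p\<in>U. transversal Q p" and Us: "U \<subseteq> slc a"
				by (rule slice_chartE[OF U]) (rule that)
			obtain c where c: "c \<in> charts_at M (flow x s)" using ex_chart[OF flow_topspace[OF slc_topspace[OF x], of s]] by (elim exE)
			have c': "c \<in> charts M" "flow x s \<in> fst c" using charts_atD[OF c] by blast+
			define h where "h = (crd Q c)"
			define V where "V = {z. (a + fst z, snd z) \<in> h ` tube a U c}"
			have oV: "open V" and gV: "Cr_on r (\<lambda>z. inv_into (tube a U c) h (a + fst z, snd z)) V"
				unfolding V_def h_def by (rule loc[OF U Q c'(1)])+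
			note ti = tube_inverse[OF U Q c'(1), folded h_def]
			\<comment> \<open>The pairs of a time and a point of \<open>U\<close> that flow into the chart
			  \<open>c\<close>, described through coordinates so that openness is visible.\<close>
			let ?E = "{z \<in> UNIV \<times> U. (fst z, \<psi> (snd z)) \<in> V}"
			have top: "mtop ?N = prod_topology euclidean (subtopology (mtop M) (slc a))"
				by (simp add: mfd_prod_def flat_def slice_def)
			have topU: "topspace (subtopology (subtopology (mtop M) (slc a)) U) = U"
				using openin_subset[OF oU] by (simp add: Int_absorb1)
			have c\<psi>: "continuous_map (subtopology (subtopology (mtop M) (slc a)) U) euclidean \<psi>"
				by (intro continuous_map_from_subtopology cr_fun_continuous slice_chart_cr[OF U])
			have cq: "continuous_map (prod_topology euclidean (subtopology (subtopology (mtop M) (slc a)) U)) euclidean (\<lambda>z. (fst z, \<psi> (snd z)))"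
			proof -
				have "continuous_map (prod_topology euclidean (subtopology (subtopology (mtop M) (slc a)) U))
						(prod_topology euclidean euclidean) (\<lambda>z. (fst z, \<psi> (snd z)))"
					unfolding continuous_map_paired
					by (rule conjI[OF continuous_map_fst continuous_map_compose[OF continuous_map_snd c\<psi>, unfolded o_def]])
				thus ?thesis by (simp only: prod_topology_euclidean)
			qed
			have topPU: "topspace (prod_topology euclidean (subtopology (subtopology (mtop M) (slc a)) U)) = UNIV \<times> U"
				using topU by simp
			have "openin euclidean V" using oV by simp
			from openin_continuous_map_preimage[OF cq this]
			have oE1: "openin (prod_topology euclidean (subtopology (subtopology (mtop M) (slc a)) U)) ?E"
				unfolding topPU .
			have oE2: "prod_topology euclidean (subtopology (subtopology (mtop M) (slc a)) U) =
					subtopology (prod_topology euclidean (subtopology (mtop M) (slc a))) (UNIV \<times> U)"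
				using prod_topology_subtopology(2)[of euclidean "subtopology (mtop M) (slc a)" U] by simp
			have oE3: "openin (prod_topology euclidean (subtopology (mtop M) (slc a))) (UNIV \<times> U)"
				by (simp add: openin_prod_Times_iff oU)
			have oE: "openin (mtop ?N) ?E"
				unfolding top by (rule openin_trans_full[OF oE1[unfolded oE2] oE3])
			have E\<Psi>: "?\<Psi> w = chart_inv c (inv_into (tube a U c) h (a + fst w, \<psi> (snd w)))" if w: "w \<in> ?E" for w
			proof -
				have wU: "snd w \<in> U" and wV: "(a + fst w, \<psi> (snd w)) \<in> h ` tube a U c"
					using w by (simp_all only: V_def mem_Collect_eq fst_conv snd_conv mem_Times_iff)
				have "?\<Psi> w = flow (snd w) (fst w)"
					using nform_inv_into[OF subsetD[OF Us wU], of "fst w"] by simp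
				also have "\<dots> = flow (inv_into U \<psi> (\<psi> (snd w))) (a + fst w - a)"
					by (simp add: inv_into_f_f[OF inj wU])
				also have "\<dots> = chart_inv c (inv_into (tube a U c) h (a + fst w, \<psi> (snd w)))"
					by (rule ti(2)[OF wV, symmetric])
				finally show ?thesis .
			qed
			have "z \<in> ?E"
			proof -
				have "(a + s, \<psi> x) \<in> h ` tube a U c"
					unfolding ti(1) using xU c'(2) inv_into_f_f[OF inj xU] by simp
				thus ?thesis using xU unfolding z V_def mem_Collect_eq mem_Times_iff fst_conv snd_conv by simp
			qed
			moreover have "continuous_map (subtopology (mtop ?N) ?E) (mtop M) ?\<Psi>"
			proof -
				have top': "topspace (subtopology (mtop ?N) ?E) = ?E" using openin_subset[OF oE] by (rule topspace_subtopology_subset)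
				have "continuous_map (subtopology (mtop ?N) ?E) euclidean (\<lambda>z. (fst z, \<psi> (snd z)))"
				proof -
					have "subtopology (mtop ?N) ?E = subtopology (prod_topology euclidean (subtopology (subtopology (mtop M) (slc a)) U)) ?E"
						unfolding top prod_topology_subtopology(2) subtopology_subtopology by (rule arg_cong2[of _ _ _ _ subtopology]) auto
					thus ?thesis using continuous_map_from_subtopology[OF cq] by simp
				qed
				hence 1: "continuous_map (subtopology (mtop ?N) ?E) (top_of_set V) (\<lambda>z. (fst z, \<psi> (snd z)))"
					unfolding continuous_map_in_subtopology top' by blast
				have "inv_into (tube a U c) h (a + fst z, snd z) \<in> cod c" if "z \<in> V" for z
					using that inv_into_into[of "(a + fst z, snd z)" h "tube a U c"] unfolding V_def mem_Collect_eq tube_def by blast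
				hence 2: "continuous_map (top_of_set V) (top_of_set (cod c)) (\<lambda>z. inv_into (tube a U c) h (a + fst z, snd z))"
					using Cr_on_continuous[OF gV] unfolding continuous_map_in_subtopology continuous_map_iff_continuous topspace_euclidean_subtopology by blast
				from continuous_map_compose[OF continuous_map_compose[OF 1 2] chart_inv_continuous[OF c'(1)]]
				have "continuous_map (subtopology (mtop ?N) ?E) (mtop M)
						(\<lambda>w. chart_inv c (inv_into (tube a U c) h (a + fst w, \<psi> (snd w))))" by (simp add: o_def)
				thus ?thesis by (rule continuous_map_eq) (simp only: top' E\<Psi>)
			qed
			ultimately show "\<exists>U. openin (mtop ?N) U \<and> z \<in> U \<and> continuous_map (subtopology (mtop ?N) U) (mtop M) ?\<Psi>"
				using oE by (intro exI[of _ ?E] conjI)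
		qed
		fix d c assume d: "d \<in> charts ?N" and c: "c \<in> charts M"
		obtain U \<psi> where dU: "d = (UNIV \<times> U, map_prod id \<psi>)" and U: "(U, \<psi>) \<in> charts (slice a)"
			using d unfolding prod_charts by (elim exE conjE)
		obtain Q where oU: "openin (subtopology (mtop M) (slc a)) U" and inj: "inj_on \<psi> U" and Q: "linear Q" "\<psi> = (\<lambda>p. Q (P p))"
			"\<forall>p\<in>U. transversal Q p" and Us: "U \<subseteq> slc a"
			by (rule slice_chartE[OF U]) (rule that)
		define h where "h = (crd Q c)"
		define V where "V = {z. (a + fst z, snd z) \<in> h ` tube a U c}"
		have oV: "open V" and gV: "Cr_on r (\<lambda>z. inv_into (tube a U c) h (a + fst z, snd z)) V"
			unfolding V_def h_def by (rule loc[OF U Q c])+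
		have Vmem: "(s, y) \<in> V \<longleftrightarrow> (a + s, y) \<in> h ` tube a U c" for s y by (simp only: V_def mem_Collect_eq fst_conv snd_conv)
		note ti = tube_inverse[OF U Q c, folded h_def]
		have V: "snd d ` (fst d \<inter> ?\<Psi> -` fst c) = V"
		proof (intro set_eqI iffI)
			fix z assume "z \<in> snd d ` (fst d \<inter> ?\<Psi> -` fst c)"
			then obtain w where w: "z = snd d w" "w \<in> fst d" "?\<Psi> w \<in> fst c" by blast
			obtain s x where sx: "w = (s, x)" by (cases w)
			have z: "z = (s, \<psi> x)" and x: "x \<in> U" "?\<Psi> (s, x) \<in> fst c" using w unfolding dU sx by simp_all
			have "flow x s \<in> fst c" using x(2) nform_inv_into[OF subsetD[OF Us x(1)]] by simp
			hence "(a + s, \<psi> x) \<in> h ` tube a U c"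
				unfolding ti(1) using x(1) inv_into_f_f[OF inj x(1)] by simp
			thus "z \<in> V" unfolding z Vmem .
		next
			fix z assume zV: "z \<in> V"
			obtain s y where z: "z = (s, y)" by (cases z)
			have "(a + s, y) \<in> h ` tube a U c" using zV unfolding z Vmem .
			hence y: "y \<in> \<psi> ` U" and fl: "flow (inv_into U \<psi> y) s \<in> fst c" unfolding ti(1) by simp_all
			have xU: "inv_into U \<psi> y \<in> U" and xy: "\<psi> (inv_into U \<psi> y) = y" using inv_into_into[OF y] f_inv_into_f[OF y] by simp_all
			have "(s, inv_into U \<psi> y) \<in> fst d \<inter> ?\<Psi> -` fst c"
				using xU fl nform_inv_into[OF subsetD[OF Us xU]] by (simp add: dU)
			from imageI[OF this, of "snd d"] show "z \<in> snd d ` (fst d \<inter> ?\<Psi> -` fst c)"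
				by (simp add: dU z xy)
		qed
		have eq: "inv_into (tube a U c) h (a + fst z, snd z) = (snd c \<circ> ?\<Psi> \<circ> chart_inv d) z" if zV: "z \<in> V" for z
		proof -
			obtain s y where z: "z = (s, y)" by (cases z)
			have im: "(a + s, y) \<in> h ` tube a U c" using zV unfolding z Vmem .
			hence y: "y \<in> \<psi> ` U" unfolding ti(1) by simp
			have xU: "inv_into U \<psi> y \<in> U" and xy: "\<psi> (inv_into U \<psi> y) = y" using inv_into_into[OF y] f_inv_into_f[OF y] by simp_all
			have "inj_on (map_prod id \<psi>) (UNIV \<times> U)" by (intro map_prod_inj_on inj inj_on_id)
			from inv_into_f_eq[OF this, of "(s, inv_into U \<psi> y)" "(s, y)"]
			have "chart_inv d z = (s, inv_into U \<psi> y)" using xU xy by (simp add: chart_inv_def dU z)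
			hence "(snd c \<circ> ?\<Psi> \<circ> chart_inv d) z = snd c (flow (inv_into U \<psi> y) s)"
				using nform_inv_into[OF subsetD[OF Us xU]] by simp
			also have "flow (inv_into U \<psi> y) s = chart_inv c (inv_into (tube a U c) h (a + s, y))"
				using ti(2)[OF im] by simp
			also have "snd c (chart_inv c (inv_into (tube a U c) h (a + s, y))) = inv_into (tube a U c) h (a + s, y)"
				by (rule chart_inv_right) (use inv_into_into[OF im] in \<open>unfold tube_def, blast\<close>)
			finally show ?thesis by (simp add: z)
		qed
		from Cr_on_cong[OF oV eq gV]
		show "Cr_on r (snd c \<circ> ?\<Psi> \<circ> chart_inv d) (snd d ` (fst d \<inter> ?\<Psi> -` fst c))" unfolding V .
	qed
qed

lemma nform_reparametrization:
	"reparametrized_as r M (\<lambda>p. F p - (a, 0)) (slice a) (normal_form (\<lambda>p. snd (F p)) \<nu>)"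
	unfolding reparametrized_as_def
proof (intro exI[of _ "nform a"] conjI ballI)
	show "Cr_diffeo r M (mfd_prod flat (slice a)) (nform a)"
		unfolding Cr_diffeo_def prod_topspace by (intro conjI nform_bij nform_Cr_map nform_inv_Cr_map)
	fix z assume "z \<in> topspace (mtop (mfd_prod (flat :: (real, real) mfd) (slice a)))"
	then obtain s x where z: "z = (s, x)" and x: "x \<in> slc a" unfolding prod_topspace by blast
	have f: "fst (F x) = a" using slc_T[OF x] by (simp add: T_def)
	have "F (flow x s) - (a, 0) = normal_form (\<lambda>p. snd (F p)) \<nu> z"
		unfolding z normal_form_def prod.case flow_F[OF slc_topspace[OF x]]
		by (simp add: prod_eq_iff f)
	thus "F (inv_into (pts M) (nform a) z) - (a, 0) = normal_form (\<lambda>p. snd (F p)) \<nu> z"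
		unfolding z nform_inv_into[OF x] .
qed

end

section \<open>The second fundamental form\<close>

text \<open>The mean value theorem is applied to the second difference, first along \<open>u\<close>
  and then along \<open>v\<close>. The left side is symmetric in \<open>u\<close> and
  \<open>v\<close>, which yields the symmetry of second derivatives.\<close>

lemma mixed_difference:
	fixes \<phi> :: "'a::real_normed_vector => real"
	assumes D: "\<And>y. y \<in> ball x e ==> (\<phi> has_derivative D y) (at y)"
		and E: "\<And>y. y \<in> ball x e ==> ((\<lambda>y. D y u) has_derivative E y) (at y)"
		and t: "0 < t" "t * (norm u + norm v) < e"
	shows "\<exists>\<xi>\<in>ball x e. \<phi> (x + t *. u + t *. v) - \<phi> (x + t *. u) - \<phi> (x + t *. v) + \<phi> x = t * (t * E \<xi> v)"
proof -
	have in_ball: "x + a *. u + b *. v \<in> ball x e" if "0 \<le> a" "a \<le> t" "0 \<le> b" "b \<le> t" for a b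
	proof -
		have "norm (a *. u + b *. v) \<le> a * norm u + b * norm v"
			using norm_triangle_ineq[of "a *. u" "b *. v"] that by simp
		also have "\<dots> \<le> t * (norm u + norm v)"
			unfolding distrib_left by (intro add_mono mult_right_mono that norm_ge_zero)
		finally show ?thesis using t by (simp add: dist_norm norm_minus_commute algebra_simps)
	qed
	have aff: "((\<lambda>b. w + b *. z) has_derivative (\<lambda>h. h *. z)) (at s)" for w z :: 'a and s
		by (rule derivative_eq_intros | simp)+
	have 1: "((\<lambda>a. \<phi> (x + a *. u + t *. v) - \<phi> (x + a *. u)) has_real_derivative
			D (x + a *. u + t *. v) u - D (x + a *. u) u) (at a)" if "0 \<le> a" "a \<le> t" for a
	proof -
		have b: "x + a *. u + t *. v \<in> ball x e" "x + a *. u \<in> ball x e"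
			using in_ball[OF that, of t] in_ball[OF that, of 0] t(1) by simp_all
		have 1: "((\<lambda>a. \<phi> (x + a *. u + t *. v)) has_derivative (\<lambda>h. D (x + a *. u + t *. v) (h *. u))) (at a)"
		proof -
			have eq: "x + t *. v + b *. u = x + b *. u + t *. v" for b by simp
			have "(\<phi> has_derivative D (x + a *. u + t *. v)) (at (x + t *. v + a *. u))"
				unfolding eq by (rule D[OF b(1)])
			from has_derivative_compose[OF aff this] show ?thesis unfolding eq .
		qed
		have 2: "((\<lambda>a. \<phi> (x + a *. u)) has_derivative (\<lambda>h. D (x + a *. u) (h *. u))) (at a)"
			by (rule has_derivative_compose[OF aff D[OF b(2)]])
		from has_derivative_diff[OF 1 2]
		have "((\<lambda>a. \<phi> (x + a *. u + t *. v) - \<phi> (x + a *. u)) has_derivative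
			(\<lambda>h. D (x + a *. u + t *. v) (h *. u) - D (x + a *. u) (h *. u))) (at a)" .
		moreover have "D y (h *. u) = h * D y u" if "y \<in> ball x e" for y h
			using linear_scale[OF has_derivative_linear[OF D[OF that]], of h u] by simp
		ultimately show ?thesis
			using b by (simp add: has_field_derivative_def mult_commute_abs right_diff_distrib[symmetric])
	qed
	have "\<exists>a>0. a < t \<and> \<phi> (x + t *. u + t *. v) - \<phi> (x + t *. u) - (\<phi> (x + 0 *. u + t *. v) - \<phi> (x + 0 *. u))
			= (t - 0) * (D (x + a *. u + t *. v) u - D (x + a *. u) u)"
		by (rule MVT2[OF t(1), of "\<lambda>a. \<phi> (x + a *. u + t *. v) - \<phi> (x + a *. u)"
					"\<lambda>a. D (x + a *. u + t *. v) u - D (x + a *. u) u"]) (rule 1)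
	then obtain a where a: "0 < a" "a < t" and
		"\<phi> (x + t *. u + t *. v) - \<phi> (x + t *. u) - (\<phi> (x + 0 *. u + t *. v) - \<phi> (x + 0 *. u))
			= (t - 0) * (D (x + a *. u + t *. v) u - D (x + a *. u) u)"
		by (elim exE conjE) (rule that)
	hence a3: "\<phi> (x + t *. u + t *. v) - \<phi> (x + t *. u) - \<phi> (x + t *. v) + \<phi> x
			= t * (D (x + a *. u + t *. v) u - D (x + a *. u) u)"
		unfolding scaleR_zero_left add_0_right diff_0_right by linarith
	have 2: "((\<lambda>b. D (x + a *. u + b *. v) u) has_real_derivative E (x + a *. u + b *. v) v) (at b)"
		if "0 \<le> b" "b \<le> t" for b
	proof -
		have y: "x + a *. u + b *. v \<in> ball x e" by (rule in_ball) (use a that in auto)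
		have "((\<lambda>b. D (x + a *. u + b *. v) u) has_derivative (\<lambda>h. E (x + a *. u + b *. v) (h *. v))) (at b)"
			by (rule has_derivative_compose[OF aff E[OF y]])
		moreover have "E (x + a *. u + b *. v) (h *. v) = h * E (x + a *. u + b *. v) v" for h
			using linear_scale[OF has_derivative_linear[OF E[OF y]], of h v] by simp
		ultimately show ?thesis by (simp add: has_field_derivative_def mult_commute_abs)
	qed
	have "\<exists>b>0. b < t \<and> D (x + a *. u + t *. v) u - D (x + a *. u + 0 *. v) u = (t - 0) * E (x + a *. u + b *. v) v"
		by (rule MVT2[OF t(1), of "\<lambda>b. D (x + a *. u + b *. v) u" "\<lambda>b. E (x + a *. u + b *. v) v"]) (rule 2)
	from this[unfolded scaleR_zero_left add_0_right diff_0_right] obtain b where b: "0 < b" "b < t"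
		"D (x + a *. u + t *. v) u - D (x + a *. u) u = t * E (x + a *. u + b *. v) v"
		by (elim exE conjE)
	show ?thesis
		unfolding a3 b(3) by (rule bexI[of _ "x + a *. u + b *. v"]) (use a(1,2) b(1,2) in_ball[of a b] in simp_all)
qed

lemma mixed_derivatives_symmetric:
	fixes \<phi> :: "'a::real_normed_vector => real"
	assumes U: "open U" "x \<in> U" and \<phi>: "Ck_on (Suc (Suc 0)) \<phi> U"
	shows "Df (\<lambda>y. Df \<phi> y u) x v =
		Df (\<lambda>y. Df \<phi> y v) x u"
proof -
	let ?D = "\<lambda>y. Df \<phi> y"
	let ?E = "\<lambda>u y. Df (\<lambda>y. ?D y u) y"
	have D: "(\<phi> has_derivative ?D y) (at y)" if "y \<in> U" for y by (rule Ck_on_SucE[OF \<phi> that])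
	have C1: "Ck_on (Suc 0) (\<lambda>y. ?D y u) U" for u
		using \<phi> unfolding Ck_on.simps(2)[of "Suc 0"] by (elim conjE allE)
	have E: "((\<lambda>y. ?D y u) has_derivative ?E u y) (at y)" if "y \<in> U" for u y
		by (rule Ck_on_SucE[OF C1 that])
	have cE: "continuous_on U (\<lambda>y. ?E u y v)" for u v
		using C1[of u] unfolding Ck_on.simps by (elim conjE allE)
	show ?thesis
	proof (rule ccontr)
		assume ne: "?E u x v \<noteq> ?E v x u"
		define d where "d = dist (?E u x v) (?E v x u) / 2"
		have d: "d > 0" using ne by (simp add: d_def)
		have near: "\<exists>e>0. \<forall>y. dist y x < e --> dist (?E u y v) (?E u x v) < d" for u v
			by (rule spec[OF cE[unfolded continuous_on_eq_continuous_at[OF U(1)], THEN bspec, OF U(2),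
						unfolded continuous_at_eps_delta], THEN mp, OF d])
		from near[of u v] obtain e1 where e1: "e1 > 0" "\<forall>y. dist y x < e1 --> dist (?E u y v) (?E u x v) < d"
			by (elim exE conjE)
		from near[of v u] obtain e2 where e2: "e2 > 0" "\<forall>y. dist y x < e2 --> dist (?E v y u) (?E v x u) < d"
			by (elim exE conjE)
		obtain e3 where e3: "e3 > 0" "ball x e3 \<subseteq> U" using U openE by blast
		define e where "e = min e1 (min e2 e3)"
		have e0: "e > 0" "ball x e \<subseteq> U" using e1(1) e2(1) e3 by (auto simp: e_def)
		define s where "s = norm u + norm v"
		\<comment> \<open>The summand 1 makes the estimate \<open>t * s < e\<close> strict and covers the
		  case \<open>s = 0\<close>.\<close>
		define t where "t = e / (s + 1)"
		have s: "s \<ge> 0" by (simp add: s_def)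
		have "t > 0" "t * s < e" using e0(1) s by (simp_all add: t_def field_simps)
		hence t: "0 < t" "t * (norm u + norm v) < e" "t * (norm v + norm u) < e"
			by (simp_all add: s_def add.commute)
		from mixed_difference[of x e \<phi> ?D u "?E u" t v, OF D[OF subsetD[OF e0(2)]] E[OF subsetD[OF e0(2)]] t(1,2)]
		obtain \<xi> where \<xi>: "\<xi> \<in> ball x e" "\<phi> (x + t *. u + t *. v) - \<phi> (x + t *. u) - \<phi> (x + t *. v) + \<phi> x = t * (t * ?E u \<xi> v)"
			by (rule bexE)
		from mixed_difference[of x e \<phi> ?D v "?E v" t u, OF D[OF subsetD[OF e0(2)]] E[OF subsetD[OF e0(2)]] t(1,3)]
		obtain \<eta> where \<eta>: "\<eta> \<in> ball x e" "\<phi> (x + t *. v + t *. u) - \<phi> (x + t *. v) - \<phi> (x + t *. u) + \<phi> x = t * (t * ?E v \<eta> u)"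
			by (rule bexE)
		have uv: "x + t *. v + t *. u = x + t *. u + t *. v" by simp
		have "t * (t * ?E u \<xi> v) = t * (t * ?E v \<eta> u)"
			using \<xi>(2) \<eta>(2)[unfolded uv] by linarith
		hence eq: "?E u \<xi> v = ?E v \<eta> u" using t(1) by simp
		have "dist (?E u \<xi> v) (?E u x v) < d" "dist (?E v \<eta> u) (?E v x u) < d"
			using \<xi>(1) \<eta>(1) spec[OF e1(2), of \<xi>] spec[OF e2(2), of \<eta>] by (simp_all add: e_def dist_commute)
		from this(1) this(2)[folded eq] have "dist (?E u x v) (?E v x u) < dist (?E u x v) (?E v x u)"
			unfolding d_def by (rule dist_triangle_half_r)
		thus False by simp
	qed
qed

text \<open>Differentiating the orthogonality of tangent vectors and normal moves the derivative
  from \<open>N\<close> to second derivatives of \<open>G\<close>, which are symmetric.\<close>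

lemma second_form_symmetric:
	fixes G :: "'a::euclidean_space => 'b::euclidean_space"
	assumes V: "open V" "y \<in> V" and G: "Ck_on (Suc (Suc 0)) G V" and N: "(N has_derivative N') (at y)"
		and orth: "\<And>z u. z \<in> V ==> Df G z u \<bullet> N z = 0"
	shows "Df G y u \<bullet> N' v = - (Df (\<lambda>z. Df G z u) y v \<bullet> N y)"
		and "Df G y u \<bullet> N' v = Df G y v \<bullet> N' u"
proof -
	let ?D = "\<lambda>z. Df G z"
	let ?E = "\<lambda>u. Df (\<lambda>z. ?D z u) y"
	have E: "((\<lambda>z. ?D z u) has_derivative ?E u) (at y)" for u
	proof -
		have "Ck_on (Suc 0) (\<lambda>z. ?D z u) V" using G unfolding Ck_on.simps(2)[of "Suc 0"] by (elim conjE allE)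
		from Ck_on_SucE[OF this V(2)] show ?thesis .
	qed
	have D: "(G has_derivative ?D z) (at z)" if "z \<in> V" for z
		using Ck_on_SucE[OF G that] .
	have 1: "?D y u \<bullet> N' v = - (?E u v \<bullet> N y)" for u v
	proof -
		have "((\<lambda>z. ?D z u \<bullet> N z) has_derivative (\<lambda>v. ?D y u \<bullet> N' v + ?E u v \<bullet> N y)) (at y)"
			by (rule has_derivative_inner[OF E N])
		moreover have "((\<lambda>z. ?D z u \<bullet> N z) has_derivative (\<lambda>v. 0)) (at y)"
			by (rule has_derivative_transform_within_open[OF has_derivative_const V]) (simp add: orth)
		ultimately have "(\<lambda>v. ?D y u \<bullet> N' v + ?E u v \<bullet> N y) = (\<lambda>v. 0)" by (rule has_derivative_unique)
		from fun_cong[OF this, of v] show ?thesis by simp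
	qed
	thus "?D y u \<bullet> N' v = - (?E u v \<bullet> N y)" .
	define \<phi> where "\<phi> = (\<lambda>z. G z \<bullet> N y)"
	have D\<phi>: "Df \<phi> z u = ?D z u \<bullet> N y" if "z \<in> V" for z u
		using fun_cong[OF frechet_derivative_at[OF has_derivative_inner_left[OF D[OF that], of "N y"]], of u] by (simp add: \<phi>_def)
	have "Ck_on (Suc (Suc 0)) \<phi> V"
		unfolding \<phi>_def by (rule Ck_on_bounded_linear[OF V(1) bounded_linear_inner_left G])
	moreover have "Df (\<lambda>z. Df \<phi> z u) y v = ?E u v \<bullet> N y" for u v
	proof -
		have "((\<lambda>z. Df \<phi> z u) has_derivative (\<lambda>v. ?E u v \<bullet> N y)) (at y)"
			by (rule has_derivative_transform_within_open[OF has_derivative_inner_left[OF E] V]) (simp add: D\<phi>)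
		from fun_cong[OF frechet_derivative_at[OF this], of v] show ?thesis by (rule sym)
	qed
	ultimately show "?D y u \<bullet> N' v = ?D y v \<bullet> N' u"
		unfolding 1 using mixed_derivatives_symmetric[OF V, of \<phi> u v] by simp
qed

text \<open>A minimum of the Rayleigh quotient is an eigenvalue.\<close>

lemma ex_least_eigenvalue:
	fixes A B :: "'a::euclidean_space => 'b::euclidean_space"
	assumes A: "linear A" "inj A" and B: "linear B" "range B \<subseteq> range A"
		and sym: "\<And>u v. A u \<bullet> B v = A v \<bullet> B u"
	shows "\<exists>\<kappa> u. u \<noteq> 0 \<and> B u = \<kappa> *. A u \<and> (\<forall>v. \<kappa> * (A v \<bullet> A v) \<le> A v \<bullet> B v)"
proof -
	have A0: "A u \<noteq> 0" if "u \<noteq> 0" for u using that linear_injective_0[OF A(1)] A(2) by blast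
	let ?q = "\<lambda>u. (A u \<bullet> B u) / (A u \<bullet> A u)"
	have "continuous_on (sphere 0 1) ?q"
	proof (rule continuous_on_divide)
		have c: "continuous_on (sphere 0 1) A" "continuous_on (sphere 0 1) B"
			using A(1) B(1) by (simp_all add: linear_continuous_on linear_conv_bounded_linear)
		show "continuous_on (sphere 0 1) (\<lambda>u. A u \<bullet> B u)" "continuous_on (sphere 0 1) (\<lambda>u. A u \<bullet> A u)"
			by (rule continuous_on_inner[OF c(1,2)], rule continuous_on_inner[OF c(1,1)])
		show "\<forall>u\<in>sphere 0 1. A u \<bullet> A u \<noteq> 0"
		proof
			fix u :: 'a assume "u \<in> sphere 0 1"
			hence "u \<noteq> 0" by auto
			from A0[OF this] show "A u \<bullet> A u \<noteq> 0" by simp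
		qed
	qed
	moreover have "sphere (0::'a) 1 \<noteq> {}" by simp
	ultimately have "\<exists>u\<in>sphere 0 1. \<forall>v\<in>sphere 0 1. ?q u \<le> ?q v"
		by (intro continuous_attains_inf compact_sphere)
	then obtain u where u: "u \<in> sphere 0 1" "\<forall>v\<in>sphere 0 1. ?q u \<le> ?q v" by (rule bexE)
	define \<kappa> where "\<kappa> = ?q u"
	have u0: "u \<noteq> 0" using u(1) by auto
	have le: "\<kappa> * (A v \<bullet> A v) \<le> A v \<bullet> B v" for v
	proof (cases "v = 0")
		case True thus ?thesis using linear_0[OF A(1)] by simp
	next
		case False
		let ?v = "v /\<^sub>R norm v"
		have "\<kappa> \<le> ?q ?v" unfolding \<kappa>_def by (rule bspec[OF u(2)]) (use False in simp)
		also have "\<dots> = ?q v" using False by (simp add: linear_scale[OF A(1)] linear_scale[OF B(1)])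
		finally show ?thesis using A0[OF False] by (simp add: pos_le_divide_eq)
	qed
	have eq: "A u \<bullet> B u = \<kappa> * (A u \<bullet> A u)" using A0[OF u0] by (simp add: \<kappa>_def)
	have orth: "A v \<bullet> (B u - \<kappa> *. A u) = 0" for v
	proof (rule ccontr)
		define b where "b = A v \<bullet> (B u - \<kappa> *. A u)"
		define q where "q = A v \<bullet> B v - \<kappa> * (A v \<bullet> A v)"
		assume "A v \<bullet> (B u - \<kappa> *. A u) \<noteq> 0"
		hence b: "b \<noteq> 0" by (simp add: b_def)
		have q: "q \<ge> 0" using le[of v] by (simp add: q_def)
		\<comment> \<open>Minimality at \<open>u\<close> compared with \<open>u + t *. v\<close>: a
		  quadratic polynomial in \<open>t\<close> without constant term is non-negative for all
		  \<open>t\<close>, so its linear coefficient \<open>b\<close> must vanish.\<close>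
		have pos: "0 \<le> 2 * t * b + t * t * q" for t
			using le[of "u + t *. v"] eq sym[of u v]
			by (simp add: b_def q_def linear_add[OF A(1)] linear_add[OF B(1)] linear_scale[OF A(1)] linear_scale[OF B(1)]
					inner_add inner_diff inner_commute algebra_simps)
		\<comment> \<open>At \<open>t = - c\<close> the polynomial has the negative value
		  \<open>- (c * c * (q + 2))\<close>; the summand 1 avoids division by zero.\<close>
		define c where "c = b / (q + 1)"
		have c: "c \<noteq> 0" "b = c * (q + 1)" using b q by (simp_all add: c_def)
		have "0 \<le> 2 * (- c) * b + (- c) * (- c) * q" by (rule pos)
		also have "\<dots> = - (c * c * (q + 2))" unfolding c(2) by (simp add: algebra_simps)
		finally have "c * c * (q + 2) \<le> 0" by simp
		moreover have "c * c * (q + 2) > 0"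
			by (rule mult_pos_pos) (use c(1) q not_sum_squares_lt_zero[of c 0] in \<open>simp_all add: zero_less_mult_iff linorder_neq_iff disj_commute\<close>)
		ultimately show False by simp
	qed
	obtain v where v: "B u - \<kappa> *. A u = A v"
	proof -
		obtain w where "B u = A w" using B(2) by blast
		hence "B u - \<kappa> *. A u = A (w - \<kappa> *. u)" by (simp add: linear_diff[OF A(1)] linear_scale[OF A(1)])
		thus thesis by (rule that)
	qed
	have "A v = 0" using orth[of v] unfolding v by simp
	hence "B u = \<kappa> *. A u" using v by simp
	with u0 le show ?thesis by (intro exI[of _ \<kappa>] exI[of _ u] conjI allI)
qed

text \<open>If only zero occurred, the least eigenvalues of \<open>B\<close> and of
  \<open>- B\<close> would both be zero. The quadratic form would then vanish, by polarization the
  bilinear form too, and with it \<open>B\<close>.\<close>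

lemma ex_nonzero_eigenvalue:
	fixes A B :: "'a::euclidean_space => 'b::euclidean_space"
	assumes A: "linear A" "inj A" and B: "linear B" "range B \<subseteq> range A"
		and sym: "\<And>u v. A u \<bullet> B v = A v \<bullet> B u" and "B w \<noteq> 0"
	shows "\<exists>\<kappa> u. u \<noteq> 0 \<and> \<kappa> \<noteq> 0 \<and> B u = \<kappa> *. A u"
proof (rule ccontr)
	assume no: "\<not> ?thesis"
	from ex_least_eigenvalue[OF A B sym] obtain \<kappa> u
		where 1: "u \<noteq> 0" "B u = \<kappa> *. A u" "\<forall>v. \<kappa> * (A v \<bullet> A v) \<le> A v \<bullet> B v" by (elim exE conjE)
	have nz: "\<kappa> = 0" if "u \<noteq> 0" "B u = \<kappa> *. A u" for \<kappa> u
	proof (rule ccontr)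
		assume "\<kappa> \<noteq> 0"
		with that have "\<exists>\<kappa> u. u \<noteq> 0 \<and> \<kappa> \<noteq> 0 \<and> B u = \<kappa> *. A u"
			by (intro exI[of _ \<kappa>] exI[of _ u] conjI)
		with no show False ..
	qed
	have B': "linear (\<lambda>u. - B u)" "range (\<lambda>u. - B u) \<subseteq> range A"
	proof -
		show "linear (\<lambda>u. - B u)" using linear_compose_neg[OF B(1)] .
		have "- B u \<in> range A" for u
		proof -
			obtain w where "B u = A w" using B(2) by blast
			hence "- B u = A (- w)" using linear_neg[OF A(1)] by simp
			thus ?thesis by simp
		qed
		thus "range (\<lambda>u. - B u) \<subseteq> range A" by blast
	qed
	have "A u \<bullet> - B v = A v \<bullet> - B u" for u v using sym[of u v] by simp
	from ex_least_eigenvalue[OF A B' this] obtain \<kappa>' u'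
		where 2: "u' \<noteq> 0" "- B u' = \<kappa>' *. A u'" "\<forall>v. \<kappa>' * (A v \<bullet> A v) \<le> A v \<bullet> - B v" by (elim exE conjE)
	have "B u' = (- \<kappa>') *. A u'" using arg_cong[OF 2(2), of uminus] by simp
	from nz[OF 2(1) this] nz[OF 1(1,2)] have zero: "A v \<bullet> B v = 0" for v
		using spec[OF 1(3), of v] spec[OF 2(3), of v] by simp
	have orth: "A u \<bullet> B v = 0" for u v
		using zero[of "u + v"] zero[of u] zero[of v] sym[of u v]
		by (simp add: linear_add[OF A(1)] linear_add[OF B(1)] inner_add)
	obtain v where v: "B w = A v" using B(2) by blast
	have "B w \<bullet> B w = 0" using orth[of v w] unfolding v .
	thus False using \<open>B w \<noteq> 0\<close> by simp
qed

lemma (in cr_manifold) unit_deriv_orth: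
	fixes \<nu> :: "'m => 'b::euclidean_space"
	assumes nu: "cr_fun r M \<nu>" and norm_nu: "\<And>x. x \<in> pts M ==> norm (\<nu> x) = 1"
		and c: "c \<in> charts_at M x"
	shows "der c \<nu> x u \<bullet> \<nu> x = 0"
proof -
	note c' = charts_atD[OF c]
	have N: "((\<lambda>y. \<nu> (chart_inv c y)) has_derivative der c \<nu> x) (at (snd c x))"
		by (rule chart_deriv_works[OF nu c])
	have "((\<lambda>y. \<nu> (chart_inv c y) \<bullet> \<nu> (chart_inv c y)) has_derivative
			(\<lambda>u. \<nu> (chart_inv c (snd c x)) \<bullet> der c \<nu> x u + der c \<nu> x u \<bullet> \<nu> (chart_inv c (snd c x)))) (at (snd c x))"
		by (rule has_derivative_inner[OF N N])
	moreover have "((\<lambda>y. \<nu> (chart_inv c y) \<bullet> \<nu> (chart_inv c y)) has_derivative (\<lambda>u. 0)) (at (snd c x))"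
	proof (rule has_derivative_transform_within_open[OF has_derivative_const chart_open[OF c'(1)]])
		show "snd c x \<in> cod c" using c'(2) by (rule imageI)
		fix y assume "y \<in> cod c"
		from norm_nu[OF subsetD[OF chart_subset[OF c'(1)] chart_inv_in[OF this]]]
		show "1 = \<nu> (chart_inv c y) \<bullet> \<nu> (chart_inv c y)" by (simp add: dot_square_norm)
	qed
	ultimately have "(\<lambda>u. \<nu> (chart_inv c (snd c x)) \<bullet> der c \<nu> x u + der c \<nu> x u \<bullet> \<nu> (chart_inv c (snd c x))) = (\<lambda>u. 0)"
		by (rule has_derivative_unique)
	from fun_cong[OF this, of u] show ?thesis using c' by (simp add: inner_commute)
qed

locale hypersurface = cr_manifold r S
	for r :: regularity and S :: "('s, real ^ 'k) mfd" +
	fixes f \<nu> :: "'s => real ^ 'n"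
	assumes card_n: "2 \<le> CARD('n)" and card_k: "CARD('k) = CARD('n) - 1"
		and f: "cr_fun r S f" and nu: "cr_fun r S \<nu>"
		and norm_nu: "x \<in> pts S ==> norm (\<nu> x) = 1"
		and tangent: "c \<in> charts_at S x ==> der c f x u \<bullet> \<nu> x = 0"
		and immersed: "c \<in> charts_at S x ==> der c f x u = 0 ==> u = 0"
begin

lemma df_linear: "c \<in> charts_at S x ==> linear (der c f x)"
	and dnu_linear: "c \<in> charts_at S x ==> linear (der c \<nu> x)"
	by (rule chart_deriv_linear[OF f], assumption) (rule chart_deriv_linear[OF nu])

lemma df_inj: "c \<in> charts_at S x ==> inj (der c f x)"
	by (rule linear_injective_0[OF df_linear, THEN iffD2]) (blast intro: immersed)+

lemma range_df:
	assumes c: "c \<in> charts_at S x"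
	shows "range (der c f x) = {w. w \<bullet> \<nu> x = 0}"
proof (rule subspace_dim_equal)
	have nz: "\<nu> x \<noteq> 0" using norm_nu[OF charts_at_topspace[OF c]] by auto
	show "subspace (range (der c f x))" by (rule linear_subspace_image[OF df_linear[OF c] subspace_UNIV])
	show "subspace {w. w \<bullet> \<nu> x = 0}" by (simp add: subspace_hyperplane2)
	show "range (der c f x) \<subseteq> {w. w \<bullet> \<nu> x = 0}" using tangent[OF c] by blast
	have "dim {w. w \<bullet> \<nu> x = 0} = CARD('n) - 1"
		using dim_hyperplane[OF nz] by (simp add: inner_commute)
	moreover have "dim (range (der c f x)) = CARD('k)"
		using dim_image_eq[OF df_linear[OF c] df_inj[OF c, THEN inj_on_subset, OF subset_UNIV], of UNIV] by simp
	ultimately show "dim {w. w \<bullet> \<nu> x = 0} \<le> dim (range (der c f x))" using card_k by simp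
qed

lemma nu_orth: "c \<in> charts_at S x ==> der c \<nu> x u \<bullet> \<nu> x = 0"
	by (rule unit_deriv_orth[OF nu norm_nu])

lemma range_dnu:
	assumes c: "c \<in> charts_at S x"
	shows "range (der c \<nu> x) \<subseteq> range (der c f x)"
	unfolding range_df[OF c] using nu_orth[OF c] by blast

lemma orth_tangent:
	assumes c: "c \<in> charts_at S x" and w: "\<And>u. der c f x u \<bullet> w = 0"
	shows "w = (w \<bullet> \<nu> x) *. \<nu> x"
proof -
	have n: "\<nu> x \<bullet> \<nu> x = 1" using norm_nu[OF charts_at_topspace[OF c]] by (simp add: dot_square_norm)
	let ?z = "w - (w \<bullet> \<nu> x) *. \<nu> x"
	have "?z \<bullet> \<nu> x = 0" by (simp add: inner_diff_left n)
	hence "?z \<in> range (der c f x)" unfolding range_df[OF c] by simp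
	then obtain u where u: "?z = der c f x u" by (rule rangeE)
	have "?z \<bullet> w = 0" unfolding u by (rule w)
	moreover have "?z \<bullet> \<nu> x = 0" by fact
	ultimately have "?z \<bullet> ?z = 0" by (simp only: inner_diff_right inner_scaleR_right)
	hence "?z = 0" by simp
	thus ?thesis by simp
qed

text \<open>Both sides are minus the second fundamental form.\<close>

lemma shape_symmetric:
	assumes c: "c \<in> charts_at S x"
	shows "der c f x u \<bullet> der c \<nu> x v = der c f x v \<bullet> der c \<nu> x u"
		and "der c f x u \<bullet> der c \<nu> x v = - (Df (\<lambda>z. Df (\<lambda>y. f (chart_inv c y)) z u) (snd c x) v \<bullet> \<nu> x)"
proof -
	note c' = charts_atD[OF c]
	let ?G = "\<lambda>y. f (chart_inv c y)"
	have G: "Ck_on (Suc (Suc 0)) ?G (cod c)" by (rule Cr_on_imp_Ck[OF cr_fun_Cr_on[OF f c'(1)]])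
	have y: "snd c x \<in> cod c" using c'(2) by (rule imageI)
	have orth: "Df ?G z u \<bullet> \<nu> (chart_inv c z) = 0" if z: "z \<in> cod c" for z u
	proof -
		have d: "c \<in> charts_at S (chart_inv c z)" using chart_inv_in[OF z] c'(1) by (simp add: charts_at_def)
		from tangent[OF d, of u] show ?thesis unfolding chart_deriv_def chart_inv_right[OF z] o_def .
	qed
	have D: "Df ?G (snd c x) = der c f x" by (simp add: chart_deriv_def o_def)
	have N: "\<nu> (chart_inv c (snd c x)) = \<nu> x" using c' by simp
	note s = second_form_symmetric[OF chart_open[OF c'(1)] y G chart_deriv_works[OF nu c] orth, unfolded D N]
	show "der c f x u \<bullet> der c \<nu> x v = der c f x v \<bullet> der c \<nu> x u" by (rule s(2))
	show "der c f x u \<bullet> der c \<nu> x v = - (Df (\<lambda>z. Df ?G z u) (snd c x) v \<bullet> \<nu> x)"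
		by (rule s(1))
qed

lemma ex_nonzero_principal:
	assumes c: "c \<in> charts_at S x" and w: "der c \<nu> x w \<noteq> 0"
	shows "\<exists>\<kappa> u. u \<noteq> 0 \<and> \<kappa> \<noteq> 0 \<and> der c \<nu> x u = \<kappa> *. der c f x u"
	by (rule ex_nonzero_eigenvalue[OF df_linear[OF c] df_inj[OF c] dnu_linear[OF c] range_dnu[OF c] shape_symmetric(1)[OF c] w])

lemma deriv_continuous:
	fixes G :: "'s => 'b::euclidean_space"
	assumes G: "cr_fun r S G" and c: "c \<in> charts S"
	shows "continuous_on ((cod c) \<times> UNIV) (\<lambda>(y, u). der c G (chart_inv c y) u)"
proof -
	let ?V = "cod c"
	have D: "der c G (chart_inv c y) = Df (\<lambda>y. G (chart_inv c y)) y" if "y \<in> ?V" for y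
		by (simp add: chart_deriv_def chart_inv_right[OF that] o_def)
	have lin: "linear (der c G (chart_inv c y))" if y: "y \<in> ?V" for y
		by (rule chart_deriv_linear[OF G]) (use chart_inv_in[OF y] c in \<open>simp add: charts_at_def\<close>)
	have cont: "continuous_on ?V (\<lambda>y. der c G (chart_inv c y) u)" for u
	proof -
		have "continuous_on ?V (\<lambda>y. Df (\<lambda>y. G (chart_inv c y)) y u)"
			by (rule Cr_on_derivative_continuous[OF cr_fun_Cr_on[OF G c]])
		thus ?thesis by (rule continuous_on_eq) (simp add: D)
	qed
	have "continuous_on (?V \<times> UNIV) (\<lambda>z. \<Sum>i\<in>Basis. (snd z \<bullet> i) *. der c G (chart_inv c (fst z)) i)"
	proof (intro continuous_on_sum continuous_on_scaleR continuous_on_inner continuous_on_snd continuous_on_const continuous_on_id)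
		fix i :: "real ^ 'k"
		show "continuous_on (?V \<times> UNIV) (\<lambda>z. der c G (chart_inv c (fst z)) i)"
			by (rule continuous_on_compose2[OF cont continuous_on_fst[OF continuous_on_id]]) auto
	qed
	thus ?thesis
	proof (rule continuous_on_eq)
		fix z assume "z \<in> ?V \<times> (UNIV :: (real ^ 'k) set)"
		hence "fst z \<in> ?V" by auto
		from linear_euclidean_expand[OF lin[OF this], of "snd z"]
		show "(\<Sum>i\<in>Basis. (snd z \<bullet> i) *. der c G (chart_inv c (fst z)) i) = (case z of (y, u) => der c G (chart_inv c y) u)"
			by (simp add: case_prod_beta)
	qed
qed

text \<open>The points having some non-zero principal curvature. In a regular slice this set will be
  identified with the projected singular set, which is compact, so that it is closed as
  well.\<close>

lemma curved_openin:
	"openin (mtop S) {x \<in> pts S. \<exists>c\<in>charts_at S x. \<exists>u. der c \<nu> x u \<noteq> 0}" (is "openin _ ?W")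
proof (subst openin_subopen, rule ballI)
	fix x assume "x \<in> ?W"
	then obtain c u where c: "c \<in> charts_at S x" and u: "der c \<nu> x u \<noteq> 0" by blast
	note c' = charts_atD[OF c]
	let ?V = "cod c" and ?g = "\<lambda>y. der c \<nu> (chart_inv c y) u"
	have "continuous_on ?V ?g"
	proof -
		have "continuous_on ?V (\<lambda>y. (\<lambda>(y, u). der c \<nu> (chart_inv c y) u) (y, u))"
			by (rule continuous_on_compose2[OF deriv_continuous[OF nu c'(1)]]) (auto intro!: continuous_intros)
		thus ?thesis by simp
	qed
	hence oV: "open (?V \<inter> ?g -` (- {0}))"
		by (rule continuous_open_preimage[OF _ chart_open[OF c'(1)]]) auto
	let ?T = "{p \<in> fst c. snd c p \<in> ?V \<inter> ?g -` (- {0})}"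
	have "openin (mtop S) ?T" by (rule chart_preimage_openin[OF c'(1) oV])
	moreover have "x \<in> ?T" using c' u by auto
	moreover have "?T \<subseteq> ?W"
	proof
		fix p assume p: "p \<in> ?T"
		hence pc: "p \<in> fst c" and ne: "der c \<nu> (chart_inv c (snd c p)) u \<noteq> 0" by simp_all
		have "der c \<nu> p u \<noteq> 0" using ne chart_inv_left[OF c'(1) pc] by simp
		moreover have "c \<in> charts_at S p" using pc c'(1) by (simp add: charts_at_def)
		ultimately show "p \<in> ?W" using charts_at_topspace by blast
	qed
	ultimately show "\<exists>T. openin (mtop S) T \<and> x \<in> T \<and> T \<subseteq> ?W" by (intro exI[of _ ?T] conjI)
qed

lemma critical_point:
	fixes h :: "'s => real"
	assumes c: "c \<in> charts_at S x" and h: "cr_fun r S h" and max: "\<And>y. y \<in> pts S ==> h y \<le> h x"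
	shows "der c h x u = 0"
proof -
	note c' = charts_atD[OF c]
	have "der c h x = (\<lambda>v. 0)"
	proof (rule differential_zero_maxmin[OF _ chart_open[OF c'(1)] chart_deriv_works[OF h c]])
		show "snd c x \<in> cod c" using c'(2) by (rule imageI)
		have "h (chart_inv c y) \<le> h (chart_inv c (snd c x))" if y: "y \<in> cod c" for y
			using max[OF subsetD[OF chart_subset[OF c'(1)] chart_inv_in[OF y]]] c' by simp
		thus "(\<forall>y\<in>cod c. h (chart_inv c y) \<le> h (chart_inv c (snd c x))) \<or>
				(\<forall>y\<in>cod c. h (chart_inv c (snd c x)) \<le> h (chart_inv c y))" by blast
	qed
	from fun_cong[OF this] show ?thesis .
qed

lemma height_cr: "cr_fun r S (\<lambda>x. f x \<bullet> a)"
	by (rule cr_fun_linear[OF f bounded_linear_inner_left])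

lemma height_deriv:
	assumes c: "c \<in> charts_at S x"
	shows "der c (\<lambda>x. f x \<bullet> a) x u = der c f x u \<bullet> a"
	using chart_deriv_eqI[of "\<lambda>x. f x \<bullet> a" c _ x, OF has_derivative_inner_left[OF chart_deriv_works[OF f c]]] by simp

lemma height_critical:
	assumes x: "x \<in> pts S" and max: "\<And>y. y \<in> pts S ==> f y \<bullet> a \<le> f x \<bullet> a"
	shows "a = (a \<bullet> \<nu> x) *. \<nu> x"
proof -
	obtain c where c: "c \<in> charts_at S x" using ex_chart[OF x] by blast
	show ?thesis
	proof (rule orth_tangent[OF c])
		fix u show "der c f x u \<bullet> a = 0"
			using critical_point[OF c height_cr max, of u] unfolding height_deriv[OF c] .
	qed
qed

end

section \<open>Singular points on null lines and the geometry of a slice\<close>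

context null_front
begin

text \<open>In terms of dT and dP, the spatial part of dF is \<open>fst w + T p *. snd w\<close>
  plus a multiple of \<nu>, where \<open>w\<close> is the value of dP. Its kernel is thus decided by
  \<open>Rg\<close> and the time; along a null line only the time varies.\<close>

lemma singular_iff:
	assumes p: "p \<in> pts M"
	shows "p \<in> singular_set M F \<longleftrightarrow> (\<exists>w\<in>Rg p. w \<noteq> 0 \<and> fst w + T p *. snd w = 0)"
proof -
	obtain c where c: "c \<in> charts_at M p" using ex_chart[OF p] by blast
	obtain X where X: "der c T p X = 1" "der c P p X = 0"
		"\<And>u. der c P p u = 0 ==> u = der c T p u *. X"
		by (rule ex_null_vector[OF c]) (rule that)
	note linT = chart_deriv_linear[OF cr_T c] and linP = chart_deriv_linear[OF cr_P c]
	have dF: "der c F p u = (der c T p u, fst (der c P p u) + T p *. snd (der c P p u) + der c T p u *. \<nu> p)" for u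
		by (simp add: prod_eq_iff T_deriv[OF c] P_deriv[OF c])
	have "p \<in> singular_set M F \<longleftrightarrow> \<not> inj (der c F p)"
		using p immersion_at_flat_iff[OF F c] by (simp add: singular_set_def)
	also have "\<dots> \<longleftrightarrow> (\<exists>u. der c F p u = 0 \<and> u \<noteq> 0)"
		using linear_injective_0[OF chart_deriv_linear[OF F c]] by blast
	also have "\<dots> \<longleftrightarrow> (\<exists>w\<in>Rg p. w \<noteq> 0 \<and> fst w + T p *. snd w = 0)"
	proof
		assume "\<exists>u. der c F p u = 0 \<and> u \<noteq> 0"
		then obtain u where u: "der c F p u = 0" "u \<noteq> 0" by (elim exE conjE)
		let ?w = "der c P p u"
		have 1: "der c T p u = 0" "fst ?w + T p *. snd ?w = 0"
		proof -
			note eq = u(1)[unfolded dF zero_prod_def prod.inject]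
			show 0: "der c T p u = 0" by (rule conjunct1[OF eq])
			show "fst ?w + T p *. snd ?w = 0" using conjunct2[OF eq] unfolding 0 scaleR_zero_left add_0_right .
		qed
		have "?w \<noteq> 0" using X(3)[of u] u(2) 1(1) by auto
		moreover have "?w \<in> Rg p" unfolding Rg_chart[OF c] by (rule rangeI)
		ultimately show "\<exists>w\<in>Rg p. w \<noteq> 0 \<and> fst w + T p *. snd w = 0" using 1(2) by (intro bexI[of _ ?w] conjI)
	next
		assume "\<exists>w\<in>Rg p. w \<noteq> 0 \<and> fst w + T p *. snd w = 0"
		then obtain w where w: "w \<in> Rg p" "w \<noteq> 0" "fst w + T p *. snd w = 0" by (elim bexE conjE)
		obtain u where u: "w = der c P p u" using w(1) unfolding Rg_chart[OF c] by (rule rangeE)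
		let ?v = "u - der c T p u *. X"
		have v: "der c P p ?v = w" "der c T p ?v = 0"
			by (simp_all add: linear_diff[OF linP] linear_scale[OF linP] linear_diff[OF linT] linear_scale[OF linT] X u)
		have "der c F p ?v = 0" unfolding dF v using w(3) by (simp add: zero_prod_def)
		moreover have "?v \<noteq> 0" using v(1) w(2) linear_0[OF linP] by force
		ultimately show "\<exists>u. der c F p u = 0 \<and> u \<noteq> 0" by (intro exI[of _ ?v] conjI)
	qed
	finally show ?thesis .
qed

lemma Rg_orth:
	assumes w: "w \<in> Rg p"
	shows "fst w \<bullet> \<nu> p = 0" "snd w \<bullet> \<nu> p = 0"
proof -
	obtain c u where c: "c \<in> charts_at M p" and u: "w = der c P p u" using w unfolding Rg_def by blast
	have n: "\<nu> p \<bullet> \<nu> p = 1" using norm_nu[OF charts_at_topspace[OF c]] by (simp add: dot_square_norm)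
	have o: "der c \<nu> p u \<bullet> \<nu> p = 0" by (rule unit_deriv_orth[OF nu norm_nu c])
	show "fst w \<bullet> \<nu> p = 0" "snd w \<bullet> \<nu> p = 0"
		using contact[OF c, of u] unfolding u P_deriv[OF c] fst_conv snd_conv inner_diff_left inner_scaleR_left n o
		by (simp_all only: inner_commute[of "\<nu> p"] mult_zero_right mult_1_right diff_self diff_0_right)
qed

text \<open>In a slice chart Q o P is the identity, so Q inverts the derivative of P on the left.
  The range lies in \<open>Rg x\<close> because the chart inverse factors through a chart of
  \<open>M\<close>, and fills it because Q is injective on \<open>Rg x\<close>.\<close>

lemma slice_P_deriv:
	assumes d: "d \<in> charts_at (slice a) x"
	shows "range (der d P x) = Rg x" "inj (der d P x)"
proof -
	interpret sl: cr_manifold r "slice a" by (rule slice_cr_manifold)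
	obtain U \<psi> where dU: "d = (U, \<psi>)" by (cases d)
	have U: "(U, \<psi>) \<in> charts (slice a)" and x: "x \<in> U" using d unfolding dU charts_at_def by auto
	obtain Q where inj: "inj_on \<psi> U" and Q: "linear Q" "\<psi> = (\<lambda>p. Q (P p))" "\<forall>p\<in>U. transversal Q p" and Us: "U \<subseteq> slc a"
		by (rule slice_chartE[OF U]) (rule that)
	let ?D = "der d P x"
	have crP: "cr_fun r (slice a) P" by (rule slice_cr_fun[OF cr_P])
	have D: "((\<lambda>y. P (chart_inv d y)) has_derivative ?D) (at (\<psi> x))"
		using sl.chart_deriv_works[OF crP d] unfolding dU by simp
	have o: "open (\<psi> ` U)" by (rule slice_fun(1)[OF U cr_T])
	have yx: "\<psi> x \<in> \<psi> ` U" using x by (rule imageI)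
	have inv: "chart_inv d y = inv_into U \<psi> y" for y by (simp add: chart_inv_def dU)
	have QD: "Q (?D u) = u" for u
	proof -
		have bl: "bounded_linear Q" using Q(1) by (simp add: linear_conv_bounded_linear)
		have "((\<lambda>y. y) has_derivative (\<lambda>u. Q (?D u))) (at (\<psi> x))"
		proof (rule has_derivative_transform_within_open[OF bounded_linear.has_derivative[OF bl D] o yx])
			fix y assume "y \<in> \<psi> ` U"
			from f_inv_into_f[OF this] show "Q (P (chart_inv d y)) = y" unfolding inv Q(2) .
		qed
		from has_derivative_unique[OF this has_derivative_ident] show ?thesis by (rule fun_cong)
	qed
	show "inj ?D" by (rule inj_on_inverseI) (rule QD)
	have xs: "x \<in> slc a" using x Us by blast
	have xM: "x \<in> pts M" by (rule slc_topspace[OF xs])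
	obtain c where c: "c \<in> charts_at M x" using ex_chart[OF xM] by blast
	note c' = charts_atD[OF c]
	define h where "h = (crd Q c)"
	note tc = tube_coord[OF U Q c'(1), folded h_def] and ti = tube_inverse[OF U Q c'(1), folded h_def]
	define g where "g = (\<lambda>y. inv_into (tube a U c) h (a, y))"
	have ax: "(a, \<psi> x) \<in> h ` tube a U c"
		unfolding ti(1) using x c'(2) inv_into_f_f[OF inj x] xM by simp
	have oW: "open {y. (a, y) \<in> h ` tube a U c}"
	proof -
		have "continuous_on UNIV (\<lambda>y :: real ^ 'k. (a, y))" by (intro continuous_on_Pair continuous_on_const continuous_on_id)
		from open_vimage[OF tc(5) this] show ?thesis unfolding vimage_def .
	qed
	have gP: "chart_inv c (g y) = chart_inv d y" if y: "(a, y) \<in> h ` tube a U c" for y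
	proof -
		have "y \<in> \<psi> ` U" using y unfolding ti(1) by (rule conjunct1)
		hence "inv_into U \<psi> y \<in> pts M" by (rule slc_topspace[OF subsetD[OF Us inv_into_into]])
		from flow_0[OF this] show ?thesis using ti(2)[OF y] unfolding g_def inv diff_self by (rule trans[rotated])
	qed
	have gx: "g (\<psi> x) = snd c x"
	proof -
		have "g (\<psi> x) \<in> cod c" unfolding g_def by (rule subsetD[OF tc(2) inv_into_into[OF ax]])
		from chart_inv_right[OF this] gP[OF ax] show ?thesis using inv_into_f_f[OF inj x] by (simp add: inv)
	qed
	have "((\<lambda>y. inv_into (tube a U c) h (a, y)) has_derivative
			(\<lambda>u. Df (inv_into (tube a U c) h) (a, \<psi> x) (0, u))) (at (\<psi> x))"
		by (rule has_derivative_compose[OF has_derivative_Pair[OF has_derivative_const has_derivative_ident] Cr_on_has_derivative[OF tc(6) ax]])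
	hence dg: "(g has_derivative (\<lambda>u. Df (inv_into (tube a U c) h) (a, \<psi> x) (0, u))) (at (\<psi> x))"
		unfolding g_def .
	have "((\<lambda>y. P (chart_inv c (g y))) has_derivative (\<lambda>u. der c P x (Df (inv_into (tube a U c) h) (a, \<psi> x) (0, u)))) (at (\<psi> x))"
	proof (rule has_derivative_compose[OF dg, of "\<lambda>y. P (chart_inv c y)"])
		show "((\<lambda>y. P (chart_inv c y)) has_derivative der c P x) (at (g (\<psi> x)))"
			unfolding gx by (rule chart_deriv_works[OF cr_P c])
	qed
	hence "((\<lambda>y. P (chart_inv d y)) has_derivative (\<lambda>u. der c P x (Df (inv_into (tube a U c) h) (a, \<psi> x) (0, u)))) (at (\<psi> x))"
	proof (rule has_derivative_transform_within_open[OF _ oW])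
		show "\<psi> x \<in> {y. (a, y) \<in> h ` tube a U c}" using ax by (rule CollectI)
		fix y assume "y \<in> {y. (a, y) \<in> h ` tube a U c}"
		hence "(a, y) \<in> h ` tube a U c" by (rule CollectD)
		from gP[OF this] show "P (chart_inv c (g y)) = P (chart_inv d y)" by (rule arg_cong)
	qed
	from has_derivative_unique[OF D this]
	have "?D = (\<lambda>u. der c P x (Df (inv_into (tube a U c) h) (a, \<psi> x) (0, u)))" .
	from fun_cong[OF this] have sub: "?D u \<in> Rg x" for u
		unfolding Rg_chart[OF c] by (rule range_eqI)
	have "w = ?D (Q w)" if w: "w \<in> Rg x" for w
	proof -
		have "subspace (Rg x)" unfolding Rg_chart[OF c]
			by (rule linear_subspace_image[OF chart_deriv_linear[OF cr_P c] subspace_UNIV])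
		from subspace_diff[OF this w sub[of "Q w"]] have "w - ?D (Q w) \<in> Rg x" .
		moreover have "Q (w - ?D (Q w)) = 0" using linear_diff[OF Q(1), of w] QD by simp
		ultimately have "w - ?D (Q w) = 0" using Q(3)[rule_format, OF x] by blast
		thus ?thesis by simp
	qed
	thus "range ?D = Rg x" using sub by blast
qed

lemma slice_deriv:
	assumes d: "d \<in> charts_at (slice a) x"
	shows "der d (\<lambda>p. snd (F p)) x u = fst (der d P x u) + a *. snd (der d P x u)"
		and "der d \<nu> x u = snd (der d P x u)"
proof -
	interpret sl: cr_manifold r "slice a" by (rule slice_cr_manifold)
	have D: "((\<lambda>y. P (chart_inv d y)) has_derivative der d P x) (at (snd d x))"
		by (rule sl.chart_deriv_works[OF slice_cr_fun[OF cr_P] d])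
	have d': "d \<in> charts (slice a)" "x \<in> fst d" using sl.charts_atD[OF d] by blast+
	have "((\<lambda>y. \<nu> (chart_inv d y)) has_derivative (\<lambda>u. snd (der d P x u))) (at (snd d x))"
		using has_derivative_snd[OF D] by (simp add: P_def)
	from sl.chart_deriv_eqI[of \<nu> d _ x, OF this] show "der d \<nu> x u = snd (der d P x u)" by (rule fun_cong)
	have "((\<lambda>y. fst (P (chart_inv d y)) + a *. snd (P (chart_inv d y))) has_derivative
			(\<lambda>u. fst (der d P x u) + a *. snd (der d P x u))) (at (snd d x))"
		by (intro has_derivative_add has_derivative_scaleR_right has_derivative_fst has_derivative_snd D)
	hence "((\<lambda>y. snd (F (chart_inv d y))) has_derivative
			(\<lambda>u. fst (der d P x u) + a *. snd (der d P x u))) (at (snd d x))"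
	proof (rule has_derivative_transform_within_open[OF _ sl.chart_open[OF d'(1)]])
		show "snd d x \<in> cod d" using d'(2) by (rule imageI)
		fix y assume y: "y \<in> cod d"
		have "chart_inv d y \<in> slc a"
			using sl.chart_inv_in[OF y] sl.chart_subset[OF d'(1)] unfolding slice_topspace by blast
		from slc_T[OF this] show "fst (P (chart_inv d y)) + a *. snd (P (chart_inv d y)) = snd (F (chart_inv d y))"
			by (simp add: P_def)
	qed
	from sl.chart_deriv_eqI[of "\<lambda>p. snd (F p)" d _ x, OF this]
	show "der d (\<lambda>p. snd (F p)) x u = fst (der d P x u) + a *. snd (der d P x u)" by (rule fun_cong)
qed

lemma slice_hypersurface:
	assumes reg: "slc a \<inter> singular_set M F = {}"
	shows "hypersurface r (slice a) (\<lambda>p. snd (F p)) \<nu>"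
proof -
	interpret sl: cr_manifold r "slice a" by (rule slice_cr_manifold)
	show ?thesis
	proof (rule hypersurface.intro[OF slice_cr_manifold hypersurface_axioms.intro])
		show "2 \<le> CARD('n)" "CARD('k) = CARD('n) - 1" by (rule card_n, rule card_k)
		show "cr_fun r (slice a) (\<lambda>p. snd (F p))" by (rule slice_cr_fun[OF cr_fun_linear[OF F bounded_linear_snd]])
		show "cr_fun r (slice a) \<nu>" by (rule slice_cr_fun[OF nu])
		show "norm (\<nu> x) = 1" if "x \<in> topspace (mtop (slice a))" for x
			using that norm_nu slc_topspace unfolding slice_topspace by blast
		fix d x u assume d: "d \<in> charts_at (slice a) x"
		have w: "der d P x u \<in> Rg x" using slice_P_deriv(1)[OF d] by blast
		show "der d (\<lambda>p. snd (F p)) x u \<bullet> \<nu> x = 0"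
			unfolding slice_deriv(1)[OF d] using Rg_orth[OF w] by (simp add: inner_add_left)
		assume z: "der d (\<lambda>p. snd (F p)) x u = 0"
		have x: "x \<in> slc a" using sl.charts_at_topspace[OF d] unfolding slice_topspace .
		have "der d P x u = 0"
		proof (rule ccontr)
			assume nz: "der d P x u \<noteq> 0"
			have "x \<in> singular_set M F"
				unfolding singular_iff[OF slc_topspace[OF x]]
				by (rule bexI[OF _ w]) (use nz z in \<open>simp add: slice_deriv(1)[OF d] slc_T[OF x]\<close>)
			with x reg show False by blast
		qed
		moreover have "linear (der d P x)" by (rule sl.chart_deriv_linear[OF slice_cr_fun[OF cr_P] d])
		ultimately show "u = 0" using slice_P_deriv(2)[OF d] linear_injective_0 by blast
	qed
qed

text \<open>The singular points on the null line through \<open>x\<close> are at the distances \<open>- 1 / \<kappa>\<close>.\<close>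

lemma principal_singular:
	assumes d: "d \<in> charts_at (slice a) x" and u: "u \<noteq> 0" and \<kappa>: "\<kappa> \<noteq> 0"
		and eig: "der d \<nu> x u = \<kappa> *. der d (\<lambda>p. snd (F p)) x u"
	shows "flow x (- 1 / \<kappa>) \<in> singular_set M F"
proof -
	interpret sl: cr_manifold r "slice a" by (rule slice_cr_manifold)
	let ?w = "der d P x u"
	have x: "x \<in> slc a" using sl.charts_at_topspace[OF d] unfolding slice_topspace .
	note xM = slc_topspace[OF x]
	have "linear (der d P x)" by (rule sl.chart_deriv_linear[OF slice_cr_fun[OF cr_P] d])
	hence w0: "?w \<noteq> 0" using u slice_P_deriv(2)[OF d] linear_injective_0 by blast
	have w: "?w \<in> Rg (flow x (- 1 / \<kappa>))" using slice_P_deriv(1)[OF d] Rg_flow[OF xM] by blast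
	\<comment> \<open>Here \<kappa> is an eigenvalue of d\<nu> relative to df, the negative of a
	  principal curvature; at time \<open>a - 1 / \<kappa>\<close> the moving slice becomes singular in
	  the direction of \<open>?w\<close>.\<close>
	have "fst ?w + (a - 1 / \<kappa>) *. snd ?w = 0"
	proof -
		have "snd ?w = \<kappa> *. (fst ?w + a *. snd ?w)" using eig unfolding slice_deriv[OF d] .
		hence "(1 / \<kappa>) *. snd ?w = (1 / \<kappa>) *. (\<kappa> *. (fst ?w + a *. snd ?w))" by (rule arg_cong)
		also have "\<dots> = fst ?w + a *. snd ?w" using \<kappa> by simp
		finally show ?thesis by (simp add: scaleR_diff_left)
	qed
	thus ?thesis
		unfolding singular_iff[OF flow_topspace[OF xM]]
		by (intro bexI[OF _ w] conjI w0) (simp add: flow_T[OF xM] slc_T[OF x])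
qed

text \<open>The projected singular set consists of the points of the slice with d\<nu> non-zero: a
  non-zero eigenvalue yields a singular point on the line, and a singular \<open>w\<close> has
  \<open>snd w\<close> non-zero. Being open, compact and non-empty, it is the whole connected
  slice.\<close>

lemma slc_eq_proj_singular:
	assumes reg: "slc a \<inter> singular_set M F = {}" and ne: "singular_set M F \<noteq> {}"
		and comp: "compactin (mtop M) (singular_set M F)"
	shows "slc a = proj a ` singular_set M F"
proof -
	interpret h: hypersurface r "slice a" "\<lambda>p. snd (F p)" \<nu> by (rule slice_hypersurface[OF reg])
	let ?W = "{x \<in> topspace (mtop (slice a)). \<exists>c\<in>charts_at (slice a) x. \<exists>u. der c \<nu> x u \<noteq> 0}"
	have W: "?W = proj a ` singular_set M F"
	proof (intro equalityI subsetI)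
		fix x assume "x \<in> ?W"
		then obtain d u where "x \<in> topspace (mtop (slice a))" and d: "d \<in> charts_at (slice a) x" and u: "der d \<nu> x u \<noteq> 0"
			by (elim CollectE conjE bexE exE)
		hence x: "x \<in> slc a" unfolding slice_topspace by simp
		from h.ex_nonzero_principal[OF d u] obtain \<kappa> v where v: "v \<noteq> 0" "\<kappa> \<noteq> 0"
			"der d \<nu> x v = \<kappa> *. der d (\<lambda>p. snd (F p)) x v" by (elim exE conjE)
		have "x = proj a (flow x (- 1 / \<kappa>))" using proj_flow[OF slc_topspace[OF x]] proj_id[OF x] by simp
		with principal_singular[OF d v] show "x \<in> proj a ` singular_set M F" by (intro image_eqI)
	next
		fix x assume "x \<in> proj a ` singular_set M F"
		then obtain p where p: "p \<in> singular_set M F" and x: "x = proj a p" by blast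
		have pM: "p \<in> pts M" using p by (simp add: singular_set_def)
		from p[unfolded singular_iff[OF pM]] obtain w where w: "w \<in> Rg p" "w \<noteq> 0" "fst w + T p *. snd w = 0"
			by (elim bexE conjE)
		have xs: "x \<in> topspace (mtop (slice a))" unfolding x slice_topspace by (rule proj_slc[OF pM])
		obtain d where d: "d \<in> charts_at (slice a) x" using h.ex_chart[OF xs] by blast
		have "w \<in> range (der d P x)" unfolding slice_P_deriv(1)[OF d] unfolding x proj_Rg[OF pM] by (rule w(1))
		then obtain u where u: "w = der d P x u" by (rule rangeE)
		have "snd w \<noteq> 0"
		proof
			assume s: "snd w = 0"
			with w(3) have "fst w = 0" by simp
			with s w(2) show False by (simp add: prod_eq_iff)
		qed
		hence "der d \<nu> x u \<noteq> 0" unfolding slice_deriv(2)[OF d] u .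
		with xs d show "x \<in> ?W" by (intro CollectI conjI bexI[of _ d] exI[of _ u])
	qed
	have "compactin (mtop M) (proj a ` singular_set M F)" by (rule image_compactin[OF comp proj_continuous])
	hence "closedin (mtop M) (proj a ` singular_set M F)" by (rule compactin_imp_closedin[OF hausdorff])
	moreover have "proj a ` singular_set M F \<subseteq> slc a" unfolding W[symmetric] slice_topspace by blast
	ultimately have "closedin (subtopology (mtop M) (slc a)) (proj a ` singular_set M F)"
		by (rule closedin_subset_topspace)
	moreover have "mtop (slice a) = subtopology (mtop M) (slc a)" by (simp add: slice_def)
	ultimately have "closedin (mtop (slice a)) ?W" unfolding W by (simp only:)
	from spec[OF h.connected[unfolded connected_space_clopen_in], THEN mp, OF conjI[OF h.curved_openin this]]
	have "?W = {} \<or> ?W = topspace (mtop (slice a))" .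
	hence "proj a ` singular_set M F = {} \<or> proj a ` singular_set M F = slc a"
		unfolding W unfolding slice_topspace .
	with ne show ?thesis by simp
qed

lemma singular_time_bounded:
	assumes comp: "compactin (mtop M) (singular_set M F)"
	shows "\<exists>R. \<forall>p\<in>singular_set M F. \<bar>T p\<bar> \<le> R"
proof -
	have "compactin euclidean (T ` singular_set M F)"
		by (rule image_compactin[OF comp cr_fun_continuous[OF cr_T]])
	hence "bounded (T ` singular_set M F)" by (simp add: compact_imp_bounded)
	thus ?thesis unfolding bounded_iff by simp
qed

text \<open>If the slice at time 0 is not regular, a time beyond all singular points is
  taken.\<close>

lemma ex_regular_slice:
	assumes comp: "compactin (mtop M) (singular_set M F)"
	shows "\<exists>a. ((\<forall>p\<in>pts M. T p = 0 --> p \<notin> singular_set M F) --> a = 0) \<and> slc a \<inter> singular_set M F = {}"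
proof (cases "\<forall>p\<in>pts M. T p = 0 --> p \<notin> singular_set M F")
	case True
	thus ?thesis by (intro exI[of _ 0]) (auto simp: slc_def)
next
	case False
	from singular_time_bounded[OF comp] obtain R where R: "\<forall>p\<in>singular_set M F. \<bar>T p\<bar> \<le> R" by (rule exE)
	have "slc (R + 1) \<inter> singular_set M F = {}" using R by (force simp: slc_def)
	with False show ?thesis by (intro exI[of _ "R + 1"] conjI impI) (rule notE)
qed

text \<open>Each non-zero eigenvalue \<kappa> produces a singular point at time
  \<open>a - 1 / \<kappa>\<close>; a bound \<open>R\<close> for singular times bounds the reciprocal
  of \<kappa>. The summand 1 in \<open>B\<close> keeps it positive.\<close>

lemma principal_gap:
	assumes comp: "compactin (mtop M) (singular_set M F)"
	shows "\<exists>\<kappa>0>0. \<forall>x. \<forall>d\<in>charts_at (slice a) x. \<forall>u \<kappa>. u \<noteq> 0 --> \<kappa> \<noteq> 0 -->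
		der d \<nu> x u = \<kappa> *. der d (\<lambda>p. snd (F p)) x u --> \<kappa>0 \<le> \<bar>\<kappa>\<bar>"
proof -
	interpret sl: cr_manifold r "slice a" by (rule slice_cr_manifold)
	from singular_time_bounded[OF comp] obtain R where R: "\<forall>p\<in>singular_set M F. \<bar>T p\<bar> \<le> R" by (rule exE)
	define B where "B = \<bar>R\<bar> + \<bar>a\<bar> + 1"
	have B: "B > 0" by (simp add: B_def)
	have "1 / B \<le> \<bar>\<kappa>\<bar>" if d: "d \<in> charts_at (slice a) x" and u: "u \<noteq> 0" and \<kappa>: "\<kappa> \<noteq> 0"
		and eig: "der d \<nu> x u = \<kappa> *. der d (\<lambda>p. snd (F p)) x u" for x d u \<kappa>
	proof -
		have x: "x \<in> slc a" using sl.charts_at_topspace[OF d] unfolding slice_topspace .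
		from bspec[OF R principal_singular[OF d u \<kappa> eig]] have "\<bar>a - 1 / \<kappa>\<bar> \<le> R"
			by (simp add: flow_T[OF slc_topspace[OF x]] slc_T[OF x])
		hence "\<bar>1 / \<kappa>\<bar> \<le> B" unfolding B_def by linarith
		thus ?thesis using B \<kappa> by (simp add: field_simps)
	qed
	with B show ?thesis by (intro exI[of _ "1 / B"] conjI allI ballI impI) simp_all
qed

end

section \<open>Definiteness of the second fundamental form\<close>

lemma farthest_point_derivatives:
	fixes G :: "'a::euclidean_space => 'b::euclidean_space"
	assumes V: "open V" "y \<in> V" and G: "Ck_on (Suc (Suc 0)) G V"
		and max: "\<And>z. z \<in> V ==> G z \<bullet> G z \<le> G y \<bullet> G y"
	shows "Df G y u \<bullet> G y = 0"
		and "Df G y u \<bullet> Df G y u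
			+ Df (\<lambda>z. Df G z u) y u \<bullet> G y \<le> 0"
proof -
	let ?D = "\<lambda>z. Df G z"
	let ?E = "Df (\<lambda>z. ?D z u) y"
	have D: "(G has_derivative ?D z) (at z)" if "z \<in> V" for z by (rule Ck_on_SucE[OF G that])
	have C1: "Ck_on (Suc 0) (\<lambda>z. ?D z u) V" using G unfolding Ck_on.simps(2)[of "Suc 0"] by (elim conjE allE)
	have E: "((\<lambda>z. ?D z u) has_derivative ?E) (at y)" by (rule Ck_on_SucE[OF C1 V(2)])
	have der: "((\<lambda>z. G z \<bullet> G z) has_derivative (\<lambda>u. G y \<bullet> ?D y u + ?D y u \<bullet> G y)) (at y)"
		by (rule has_derivative_inner[OF D[OF V(2)] D[OF V(2)]])
	have "(\<lambda>u. G y \<bullet> ?D y u + ?D y u \<bullet> G y) = (\<lambda>v. 0)"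
		by (rule differential_zero_maxmin[OF V(2,1) der]) (intro disjI1 ballI max)
	from fun_cong[OF this, of u] show orth: "?D y u \<bullet> G y = 0" by (simp add: inner_commute)
	show "?D y u \<bullet> ?D y u + ?E u \<bullet> G y \<le> 0"
	proof (rule ccontr)
		assume neg: "\<not> ?D y u \<bullet> ?D y u + ?E u \<bullet> G y \<le> 0"
		have aff: "((\<lambda>t. y + t *. u) has_derivative (\<lambda>h. h *. u)) (at t)" for t
			by (rule derivative_eq_intros | simp)+
		\<comment> \<open>The squared distance along a line and half its derivative. If the derivative of
		  \<open>?\<psi>\<close> at 0 were positive, \<open>?\<psi>\<close> would be positive just after 0
		  and \<open>?\<phi>\<close> would exceed its maximum there.\<close>
		let ?\<phi> = "\<lambda>t. G (y + t *. u) \<bullet> G (y + t *. u)"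
		let ?\<psi> = "\<lambda>t. ?D (y + t *. u) u \<bullet> G (y + t *. u)"
		have d\<phi>: "(?\<phi> has_real_derivative 2 * ?\<psi> t) (at t)" if t: "y + t *. u \<in> V" for t
		proof -
			have g: "((\<lambda>t. G (y + t *. u)) has_derivative (\<lambda>h. ?D (y + t *. u) (h *. u))) (at t)"
				by (rule has_derivative_compose[OF aff D[OF t]])
			have lin: "?D (y + t *. u) (h *. u) = h *. ?D (y + t *. u) u" for h
				by (rule linear_scale[OF has_derivative_linear[OF D[OF t]]])
			have "(?\<phi> has_derivative (\<lambda>h. G (y + t *. u) \<bullet> ?D (y + t *. u) (h *. u) + ?D (y + t *. u) (h *. u) \<bullet> G (y + t *. u))) (at t)"
				by (rule has_derivative_inner[OF g g])
			also have "(\<lambda>h. G (y + t *. u) \<bullet> ?D (y + t *. u) (h *. u) + ?D (y + t *. u) (h *. u) \<bullet> G (y + t *. u)) = (*) (2 * ?\<psi> t)"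
				unfolding lin by (rule ext) (simp add: inner_commute)
			finally show ?thesis unfolding has_field_derivative_def .
		qed
		have y0: "y + 0 *. u = y" by simp
		have "(?\<psi> has_real_derivative ?D y u \<bullet> ?D y u + ?E u \<bullet> G y) (at 0)"
		proof -
			have E0: "((\<lambda>z. ?D z u) has_derivative ?E) (at (y + 0 *. u))" and D0: "(G has_derivative ?D y) (at (y + 0 *. u))"
				unfolding y0 by (rule E, rule D[OF V(2)])
			have lin: "?D y (h *. u) = h *. ?D y u" "?E (h *. u) = h *. ?E u" for h
				by (rule linear_scale[OF has_derivative_linear[OF D[OF V(2)]]], rule linear_scale[OF has_derivative_linear[OF E]])
			have "(?\<psi> has_derivative (\<lambda>h. ?D (y + 0 *. u) u \<bullet> ?D y (h *. u) + ?E (h *. u) \<bullet> G (y + 0 *. u))) (at 0)"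
				by (rule has_derivative_inner[OF has_derivative_compose[OF aff E0] has_derivative_compose[OF aff D0]])
			also have "(\<lambda>h. ?D (y + 0 *. u) u \<bullet> ?D y (h *. u) + ?E (h *. u) \<bullet> G (y + 0 *. u)) = (*) (?D y u \<bullet> ?D y u + ?E u \<bullet> G y)"
				unfolding y0 lin by (rule ext) (simp add: algebra_simps)
			finally show ?thesis unfolding has_field_derivative_def .
		qed
		from DERIV_pos_inc_right[OF this] neg
		have "\<exists>d>0. \<forall>h>0. h < d --> ?\<psi> 0 < ?\<psi> (0 + h)" by (simp only: not_le)
		then obtain d where d: "d > 0" "\<forall>h>0. h < d --> ?\<psi> 0 < ?\<psi> (0 + h)" by (elim exE conjE)
		obtain e where e: "e > 0" "ball y e \<subseteq> V" using V openE by blast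
		\<comment> \<open>Small enough for the sign of \<open>?\<psi>\<close> and for the segment from
		  \<open>y\<close> to \<open>y + h *. u\<close> to stay in the ball.\<close>
		define h where "h = min (d / 2) (e / (norm u + 1) / 2)"
		have nu: "norm u + 1 > 0" by (rule add_nonneg_pos) auto
		have cancel: "e / N / 2 * N = e / 2" if "N > 0" for N using that by simp
		have h: "h > 0" "h < d" using d(1) e(1) nu by (auto simp: h_def)
		have inV: "y + t *. u \<in> V" if "0 \<le> t" "t \<le> h" for t
		proof -
			have "t * (norm u + 1) \<le> e / (norm u + 1) / 2 * (norm u + 1)"
				by (rule mult_right_mono) (use that nu in \<open>simp_all add: h_def\<close>)
			also have "\<dots> = e / 2" by (rule cancel[OF nu])
			finally have "norm (t *. u) \<le> e / 2 - t" using that(1) by (simp add: algebra_simps)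
			hence "y + t *. u \<in> ball y e" using e(1) that(1) by (simp add: dist_norm)
			with e(2) show ?thesis by blast
		qed
		have "\<exists>z>0. z < h \<and> ?\<phi> h - ?\<phi> 0 = (h - 0) * (2 * ?\<psi> z)"
			by (rule MVT2[OF h(1), of ?\<phi> "\<lambda>t. 2 * ?\<psi> t"]) (rule d\<phi>[OF inV])
		then obtain z where z: "0 < z" "z < h" "?\<phi> h - ?\<phi> 0 = (h - 0) * (2 * ?\<psi> z)" by (elim exE conjE)
		have "?\<psi> 0 = 0" unfolding y0 by (rule orth)
		moreover have "?\<psi> 0 < ?\<psi> (0 + z)"
			by (rule mp[OF mp[OF spec[OF d(2)] z(1)]]) (use z(2) h(2) in simp)
		ultimately have "?\<psi> z > 0" unfolding add_0_left by (simp only:)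
		with h(1) have "?\<phi> h - ?\<phi> 0 > 0" unfolding z(3) by simp
		moreover have "?\<phi> h \<le> G y \<bullet> G y" by (rule max[OF inV]) (use h(1) in simp_all)
		ultimately show False unfolding y0 by simp
	qed
qed

locale compact_hypersurface = hypersurface r S f \<nu>
	for r :: regularity and S :: "('s, real ^ 'k) mfd" and f \<nu> :: "'s => real ^ 'n" +
	fixes \<kappa>0 :: real
	assumes compact: "compact_space (mtop S)" and nonempty: "pts S \<noteq> {}"
		and gap_pos: "0 < \<kappa>0"
		and gap: "c \<in> charts_at S x ==> u \<noteq> 0 ==> \<kappa> \<noteq> 0 ==>
			der c \<nu> x u = \<kappa> *. der c f x u ==> \<kappa>0 \<le> \<bar>\<kappa>\<bar>"
begin

abbreviation (input) sff where "sff c x u \<equiv> der c f x u \<bullet> der c \<nu> x u"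

text \<open>The sign \<open>s\<close> will be 1 or -1, and \<open>sff\<close> is minus the second
  fundamental form. The inequality is non-strict and uniform in the point, hence closed; by the gap
  it is equivalent to definiteness, which is open.\<close>

definition pinched :: "real => 's set" where
	"pinched s = {x \<in> pts S. \<forall>c\<in>charts_at S x. \<forall>u.
		 \<kappa>0 * (der c f x u \<bullet> der c f x u) \<le> s * sff c x u}"

lemma pinched_iff:
	assumes c: "c \<in> charts_at S x"
	shows "x \<in> pinched s \<longleftrightarrow> (\<forall>u. \<kappa>0 * (der c f x u \<bullet> der c f x u) \<le> s * sff c x u)"
		(is "_ \<longleftrightarrow> (\<forall>u. ?Q c u)")
proof
	assume "x \<in> pinched s" thus "\<forall>u. ?Q c u" using c unfolding pinched_def by blast
next
	assume Q: "\<forall>u. ?Q c u"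
	have "?Q d u" if d: "d \<in> charts_at S x" for d u
		unfolding chart_deriv_transition[OF f d c] chart_deriv_transition[OF nu d c] by (rule spec[OF Q])
	thus "x \<in> pinched s" using charts_at_topspace[OF c] unfolding pinched_def by blast
qed

text \<open>By the gap, definiteness at one point is already quantitative.\<close>

lemma definite_pinched:
	assumes c: "c \<in> charts_at S x" and s: "s * s = 1"
		and pos: "\<And>u. u \<noteq> 0 ==> 0 < s * sff c x u"
	shows "x \<in> pinched s"
proof -
	let ?A = "der c f x" and ?B = "\<lambda>u. s *. der c \<nu> x u"
	have B: "linear ?B" by (rule linear_compose_scale_right[OF dnu_linear[OF c]])
	have "?B u \<in> range ?A" for u
		unfolding range_df[OF c] by (simp add: nu_orth[OF c])
	hence rg: "range ?B \<subseteq> range ?A" by blast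
	have "?A u \<bullet> ?B v = ?A v \<bullet> ?B u" for u v using shape_symmetric(1)[OF c, of u v] by simp
	from ex_least_eigenvalue[OF df_linear[OF c] df_inj[OF c] B rg this]
	obtain \<kappa> u where u: "u \<noteq> 0" "?B u = \<kappa> *. ?A u" and le: "\<forall>v. \<kappa> * (?A v \<bullet> ?A v) \<le> ?A v \<bullet> ?B v"
		by (elim exE conjE)
	have Au: "?A u \<bullet> ?A u > 0" using immersed[OF c] u(1) by auto
	have "0 < ?A u \<bullet> ?B u" using pos[OF u(1)] by simp
	hence \<kappa>: "\<kappa> > 0" unfolding u(2) using Au by (simp add: zero_less_mult_iff)
	have s0: "s \<noteq> 0" using s by auto
	\<comment> \<open>Since \<open>s * s = 1\<close>, the product \<open>s * \<kappa>\<close> is an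
	  eigenvalue for d\<nu> itself, to which the gap applies.\<close>
	have "s *. ?B u = s *. (\<kappa> *. ?A u)" unfolding u(2) ..
	hence "der c \<nu> x u = (s * \<kappa>) *. ?A u" using s by simp
	from gap[OF c u(1) _ this] have "\<kappa>0 \<le> \<bar>s * \<kappa>\<bar>" using \<kappa> s0 by simp
	moreover have "s = 1 \<or> s = - 1" using s by (simp add: power2_eq_square[symmetric] power2_eq_1_iff)
	hence "\<bar>s\<bar> = 1" by auto
	ultimately have "\<kappa>0 \<le> \<kappa>" using \<kappa> by (simp add: abs_mult)
	show ?thesis unfolding pinched_iff[OF c]
	proof
		fix v
		have "\<kappa>0 * (?A v \<bullet> ?A v) \<le> \<kappa> * (?A v \<bullet> ?A v)" using \<open>\<kappa>0 \<le> \<kappa>\<close> by (rule mult_right_mono) simp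
		also have "\<dots> \<le> ?A v \<bullet> ?B v" by (rule spec[OF le])
		finally show "\<kappa>0 * (?A v \<bullet> ?A v) \<le> s * (?A v \<bullet> der c \<nu> x v)" by simp
	qed
qed

lemma deriv_continuous_on:
	fixes G :: "'s => 'b::euclidean_space"
	assumes "cr_fun r S G" "c \<in> charts S"
	shows "continuous_on ((cod c) \<times> UNIV) (\<lambda>z. der c G (chart_inv c (fst z)) (snd z))"
	using deriv_continuous[OF assms] by (simp add: case_prod_beta)

text \<open>Strict positivity on the compact unit sphere of directions persists at nearby points by
  the tube lemma, and there definiteness improves to the full inequality by
  \<open>definite_pinched\<close>.\<close>

lemma pinched_openin:
	assumes s: "s * s = 1"
	shows "openin (mtop S) (pinched s)"
proof (subst openin_subopen, rule ballI)
	fix x assume x: "x \<in> pinched s"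
	hence "x \<in> pts S" by (simp add: pinched_def)
	then obtain c where c: "c \<in> charts_at S x" using ex_chart by blast
	note c' = charts_atD[OF c]
	let ?V = "cod c"
	let ?q = "\<lambda>z. s * (der c f (chart_inv c (fst z)) (snd z) \<bullet> der c \<nu> (chart_inv c (fst z)) (snd z))"
	let ?O = "(?V \<times> UNIV) \<inter> ?q -` {0<..}"
	have "continuous_on (?V \<times> UNIV) ?q"
		by (rule continuous_on_mult[OF continuous_on_const
					continuous_on_inner[OF deriv_continuous_on[OF f c'(1)] deriv_continuous_on[OF nu c'(1)]]])
	hence O: "open ?O"
		by (rule continuous_open_preimage[OF _ open_Times[OF chart_open[OF c'(1)] open_UNIV] open_greaterThan])
	have sub: "{snd c x} \<times> sphere (0 :: real ^ 'k) 1 \<subseteq> ?O"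
	proof
		fix z :: "(real ^ 'k) \<times> (real ^ 'k)" assume "z \<in> {snd c x} \<times> sphere 0 1"
		hence z: "z = (snd c x, snd z)" and "norm (snd z) = 1" by (simp_all add: mem_Times_iff prod_eq_iff)
		define u where "u = snd z"
		have z: "z = (snd c x, u)" using z unfolding u_def .
		have u: "u \<noteq> 0" using \<open>norm (snd z) = 1\<close> unfolding u_def by auto
		have "0 < \<kappa>0 * (der c f x u \<bullet> der c f x u)"
			using gap_pos immersed[OF c, of u] u by (intro mult_pos_pos) auto
		also have "\<dots> \<le> s * sff c x u" using x unfolding pinched_iff[OF c] by (rule spec)
		finally show "z \<in> ?O"
			unfolding z Int_iff vimage_eq fst_conv snd_conv chart_inv_left[OF c'] greaterThan_iff
			using imageI[OF c'(2), of "snd c"] by (intro conjI SigmaI UNIV_I)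
	qed
	from Elementary_Topology.tube_lemma[OF compact_sphere O sub] obtain X0 where X0: "snd c x \<in> X0" "open X0" "X0 \<times> sphere (0 :: real ^ 'k) 1 \<subseteq> ?O" by (elim exE conjE)
	let ?T = "{p \<in> fst c. snd c p \<in> X0}"
	have "openin (mtop S) ?T" by (rule chart_preimage_openin[OF c'(1) X0(2)])
	moreover have "x \<in> ?T" using c'(2) X0(1) by simp
	moreover have "?T \<subseteq> pinched s"
	proof
		fix p assume "p \<in> ?T"
		hence p: "p \<in> fst c" "snd c p \<in> X0" by simp_all
		have cp: "c \<in> charts_at S p" using p(1) c'(1) by (simp add: charts_at_def)
		show "p \<in> pinched s"
		proof (rule definite_pinched[OF cp s])
			fix u :: "real ^ 'k" assume u: "u \<noteq> 0"
			have "(snd c p, u /\<^sub>R norm u) \<in> ?O" by (rule subsetD[OF X0(3)]) (use p(2) u in simp)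
			hence "0 < s * (der c f p (u /\<^sub>R norm u) \<bullet> der c \<nu> p (u /\<^sub>R norm u))"
				unfolding Int_iff vimage_eq fst_conv snd_conv chart_inv_left[OF c'(1) p(1)] greaterThan_iff by (rule conjunct2)
			also have "\<dots> = (inverse (norm u) * inverse (norm u)) * (s * (der c f p u \<bullet> der c \<nu> p u))"
				unfolding linear_scale[OF df_linear[OF cp]] linear_scale[OF dnu_linear[OF cp]] inner_scaleR_left inner_scaleR_right
				by (simp only: mult.assoc mult.left_commute[of s])
			finally show "0 < s * (der c f p u \<bullet> der c \<nu> p u)"
				by (rule zero_less_mult_pos) (use u in simp)
		qed
	qed
	ultimately show "\<exists>T. openin (mtop S) T \<and> x \<in> T \<and> T \<subseteq> pinched s" by (intro exI[of _ ?T] conjI)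
qed

lemma pinched_closedin: "closedin (mtop S) (pinched s)"
proof -
	have "openin (mtop S) (pts S - pinched s)"
	proof (subst openin_subopen, rule ballI)
		fix x assume x: "x \<in> pts S - pinched s"
		then obtain c where c: "c \<in> charts_at S x" using ex_chart by blast
		note c' = charts_atD[OF c]
		have "\<exists>u. s * sff c x u < \<kappa>0 * (der c f x u \<bullet> der c f x u)"
			using x unfolding pinched_iff[OF c] Diff_iff not_all not_le by (rule conjunct2)
		then obtain u where u: "s * sff c x u < \<kappa>0 * (der c f x u \<bullet> der c f x u)"
			by (rule exE)
		let ?V = "cod c"
		let ?d = "\<lambda>G y. der c G (chart_inv c y) u"
		let ?q = "\<lambda>y. \<kappa>0 * (?d f y \<bullet> ?d f y) - s * (?d f y \<bullet> ?d \<nu> y)"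
		have cd: "continuous_on ?V (?d G)" if "cr_fun r S G" for G :: "'s => real ^ 'n"
		proof -
			have "continuous_on ?V (\<lambda>y. (y, u))" by (intro continuous_on_Pair continuous_on_const continuous_on_id)
			from continuous_on_compose2[OF deriv_continuous_on[OF that c'(1)] this]
			show ?thesis unfolding fst_conv snd_conv by (rule meta_mp) auto
		qed
		have "continuous_on ?V ?q"
			by (rule continuous_on_diff[OF continuous_on_mult[OF continuous_on_const continuous_on_inner[OF cd[OF f] cd[OF f]]]
						continuous_on_mult[OF continuous_on_const continuous_on_inner[OF cd[OF f] cd[OF nu]]]])
		hence O: "open (?V \<inter> ?q -` {0<..})"
			by (rule continuous_open_preimage[OF _ chart_open[OF c'(1)] open_greaterThan])
		let ?T = "{p \<in> fst c. snd c p \<in> ?V \<inter> ?q -` {0<..}}"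
		have "openin (mtop S) ?T" by (rule chart_preimage_openin[OF c'(1) O])
		moreover have "x \<in> ?T"
			unfolding mem_Collect_eq Int_iff vimage_eq chart_inv_left[OF c'] greaterThan_iff
			using u imageI[OF c'(2), of "snd c"] c'(2) by (intro conjI) simp_all
		moreover have "?T \<subseteq> pts S - pinched s"
		proof
			fix p assume "p \<in> ?T"
			note pq = this[unfolded mem_Collect_eq Int_iff vimage_eq greaterThan_iff]
			have p: "p \<in> fst c" and q: "0 < ?q (snd c p)" by (rule conjunct1[OF pq], rule conjunct2[OF conjunct2[OF pq]])
			have cp: "c \<in> charts_at S p" using p c'(1) by (simp add: charts_at_def)
			have "\<not> \<kappa>0 * (der c f p u \<bullet> der c f p u) \<le> s * (der c f p u \<bullet> der c \<nu> p u)"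
				using q unfolding chart_inv_left[OF c'(1) p] by simp
			thus "p \<in> pts S - pinched s" unfolding Diff_iff pinched_iff[OF cp] using charts_at_topspace[OF cp] by blast
		qed
		ultimately show "\<exists>T. openin (mtop S) T \<and> x \<in> T \<and> T \<subseteq> pts S - pinched s" by (intro exI[of _ ?T] conjI)
	qed
	thus ?thesis unfolding closedin_def by (auto simp: pinched_def)
qed

lemma attains_max:
	fixes h :: "'s => real"
	assumes "continuous_map (mtop S) euclidean h"
	shows "\<exists>x\<in>pts S. \<forall>y\<in>pts S. h y \<le> h x"
proof -
	have "compactin euclidean (h ` pts S)"
		using image_compactin[OF _ assms] compact by (simp add: compact_space_def)
	hence "compact (h ` pts S)" by simp
	moreover have "h ` pts S \<noteq> {}" using nonempty by simp
	ultimately have "\<exists>s\<in>h ` pts S. \<forall>t\<in>h ` pts S. t \<le> s"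
		by (rule compact_attains_sup)
	thus ?thesis by simp
qed

text \<open>At a point farthest from the origin the position vector is \<rho> times the normal, and
  the second order condition reads df . df \<le> \<rho> sff. Thus the form is definite there, with
  the sign of \<rho>.\<close>

lemma ex_pinched: "\<exists>s x. s * s = 1 \<and> x \<in> pinched s"
proof -
	have cf: "continuous_map (mtop S) euclidean f" by (rule cr_fun_continuous[OF f])
	have "continuous_map (mtop S) euclidean (\<lambda>x. f x \<bullet> f x)"
		by (intro continuous_map_compose[OF cf, of euclidean "\<lambda>z. z \<bullet> z", unfolded o_def])
			(simp add: continuous_map_iff_continuous2 continuous_intros)
	from attains_max[OF this] obtain x where x: "x \<in> pts S"
		and max: "\<forall>y\<in>pts S. f y \<bullet> f y \<le> f x \<bullet> f x" by (rule bexE)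
	obtain c where c: "c \<in> charts_at S x" using ex_chart[OF x] by blast
	note c' = charts_atD[OF c]
	let ?G = "\<lambda>y. f (chart_inv c y)" and ?V = "cod c"
	have y: "snd c x \<in> ?V" using c'(2) by (rule imageI)
	have Gx: "?G (snd c x) = f x" using c' by simp
	have "?G z \<bullet> ?G z \<le> ?G (snd c x) \<bullet> ?G (snd c x)" if z: "z \<in> ?V" for z
		unfolding Gx by (rule bspec[OF max subsetD[OF chart_subset[OF c'(1)] chart_inv_in[OF z]]])
	note fp = farthest_point_derivatives[OF chart_open[OF c'(1)] y Cr_on_imp_Ck[OF cr_fun_Cr_on[OF f c'(1)]] this, unfolded Gx]
	have D: "Df ?G (snd c x) = der c f x" by (simp add: chart_deriv_def o_def)
	define \<rho> where "\<rho> = f x \<bullet> \<nu> x"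
	have f\<rho>: "f x = \<rho> *. \<nu> x" unfolding \<rho>_def by (rule orth_tangent[OF c fp(1)[unfolded D]])
	have le: "der c f x u \<bullet> der c f x u \<le> \<rho> * sff c x u" for u
		using fp(2)[of u, unfolded D, unfolded f\<rho>] unfolding shape_symmetric(2)[OF c] by simp
	have pos: "0 < \<rho> * sff c x u" if u: "u \<noteq> 0" for u
	proof -
		have "0 < der c f x u \<bullet> der c f x u" using immersed[OF c, of u] u by auto
		thus ?thesis using le[of u] by linarith
	qed
	obtain u0 :: "real ^ 'k" where "u0 \<noteq> 0" using zero_neq_one by metis
	hence \<rho>0: "\<rho> \<noteq> 0" using pos by force
	have "x \<in> pinched (sgn \<rho>)"
	proof (rule definite_pinched[OF c])
		show "sgn \<rho> * sgn \<rho> = 1" using \<rho>0 by (simp add: sgn_if)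
		fix u :: "real ^ 'k" assume u: "u \<noteq> 0"
		from pos[OF u] show "0 < sgn \<rho> * sff c x u"
			by (auto simp: zero_less_mult_iff)
	qed
	moreover have "sgn \<rho> * sgn \<rho> = 1" using \<rho>0 by (simp add: sgn_if)
	ultimately show ?thesis by (intro exI[of _ "sgn \<rho>"] exI[of _ x] conjI)
qed

lemma definite:
	"\<exists>s. s * s = 1 \<and> (\<forall>x. \<forall>c\<in>charts_at S x. \<forall>u. u \<noteq> 0 --> 0 < s * sff c x u)"
proof -
	from ex_pinched obtain s x where s: "s * s = 1" and x: "x \<in> pinched s" by (elim exE conjE)
	have P: "pinched s = pts S"
		using spec[OF connected[unfolded connected_space_clopen_in], THEN mp, OF conjI[OF pinched_openin[OF s] pinched_closedin]] x
		by blast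
	have "0 < s * sff c x u" if c: "c \<in> charts_at S x" and u: "u \<noteq> 0" for x c u
	proof -
		have "x \<in> pinched s" unfolding P by (rule charts_at_topspace[OF c])
		moreover have "0 < \<kappa>0 * (der c f x u \<bullet> der c f x u)"
			using gap_pos immersed[OF c, of u] u by (intro mult_pos_pos) auto
		ultimately show ?thesis using less_le_trans unfolding pinched_iff[OF c] by (elim allE[of _ u]) (rule less_le_trans)
	qed
	with s show ?thesis by (intro exI[of _ s] conjI allI ballI impI)
qed

end

section \<open>Local homeomorphisms from a compact space\<close>

locale compact_local_homeo =
	fixes X :: "'s topology" and p :: "'s => 'b::metric_space" and E :: "'b set"
	assumes comp: "compact_space X" and haus: "Hausdorff_space X"
		and cont: "continuous_map X (top_of_set E) p" and opn: "open_map X (top_of_set E) p"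
		and loc_inj: "x \<in> topspace X ==> \<exists>N. openin X N \<and> x \<in> N \<and> inj_on p N"
begin

lemma p_in: "x \<in> topspace X ==> p x \<in> E"
	using continuous_map_image_subset_topspace[OF cont] by auto

lemma local_section:
	assumes N: "openin X N" "inj_on p N"
	shows "continuous_map (top_of_set (p ` N)) X (inv_into N p)"
	unfolding continuous_map_def
proof (intro conjI allI impI)
	have NX: "N \<subseteq> topspace X" by (rule openin_subset[OF N(1)])
	show "inv_into N p \<in> topspace (top_of_set (p ` N)) \<rightarrow> topspace X"
		using NX by (auto simp: inv_into_f_f[OF N(2)])
	fix W assume W: "openin X W"
	have "{y \<in> topspace (top_of_set (p ` N)). inv_into N p y \<in> W} = p ` (N \<inter> W)"
		by (auto simp: inv_into_f_f[OF N(2)])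
	moreover have "openin (top_of_set E) (p ` (N \<inter> W))"
		using opn openin_Int[OF N(1) W] unfolding open_map_def by blast
	moreover have "p ` N \<subseteq> E" using NX p_in by blast
	moreover have "p ` (N \<inter> W) \<subseteq> p ` N" by blast
	ultimately show "openin (top_of_set (p ` N)) {y \<in> topspace (top_of_set (p ` N)). inv_into N p y \<in> W}"
		by (simp only: openin_subset_trans)
qed

lemma image_compact:
	assumes "closedin X C"
	shows "compact (p ` C)"
proof -
	have "compactin X C" by (rule closedin_compact_space[OF comp assms])
	from image_compactin[OF this, of euclidean p] show ?thesis
		using cont by (simp add: continuous_map_in_subtopology)
qed

lemma fibre_cover:
	shows "\<exists>I N. finite I \<and> I \<subseteq> {x \<in> topspace X. p x = q} \<and> {x \<in> topspace X. p x = q} \<subseteq> \<Union> (N ` I) \<and>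
		(\<forall>x\<in>I. openin X (N x) \<and> x \<in> N x \<and> inj_on p (N x))"
proof -
	let ?F = "{x \<in> topspace X. p x = q}"
	have "\<forall>x\<in>topspace X. \<exists>N. openin X N \<and> x \<in> N \<and> inj_on p N" using loc_inj by blast
	from bchoice[OF this] obtain N where N: "\<forall>x\<in>topspace X. openin X (N x) \<and> x \<in> N x \<and> inj_on p (N x)" by (rule exE)
	have "continuous_map X euclidean p" using cont by (simp add: continuous_map_in_subtopology)
	from closedin_continuous_map_preimage[OF this, of "{q}"] have "closedin X ?F" by simp
	hence "compactin X ?F" by (rule closedin_compact_space[OF comp])
	moreover have "\<forall>U\<in>N ` ?F. openin X U" using N by blast
	moreover have "?F \<subseteq> \<Union> (N ` ?F)" using N by blast
	ultimately have "\<exists>\<F>. finite \<F> \<and> \<F> \<subseteq> N ` ?F \<and> ?F \<subseteq> \<Union> \<F>"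
		unfolding compactin_def by (elim conjE allE[of _ "N ` ?F"] impE) (intro conjI)
	then obtain \<F> where \<F>: "finite \<F>" "\<F> \<subseteq> N ` ?F" "?F \<subseteq> \<Union> \<F>" by (elim exE conjE)
	obtain I where I: "I \<subseteq> ?F" "finite I" "\<F> = N ` I"
		using finite_subset_image[OF \<F>(1,2)] by (elim exE conjE) (rule that)
	have "\<forall>x\<in>I. openin X (N x) \<and> x \<in> N x \<and> inj_on p (N x)" using I(1) N by blast
	with I \<F>(3) show ?thesis by (intro exI[of _ I] exI[of _ N] conjI) simp_all
qed

text \<open>Each of the finitely many sheets covering the fibre contains only one of its
  points.\<close>

lemma finite_fibre: "finite {x \<in> topspace X. p x = q}"
proof -
	from fibre_cover[of q] obtain I N where I: "finite I" "I \<subseteq> {x \<in> topspace X. p x = q}"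
		"{x \<in> topspace X. p x = q} \<subseteq> \<Union> (N ` I)" "\<forall>x\<in>I. openin X (N x) \<and> x \<in> N x \<and> inj_on p (N x)"
		by (elim exE conjE)
	have "{x \<in> topspace X. p x = q} \<subseteq> I"
	proof
		fix x assume x: "x \<in> {x \<in> topspace X. p x = q}"
		from subsetD[OF I(3) x] obtain y where y: "y \<in> I" "x \<in> N y" by (rule UN_E)
		note Ny = bspec[OF I(4) y(1)]
		have "p x = q" "p y = q" using x subsetD[OF I(2) y(1)] by simp_all
		hence "p x = p y" by simp
		from inj_onD[OF conjunct2[OF conjunct2[OF Ny]] this y(2) conjunct1[OF conjunct2[OF Ny]]] y(1)
		show "x \<in> I" by simp
	qed
	thus ?thesis using I(1) by (rule finite_subset)
qed

text \<open>An evenly covered neighbourhood: the common image of the finitely many sheets through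
  the fibre, minus the compact image of everything outside these sheets.\<close>

lemma sections_around:
	assumes q: "q \<in> E"
	shows "\<exists>W. openin (top_of_set E) W \<and> q \<in> W \<and> (\<forall>x\<in>topspace X. p x \<in> W -->
		(\<exists>s. continuous_map (top_of_set W) X s \<and> s (p x) = x \<and> (\<forall>y\<in>W. p (s y) = y)))"
proof -
	from fibre_cover[of q] obtain I N where I: "finite I" "I \<subseteq> {x \<in> topspace X. p x = q}"
		"{x \<in> topspace X. p x = q} \<subseteq> \<Union> (N ` I)" "\<forall>x\<in>I. openin X (N x) \<and> x \<in> N x \<and> inj_on p (N x)"
		by (elim exE conjE)
	let ?C = "topspace X - \<Union> (N ` I)"
	\<comment> \<open>The factor \<open>topspace\<close> takes care of an empty fibre, where the
	  intersection over \<open>I\<close> is the whole type.\<close>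
	let ?W = "((\<Inter>x\<in>I. p ` N x) \<inter> topspace (top_of_set E)) \<inter> (E - p ` ?C)"
	have "openin X (\<Union> (N ` I))" using I(4) by blast
	hence "closedin X ?C" by blast
	hence "closed (p ` ?C)" by (rule compact_imp_closed[OF image_compact])
	hence "openin (top_of_set E) (E - p ` ?C)"
		by (simp add: Diff_eq openin_open_Int open_Compl)
	moreover have "openin (top_of_set E) ((\<Inter>x\<in>I. p ` N x) \<inter> topspace (top_of_set E))"
		by (rule openin_INT[OF I(1)]) (use I(4) opn in \<open>auto simp: open_map_def\<close>)
	ultimately have oW: "openin (top_of_set E) ?W" by (rule openin_Int[rotated])
	have qW: "q \<in> ?W"
	proof (intro IntI INT_I DiffI)
		fix x assume "x \<in> I" thus "q \<in> p ` N x" using I(2,4) by blast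
	next
		show "q \<notin> p ` ?C" using I(3) by blast
	qed (use q in auto)
	have "\<exists>s. continuous_map (top_of_set ?W) X s \<and> s (p x) = x \<and> (\<forall>y\<in>?W. p (s y) = y)"
		if x: "x \<in> topspace X" "p x \<in> ?W" for x
	proof -
		have "p x \<notin> p ` ?C" using x(2) by (elim IntE DiffE)
		hence "x \<in> \<Union> (N ` I)" using x(1) by blast
		then obtain z where z: "z \<in> I" "x \<in> N z" by blast
		have Nz: "openin X (N z)" "inj_on p (N z)" using I(4) z(1) by blast+
		have sub: "?W \<subseteq> p ` N z" using z(1) by blast
		have "continuous_map (top_of_set ?W) X (inv_into (N z) p)"
			by (rule continuous_map_from_subtopology_mono[OF local_section[OF Nz] sub])
		moreover have "inv_into (N z) p (p x) = x" by (rule inv_into_f_f[OF Nz(2) z(2)])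
		moreover have "p (inv_into (N z) p y) = y" if "y \<in> ?W" for y by (rule f_inv_into_f[OF subsetD[OF sub that]])
		ultimately show ?thesis by (intro exI[of _ "inv_into (N z) p"] conjI ballI)
	qed
	with oW qW show ?thesis by (intro exI[of _ ?W] conjI ballI impI)
qed

lemma lifts_agree:
	assumes "connected J" "continuous_map (top_of_set J) X a" "continuous_map (top_of_set J) X b"
		"\<And>t. t \<in> J ==> p (a t) = p (b t)" "t0 \<in> J" "a t0 = b t0" "t \<in> J"
	shows "a t = b t"
proof (rule lift_unique[OF _ haus assms(2,3) loc_inj])
	show "connected_space (top_of_set J)" using assms(1) by (simp add: connectedin_def[symmetric] connected_space_subtopology)
qed (use assms in auto)

text \<open>The three pieces are glued at \<open>a\<close> and \<open>b\<close>. Both ends are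
  extended at once because the intervals used for lifting are symmetric about 0.\<close>

lemma extend_lift:
	fixes \<gamma> :: "real => 'b"
	assumes L: "continuous_map (top_of_set {a..b}) X L" "\<And>t. t \<in> {a..b} ==> p (L t) = \<gamma> t"
		and \<gamma>: "continuous_on {a'..b'} \<gamma>" "a' \<le> a" "a \<le> b" "b \<le> b'"
		and W1: "\<gamma> ` {a'..a} \<subseteq> W1" "continuous_map (top_of_set W1) X s1" "s1 (\<gamma> a) = L a" "\<And>y. y \<in> W1 ==> p (s1 y) = y"
		and W2: "\<gamma> ` {b..b'} \<subseteq> W2" "continuous_map (top_of_set W2) X s2" "s2 (\<gamma> b) = L b" "\<And>y. y \<in> W2 ==> p (s2 y) = y"
	shows "\<exists>L'. continuous_map (top_of_set {a'..b'}) X L' \<and> (\<forall>t\<in>{a'..b'}. p (L' t) = \<gamma> t) \<and> (\<forall>t\<in>{a..b}. L' t = L t)"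
proof -
	have c: "continuous_map (top_of_set J) X (\<lambda>t. s (\<gamma> t))"
		if "J \<subseteq> {a'..b'}" "\<gamma> ` J \<subseteq> W" "continuous_map (top_of_set W) X s" for J W s
	proof -
		have "continuous_map (top_of_set J) (top_of_set W) \<gamma>"
			using continuous_on_subset[OF \<gamma>(1) that(1)] that(2) by (auto simp: continuous_map_in_subtopology)
		from continuous_map_compose[OF this that(3)] show ?thesis unfolding o_def .
	qed
	let ?R = "\<lambda>t. if t \<le> b then L t else s2 (\<gamma> t)"
	let ?L = "\<lambda>t. if t \<le> a then s1 (\<gamma> t) else ?R t"
	have id: "continuous_map (top_of_set J) euclideanreal (\<lambda>t. t)" "continuous_map (top_of_set J) euclideanreal (\<lambda>t. k)"
		for J :: "real set" and k by simp_all
	have R: "continuous_map (top_of_set {a..b'}) X ?R"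
	proof (rule continuous_map_cases_le[OF id])
		have "{a..b'} \<inter> {x \<in> topspace (top_of_set {a..b'}). x \<le> b} = {a..b}" using \<gamma>(4) by auto
		thus "continuous_map (subtopology (top_of_set {a..b'}) {x \<in> topspace (top_of_set {a..b'}). x \<le> b}) X L"
			using L(1) by (simp only: subtopology_subtopology)
		have "{a..b'} \<inter> {x \<in> topspace (top_of_set {a..b'}). b \<le> x} = {b..b'}" using \<gamma>(3) by auto
		thus "continuous_map (subtopology (top_of_set {a..b'}) {x \<in> topspace (top_of_set {a..b'}). b \<le> x}) X (\<lambda>t. s2 (\<gamma> t))"
			using c[OF _ W2(1,2)] \<gamma>(2,3) by (simp only: subtopology_subtopology) auto
		show "L t = s2 (\<gamma> t)" if "t = b" for t using W2(3) that by simp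
	qed
	have "continuous_map (top_of_set {a'..b'}) X ?L"
	proof (rule continuous_map_cases_le[OF id])
		have "{a'..b'} \<inter> {x \<in> topspace (top_of_set {a'..b'}). x \<le> a} = {a'..a}" using \<gamma>(3,4) by auto
		thus "continuous_map (subtopology (top_of_set {a'..b'}) {x \<in> topspace (top_of_set {a'..b'}). x \<le> a}) X (\<lambda>t. s1 (\<gamma> t))"
			using c[OF _ W1(1,2)] \<gamma>(3,4) by (simp only: subtopology_subtopology) auto
		have "{a'..b'} \<inter> {x \<in> topspace (top_of_set {a'..b'}). a \<le> x} = {a..b'}" using \<gamma>(2) by auto
		thus "continuous_map (subtopology (top_of_set {a'..b'}) {x \<in> topspace (top_of_set {a'..b'}). a \<le> x}) X ?R"
			using R by (simp only: subtopology_subtopology)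
		show "s1 (\<gamma> t) = ?R t" if "t = a" for t using W1(3) that \<gamma>(3) by simp
	qed
	moreover have "p (?L t) = \<gamma> t" if t: "t \<in> {a'..b'}" for t
	proof -
		consider "t \<le> a" | "a < t" "t \<le> b" | "a < t" "b < t" by linarith
		thus ?thesis
		proof cases
			case 1
			hence "\<gamma> t \<in> W1" using t W1(1) by auto
			thus ?thesis using 1 W1(4) by simp
		next
			case 2 thus ?thesis using L(2)[of t] by simp
		next
			case 3
			hence "\<gamma> t \<in> W2" using t W2(1) by auto
			thus ?thesis using 3 W2(4) by simp
		qed
	qed
	moreover have "?L t = L t" if "t \<in> {a..b}" for t using that W1(3) by auto
	ultimately show ?thesis by (intro exI[of _ ?L] conjI ballI)
qed

abbreviation (input) sections_over where "sections_over W \<equiv> \<forall>x\<in>topspace X. p x \<in> W --> (\<exists>s. continuous_map (top_of_set W) X s \<and> s (p x) = x \<and> (\<forall>y\<in>W. p (s y) = y))"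

text \<open>Absolute values make the claim meaningful for every real \<open>T\<close>, so that it
  can be continued from \<open>T = 0\<close> by \<open>locally_constant_real\<close>. Evenly covered
  neighbourhoods of both end points provide the extension.\<close>

lemma lift_on_interval:
	fixes \<gamma> :: "real => 'b"
	assumes \<gamma>: "continuous_on UNIV \<gamma>" "\<And>t. \<gamma> t \<in> E" and x0: "x0 \<in> topspace X" "p x0 = \<gamma> 0"
	shows "\<exists>L. continuous_map (top_of_set {-\<bar>T\<bar>..\<bar>T\<bar>}) X L \<and> (\<forall>t\<in>{-\<bar>T\<bar>..\<bar>T\<bar>}. p (L t) = \<gamma> t) \<and> L 0 = x0" (is "?S T")
proof -
	have loc: "\<exists>d>0. \<exists>W. \<gamma> ` {t. \<bar>t - t0\<bar> < d} \<subseteq> W \<and> (\<forall>x\<in>topspace X. p x \<in> W -->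
		(\<exists>s. continuous_map (top_of_set W) X s \<and> s (p x) = x \<and> (\<forall>y\<in>W. p (s y) = y)))" for t0
	proof -
		from sections_around[OF \<gamma>(2)[of t0]] obtain W where W: "openin (top_of_set E) W" "\<gamma> t0 \<in> W"
			"sections_over W"
			by (elim exE conjE)
		obtain V where V: "open V" "W = E \<inter> V" using W(1) unfolding openin_open by blast
		have "open (\<gamma> -` V)" by (rule open_vimage[OF V(1) \<gamma>(1)])
		moreover have "t0 \<in> \<gamma> -` V" using W(2) V(2) by simp
		ultimately obtain d where d: "d > 0" "ball t0 d \<subseteq> \<gamma> -` V" by (rule openE)
		have "\<gamma> ` {t. \<bar>t - t0\<bar> < d} \<subseteq> W"
		proof (rule image_subsetI)
			fix t assume "t \<in> {t. \<bar>t - t0\<bar> < d}"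
			hence "t \<in> ball t0 d" by (simp add: dist_real_def abs_minus_commute)
			with d(2) show "\<gamma> t \<in> W" unfolding V(2) using \<gamma>(2) by blast
		qed
		with d(1) W(3) show ?thesis by (intro exI[of _ d] exI[of _ W] conjI)
	qed
	have step: "\<exists>d>0. \<forall>T'. \<bar>T' - T0\<bar> < d --> ?S T' = ?S T0" for T0
	proof -
		from loc[of "- \<bar>T0\<bar>"] obtain d1 W1 where d1: "d1 > 0" "\<gamma> ` {t. \<bar>t - (- \<bar>T0\<bar>)\<bar> < d1} \<subseteq> W1" "\<forall>x\<in>topspace X. p x \<in> W1 -->
			(\<exists>s. continuous_map (top_of_set W1) X s \<and> s (p x) = x \<and> (\<forall>y\<in>W1. p (s y) = y))" by (elim exE conjE)
		from loc[of "\<bar>T0\<bar>"] obtain d2 W2 where d2: "d2 > 0" "\<gamma> ` {t. \<bar>t - \<bar>T0\<bar>\<bar> < d2} \<subseteq> W2" "\<forall>x\<in>topspace X. p x \<in> W2 -->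
			(\<exists>s. continuous_map (top_of_set W2) X s \<and> s (p x) = x \<and> (\<forall>y\<in>W2. p (s y) = y))" by (elim exE conjE)
		define d where "d = min d1 d2"
		have d: "d > 0" "d \<le> d1" "d \<le> d2" using d1(1) d2(1) by (simp_all add: d_def)
		have ext: "?S T'" if S: "?S T1" and near: "\<bar>T1 - T0\<bar> < d" "\<bar>T' - T0\<bar> < d" for T1 T'
		proof (cases "\<bar>T'\<bar> \<le> \<bar>T1\<bar>")
			case True
			from S obtain L where L: "continuous_map (top_of_set {-\<bar>T1\<bar>..\<bar>T1\<bar>}) X L" "\<forall>t\<in>{-\<bar>T1\<bar>..\<bar>T1\<bar>}. p (L t) = \<gamma> t" "L 0 = x0"
				by (elim exE conjE)
			have sub: "{-\<bar>T'\<bar>..\<bar>T'\<bar>} \<subseteq> {-\<bar>T1\<bar>..\<bar>T1\<bar>}" using True by auto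
			show ?thesis
				by (intro exI[of _ L] conjI continuous_map_from_subtopology_mono[OF L(1) sub] L(3) ballI)
					(rule bspec[OF L(2) subsetD[OF sub]])
		next
			case False
			from S obtain L where L: "continuous_map (top_of_set {-\<bar>T1\<bar>..\<bar>T1\<bar>}) X L" "\<forall>t\<in>{-\<bar>T1\<bar>..\<bar>T1\<bar>}. p (L t) = \<gamma> t" "L 0 = x0"
				by (elim exE conjE)
			have near1: "\<bar>\<bar>T1\<bar> - \<bar>T0\<bar>\<bar> < d" "\<bar>\<bar>T'\<bar> - \<bar>T0\<bar>\<bar> < d" using near by linarith+
			have g1: "\<gamma> ` {- \<bar>T'\<bar>..- \<bar>T1\<bar>} \<subseteq> W1"
			proof (rule subset_trans[OF image_mono d1(2)], rule subsetI)
				fix t assume "t \<in> {- \<bar>T'\<bar>..- \<bar>T1\<bar>}"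
				hence "\<bar>t - (- \<bar>T0\<bar>)\<bar> < d1" unfolding atLeastAtMost_iff using near1 d(2) by linarith
				thus "t \<in> {t. \<bar>t - (- \<bar>T0\<bar>)\<bar> < d1}" by (rule CollectI)
			qed
			have g2: "\<gamma> ` {\<bar>T1\<bar>..\<bar>T'\<bar>} \<subseteq> W2"
			proof (rule subset_trans[OF image_mono d2(2)], rule subsetI)
				fix t assume "t \<in> {\<bar>T1\<bar>..\<bar>T'\<bar>}"
				hence "\<bar>t - \<bar>T0\<bar>\<bar> < d2" unfolding atLeastAtMost_iff using near1 d(3) by linarith
				thus "t \<in> {t. \<bar>t - \<bar>T0\<bar>\<bar> < d2}" by (rule CollectI)
			qed
			have LX: "L t \<in> topspace X" if "t \<in> {-\<bar>T1\<bar>..\<bar>T1\<bar>}" for t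
				using continuous_map_image_subset_topspace[OF L(1)] that by auto
			have ends: "- \<bar>T1\<bar> \<in> {-\<bar>T1\<bar>..\<bar>T1\<bar>}" "\<bar>T1\<bar> \<in> {-\<bar>T1\<bar>..\<bar>T1\<bar>}" by auto
			have pe: "p (L (- \<bar>T1\<bar>)) = \<gamma> (- \<bar>T1\<bar>)" "p (L \<bar>T1\<bar>) = \<gamma> \<bar>T1\<bar>" by (rule bspec[OF L(2) ends(1)], rule bspec[OF L(2) ends(2)])
			have "\<gamma> (- \<bar>T1\<bar>) \<in> W1" by (rule subsetD[OF g1 imageI]) (use False in auto)
			from mp[OF bspec[OF d1(3) LX[OF ends(1)]], unfolded pe, OF this]
			obtain s1 where s1: "continuous_map (top_of_set W1) X s1" "s1 (\<gamma> (- \<bar>T1\<bar>)) = L (- \<bar>T1\<bar>)" "\<forall>y\<in>W1. p (s1 y) = y"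
				by (elim exE conjE)
			have "\<gamma> \<bar>T1\<bar> \<in> W2" by (rule subsetD[OF g2 imageI]) (use False in auto)
			from mp[OF bspec[OF d2(3) LX[OF ends(2)]], unfolded pe, OF this]
			obtain s2 where s2: "continuous_map (top_of_set W2) X s2" "s2 (\<gamma> \<bar>T1\<bar>) = L \<bar>T1\<bar>" "\<forall>y\<in>W2. p (s2 y) = y"
				by (elim exE conjE)
			have "\<exists>L'. continuous_map (top_of_set {- \<bar>T'\<bar>..\<bar>T'\<bar>}) X L' \<and> (\<forall>t\<in>{- \<bar>T'\<bar>..\<bar>T'\<bar>}. p (L' t) = \<gamma> t) \<and> (\<forall>t\<in>{- \<bar>T1\<bar>..\<bar>T1\<bar>}. L' t = L t)"
				by (rule extend_lift[OF L(1) bspec[OF L(2)] continuous_on_subset[OF \<gamma>(1) subset_UNIV] _ _ _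
							g1 s1(1,2) bspec[OF s1(3)] g2 s2(1,2) bspec[OF s2(3)]]) (use False in auto)
			then obtain L' where L': "continuous_map (top_of_set {- \<bar>T'\<bar>..\<bar>T'\<bar>}) X L'" "\<forall>t\<in>{- \<bar>T'\<bar>..\<bar>T'\<bar>}. p (L' t) = \<gamma> t" "\<forall>t\<in>{- \<bar>T1\<bar>..\<bar>T1\<bar>}. L' t = L t"
				by (elim exE conjE)
			have "L' 0 = x0" using bspec[OF L'(3), of 0] L(3) by simp
			with L' show ?thesis by (intro exI[of _ L'] conjI)
		qed
		have "?S T' = ?S T0" if near: "\<bar>T' - T0\<bar> < d" for T'
		proof
			assume "?S T'" from ext[OF this near] d(1) show "?S T0" by simp
		next
			assume "?S T0" from ext[OF this _ near] d(1) show "?S T'" by simp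
		qed
		with d(1) show ?thesis by (intro exI[of _ d] conjI allI impI)
	qed
	have "?S 0"
		by (rule exI[of _ "\<lambda>t. x0"]) (use x0 in simp)
	moreover have "?S T = ?S 0" by (rule locally_constant_real[of ?S, OF step])
	ultimately show ?thesis by (rule iffD2[rotated])
qed

lemma path_lifting:
	fixes \<gamma> :: "real => 'b"
	assumes \<gamma>: "continuous_on UNIV \<gamma>" "\<And>t. \<gamma> t \<in> E" and x0: "x0 \<in> topspace X" "p x0 = \<gamma> 0"
	shows "\<exists>L. continuous_map euclidean X L \<and> (\<forall>t. p (L t) = \<gamma> t) \<and> L 0 = x0"
proof -
	have "\<forall>T. \<exists>L. continuous_map (top_of_set {-\<bar>T\<bar>..\<bar>T\<bar>}) X L \<and> (\<forall>t\<in>{-\<bar>T\<bar>..\<bar>T\<bar>}. p (L t) = \<gamma> t) \<and> L 0 = x0"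
		by (intro allI lift_on_interval assms)
	from choice[OF this] obtain K where K: "\<forall>T. continuous_map (top_of_set {-\<bar>T\<bar>..\<bar>T\<bar>}) X (K T) \<and> (\<forall>t\<in>{-\<bar>T\<bar>..\<bar>T\<bar>}. p (K T t) = \<gamma> t) \<and> K T 0 = x0"
		by (rule exE)
	have K1: "continuous_map (top_of_set {-\<bar>T\<bar>..\<bar>T\<bar>}) X (K T)" for T by (rule conjunct1[OF spec[OF K]])
	have K2: "p (K T t) = \<gamma> t" if "t \<in> {-\<bar>T\<bar>..\<bar>T\<bar>}" for T t
		by (rule bspec[OF conjunct1[OF conjunct2[OF spec[OF K]]] that])
	have K3: "K T 0 = x0" for T by (rule conjunct2[OF conjunct2[OF spec[OF K]]])
	\<comment> \<open>The lifts on the various intervals agree where both are defined, so evaluating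
	  the lift for \<open>t\<close> at \<open>t\<close> itself is consistent.\<close>
	define L where "L t = K t t" for t
	have LK: "L t = K T t" if "\<bar>t\<bar> \<le> \<bar>T\<bar>" for t T
		unfolding L_def
	proof (rule lifts_agree[of "{-\<bar>t\<bar>..\<bar>t\<bar>}" "K t" "K T" 0 t])
		have sub: "{-\<bar>t\<bar>..\<bar>t\<bar>} \<subseteq> {-\<bar>T\<bar>..\<bar>T\<bar>}" using that by auto
		show "continuous_map (top_of_set {-\<bar>t\<bar>..\<bar>t\<bar>}) X (K T)" by (rule continuous_map_from_subtopology_mono[OF K1 sub])
		show "p (K t u) = p (K T u)" if "u \<in> {-\<bar>t\<bar>..\<bar>t\<bar>}" for u
			unfolding K2[OF that] K2[OF subsetD[OF sub that]] ..
		show "K t 0 = K T 0" unfolding K3 ..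
	qed (auto intro: K1)
	have "continuous_map euclidean X L"
	proof (rule continuous_map_local)
		fix t0 :: real
		let ?T = "\<bar>t0\<bar> + 1"
		let ?U = "{- ?T<..<?T}"
		have sub: "?U \<subseteq> {-\<bar>?T\<bar>..\<bar>?T\<bar>}" by auto
		have "continuous_map (top_of_set ?U) X (K ?T)" by (rule continuous_map_from_subtopology_mono[OF K1 sub])
		hence "continuous_map (top_of_set ?U) X L"
			by (rule continuous_map_eq) (use LK[of _ ?T] in auto)
		moreover have "openin euclidean ?U" "t0 \<in> ?U" by auto
		ultimately show "\<exists>U. openin euclidean U \<and> t0 \<in> U \<and> continuous_map (top_of_set U) X L" by (intro exI[of _ ?U] conjI)
	qed
	moreover have "p (L t) = \<gamma> t" for t unfolding L_def by (rule K2) auto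
	moreover have "L 0 = x0" unfolding L_def by (rule K3)
	ultimately show ?thesis by (intro exI[of _ L] conjI allI)
qed

end

context compact_local_homeo
begin

text \<open>The paths for the various \<open>y\<close> all start at \<open>p x0\<close> and are
  lifted separately from \<open>x0\<close>. Continuity in \<open>y\<close> is trivial at time 0 and
  is continued in time through evenly covered neighbourhoods.\<close>

lemma homotopy_lifting:
	fixes H :: "real => 'y => 'b"
	assumes H: "continuous_map (prod_topology euclideanreal Y) (top_of_set E) (\<lambda>z. H (fst z) (snd z))"
		and x0: "x0 \<in> topspace X" "\<And>y. y \<in> topspace Y ==> H 0 y = p x0"
	shows "\<exists>g. continuous_map Y X g \<and> (\<forall>y\<in>topspace Y. p (g y) = H 1 y)"
proof -
	have HE: "H t y \<in> E" if "y \<in> topspace Y" for t y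
		using continuous_map_image_subset_topspace[OF H] that by (auto simp: image_subset_iff)
	have Hc: "continuous_on UNIV (\<lambda>t. H t y)" if y: "y \<in> topspace Y" for y
	proof -
		have "continuous_map euclideanreal (prod_topology euclideanreal Y) (\<lambda>t. (t, y))"
			unfolding continuous_map_pairwise o_def fst_conv snd_conv using y by simp
		from continuous_map_compose[OF this H] have "continuous_map euclideanreal (top_of_set E) (\<lambda>t. H t y)"
			unfolding o_def fst_conv snd_conv .
		thus ?thesis by (simp add: continuous_map_in_subtopology)
	qed
	have "\<forall>y\<in>topspace Y. \<exists>L. continuous_map euclidean X L \<and> (\<forall>t. p (L t) = H t y) \<and> L 0 = x0"
	proof
		fix y assume y: "y \<in> topspace Y"
		show "\<exists>L. continuous_map euclidean X L \<and> (\<forall>t. p (L t) = H t y) \<and> L 0 = x0"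
			by (rule path_lifting[OF Hc[OF y] HE[OF y] x0(1) x0(2)[OF y, symmetric]])
	qed
	from bchoice[OF this] obtain G where G: "\<forall>y\<in>topspace Y. continuous_map euclidean X (G y) \<and> (\<forall>t. p (G y t) = H t y) \<and> G y 0 = x0"
		by (rule exE)
	have G1: "continuous_map euclidean X (G y)" and G2: "p (G y t) = H t y" and G3: "G y 0 = x0" if y: "y \<in> topspace Y" for y t
		by (rule conjunct1[OF bspec[OF G y]], rule spec[OF conjunct1[OF conjunct2[OF bspec[OF G y]]]],
				rule conjunct2[OF conjunct2[OF bspec[OF G y]]])
	have GX: "G y t \<in> topspace X" if y: "y \<in> topspace Y" for y t
		using continuous_map_image_subset_topspace[OF G1[OF y]] by auto
	have good: "\<exists>U. openin Y U \<and> y0 \<in> U \<and> continuous_map (subtopology Y U) X (\<lambda>y. G y s)" (is "?good s")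
		if y0: "y0 \<in> topspace Y" for y0 s
	proof -
		have step: "\<exists>d>0. \<forall>s'. \<bar>s' - s0\<bar> < d --> ?good s' = ?good s0" for s0
		proof -
			from sections_around[OF HE[OF y0, of s0]] obtain W where W: "openin (top_of_set E) W" "H s0 y0 \<in> W"
				"sections_over W"
				by (elim exE conjE)
			have "p (G y0 s0) \<in> W" unfolding G2[OF y0] by (rule W(2))
			from mp[OF bspec[OF W(3) GX[OF y0]] this] obtain \<sigma> where \<sigma>: "continuous_map (top_of_set W) X \<sigma>"
				"\<sigma> (p (G y0 s0)) = G y0 s0" "\<forall>y\<in>W. p (\<sigma> y) = y" by (elim exE conjE)
			let ?O = "{z \<in> topspace (prod_topology euclideanreal Y). H (fst z) (snd z) \<in> W}"
			have O: "openin (prod_topology euclideanreal Y) ?O" by (rule openin_continuous_map_preimage[OF H W(1)])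
			have "(s0, y0) \<in> ?O" using y0 W(2) by simp
			with O have "\<exists>U V. openin euclideanreal U \<and> openin Y V \<and> s0 \<in> U \<and> y0 \<in> V \<and> U \<times> V \<subseteq> ?O"
				unfolding openin_prod_topology_alt by (elim allE impE)
			then obtain U V where UV: "openin euclideanreal U" "openin Y V" "s0 \<in> U" "y0 \<in> V" "U \<times> V \<subseteq> ?O" by (elim exE conjE)
			have "open U" using UV(1) by simp
			then obtain d where d: "d > 0" "ball s0 d \<subseteq> U" using UV(3) by (rule openE)
			let ?J = "ball s0 d"
			have HW: "H t y \<in> W" if "t \<in> ?J" "y \<in> V" for t y
			proof -
				have "(t, y) \<in> ?O" by (rule subsetD[OF UV(5) SigmaI[OF subsetD[OF d(2) that(1)] that(2)]])
				thus ?thesis by simp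
			qed
			have VY: "V \<subseteq> topspace Y" by (rule openin_subset[OF UV(2)])
			have cont\<sigma>: "continuous_map (top_of_set ?J) X (\<lambda>t. \<sigma> (H t y))" if y: "y \<in> V" for y
			proof -
				have "continuous_map (top_of_set ?J) (top_of_set W) (\<lambda>t. H t y)"
					using continuous_on_subset[OF Hc[OF subsetD[OF VY y]] subset_UNIV] HW[OF _ y]
					by (auto simp: continuous_map_in_subtopology)
				from continuous_map_compose[OF this \<sigma>(1)] show ?thesis unfolding o_def .
			qed
			have agree: "G y t = \<sigma> (H t y)" if y: "y \<in> V" and t1: "t1 \<in> ?J" "G y t1 = \<sigma> (H t1 y)" and t: "t \<in> ?J" for y t1 t
			proof (rule lifts_agree[of ?J "G y" "\<lambda>t. \<sigma> (H t y)" t1 t])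
				show "continuous_map (top_of_set ?J) X (G y)"
					by (rule continuous_map_from_subtopology[OF G1[OF subsetD[OF VY y]]])
				show "p (G y u) = p (\<sigma> (H u y))" if u: "u \<in> ?J" for u
					unfolding G2[OF subsetD[OF VY y]] using bspec[OF \<sigma>(3) HW[OF u y]] by (rule sym)
			qed (use t1 t cont\<sigma>[OF y] in simp_all)
			have trans: "?good s'" if g: "?good s" and s: "s \<in> ?J" and s': "s' \<in> ?J" for s s'
			proof -
				from g obtain U1 where U1: "openin Y U1" "y0 \<in> U1" "continuous_map (subtopology Y U1) X (\<lambda>y. G y s)" by (elim exE conjE)
				have s0J: "s0 \<in> ?J" using d(1) by simp
				have eq0: "G y0 s = \<sigma> (H s y0)"
					by (rule agree[OF UV(4) s0J _ s]) (use \<sigma>(2) G2[OF y0] in simp)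
				from loc_inj[OF GX[OF y0, of s]] obtain N where N: "openin X N" "G y0 s \<in> N" "inj_on p N" by (elim exE conjE)
				let ?Z = "subtopology Y (U1 \<inter> V)"
				have oUV: "openin Y (U1 \<inter> V)" by (rule openin_Int[OF U1(1) UV(2)])
				have tZ: "topspace ?Z = U1 \<inter> V" using openin_subset[OF oUV] by (simp add: Int_absorb1)
				have c1: "continuous_map ?Z X (\<lambda>y. G y s)"
					by (rule continuous_map_from_subtopology_mono[OF U1(3) Int_lower1])
				have cH: "continuous_map (subtopology Y V) X (\<lambda>y. \<sigma> (H t y))" if t: "t \<in> ?J" for t
				proof -
					have "continuous_map Y (prod_topology euclideanreal Y) (\<lambda>y. (t, y))"
						unfolding continuous_map_pairwise o_def fst_conv snd_conv by simp
					from continuous_map_compose[OF this H] have "continuous_map Y euclidean (\<lambda>y. H t y)"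
						unfolding o_def fst_conv snd_conv by (simp add: continuous_map_in_subtopology)
					hence "continuous_map (subtopology Y V) (top_of_set W) (\<lambda>y. H t y)"
						using HW[OF t] by (auto simp: continuous_map_in_subtopology continuous_map_from_subtopology)
					from continuous_map_compose[OF this \<sigma>(1)] show ?thesis unfolding o_def .
				qed
				have c2: "continuous_map ?Z X (\<lambda>y. \<sigma> (H s y))"
					by (rule continuous_map_from_subtopology_mono[OF cH[OF s] Int_lower2])
				\<comment> \<open>Here the lifted path and the local section lie in one sheet \<open>N\<close>
				  at time \<open>s\<close>, hence coincide; by uniqueness of lifts they then coincide on all of
				  \<open>?J\<close>.\<close>
				let ?\<Omega> = "{y \<in> topspace ?Z. G y s \<in> N} \<inter> {y \<in> topspace ?Z. \<sigma> (H s y) \<in> N}"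
				have "openin ?Z ?\<Omega>"
					by (rule openin_Int[OF openin_continuous_map_preimage[OF c1 N(1)] openin_continuous_map_preimage[OF c2 N(1)]])
				hence o\<Omega>: "openin Y ?\<Omega>" by (rule openin_trans_full[OF _ oUV])
				have \<Omega>V: "?\<Omega> \<subseteq> V" unfolding tZ by blast
				have eq: "G y s' = \<sigma> (H s' y)" if y: "y \<in> ?\<Omega>" for y
				proof (rule agree[OF subsetD[OF \<Omega>V y] s _ s'])
					have yV: "y \<in> V" by (rule subsetD[OF \<Omega>V y])
					have "p (G y s) = p (\<sigma> (H s y))"
						unfolding G2[OF subsetD[OF VY yV]] using bspec[OF \<sigma>(3) HW[OF s yV]] by (rule sym)
					thus "G y s = \<sigma> (H s y)" by (rule inj_onD[OF N(3)]) (use y in simp_all)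
				qed
				have "y0 \<in> ?\<Omega>" unfolding tZ using U1(2) UV(4) N(2) eq0 by simp
				moreover have "continuous_map (subtopology Y ?\<Omega>) X (\<lambda>y. G y s')"
				proof (rule continuous_map_eq[OF continuous_map_from_subtopology_mono[OF cH[OF s'] \<Omega>V]])
					fix y assume "y \<in> topspace (subtopology Y ?\<Omega>)"
					hence "y \<in> ?\<Omega>" unfolding topspace_subtopology by (rule IntD2)
					from eq[OF this] show "\<sigma> (H s' y) = G y s'" by (rule sym)
				qed
				ultimately show ?thesis using o\<Omega> by (intro exI[of _ ?\<Omega>] conjI)
			qed
			have "?good s' = ?good s0" if "\<bar>s' - s0\<bar> < d" for s'
			proof -
				have J: "s' \<in> ?J" "s0 \<in> ?J" using that d(1) by (simp_all add: dist_real_def abs_minus_commute)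
				show ?thesis by (rule iffI) (erule trans[OF _ J], erule trans[OF _ J(2,1)])
			qed
			with d(1) show ?thesis by (intro exI[of _ d] conjI allI impI)
		qed
		have "continuous_map Y X (\<lambda>y. G y 0)"
		proof (rule continuous_map_eq[of _ _ "\<lambda>y. x0"])
			show "continuous_map Y X (\<lambda>y. x0)" using x0(1) by simp
			show "x0 = G y 0" if "y \<in> topspace Y" for y using G3[OF that] by simp
		qed
		hence "?good 0" using y0 by (intro exI[of _ "topspace Y"] conjI) simp_all
		moreover have "?good s = ?good 0" by (rule locally_constant_real[of ?good, OF step])
		ultimately show ?thesis by (rule iffD2[rotated])
	qed
	have "continuous_map Y X (\<lambda>y. G y 1)" by (rule continuous_map_local) (rule good)
	with G2 show ?thesis by (intro exI[of _ "\<lambda>y. G y 1"] conjI ballI)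
qed

end

section \<open>Simple connectedness of the sphere\<close>

lemma punctured_cap_connected:
	fixes e :: "'a::euclidean_space"
	assumes dim: "3 \<le> DIM('a)" and e: "norm e = 1" and W: "openin (top_of_set (sphere 0 1)) W" "e \<in> W"
	shows "\<exists>U. openin (top_of_set (sphere 0 1)) U \<and> e \<in> U \<and> U \<subseteq> W \<and> connected (U - {e}) \<and> U - {e} \<noteq> {}"
proof -
	\<comment> \<open>The cap is the graph over a disc orthogonal to \<open>e\<close>. This disc has
	  dimension at least 2, so it stays connected without its centre.\<close>
	let ?\<phi> = "\<lambda>w. w + sqrt (1 - w \<bullet> w) *. e"
	have ee: "e \<bullet> e = 1" using e by (simp add: dot_square_norm)
	obtain V where V: "open V" "W = sphere 0 1 \<inter> V" using W(1) unfolding openin_open by blast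
	have "continuous_on UNIV ?\<phi>" by (intro continuous_intros)
	hence "open (?\<phi> -` V)" by (rule open_vimage[OF V(1)])
	moreover have "0 \<in> ?\<phi> -` V" using W(2) V(2) by simp
	ultimately obtain d where d: "d > 0" "ball 0 d \<subseteq> ?\<phi> -` V" by (rule openE)
	define \<rho> where "\<rho> = min d 1"
	have \<rho>: "\<rho> > 0" "\<rho> \<le> d" "\<rho> \<le> 1" using d(1) by (simp_all add: \<rho>_def)
	let ?C = "{w. e \<bullet> w = 0} \<inter> ball 0 \<rho>"
	define U where "U = {q \<in> sphere 0 1. 0 < q \<bullet> e \<and> norm (q - (q \<bullet> e) *. e) < \<rho>}"
	have img: "?\<phi> w \<in> U" if w: "w \<in> ?C" for w
	proof -
		have w': "e \<bullet> w = 0" "norm w < \<rho>" using w by simp_all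
		have "norm w * norm w < 1 * 1" by (rule mult_strict_mono) (use w'(2) \<rho>(3) in auto)
		hence lt: "w \<bullet> w < 1" by (simp add: dot_square_norm power2_eq_square)
		hence s: "sqrt (1 - w \<bullet> w) > 0" "sqrt (1 - w \<bullet> w) * sqrt (1 - w \<bullet> w) = 1 - w \<bullet> w" by simp_all
		have we: "w \<bullet> e = 0" using w'(1) by (simp add: inner_commute)
		have q: "?\<phi> w \<bullet> e = sqrt (1 - w \<bullet> w)" by (simp add: inner_add_left ee we)
		have "?\<phi> w \<bullet> ?\<phi> w = 1"
			using lt by (simp add: inner_add_left inner_add_right ee we w'(1) abs_if)
		hence "norm (?\<phi> w) = 1" by (simp add: norm_eq_sqrt_inner)
		thus ?thesis unfolding U_def mem_Collect_eq q using s(1) w'(2) by simp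
	qed
	have inv: "q - (q \<bullet> e) *. e \<in> ?C \<and> ?\<phi> (q - (q \<bullet> e) *. e) = q" if q: "q \<in> U" for q
	proof -
		let ?w = "q - (q \<bullet> e) *. e"
		have q': "norm q = 1" "0 < q \<bullet> e" "norm ?w < \<rho>" using q unfolding U_def by simp_all
		have "q \<bullet> q = 1" using q'(1) by (simp add: dot_square_norm)
		hence "1 - ?w \<bullet> ?w = (q \<bullet> e) * (q \<bullet> e)"
			by (simp add: inner_diff_left inner_diff_right ee inner_commute[of e q])
		hence "sqrt (1 - ?w \<bullet> ?w) = q \<bullet> e" using q'(2) by simp
		moreover have "e \<bullet> ?w = 0" by (simp add: inner_diff_right ee inner_commute[of e q])
		ultimately show ?thesis using q'(3) by simp
	qed
	have \<phi>0: "?\<phi> w = e \<longleftrightarrow> w = 0" if w: "w \<in> ?C" for w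
	proof
		assume eq: "?\<phi> w = e"
		have "w \<bullet> w = w \<bullet> ?\<phi> w" using w by (simp add: inner_add_right inner_commute[of w e])
		also have "\<dots> = 0" unfolding eq using w by (simp add: inner_commute)
		finally show "w = 0" by simp
	qed simp
	have UC: "U - {e} = ?\<phi> ` (?C - {0})"
	proof (intro equalityI subsetI)
		fix q assume q: "q \<in> U - {e}"
		let ?w = "q - (q \<bullet> e) *. e"
		have "?w \<in> ?C" "?\<phi> ?w = q" using inv[of q] q by blast+
		moreover have "?w \<noteq> 0" using q calculation(2) \<phi>0[OF calculation(1)] by auto
		ultimately show "q \<in> ?\<phi> ` (?C - {0})" by (intro image_eqI[of _ _ ?w]) auto
	next
		fix q assume "q \<in> ?\<phi> ` (?C - {0})"
		then obtain w where "w \<in> ?C" "w \<noteq> 0" "q = ?\<phi> w" by blast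
		thus "q \<in> U - {e}" using img[of w] \<phi>0[of w] by simp
	qed
	have e0: "e \<noteq> 0" using e by auto
	have aff: "aff_dim ?C = int (DIM('a)) - 1"
	proof -
		have "aff_dim ?C = aff_dim {w. e \<bullet> w = 0}"
		proof (rule aff_dim_convex_Int_open)
			have "0 \<in> ?C" using \<rho>(1) by simp
			thus "?C \<noteq> {}" by blast
		qed (simp_all add: convex_hyperplane)
		thus ?thesis using aff_dim_hyperplane[OF e0, of 0] by simp
	qed
	have "connected (?C - {0})"
		by (rule path_connected_imp_connected[OF path_connected_punctured_convex])
			(use aff dim in \<open>auto intro: convex_Int convex_hyperplane\<close>)
	moreover have "continuous_on (?C - {0}) ?\<phi>" by (intro continuous_intros)
	ultimately have con: "connected (U - {e})" unfolding UC by (rule connected_continuous_image[rotated])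
	have ne: "U - {e} \<noteq> {}"
	proof
		assume "U - {e} = {}"
		hence "?C \<subseteq> {0}" unfolding UC by blast
		hence "aff_dim ?C \<le> 0" using aff_dim_subset[of ?C "{0}"] by simp
		with aff dim show False by simp
	qed
	have "open {q. 0 < q \<bullet> e \<and> norm (q - (q \<bullet> e) *. e) < \<rho>}"
		by (intro open_Collect_conj open_Collect_less continuous_intros)
	moreover have "U = sphere 0 1 \<inter> {q. 0 < q \<bullet> e \<and> norm (q - (q \<bullet> e) *. e) < \<rho>}" unfolding U_def by blast
	ultimately have oU: "openin (top_of_set (sphere 0 1)) U" by (simp only: openin_open_Int)
	have "U \<subseteq> W"
	proof
		fix q assume q: "q \<in> U"
		have "q - (q \<bullet> e) *. e \<in> ball 0 d" using inv[OF q] \<rho>(2) by simp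
		with d(2) have "?\<phi> (q - (q \<bullet> e) *. e) \<in> V" by blast
		thus "q \<in> W" unfolding V(2) using inv[OF q] q by (simp add: U_def)
	qed
	moreover have "e \<in> U" unfolding U_def using e ee \<rho>(1) by simp
	ultimately show ?thesis using oU con ne by (intro exI[of _ U] conjI)
qed

text \<open>Straight segments to \<open>e\<close> avoid the origin away from the antipode and are
  normalized. The time is clamped to the unit interval because \<open>homotopy_lifting\<close>
  expects all real times.\<close>

lemma sphere_contraction:
	fixes e :: "'a::euclidean_space"
	assumes e: "norm e = 1"
	defines "H \<equiv> \<lambda>t q. sgn ((1 - min 1 (max 0 t)) *. e + min 1 (max 0 t) *. q)"
	shows "continuous_map (prod_topology euclideanreal (top_of_set (sphere 0 1 - {- e}))) (top_of_set (sphere 0 1)) (\<lambda>z. H (fst z) (snd z))"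
		"H 0 q = e" "q \<in> sphere 0 1 ==> H 1 q = q"
proof -
	let ?g = "\<lambda>z. (1 - min 1 (max 0 (fst z))) *. e + min 1 (max 0 (fst z)) *. snd z"
	have nz: "?g z \<noteq> 0" if z: "snd z \<in> sphere 0 1 - {- e}" for z :: "real \<times> 'a"
	proof
		define c where "c = min 1 (max 0 (fst z))"
		have c: "0 \<le> c" "c \<le> 1" by (auto simp: c_def)
		assume "?g z = 0"
		hence eq: "(1 - c) *. e = - (c *. snd z)" unfolding c_def by (rule eq_neg_iff_add_eq_0[THEN iffD2])
		hence "norm ((1 - c) *. e) = norm (- (c *. snd z))" by (rule arg_cong)
		hence "1 - c = c" using z e c by simp
		hence c2: "c = 1/2" by simp
		have "2 *. ((1 - c) *. e) = 2 *. - (c *. snd z)" unfolding eq ..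
		hence "snd z = - e" unfolding c2 by simp
		with z show False by simp
	qed
	have "continuous_on (UNIV \<times> (sphere 0 1 - {- e})) (\<lambda>z. sgn (?g z))"
		by (intro continuous_on_sgn continuous_intros ballI nz) auto
	moreover have "prod_topology euclideanreal (top_of_set (sphere 0 1 - {- e})) = top_of_set (UNIV \<times> (sphere 0 1 - {- e}))"
		using prod_topology_subtopology(2)[of euclideanreal euclidean "sphere 0 1 - {- e}"] by (simp only: prod_topology_euclidean topspace_euclidean)
	moreover have "sgn (?g z) \<in> sphere 0 1" if "z \<in> UNIV \<times> (sphere 0 1 - {- e})" for z
		using nz[of z] that by (auto simp: norm_sgn mem_Times_iff)
	ultimately show "continuous_map (prod_topology euclideanreal (top_of_set (sphere 0 1 - {- e}))) (top_of_set (sphere 0 1)) (\<lambda>z. H (fst z) (snd z))"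
		unfolding H_def by (simp only: continuous_map_in_subtopology continuous_map_iff_continuous topspace_euclidean_subtopology) auto
	show "H 0 q = e" unfolding H_def using e by (simp add: sgn_div_norm)
	show "H 1 q = q" if "q \<in> sphere 0 1" unfolding H_def using that by (simp add: sgn_div_norm)
qed

text \<open>The sphere is simply connected in dimension at least 2.\<close>

lemma local_homeo_sphere:
	fixes p :: "'s => 'b::euclidean_space"
	assumes lh: "compact_local_homeo X p (sphere 0 1)" and dim: "3 \<le> DIM('b)"
		and con: "connected_space X" and ne: "topspace X \<noteq> {}"
	shows "inj_on p (topspace X)" "p ` topspace X = sphere 0 1"
proof -
	interpret compact_local_homeo X p "sphere 0 1" by (rule lh)
	obtain x0 where x0: "x0 \<in> topspace X" using ne by blast
	define e where "e = p x0"
	have e: "norm e = 1" using p_in[OF x0] by (simp add: e_def)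
	let ?S = "sphere (0::'b) 1" and ?Y = "sphere (0::'b) 1 - {- e}"
	note sc = sphere_contraction[OF e]
	\<comment> \<open>A section \<open>g\<close> over the sphere without the antipode of
	  \<open>e\<close>, obtained by lifting its contraction to \<open>e\<close>.\<close>
	from homotopy_lifting[of "top_of_set ?Y", OF sc(1) x0] sc(2)
	have "\<exists>g. continuous_map (top_of_set ?Y) X g \<and> (\<forall>y\<in>topspace (top_of_set ?Y). p (g y) = sgn ((1 - min 1 (max 0 1)) *. e + min 1 (max 0 1) *. y))"
		unfolding e_def by blast
	then obtain g where g: "continuous_map (top_of_set ?Y) X g" and "\<forall>y\<in>topspace (top_of_set ?Y). p (g y) = sgn ((1 - min 1 (max 0 1)) *. e + min 1 (max 0 1) *. y)"
		by (elim exE conjE)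
	hence pg: "p (g y) = y" if "y \<in> ?Y" for y using sc(3)[of y] that by simp
	have "- e \<in> ?S" using e by simp
	from sections_around[OF this] obtain W where W: "openin (top_of_set ?S) W" "- e \<in> W"
		"sections_over W"
		by (elim exE conjE)
	have "norm (- e) = 1" using e by simp
	from punctured_cap_connected[OF dim this W(1,2)] obtain U where U: "openin (top_of_set ?S) U" "- e \<in> U" "U \<subseteq> W"
		"connected (U - {- e})" "U - {- e} \<noteq> {}" by (elim exE conjE)
	have US: "U \<subseteq> ?S" using openin_subset[OF U(1)] by simp
	have UY: "U - {- e} \<subseteq> ?Y" using US by blast
	obtain q0 where q0: "q0 \<in> U - {- e}" using U(5) by blast
	have gX: "g y \<in> topspace X" if "y \<in> ?Y" for y
		using continuous_map_image_subset_topspace[OF g] that by auto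
	have q0W: "p (g q0) \<in> W" using pg[OF subsetD[OF UY q0]] q0 U(3) by auto
	from mp[OF bspec[OF W(3) gX[OF subsetD[OF UY q0]]] q0W] obtain \<sigma> where \<sigma>: "continuous_map (top_of_set W) X \<sigma>"
		"\<sigma> (p (g q0)) = g q0" "\<forall>y\<in>W. p (\<sigma> y) = y" by (elim exE conjE)
	\<comment> \<open>The section extends over the antipode: on the connected punctured cap it agrees
	  with a local section defined through the missing point.\<close>
	have agree: "g y = \<sigma> y" if y: "y \<in> U - {- e}" for y
	proof -
		have Z: "connected_space (top_of_set (U - {- e}))"
			using U(4) by (simp add: connectedin_def[symmetric] connected_space_subtopology)
		have c: "continuous_map (top_of_set (U - {- e})) X g" "continuous_map (top_of_set (U - {- e})) X \<sigma>"
			by (rule continuous_map_from_subtopology_mono[OF g UY], rule continuous_map_from_subtopology_mono[OF \<sigma>(1)]) (use U(3) in blast)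
		show ?thesis
		proof (rule lift_unique[OF Z haus c loc_inj])
			show "p (g z) = p (\<sigma> z)" if z: "z \<in> topspace (top_of_set (U - {- e}))" for z
			proof -
				have z': "z \<in> U - {- e}" using z by simp
				have "z \<in> W" using z' U(3) by blast
				from bspec[OF \<sigma>(3) this] pg[OF subsetD[OF UY z']] show ?thesis by simp
			qed
			show "g q0 = \<sigma> q0" using \<sigma>(2) unfolding pg[OF subsetD[OF UY q0]] by (rule sym)
		qed (use q0 y in simp_all)
	qed
	define s where "s y = (if y = - e then \<sigma> y else g y)" for y
	have ps: "p (s y) = y" if "y \<in> ?S" for y
		using that pg[of y] bspec[OF \<sigma>(3) W(2)] by (simp add: s_def)
	have sc: "continuous_map (top_of_set ?S) X s"
	proof (rule continuous_map_local)
		fix y assume "y \<in> topspace (top_of_set ?S)"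
		hence y: "y \<in> ?S" by simp
		show "\<exists>U. openin (top_of_set ?S) U \<and> y \<in> U \<and> continuous_map (subtopology (top_of_set ?S) U) X s"
		proof (cases "y = - e")
			case True
			have "continuous_map (top_of_set U) X s"
			proof (rule continuous_map_eq[OF continuous_map_from_subtopology_mono[OF \<sigma>(1) U(3)]])
				fix z assume "z \<in> topspace (top_of_set U)"
				thus "\<sigma> z = s z" using agree[of z] by (simp add: s_def)
			qed
			hence "continuous_map (subtopology (top_of_set ?S) U) X s"
				using US by (simp add: subtopology_subtopology Int_absorb1)
			with U(1,2) True show ?thesis by (intro exI[of _ U] conjI) simp_all
		next
			case False
			have "openin (top_of_set ?S) ?Y" by (simp add: Diff_eq openin_open_Int open_Compl)
			moreover have "continuous_map (top_of_set ?Y) X s"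
				by (rule continuous_map_eq[OF g]) (simp add: s_def)
			hence "continuous_map (subtopology (top_of_set ?S) ?Y) X s"
				by (simp add: subtopology_subtopology Int_absorb1)
			ultimately show ?thesis using y False by (intro exI[of _ ?Y] conjI) simp_all
		qed
	qed
	define z0 where "z0 = s e"
	have eS: "e \<in> ?S" using e by simp
	have z0: "z0 \<in> topspace X" using continuous_map_image_subset_topspace[OF sc] eS by (auto simp: z0_def)
	have pz0: "p z0 = e" unfolding z0_def by (rule ps[OF eS])
	\<comment> \<open>The map s o p and the identity lift the same map and agree at \<open>z0\<close>;
	  so \<open>s\<close> is a two-sided inverse of \<open>p\<close>.\<close>
	have "s (p x) = x" if x: "x \<in> topspace X" for x
	proof (rule lift_unique[OF con haus _ _ loc_inj])
		show "continuous_map X X (\<lambda>x. s (p x))" using continuous_map_compose[OF cont sc] unfolding o_def .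
		show "p (s (p z)) = p z" if "z \<in> topspace X" for z by (rule ps[OF p_in[OF that]])
		show "s (p z0) = z0" unfolding pz0 unfolding z0_def ..
	qed (use x z0 in simp_all)
	thus "inj_on p (topspace X)" by (rule inj_on_inverseI)
	show "p ` topspace X = ?S"
	proof (intro equalityI subsetI)
		fix y assume y: "y \<in> ?S"
		have "s y \<in> topspace X" using continuous_map_image_subset_topspace[OF sc] y by auto
		from imageI[OF this, of p] show "y \<in> p ` topspace X" unfolding ps[OF y] .
	qed (use p_in in blast)
qed

section \<open>The Gauss map as a local homeomorphism\<close>

context compact_hypersurface
begin

lemma dnu_inj:
	assumes c: "c \<in> charts_at S x"
	shows "inj (der c \<nu> x)"
proof -
	from definite obtain s where s: "\<forall>x. \<forall>c\<in>charts_at S x. \<forall>u. u \<noteq> 0 --> 0 < s * sff c x u"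
		by (elim exE conjE)
	have "u = 0" if "der c \<nu> x u = 0" for u
	proof (rule ccontr)
		assume "u \<noteq> 0"
		hence "0 < s * sff c x u" using s c by blast
		with that show False by simp
	qed
	thus ?thesis using linear_injective_0[OF dnu_linear[OF c]] by blast
qed

lemma range_dnu_eq:
	assumes c: "c \<in> charts_at S x"
	shows "range (der c \<nu> x) = {w. w \<bullet> \<nu> x = 0}"
proof (rule subspace_dim_equal)
	show "subspace (range (der c \<nu> x))" by (rule linear_subspace_image[OF dnu_linear[OF c] subspace_UNIV])
	show "subspace {w. w \<bullet> \<nu> x = 0}" by (simp add: subspace_hyperplane2)
	show "range (der c \<nu> x) \<subseteq> {w. w \<bullet> \<nu> x = 0}" using nu_orth[OF c] by blast
	have "dim {w. w \<bullet> \<nu> x = 0} = dim (range (der c f x))" unfolding range_df[OF c] ..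
	also have "\<dots> = CARD('k)"
		using dim_image_eq[OF df_linear[OF c] df_inj[OF c, THEN inj_on_subset, OF subset_UNIV], of UNIV] by simp
	also have "\<dots> = dim (range (der c \<nu> x))"
		using dim_image_eq[OF dnu_linear[OF c] dnu_inj[OF c, THEN inj_on_subset, OF subset_UNIV], of UNIV] by simp
	finally show "dim {w. w \<bullet> \<nu> x = 0} \<le> dim (range (der c \<nu> x))" by simp
qed

lemma nu_in_sphere: "x \<in> pts S ==> \<nu> x \<in> sphere 0 1"
	using norm_nu by simp

lemma chart_nu:
	assumes c: "c \<in> charts_at S x"
	shows "open (cod c)" "snd c x \<in> cod c" "Cr_on r (\<lambda>y. \<nu> (chart_inv c y)) (cod c)"
		"Df (\<lambda>y. \<nu> (chart_inv c y)) (snd c x) = der c \<nu> x" "\<nu> (chart_inv c (snd c x)) = \<nu> x"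
	using chart_open[of c] cr_fun_Cr_on[OF nu, of c] charts_atD[OF c] by (simp_all add: chart_deriv_def o_def)

lemma nu_locally_injective:
	assumes x: "x \<in> pts S"
	shows "\<exists>N. openin (mtop S) N \<and> x \<in> N \<and> inj_on \<nu> N"
proof -
	obtain c where c: "c \<in> charts_at S x" using ex_chart[OF x] by blast
	note c' = charts_atD[OF c]
	let ?g = "\<lambda>y. \<nu> (chart_inv c y)"
	note cn = chart_nu[OF c]
	have "inj (Df ?g (snd c x))" unfolding cn(4) by (rule dnu_inj[OF c])
	from Cr_on_locally_injective[OF cn(1-3) this] obtain s where s: "s > 0" "inj_on ?g (ball (snd c x) s)" by (elim exE conjE)
	let ?N = "{p \<in> fst c. snd c p \<in> ball (snd c x) s}"
	have "inj_on \<nu> ?N"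
	proof (rule inj_onI)
		fix p q assume p: "p \<in> ?N" and q: "q \<in> ?N" and eq: "\<nu> p = \<nu> q"
		have "?g (snd c p) = ?g (snd c q)" using p q eq c'(1) by simp
		from inj_onD[OF s(2) this] p q have "snd c p = snd c q" by simp
		from inj_onD[OF chart_inj[OF c'(1)] this] p q show "p = q" by simp
	qed
	moreover have "openin (mtop S) ?N" by (rule chart_preimage_openin[OF c'(1) open_ball])
	moreover have "x \<in> ?N" using c'(2) s(1) by simp
	ultimately show ?thesis by (intro exI[of _ ?N] conjI)
qed

text \<open>A projection along \<open>\<nu> x\<close> is injective on the hemisphere around \<open>\<nu> x\<close>.\<close>

lemma ex_projection:
	assumes c: "c \<in> charts_at S x"
	shows "\<exists>Q :: real ^ 'n => real ^ 'k. linear Q \<and> (\<forall>u. Q (der c \<nu> x u) = u) \<and>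
		(\<forall>q\<in>sphere 0 1. \<forall>q'\<in>sphere 0 1. 0 < q \<bullet> \<nu> x --> 0 < q' \<bullet> \<nu> x --> Q q = Q q' --> q = q')"
proof -
	have n: "\<nu> x \<bullet> \<nu> x = 1" using norm_nu[OF charts_at_topspace[OF c]] by (simp add: dot_square_norm)
	from linear_injective_left_inverse[OF dnu_linear[OF c] dnu_inj[OF c]]
	obtain g where g: "linear g" "g \<circ> der c \<nu> x = id" by (elim exE conjE)
	have gB: "g (der c \<nu> x u) = u" for u using fun_cong[OF g(2), of u] by simp
	define Q where "Q w = g (w - (w \<bullet> \<nu> x) *. \<nu> x)" for w
	have lin: "linear Q" unfolding Q_def
		by (rule linear_compose[OF _ g(1), unfolded o_def], rule linearI) (simp_all add: inner_add_left algebra_simps)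
	have QB: "Q (der c \<nu> x u) = u" for u
		unfolding Q_def nu_orth[OF c] by (simp add: gB)
	have ker: "w = (w \<bullet> \<nu> x) *. \<nu> x" if w: "Q w = 0" for w
	proof -
		have "w - (w \<bullet> \<nu> x) *. \<nu> x \<in> range (der c \<nu> x)"
			unfolding range_dnu_eq[OF c] by (simp add: inner_diff_left n)
		then obtain u where u: "w - (w \<bullet> \<nu> x) *. \<nu> x = der c \<nu> x u" by (rule rangeE)
		have "u = 0" using w unfolding Q_def u gB .
		hence "w - (w \<bullet> \<nu> x) *. \<nu> x = 0" using u linear_0[OF dnu_linear[OF c]] by simp
		thus ?thesis by simp
	qed
	have "q = q'" if q: "q \<in> sphere 0 1" "q' \<in> sphere 0 1" "0 < q \<bullet> \<nu> x" "0 < q' \<bullet> \<nu> x" "Q q = Q q'" for q q'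
	proof -
		define t where "t = (q - q') \<bullet> \<nu> x"
		have "Q (q - q') = 0" using linear_diff[OF lin, of q q'] q(5) by simp
		from ker[OF this] have d: "q - q' = t *. \<nu> x" unfolding t_def .
		have "q \<bullet> q = 1" "q' \<bullet> q' = 1" using q(1,2) by (simp_all add: dot_square_norm)
		hence "(q - q') \<bullet> (q + q') = 0" by (simp add: inner_diff_left inner_diff_right inner_add_right inner_commute[of q' q])
		hence "t * (\<nu> x \<bullet> (q + q')) = 0" unfolding d by simp
		moreover have "\<nu> x \<bullet> (q + q') > 0" using q(3,4) by (simp add: inner_add_right inner_commute)
		ultimately have "t = 0" by simp
		with d show ?thesis by simp
	qed
	with lin QB show ?thesis by (intro exI[of _ Q] conjI allI ballI impI)
qed

text \<open>Composed with a projection \<open>Q\<close> to the tangent directions, \<nu> becomes a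
  local homeomorphism between spaces of equal dimension, so its image is open. It is pulled back to
  the sphere on the hemisphere on which \<open>Q\<close> is injective.\<close>

lemma nu_open_map: "open_map (mtop S) (top_of_set (sphere 0 1)) \<nu>"
	unfolding open_map_def
proof (intro allI impI)
	fix N assume N: "openin (mtop S) N"
	show "openin (top_of_set (sphere 0 1)) (\<nu> ` N)"
	proof (subst openin_subopen, rule ballI)
		fix q assume "q \<in> \<nu> ` N"
		then obtain x where q: "q = \<nu> x" and xN: "x \<in> N" by blast
		have x: "x \<in> pts S" using xN openin_subset[OF N] by blast
		obtain c where c: "c \<in> charts_at S x" using ex_chart[OF x] by blast
		note c' = charts_atD[OF c]
		let ?V = "cod c" and ?g = "\<lambda>y. \<nu> (chart_inv c y)"
		note cn = chart_nu[OF c]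
		from ex_projection[OF c] obtain Q :: "real ^ 'n => real ^ 'k" where Q: "linear Q" "\<forall>u. Q (der c \<nu> x u) = u"
			and Qi: "\<forall>q\<in>sphere 0 1. \<forall>q'\<in>sphere 0 1. 0 < q \<bullet> \<nu> x --> 0 < q' \<bullet> \<nu> x --> Q q = Q q' --> q = q'"
			by (elim exE conjE)
		have bl: "bounded_linear Q" using Q(1) by (simp add: linear_conv_bounded_linear)
		let ?h = "\<lambda>y. Q (?g y)"
		have h: "Cr_on r ?h ?V" by (rule Cr_on_linear_compose[OF cn(1) bl cn(3)])
		have "(?h has_derivative (\<lambda>u. Q (der c \<nu> x u))) (at (snd c x))"
			by (rule bounded_linear.has_derivative[OF bl chart_deriv_works[OF nu c]])
		from frechet_derivative_at[OF this] have "Df ?h (snd c x) = (\<lambda>u. u)" using Q(2) by simp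
		hence "inj (Df ?h (snd c x))" by (simp add: inj_on_def)
		from Cr_on_locally_injective[OF cn(1,2) h this] obtain s where s: "s > 0" "ball (snd c x) s \<subseteq> ?V" "inj_on ?h (ball (snd c x) s)"
			by (elim exE conjE)
		let ?P = "?V \<inter> (\<lambda>y. ?g y \<bullet> \<nu> x) -` {0<..}"
		have "continuous_on ?V (\<lambda>y. ?g y \<bullet> \<nu> x)"
			by (intro continuous_on_inner continuous_on_const Cr_on_continuous[OF cn(3)])
		from continuous_open_preimage[OF this cn(1) open_greaterThan] have oP: "open ?P" .
		let ?B = "ball (snd c x) s \<inter> (snd c ` (fst c \<inter> N) \<inter> ?P)"
		have oB: "open ?B" by (intro open_Int open_ball chart_image_open[OF c'(1) N] oP)
		have "continuous_on ?B ?h" by (rule continuous_on_subset[OF Cr_on_continuous[OF h]]) blast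
		moreover have "inj_on ?h ?B" by (rule inj_on_subset[OF s(3) Int_lower1])
		ultimately have oh: "open (?h ` ?B)" using oB by (intro invariance_of_domain)
		let ?T = "sphere 0 1 \<inter> ({q'. 0 < q' \<bullet> \<nu> x} \<inter> Q -` (?h ` ?B))"
		have "open {q'. 0 < q' \<bullet> \<nu> x}" by (intro open_Collect_less continuous_intros)
		moreover have "open (Q -` (?h ` ?B))" by (rule open_vimage[OF oh linear_continuous_on[OF bl]])
		ultimately have "openin (top_of_set (sphere 0 1)) ?T" by (intro openin_open_Int open_Int)
		moreover have "q \<in> ?T"
		proof -
			have n: "\<nu> x \<bullet> \<nu> x = 1" using norm_nu[OF x] by (simp add: dot_square_norm)
			have "snd c x \<in> ?B"
				using s(1) cn(2,5) c'(2) xN n by auto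
			hence "?h (snd c x) \<in> ?h ` ?B" by (rule imageI)
			thus ?thesis unfolding q cn(5) using nu_in_sphere[OF x] n by simp
		qed
		moreover have "?T \<subseteq> \<nu> ` N"
		proof
			fix q' assume "q' \<in> ?T"
			hence q': "q' \<in> sphere 0 1" "0 < q' \<bullet> \<nu> x" and "Q q' \<in> ?h ` ?B" by simp_all
			then obtain y where y: "y \<in> ?B" "Q q' = ?h y" by blast
			obtain p where p: "p \<in> fst c" "p \<in> N" "y = snd c p" using y(1) by blast
			have gy: "?g y = \<nu> p" using p(1,3) c'(1) by simp
			have "0 < \<nu> p \<bullet> \<nu> x" using y(1) unfolding gy[symmetric] by simp
			moreover have "\<nu> p \<in> sphere 0 1" using p(2) openin_subset[OF N] nu_in_sphere by blast
			ultimately have "q' = \<nu> p" using Qi q' y(2) unfolding gy by blast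
			with p(2) show "q' \<in> \<nu> ` N" by blast
		qed
		ultimately show "\<exists>T. openin (top_of_set (sphere 0 1)) T \<and> q \<in> T \<and> T \<subseteq> \<nu> ` N" by (intro exI[of _ ?T] conjI)
	qed
qed

lemma nu_local_homeo: "compact_local_homeo (mtop S) \<nu> (sphere 0 1)"
proof
	show "continuous_map (mtop S) (top_of_set (sphere 0 1)) \<nu>"
		using cr_fun_continuous[OF nu] nu_in_sphere by (auto simp: continuous_map_in_subtopology)
qed (use compact hausdorff nu_open_map nu_locally_injective in auto)

end

lemma (in hypersurface) Cr_immersion_f: "Cr_immersion r S flat f"
	unfolding Cr_immersion_def
proof (intro conjI ballI)
	show "Cr_map r S flat f" by (rule Cr_map_flat_iff[THEN iffD2, OF f])
	fix x assume "x \<in> pts S"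
	then obtain c where c: "c \<in> charts_at S x" using ex_chart by blast
	show "immersion_at S flat f x" unfolding immersion_at_flat_iff[OF f c] by (rule df_inj[OF c])
qed

section \<open>Convexity for n at least 3\<close>

locale convex_hypersurface = compact_hypersurface r S f \<nu> \<kappa>0
	for r :: regularity and S :: "('s, real ^ 'k) mfd" and f \<nu> :: "'s => real ^ 'n" and \<kappa>0 +
	assumes dim3: "3 \<le> CARD('n)"
begin

lemma nu_inj: "inj_on \<nu> (pts S)" and nu_onto: "\<nu> ` pts S = sphere 0 1"
	using local_homeo_sphere[OF nu_local_homeo _ connected nonempty] dim3 by simp_all

text \<open>A constant height function makes every point critical, so \<open>a\<close> is normal
  everywhere; but the Gauss map is onto and takes a value orthogonal to \<open>a\<close>.\<close>

lemma height_not_constant: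
	assumes a: "a \<noteq> 0" and const: "\<And>x y. x \<in> pts S ==> y \<in> pts S ==> f x \<bullet> a = f y \<bullet> a"
	shows False
proof -
	have "2 \<le> DIM(real ^ 'n)" using card_n by simp
	from orthogonal_to_vector_exists[OF this, of a] obtain b where b: "b \<noteq> 0" "orthogonal a b" by blast
	have "sgn b \<in> sphere 0 1" using b(1) by (simp add: norm_sgn)
	then obtain x where x: "x \<in> pts S" "\<nu> x = sgn b" unfolding nu_onto[symmetric] by auto
	have "f y \<bullet> a \<le> f x \<bullet> a" if "y \<in> pts S" for y using const[OF that x(1)] by simp
	from height_critical[OF x(1) this] have "a = (a \<bullet> sgn b) *. sgn b" unfolding x(2) .
	moreover have "a \<bullet> sgn b = 0" using b(2) by (simp add: orthogonal_def sgn_div_norm)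
	ultimately show False using a by simp
qed

lemma height_constant_False:
	assumes "a \<noteq> 0" and const: "\<And>y. y \<in> pts S ==> f y \<bullet> a = b"
	shows False
	by (rule height_not_constant[OF assms(1)]) (simp only: const)

lemma critical_normal:
	assumes x: "x \<in> pts S" and a: "norm a = 1"
		and max: "\<And>y. y \<in> pts S ==> f y \<bullet> a \<le> f x \<bullet> a"
	shows "\<nu> x = a \<or> \<nu> x = - a"
proof -
	have eq: "a = (a \<bullet> \<nu> x) *. \<nu> x" by (rule height_critical[OF x max])
	hence "norm a = \<bar>a \<bullet> \<nu> x\<bar> * norm (\<nu> x)" by (metis norm_scaleR)
	hence "\<bar>a \<bullet> \<nu> x\<bar> = 1" using a norm_nu[OF x] by simp
	hence "a \<bullet> \<nu> x = 1 \<or> a \<bullet> \<nu> x = - 1" by linarith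
	thus ?thesis
	proof
		assume "a \<bullet> \<nu> x = 1" with eq show ?thesis by simp
	next
		assume "a \<bullet> \<nu> x = - 1" with eq have "a = - \<nu> x" by simp
		thus ?thesis by simp
	qed
qed

text \<open>The points whose tangent hyperplane has the hypersurface on one side; only the sign of
  \<tau> matters, and the factor treats both sides together.\<close>

definition below :: "real => 's set" where
	"below \<tau> = {x \<in> pts S. \<forall>y\<in>pts S. \<tau> * ((f y - f x) \<bullet> \<nu> x) \<le> 0}"

lemma below_closedin: "closedin (mtop S) (below \<tau>)"
proof -
	have "closedin (mtop S) {x \<in> pts S. \<tau> * ((f y - f x) \<bullet> \<nu> x) \<in> {..0}}" for y
	proof (rule closedin_continuous_map_preimage)
		have fn: "continuous_map (mtop S) euclidean (\<lambda>x. (f x, \<nu> x))"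
			by (rule cr_fun_continuous[OF cr_fun_Pair[OF f nu]])
		have "continuous_map euclidean euclidean (\<lambda>z :: (real ^ 'n) \<times> (real ^ 'n). \<tau> * ((f y - fst z) \<bullet> snd z))"
			by (simp add: continuous_map_iff_continuous2) (intro continuous_intros)
		from continuous_map_compose[OF fn this]
		show "continuous_map (mtop S) euclidean (\<lambda>x. \<tau> * ((f y - f x) \<bullet> \<nu> x))"
			unfolding o_def fst_conv snd_conv .
	qed simp
	hence "closedin (mtop S) (\<Inter>y\<in>pts S. {x \<in> pts S. \<tau> * ((f y - f x) \<bullet> \<nu> x) \<in> {..0}})"
		using nonempty by (intro closedin_INT) auto
	moreover have "below \<tau> = (\<Inter>y\<in>pts S. {x \<in> pts S. \<tau> * ((f y - f x) \<bullet> \<nu> x) \<in> {..0}})"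
	proof -
		obtain y0 where "y0 \<in> pts S" using nonempty by blast
		thus ?thesis unfolding below_def by auto
	qed
	ultimately show ?thesis by simp
qed

text \<open>The maximum and the minimum of the height in direction \<nu> x have normals \<nu> x or
  its negative. Both cannot have the negative, as they would coincide by injectivity and the height
  would be constant; so \<open>x\<close> itself is one of the two. The two closed cases are
  disjoint, and connectedness selects one.\<close>

lemma one_sided: "\<exists>\<tau>. \<tau> \<noteq> 0 \<and> below \<tau> = pts S"
proof -
	have cover: "x \<in> below 1 \<or> x \<in> below (- 1)" if x: "x \<in> pts S" for x
	proof -
		have n: "norm (\<nu> x) = 1" "norm (- \<nu> x) = 1" using norm_nu[OF x] by simp_all
		have "\<exists>x'\<in>pts S. \<forall>y\<in>pts S. f y \<bullet> \<nu> x \<le> f x' \<bullet> \<nu> x"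
			by (rule attains_max[OF cr_fun_continuous[OF height_cr]])
		then obtain M where M: "M \<in> pts S" "\<forall>y\<in>pts S. f y \<bullet> \<nu> x \<le> f M \<bullet> \<nu> x" by (rule bexE)
		have "\<exists>x'\<in>pts S. \<forall>y\<in>pts S. f y \<bullet> (- \<nu> x) \<le> f x' \<bullet> (- \<nu> x)"
			by (rule attains_max[OF cr_fun_continuous[OF height_cr]])
		then obtain m where m: "m \<in> pts S" "\<forall>y\<in>pts S. f y \<bullet> (- \<nu> x) \<le> f m \<bullet> (- \<nu> x)" by (rule bexE)
		have "\<nu> M = \<nu> x \<or> \<nu> M = - \<nu> x" by (rule critical_normal[OF M(1) n(1) bspec[OF M(2)]])
		moreover have "\<nu> m = - \<nu> x \<or> \<nu> m = - (- \<nu> x)" by (rule critical_normal[OF m(1) n(2) bspec[OF m(2)]])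
		moreover have "\<not> (\<nu> M = - \<nu> x \<and> \<nu> m = - \<nu> x)"
		proof
			assume "\<nu> M = - \<nu> x \<and> \<nu> m = - \<nu> x"
			hence "M = m" using inj_onD[OF nu_inj, of M m] M(1) m(1) by simp
			have "f y \<bullet> \<nu> x = f M \<bullet> \<nu> x" if "y \<in> pts S" for y
				using bspec[OF M(2) that] bspec[OF m(2) that] unfolding \<open>M = m\<close> inner_minus_right by linarith
			moreover have "\<nu> x \<noteq> 0" using n(1) by auto
			ultimately show False by (rule height_constant_False[rotated])
		qed
		ultimately consider "\<nu> M = \<nu> x" | "\<nu> m = \<nu> x" by fastforce
		thus ?thesis
		proof cases
			case 1
			hence "M = x" by (rule inj_onD[OF nu_inj _ M(1) x])
			thus ?thesis using M(2) x by (simp add: below_def inner_diff_left)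
		next
			case 2
			hence "m = x" by (rule inj_onD[OF nu_inj _ m(1) x])
			thus ?thesis using m(2) x by (simp add: below_def inner_diff_left)
		qed
	qed
	have disj: "below 1 \<inter> below (- 1) = {}"
	proof (rule ccontr)
		assume "below 1 \<inter> below (- 1) \<noteq> {}"
		then obtain x where x: "x \<in> below 1" "x \<in> below (- 1)" by blast
		have xS: "x \<in> pts S" using x(1) by (simp add: below_def)
		have const: "f y \<bullet> \<nu> x = f x \<bullet> \<nu> x" if "y \<in> pts S" for y
		proof -
			have "(f y - f x) \<bullet> \<nu> x \<le> 0" "0 \<le> (f y - f x) \<bullet> \<nu> x" using x that by (simp_all add: below_def)
			thus ?thesis by (simp add: inner_diff_left)
		qed
		have "\<nu> x \<noteq> 0" using norm_nu[OF xS] by auto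
		from height_constant_False[OF this const] show False .
	qed
	have sub: "below \<tau> \<subseteq> pts S" for \<tau> by (auto simp: below_def)
	have "below (- 1) = pts S - below 1" using cover disj sub by blast
	hence "openin (mtop S) (below 1)"
		using below_closedin[of "- 1"] sub[of 1] by (simp add: closedin_def double_diff)
	from spec[OF connected[unfolded connected_space_clopen_in], THEN mp, OF conjI[OF this below_closedin]]
	have "below 1 = {} \<or> below 1 = pts S" .
	thus ?thesis
	proof
		assume "below 1 = {}"
		with \<open>below (- 1) = pts S - below 1\<close> show ?thesis by (intro exI[of _ "- 1"]) simp
	next
		assume "below 1 = pts S" thus ?thesis by (intro exI[of _ 1]) simp
	qed
qed

text \<open>Maximizers have normals parallel to \<open>a\<close>. Equal normals mean equal points;
  opposite normals would put the hypersurface on both sides of one hyperplane, hence inside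
  it.\<close>

lemma maximizer_unique:
	assumes a: "a \<noteq> 0" and x: "x \<in> pts S" and y: "y \<in> pts S"
		and maxx: "\<And>z. z \<in> pts S ==> f z \<bullet> a \<le> f x \<bullet> a"
		and maxy: "\<And>z. z \<in> pts S ==> f z \<bullet> a \<le> f y \<bullet> a"
	shows "x = y"
proof -
	let ?b = "sgn a"
	have b: "norm ?b = 1" using a by (simp add: norm_sgn)
	have ib: "v \<bullet> ?b = v \<bullet> a / norm a" for v by (simp add: sgn_div_norm divide_inverse mult.commute)
	have mx: "f z \<bullet> ?b \<le> f x \<bullet> ?b" and my: "f z \<bullet> ?b \<le> f y \<bullet> ?b" if "z \<in> pts S" for z
		unfolding ib by (rule divide_right_mono[OF maxx[OF that]], simp, rule divide_right_mono[OF maxy[OF that]]) simp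
	have eq: "f x \<bullet> ?b = f y \<bullet> ?b" using mx[OF y] my[OF x] by simp
	have nx: "\<nu> x = ?b \<or> \<nu> x = - ?b" by (rule critical_normal[OF x b mx])
	have ny: "\<nu> y = ?b \<or> \<nu> y = - ?b" by (rule critical_normal[OF y b my])
	have "\<nu> x = \<nu> y"
	proof (rule ccontr)
		assume "\<nu> x \<noteq> \<nu> y"
		with nx ny have opp: "\<nu> y = - \<nu> x" by auto
		from one_sided obtain \<tau> where \<tau>: "\<tau> \<noteq> 0" "below \<tau> = pts S" by (elim exE conjE)
		have eq': "f x \<bullet> \<nu> x = f y \<bullet> \<nu> x" using nx eq by auto
		have const: "f z \<bullet> \<nu> x = f x \<bullet> \<nu> x" if z: "z \<in> pts S" for z
		proof -
			have "\<tau> * ((f z - f x) \<bullet> \<nu> x) \<le> 0" "\<tau> * ((f z - f y) \<bullet> \<nu> y) \<le> 0"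
				using x y z unfolding \<tau>(2)[symmetric] by (simp_all add: below_def)
			moreover have "(f z - f y) \<bullet> \<nu> y = - ((f z - f x) \<bullet> \<nu> x)" unfolding opp inner_minus_right inner_diff_left eq' ..
			ultimately have "\<tau> * ((f z - f x) \<bullet> \<nu> x) = 0" by simp
			with \<tau>(1) show ?thesis by (simp add: inner_diff_left)
		qed
		have "\<nu> x \<noteq> 0" using norm_nu[OF x] by auto
		from height_constant_False[OF this const] show False .
	qed
	from inj_onD[OF nu_inj this x y] show ?thesis .
qed

lemma f_supported: "\<exists>\<tau>. \<tau> \<noteq> 0 \<and> (\<forall>x\<in>pts S. \<forall>z\<in>pts S. f z \<bullet> (\<tau> *. \<nu> x) \<le> f x \<bullet> (\<tau> *. \<nu> x))"
proof -
	from one_sided obtain \<tau> where \<tau>: "\<tau> \<noteq> 0" "below \<tau> = pts S" by (elim exE conjE)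
	have "f z \<bullet> (\<tau> *. \<nu> x) \<le> f x \<bullet> (\<tau> *. \<nu> x)" if x: "x \<in> pts S" and z: "z \<in> pts S" for x z
	proof -
		have "\<tau> * ((f z - f x) \<bullet> \<nu> x) \<le> 0" using x z unfolding \<tau>(2)[symmetric] by (simp add: below_def)
		thus ?thesis by (simp add: inner_diff_left algebra_simps)
	qed
	with \<tau>(1) show ?thesis by (intro exI[of _ \<tau>] conjI ballI)
qed

lemma f_inj: "inj_on f (pts S)"
proof (rule inj_onI)
	fix x y assume x: "x \<in> pts S" and y: "y \<in> pts S" and eq: "f x = f y"
	from f_supported obtain \<tau> where \<tau>: "\<tau> \<noteq> 0"
		"\<forall>x\<in>pts S. \<forall>z\<in>pts S. f z \<bullet> (\<tau> *. \<nu> x) \<le> f x \<bullet> (\<tau> *. \<nu> x)" by (elim exE conjE)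
	have max: "f z \<bullet> (\<tau> *. \<nu> x) \<le> f x \<bullet> (\<tau> *. \<nu> x)" if "z \<in> pts S" for z
		by (rule bspec[OF bspec[OF \<tau>(2) x] that])
	have "\<tau> *. \<nu> x \<noteq> 0" using norm_nu[OF x] \<tau>(1) by auto
	from maximizer_unique[OF this x y max max[unfolded eq]] show "x = y" .
qed

text \<open>The body is the convex hull of the image. Image points have supporting hyperplanes and
  so lie on its frontier. Conversely, a frontier point lies in an exposed face whose extreme points
  are image points maximizing one linear function, and there is only one such point.\<close>

lemma image_frontier:
	"\<exists>K. compact K \<and> convex K \<and> interior K \<noteq> {} \<and> f ` pts S = frontier K"
proof -
	let ?C = "f ` pts S"
	define K where "K = convex hull ?C"
	have "compactin euclidean ?C"
		by (rule image_compactin[OF _ cr_fun_continuous[OF f]]) (use compact in \<open>simp add: compact_space_def\<close>)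
	hence "compact ?C" by simp
	hence K: "compact K" "convex K" unfolding K_def by (rule compact_convex_hull, simp add: convex_convex_hull)
	have CK: "?C \<subseteq> K" unfolding K_def by (rule hull_subset)
	have int: "interior K \<noteq> {}"
	proof
		assume "interior K = {}"
		from empty_interior_subset_hyperplane[OF K(2) this] obtain a b where a: "a \<noteq> 0" "K \<subseteq> {x. a \<bullet> x = b}" .
		have "f x \<bullet> a = b" if "x \<in> pts S" for x
			using subsetD[OF a(2) subsetD[OF CK imageI[OF that]]] by (simp add: inner_commute)
		thus False by (rule height_constant_False[OF a(1)])
	qed
	have clK: "closure K = K" by (rule closure_closed[OF compact_imp_closed[OF K(1)]])
	have "?C = frontier K"
	proof (intro equalityI subsetI)
		fix p assume "p \<in> ?C"
		then obtain x where x: "x \<in> pts S" "p = f x" by blast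
		from f_supported obtain \<tau> where \<tau>: "\<tau> \<noteq> 0"
			"\<forall>x\<in>pts S. \<forall>z\<in>pts S. f z \<bullet> (\<tau> *. \<nu> x) \<le> f x \<bullet> (\<tau> *. \<nu> x)" by (elim exE conjE)
		define a where "a = \<tau> *. \<nu> x"
		have a: "a \<noteq> 0" using norm_nu[OF x(1)] \<tau>(1) by (auto simp: a_def)
		have "?C \<subseteq> {z. a \<bullet> z \<le> a \<bullet> p}"
			using bspec[OF \<tau>(2) x(1)] by (auto simp: a_def x(2) inner_commute)
		hence sup: "K \<subseteq> {z. a \<bullet> z \<le> a \<bullet> p}"
			unfolding K_def by (rule hull_minimal) (rule convex_halfspace_le)
		have "p \<notin> interior K"
		proof
			assume "p \<in> interior K"
			then obtain e where e: "e > 0" "ball p e \<subseteq> K" unfolding mem_interior by blast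
			have "p + (e / 2) *. sgn a \<in> ball p e" using e(1) a by (simp add: dist_norm norm_sgn)
			hence "a \<bullet> (p + (e / 2) *. sgn a) \<le> a \<bullet> p" using e(2) sup by blast
			moreover have "a \<bullet> sgn a > 0" using a by (simp add: sgn_div_norm)
			ultimately show False using e(1) by (simp add: inner_add_right mult_le_0_iff)
		qed
		moreover have "p \<in> K" using CK x by blast
		ultimately show "p \<in> frontier K" unfolding frontier_def clK by blast
	next
		fix p assume p: "p \<in> frontier K"
		hence pK: "p \<in> K" "p \<notin> interior K" unfolding frontier_def clK by blast+
		have "p \<in> closure K" "p \<notin> rel_interior K"
			using pK int by (simp_all add: clK rel_interior_nonempty_interior)
		from supporting_hyperplane_relative_frontier[OF K(2) this]
		obtain a where a: "a \<noteq> 0" "\<And>y. y \<in> closure K ==> a \<bullet> p \<le> a \<bullet> y" by metis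
		\<comment> \<open>By Krein-Milman the face is spanned by its extreme points, which are extreme in
		  \<open>K\<close> and therefore among the generators of the hull.\<close>
		let ?F = "K \<inter> {y. a \<bullet> y = a \<bullet> p}"
		have face: "?F face_of K"
			by (rule face_of_Int_supporting_hyperplane_ge[OF K(2)]) (use a(2) clK in simp)
		have F: "compact ?F" "convex ?F"
			using K by (auto intro: compact_Int_closed closed_hyperplane convex_Int convex_hyperplane)
		have pre: "\<exists>x\<in>pts S. q = f x \<and> (\<forall>z\<in>pts S. f z \<bullet> (- a) \<le> f x \<bullet> (- a))"
			if q: "q extreme_point_of ?F" for q
		proof -
			have "q extreme_point_of K" "q \<in> ?F" using q extreme_point_of_face[OF face] by blast+
			hence "q \<in> ?C" unfolding K_def by (intro extreme_point_of_convex_hull)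
			then obtain x where x: "x \<in> pts S" "q = f x" by blast
			have "f z \<bullet> (- a) \<le> f x \<bullet> (- a)" if "z \<in> pts S" for z
				using a(2)[of "f z"] that CK \<open>q \<in> ?F\<close> unfolding clK x(2) by (auto simp: inner_commute)
			with x show ?thesis by (intro bexI[of _ x] conjI ballI)
		qed
		have KM: "?F = convex hull {x. x extreme_point_of ?F}" by (rule Krein_Milman_Minkowski[OF F])
		have pF: "p \<in> ?F" using pK(1) by simp
		have "{x. x extreme_point_of ?F} \<noteq> {}"
		proof
			assume "{x. x extreme_point_of ?F} = {}"
			from KM[unfolded this] pF show False by simp
		qed
		then obtain q where q: "q extreme_point_of ?F" by blast
		from pre[OF q] obtain x where x: "x \<in> pts S" "q = f x" "\<forall>z\<in>pts S. f z \<bullet> (- a) \<le> f x \<bullet> (- a)"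
			by (elim bexE conjE)
		have "{x. x extreme_point_of ?F} \<subseteq> {q}"
		proof
			fix q' assume "q' \<in> {x. x extreme_point_of ?F}"
			hence "q' extreme_point_of ?F" by (rule CollectD)
			from pre[OF this] obtain x' where x': "x' \<in> pts S" "q' = f x'" "\<forall>z\<in>pts S. f z \<bullet> (- a) \<le> f x' \<bullet> (- a)"
				by (elim bexE conjE)
			have "- a \<noteq> 0" using a(1) by simp
			from maximizer_unique[OF this x'(1) x(1) bspec[OF x'(3)] bspec[OF x(3)]] have "x' = x" .
			thus "q' \<in> {q}" unfolding x'(2) x(2) by simp
		qed
		from hull_mono[OF this, of convex] have "?F \<subseteq> {q}" unfolding KM[symmetric] by simp
		with pF have "p = q" by blast
		thus "p \<in> ?C" unfolding x(2) using x(1) by blast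
	qed
	with K int show ?thesis by (intro exI[of _ K] conjI)
qed

lemma convex: "compact_convex_hypersurface r S f"
	unfolding compact_convex_hypersurface_def
proof (intro conjI image_frontier compact Cr_immersion_f)
	have cf: "continuous_map (mtop S) euclidean f" by (rule cr_fun_continuous[OF f])
	show "embedding_map (mtop S) euclidean f"
		by (rule injective_closed_imp_embedding_map[OF cf _ f_inj])
			(rule continuous_imp_closed_map[OF cf compact], simp)
qed

end

section \<open>Closed curves in the plane\<close>

lemma ex_plane_basis:
	assumes "CARD('n) = 2"
	shows "\<exists>e1 e2 :: real ^ 'n. e1 \<bullet> e1 = 1 \<and> e2 \<bullet> e2 = 1 \<and> e1 \<bullet> e2 = 0 \<and> (\<forall>q. q = (q \<bullet> e1) *. e1 + (q \<bullet> e2) *. e2)"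
proof -
	from assms obtain i j :: 'n where ij: "UNIV = {i, j}" "i \<noteq> j" unfolding card_2_iff by (elim exE conjE)
	have ax: "axis a (1::real) $ b = (if b = a then 1 else 0)" for a b :: 'n by (simp add: axis_def)
	have "q = (q \<bullet> axis i 1) *. axis i 1 + (q \<bullet> axis j 1) *. axis j 1" for q :: "real ^ 'n"
	proof (subst vec_eq_iff, rule allI)
		fix k :: 'n
		have "k = i \<or> k = j" using ij(1) by blast
		thus "q $ k = ((q \<bullet> axis i 1) *. axis i 1 + (q \<bullet> axis j 1) *. axis j 1) $ k"
			using ij(2) by (auto simp: inner_axis ax)
	qed
	thus ?thesis
		using ij(2) by (intro exI[of _ "axis i 1"] exI[of _ "axis j 1"] conjI allI) (simp_all add: inner_axis ax)
qed

text \<open>The curve is parametrized by the angle of its normal: \<sigma> is a lift of the circle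
  through the Gauss map. The offset \<open>t0\<close> allows the lift to start at an arbitrary
  point.\<close>

locale closed_curve = compact_hypersurface r S f \<nu> \<kappa>0
	for r :: regularity and S :: "('s, real ^ 'k) mfd" and f \<nu> :: "'s => real ^ 'n" and \<kappa>0 +
	fixes e1 e2 :: "real ^ 'n" and t0 :: real and \<sigma> :: "real => 's"
	assumes unit: "e1 \<bullet> e1 = 1" "e2 \<bullet> e2 = 1" "e1 \<bullet> e2 = 0"
		and basis: "\<And>q. q = (q \<bullet> e1) *. e1 + (q \<bullet> e2) *. e2"
		and sigma_cont: "continuous_map euclidean (mtop S) \<sigma>"
		and nu_sigma: "\<nu> (\<sigma> t) = cos (t + t0) *. e1 + sin (t + t0) *. e2"
begin

interpretation lh: compact_local_homeo "mtop S" \<nu> "sphere 0 1" by (rule nu_local_homeo)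

definition circle :: "real => real ^ 'n" where
	"circle t = cos (t + t0) *. e1 + sin (t + t0) *. e2"

lemma nu_circle: "\<nu> (\<sigma> t) = circle t"
	by (simp add: nu_sigma circle_def)

lemma circle_inner: "circle t \<bullet> e1 = cos (t + t0)" "circle t \<bullet> e2 = sin (t + t0)"
	using unit by (simp_all add: circle_def inner_add_left inner_commute[of e2 e1])

lemma circle_eq_iff: "circle s = circle t \<longleftrightarrow> (\<exists>m::int. s = t + 2 * pi * m)"
proof -
	have "circle s = circle t \<longleftrightarrow> sin (s + t0) = sin (t + t0) \<and> cos (s + t0) = cos (t + t0)"
		using circle_inner[of s] circle_inner[of t] by (metis circle_def)
	also have "\<dots> \<longleftrightarrow> (\<exists>m::int. s + t0 = t + t0 + 2 * pi * m)" by (rule sin_cos_eq_iff)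
	also have "\<dots> \<longleftrightarrow> (\<exists>m::int. s = t + 2 * pi * m)" by (simp add: algebra_simps)
	finally show ?thesis .
qed

lemma circle_surj:
	assumes q: "norm q = 1"
	shows "\<exists>t. s - pi < t \<and> t \<le> s + pi \<and> q = circle t"
proof -
	have "q \<bullet> q = ((q \<bullet> e1) *. e1 + (q \<bullet> e2) *. e2) \<bullet> ((q \<bullet> e1) *. e1 + (q \<bullet> e2) *. e2)"
		by (rule arg_cong2[of _ _ _ _ inner]; rule basis)
	also have "\<dots> = (q \<bullet> e1)\<^sup>2 + (q \<bullet> e2)\<^sup>2"
		using unit by (simp add: inner_add_left inner_add_right inner_commute[of e2 e1] power2_eq_square)
	finally have "(q \<bullet> e1)\<^sup>2 + (q \<bullet> e2)\<^sup>2 = 1" using q by (simp add: dot_square_norm)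
	then obtain a where a: "q \<bullet> e1 = cos a" "q \<bullet> e2 = sin a" by (rule sincos_total_2pi)
	define b where "b = a - t0"
	have qb: "q = circle b" unfolding circle_def b_def using basis[of q] a by simp
	\<comment> \<open>The number of full turns that brings the angle \<open>b\<close> into the
	  half-open interval of length 2 pi centred at \<open>s\<close>.\<close>
	define m where "m = \<lfloor>(s + pi - b) / (2 * pi)\<rfloor>"
	have "of_int m \<le> (s + pi - b) / (2 * pi)" "(s + pi - b) / (2 * pi) < of_int m + 1"
		unfolding m_def by (rule of_int_floor_le, rule real_of_int_floor_add_one_gt)
	hence "2 * pi * of_int m \<le> s + pi - b" "s + pi - b < 2 * pi * of_int m + 2 * pi"
		by (simp_all add: pos_le_divide_eq pos_divide_less_eq algebra_simps)
	hence "s - pi < b + 2 * pi * of_int m" "b + 2 * pi * of_int m \<le> s + pi" by linarith+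
	moreover have "q = circle (b + 2 * pi * of_int m)" unfolding qb circle_eq_iff by (intro exI[of _ "- m"]) simp
	ultimately show ?thesis by (intro exI[of _ "b + 2 * pi * of_int m"] conjI)
qed

lemma sigma_topspace: "\<sigma> t \<in> pts S"
	using continuous_map_image_subset_topspace[OF sigma_cont] by auto

text \<open>Two parameters with the same value differ by a multiple of 2 pi, so the shifted curve is
  a second lift of the same circle; having one value in common, the lifts agree.\<close>

lemma sigma_shift:
	assumes "\<sigma> s = \<sigma> u"
	shows "\<sigma> (t + (u - s)) = \<sigma> t"
proof -
	have "circle u = circle s" using assms nu_circle[of s] nu_circle[of u] by simp
	then obtain m :: int where m: "u = s + 2 * pi * m" unfolding circle_eq_iff by (rule exE)
	show ?thesis
	proof (rule lh.lifts_agree[of UNIV "\<lambda>t. \<sigma> (t + (u - s))" \<sigma> s t])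
		have "continuous_map euclideanreal euclideanreal (\<lambda>t. t + (u - s))"
			by (simp add: continuous_map_iff_continuous2 continuous_intros)
		from continuous_map_compose[OF this sigma_cont]
		show "continuous_map (top_of_set UNIV) (mtop S) (\<lambda>t. \<sigma> (t + (u - s)))" unfolding o_def subtopology_UNIV .
		show "continuous_map (top_of_set UNIV) (mtop S) \<sigma>" unfolding subtopology_UNIV by (rule sigma_cont)
		show "\<nu> (\<sigma> (t + (u - s))) = \<nu> (\<sigma> t)" for t
			unfolding nu_circle circle_eq_iff by (rule exI[of _ m]) (simp add: m)
		show "\<sigma> (s + (u - s)) = \<sigma> s" using assms by simp
	qed simp_all
qed

text \<open>The points at multiples of 2 pi lie in one finite fibre of the Gauss map, so two of them
  coincide, and \<open>sigma_shift\<close> turns this into a period.\<close>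

lemma ex_period: "\<exists>k. (0::nat) < k \<and> (\<forall>t. \<sigma> (t + 2 * pi * real k) = \<sigma> t)"
proof -
	let ?g = "\<lambda>j::nat. \<sigma> (2 * pi * real j)"
	have "range ?g \<subseteq> {x \<in> pts S. \<nu> x = circle 0}"
	proof (rule image_subsetI)
		fix j :: nat
		have "circle (2 * pi * j) = circle 0" unfolding circle_eq_iff by (rule exI[of _ "int j"]) simp
		thus "?g j \<in> {x \<in> pts S. \<nu> x = circle 0}" by (simp add: sigma_topspace nu_circle)
	qed
	hence "finite (range ?g)" using lh.finite_fibre by (rule finite_subset)
	hence "\<not> inj ?g" using range_inj_infinite by blast
	then obtain i j where ij: "?g i = ?g j" "i \<noteq> j" unfolding inj_on_def by blast
	have main: "\<exists>k. (0::nat) < k \<and> (\<forall>t. \<sigma> (t + 2 * pi * real k) = \<sigma> t)" if lt: "i < j" and eq: "?g i = ?g j" for i j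
	proof -
		have "\<sigma> (t + 2 * pi * (j - i)) = \<sigma> t" for t
			using sigma_shift[OF eq, of t] lt by (simp add: of_nat_diff right_diff_distrib)
		with lt show ?thesis by (intro exI[of _ "j - i"] conjI allI) simp_all
	qed
	from ij(2) consider "i < j" | "j < i" by linarith
	thus ?thesis by cases (rule main[OF _ ij(1)], assumption, rule main[OF _ ij(1)[symmetric]], assumption)
qed

text \<open>The turning number of the normal during one period of \<sigma>.\<close>

definition wind :: nat where "wind = (LEAST k. (0::nat) < k \<and> (\<forall>t. \<sigma> (t + 2 * pi * real k) = \<sigma> t))"

lemma wind: "0 < wind" "\<sigma> (t + 2 * pi * real wind) = \<sigma> t"
	using LeastI_ex[OF ex_period] unfolding wind_def[symmetric] by (rule conjunct1, elim conjE allE)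

lemma wind_int: "\<sigma> (t + of_int d * (2 * pi * real wind)) = \<sigma> t"
proof -
	have nat: "\<sigma> (t + real j * (2 * pi * real wind)) = \<sigma> t" for t j
	proof (induction j)
		case (Suc j)
		have "\<sigma> (t + real (Suc j) * (2 * pi * real wind)) = \<sigma> (t + real j * (2 * pi * real wind) + 2 * pi * real wind)"
			by (simp add: algebra_simps)
		also have "\<dots> = \<sigma> (t + real j * (2 * pi * real wind))" by (rule wind(2))
		also have "\<dots> = \<sigma> t" by (rule Suc)
		finally show ?case .
	qed simp
	show ?thesis
	proof (cases "0 \<le> d")
		case True
		then obtain j where j: "d = int j" by (rule zero_le_imp_eq_int[THEN exE])
		show ?thesis using nat[of t j] unfolding j by simp
	next
		case False
		then obtain j where j: "d = - int j" by (metis linear zero_le_imp_eq_int neg_0_le_iff_le minus_minus)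
		have "t + of_int d * (2 * pi * real wind) + real j * (2 * pi * real wind) = t"
			unfolding j by simp
		from nat[of "t + of_int d * (2 * pi * real wind)" j, unfolded this] show ?thesis by (rule sym)
	qed
qed

lemma sigma_eq_iff: "\<sigma> s = \<sigma> u \<longleftrightarrow> (\<exists>k::int. u = s + of_int k * (2 * pi * real wind))"
proof
	assume eq: "\<sigma> s = \<sigma> u"
	have "circle u = circle s" using eq nu_circle[of s] nu_circle[of u] by simp
	then obtain m :: int where m: "u = s + 2 * pi * m" unfolding circle_eq_iff by (rule exE)
	have shift: "\<sigma> (t + 2 * pi * of_int m) = \<sigma> t" for t
		using sigma_shift[OF eq, of t] unfolding m add_diff_cancel_left' .
	\<comment> \<open>Division with remainder: the remainder \<open>j\<close> is again a period in
	  units of 2 pi and smaller than the least positive one, hence zero.\<close>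
	define d where "d = m div int wind"
	define j where "j = nat (m mod int wind)"
	have j: "int j = m mod int wind" "j < wind" using wind(1) by (simp_all add: j_def nat_less_iff)
	have "m = d * int wind + int j" unfolding d_def j(1) by simp
	hence mr: "of_int m = of_int d * real wind + real j" by (metis of_int_add of_int_mult of_int_of_nat_eq)
	have per: "\<sigma> (t + 2 * pi * real j) = \<sigma> t" for t
	proof -
		have "\<sigma> (t + 2 * pi * real j) = \<sigma> (t + 2 * pi * real j + of_int d * (2 * pi * real wind))" by (rule wind_int[symmetric])
		also have "t + 2 * pi * real j + of_int d * (2 * pi * real wind) = t + 2 * pi * of_int m"
			unfolding mr by (simp add: algebra_simps)
		also have "\<sigma> (t + 2 * pi * of_int m) = \<sigma> t" by (rule shift)
		finally show ?thesis .
	qed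
	have "j = 0"
	proof (rule ccontr)
		assume "j \<noteq> 0"
		hence "0 < j \<and> (\<forall>t. \<sigma> (t + 2 * pi * real j) = \<sigma> t)" using per by (intro conjI allI) simp_all
		with not_less_Least[OF j(2)[unfolded wind_def]] show False by (rule notE)
	qed
	hence "u = s + of_int d * (2 * pi * real wind)" unfolding m mr by (simp add: algebra_simps)
	thus "\<exists>k::int. u = s + of_int k * (2 * pi * real wind)" by (rule exI)
next
	assume "\<exists>k::int. u = s + of_int k * (2 * pi * real wind)"
	then obtain k :: int where "u = s + of_int k * (2 * pi * real wind)" by (rule exE)
	with wind_int[of s k] show "\<sigma> s = \<sigma> u" by (simp only:)
qed

text \<open>The range is the compact image of one period, hence closed. It is open since nearby
  points have nearby normals, which \<sigma> attains in the same sheet. Connectedness does the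
  rest.\<close>

lemma range_sigma: "range \<sigma> = pts S"
proof -
	define L where "L = 2 * pi * real wind"
	have L: "L > 0" using wind(1) by (simp add: L_def)
	have "range \<sigma> = \<sigma> ` {0..L}"
	proof (intro equalityI subsetI)
		fix x assume "x \<in> range \<sigma>"
		then obtain t where t: "x = \<sigma> t" by (rule rangeE)
		define d where "d = \<lfloor>t / L\<rfloor>"
		have "of_int d \<le> t / L" "t / L < of_int d + 1" unfolding d_def by (rule of_int_floor_le, rule real_of_int_floor_add_one_gt)
		hence "of_int d * L \<le> t" "t < of_int d * L + L" using L by (simp_all add: pos_le_divide_eq pos_divide_less_eq algebra_simps)
		hence "t - of_int d * L \<in> {0..L}" by simp
		moreover have "\<sigma> (t - of_int d * L) = x" using wind_int[of t "- d"] by (simp add: t L_def)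
		ultimately show "x \<in> \<sigma> ` {0..L}" by (intro image_eqI[of _ _ "t - of_int d * L"]) simp_all
	qed blast
	moreover have "compactin (mtop S) (\<sigma> ` {0..L})" by (rule image_compactin[OF _ sigma_cont]) simp
	ultimately have cl: "closedin (mtop S) (range \<sigma>)" using compactin_imp_closedin[OF hausdorff] by simp
	have "openin (mtop S) (range \<sigma>)"
	proof (subst openin_subopen, rule ballI)
		fix x assume "x \<in> range \<sigma>"
		then obtain s where s: "x = \<sigma> s" by (rule rangeE)
		from lh.loc_inj[OF sigma_topspace[of s]] obtain N where N: "openin (mtop S) N" "\<sigma> s \<in> N" "inj_on \<nu> N" by (elim exE conjE)
		have "openin euclideanreal {t \<in> topspace euclideanreal. \<sigma> t \<in> N}" by (rule openin_continuous_map_preimage[OF sigma_cont N(1)])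
		hence "open {t. \<sigma> t \<in> N}" by simp
		moreover have "s \<in> {t. \<sigma> t \<in> N}" using N(2) by simp
		ultimately obtain e where e: "e > 0" "ball s e \<subseteq> {t. \<sigma> t \<in> N}" by (rule openE)
		\<comment> \<open>The directions with an angle within pi of \<open>s\<close> but away from
		  \<open>s\<close>. Outside this compact set a direction has an angle in the small ball around
		  \<open>s\<close>.\<close>
		let ?C = "circle ` ({s - pi..s + pi} - ball s (min e pi))"
		have "continuous_on A circle" for A unfolding circle_def by (intro continuous_intros)
		hence C: "closed ?C"
			by (intro compact_imp_closed compact_continuous_image compact_diff compact_Icc open_ball)
		have "circle s \<notin> ?C"
		proof
			assume "circle s \<in> ?C"
			then obtain t where t: "circle s = circle t" "s - pi \<le> t" "t \<le> s + pi" "t \<notin> ball s (min e pi)" by auto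
			from t(1) obtain m :: int where m: "s = t + 2 * pi * m" unfolding circle_eq_iff by (rule exE)
			have "\<bar>2 * pi * of_int m\<bar> \<le> pi" using t(2,3) unfolding m by linarith
			hence "\<bar>of_int m :: real\<bar> * (2 * pi) \<le> pi" by (simp add: abs_mult mult.commute)
			hence "\<bar>of_int m :: real\<bar> * 2 \<le> 1" using pi_gt_zero by (simp add: mult.assoc[symmetric])
			hence "m = 0" by linarith
			with m t(4) e(1) show False by simp
		qed
		let ?\<Omega> = "{y \<in> pts S. \<nu> y \<in> - ?C} \<inter> N"
		have "openin (mtop S) {y \<in> pts S. \<nu> y \<in> - ?C}"
			by (rule openin_continuous_map_preimage[OF cr_fun_continuous[OF nu]]) (use C in \<open>simp add: open_Compl\<close>)
		hence "openin (mtop S) ?\<Omega>" using N(1) by (rule openin_Int)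
		moreover have "x \<in> ?\<Omega>" using \<open>circle s \<notin> ?C\<close> N(2) sigma_topspace[of s] unfolding s by (simp add: nu_circle)
		moreover have "?\<Omega> \<subseteq> range \<sigma>"
		proof
			fix y assume y: "y \<in> ?\<Omega>"
			hence yS: "y \<in> pts S" and yC: "\<nu> y \<notin> ?C" and yN: "y \<in> N" by blast+
			from circle_surj[OF norm_nu[OF yS], of s] obtain t where t: "s - pi < t" "t \<le> s + pi" "\<nu> y = circle t" by (elim exE conjE)
			have "t \<in> ball s (min e pi)"
			proof (rule ccontr)
				assume "t \<notin> ball s (min e pi)"
				hence "t \<in> {s - pi..s + pi} - ball s (min e pi)" using t by simp
				with yC t(3) show False by blast
			qed
			hence "\<sigma> t \<in> N" using e(2) by auto
			from inj_onD[OF N(3) _ yN this] have "y = \<sigma> t" using t(3) nu_circle by simp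
			thus "y \<in> range \<sigma>" by simp
		qed
		ultimately show "\<exists>T. openin (mtop S) T \<and> x \<in> T \<and> T \<subseteq> range \<sigma>" by (intro exI[of _ ?\<Omega>] conjI)
	qed
	from spec[OF connected[unfolded connected_space_clopen_in], THEN mp, OF conjI[OF this cl]] show ?thesis by blast
qed

lemma Cr_circle: "open J ==> Cr_on r circle J"
proof -
	assume J: "open J"
	have sh: "Cr_on r (\<lambda>t::real. t + t0) J"
		by (rule Cr_on_add[OF J Cr_on_bounded_linear[OF J bounded_linear_ident] Cr_on_const[OF J]])
	have 1: "Cr_on r (\<lambda>t. cos (t + t0)) J" by (rule Cr_on_compose[OF J open_UNIV subset_UNIV sh Cr_on_cos])
	have 2: "Cr_on r (\<lambda>t. sin (t + t0)) J" by (rule Cr_on_compose[OF J open_UNIV subset_UNIV sh Cr_on_sin])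
	show "Cr_on r circle J"
		unfolding circle_def by (rule Cr_on_add[OF J Cr_on_scaleR[OF J 1 Cr_on_const[OF J]] Cr_on_scaleR[OF J 2 Cr_on_const[OF J]]])
qed

lemma sigma_preimage_open: "openin (mtop S) N ==> open {t. \<sigma> t \<in> N}"
	using openin_continuous_map_preimage[OF sigma_cont, of N] by simp

text \<open>In a chart, \<open>\<sigma>\<close> is the circle followed by the inverse of \<open>Q \<circ> \<nu>\<close>.\<close>

lemma Cr_chart_sigma:
	assumes d: "d \<in> charts S"
	shows "Cr_on r (\<lambda>t. snd d (\<sigma> t)) {t. \<sigma> t \<in> fst d}"
proof (rule Cr_on_local)
	show "open {t. \<sigma> t \<in> fst d}" by (rule sigma_preimage_open[OF chart_openin[OF d]])
	fix s assume "s \<in> {t. \<sigma> t \<in> fst d}"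
	hence s: "\<sigma> s \<in> fst d" by simp
	hence c: "d \<in> charts_at S (\<sigma> s)" using d by (simp add: charts_at_def)
	let ?V = "cod d"
	note cn = chart_nu[OF c]
	from ex_projection[OF c] obtain Q :: "real ^ 'n => real ^ 'k" where Q: "linear Q" "\<forall>u. Q (der d \<nu> (\<sigma> s) u) = u"
		by (elim exE conjE)
	have bl: "bounded_linear Q" using Q(1) by (simp add: linear_conv_bounded_linear)
	define h where "h = (\<lambda>y. Q (\<nu> (chart_inv d y)))"
	have h: "Cr_on r h ?V" unfolding h_def by (rule Cr_on_linear_compose[OF cn(1) bl cn(3)])
	have "(h has_derivative (\<lambda>u. Q (der d \<nu> (\<sigma> s) u))) (at (snd d (\<sigma> s)))"
		unfolding h_def by (rule bounded_linear.has_derivative[OF bl chart_deriv_works[OF nu c]])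
	from frechet_derivative_at[OF this] have "Df h (snd d (\<sigma> s)) = (\<lambda>u. u)" using Q(2) by simp
	hence "inj (Df h (snd d (\<sigma> s)))" by (simp add: inj_on_def)
	from Cr_on_locally_injective[OF cn(1,2) h this] obtain e where e: "e > 0" "ball (snd d (\<sigma> s)) e \<subseteq> ?V"
		"inj_on h (ball (snd d (\<sigma> s)) e)" "\<forall>y\<in>ball (snd d (\<sigma> s)) e. inj (Df h y)"
		by (elim exE conjE)
	define B where "B = ball (snd d (\<sigma> s)) e"
	have hB: "Cr_on r h B" unfolding B_def by (rule Cr_on_subset[OF h e(2)])
	have ih: "inj_on h B" using e(3) by (simp add: B_def)
	have oB: "open B" by (simp add: B_def)
	have ch: "continuous_on B h" by (rule Cr_on_continuous[OF hB])
	have o: "open (h ` B)" by (rule invariance_of_domain[OF ch oB ih])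
	have g: "Cr_on r (inv_into B h) (h ` B)"
	proof (rule Cr_on_inverse_map[OF _ oB o _ _ _ hB])
		show "DIM(real ^ 'k) = CARD('k)" by simp
		show "inv_into B h ` h ` B \<subseteq> B" by (rule image_subsetI, rule inv_into_into)
		show "continuous_on (h ` B) (inv_into B h)"
			by (rule continuous_on_inverse_open[OF oB ch _ inv_into_f_f[OF ih]]) simp
		show "h (inv_into B h y) = y" if "y \<in> h ` B" for y using f_inv_into_f[OF that] .
		show "inj (Df h y)" if "y \<in> B" for y using e(4) that by (simp add: B_def)
		show "inv_into B h (h y) = y" if "y \<in> B" for y using inv_into_f_f[OF ih that] .
	qed
	let ?N = "{p \<in> fst d. snd d p \<in> B}"
	let ?J = "{t. \<sigma> t \<in> ?N}"
	have oJ: "open ?J" by (rule sigma_preimage_open[OF chart_preimage_openin[OF d oB]])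
	have sJ: "s \<in> ?J" using s e(1) by (simp add: B_def)
	have hs: "Q (circle t) = h (snd d (\<sigma> t))" if "t \<in> ?J" for t
		using that chart_inv_left[OF d] by (simp add: h_def nu_circle)
	have "Cr_on r (\<lambda>t. inv_into B h (Q (circle t))) ?J"
	proof (rule Cr_on_compose[OF oJ o _ Cr_on_linear_compose[OF oJ bl Cr_circle[OF oJ]] g])
		show "(\<lambda>t. Q (circle t)) ` ?J \<subseteq> h ` B"
		proof (rule image_subsetI)
			fix t assume t: "t \<in> ?J"
			hence "snd d (\<sigma> t) \<in> B" by simp
			thus "Q (circle t) \<in> h ` B" unfolding hs[OF t] by (rule imageI)
		qed
	qed
	hence "Cr_on r (\<lambda>t. snd d (\<sigma> t)) ?J"
	proof (rule Cr_on_cong[OF oJ, rotated])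
		fix t assume t: "t \<in> ?J"
		hence "snd d (\<sigma> t) \<in> B" by simp
		thus "inv_into B h (Q (circle t)) = snd d (\<sigma> t)" unfolding hs[OF t] by (rule inv_into_f_f[OF ih])
	qed
	with oJ sJ show "\<exists>V. open V \<and> s \<in> V \<and> Cr_on r (\<lambda>t. snd d (\<sigma> t)) V" by (intro exI[of _ ?J] conjI)
qed

lemma Cr_compose_sigma:
	fixes G :: "'s => 'b::euclidean_space"
	assumes G: "cr_fun r S G"
	shows "Cr_on r (\<lambda>t. G (\<sigma> t)) UNIV"
proof (rule Cr_on_local[OF open_UNIV])
	fix s :: real
	obtain d where c: "d \<in> charts_at S (\<sigma> s)" using ex_chart[OF sigma_topspace[of s]] by blast
	have d: "d \<in> charts S" "\<sigma> s \<in> fst d" using charts_atD[OF c] by blast+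
	let ?J = "{t. \<sigma> t \<in> fst d}"
	have oJ: "open ?J" by (rule sigma_preimage_open[OF chart_openin[OF d(1)]])
	have "Cr_on r (\<lambda>t. G (chart_inv d (snd d (\<sigma> t)))) ?J"
		by (rule Cr_on_compose[OF oJ chart_open[OF d(1)] _ Cr_chart_sigma[OF d(1)] cr_fun_Cr_on[OF G d(1)]]) blast
	hence "Cr_on r (\<lambda>t. G (\<sigma> t)) ?J"
		by (rule Cr_on_cong[OF oJ, rotated]) (simp add: chart_inv_left[OF d(1)])
	with oJ d(2) show "\<exists>V. open V \<and> s \<in> V \<and> Cr_on r (\<lambda>t. G (\<sigma> t)) V" by (intro exI[of _ ?J] conjI) simp_all
qed

text \<open>One \<open>w\<close> serves every \<open>G\<close>, so the velocities of f o \<sigma>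
  and \<nu> o \<sigma> are images of the same coordinate vector and can be compared by the second
  fundamental form.\<close>

lemma ex_velocity:
	assumes c: "d \<in> charts_at S (\<sigma> s)"
	shows "\<exists>w. \<forall>G :: 's => real ^ 'n. cr_fun r S G --> ((\<lambda>t. G (\<sigma> t)) has_vector_derivative der d G (\<sigma> s) w) (at s)"
proof -
	have d: "d \<in> charts S" "\<sigma> s \<in> fst d" using charts_atD[OF c] by blast+
	let ?J = "{t. \<sigma> t \<in> fst d}"
	have oJ: "open ?J" by (rule sigma_preimage_open[OF chart_openin[OF d(1)]])
	have sJ: "s \<in> ?J" using d(2) by simp
	define D where "D = Df (\<lambda>t. snd d (\<sigma> t)) s"
	have D: "((\<lambda>t. snd d (\<sigma> t)) has_derivative D) (at s)"
		unfolding D_def by (rule Cr_on_has_derivative[OF Cr_chart_sigma[OF d(1)] sJ])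
	have "((\<lambda>t. G (\<sigma> t)) has_vector_derivative der d G (\<sigma> s) (D 1)) (at s)" if G: "cr_fun r S G" for G :: "'s => real ^ 'n"
	proof -
		have "((\<lambda>t. G (chart_inv d (snd d (\<sigma> t)))) has_derivative (\<lambda>h. der d G (\<sigma> s) (D h))) (at s)"
			by (rule has_derivative_compose[OF D chart_deriv_works[OF G c]])
		hence 1: "((\<lambda>t. G (\<sigma> t)) has_derivative (\<lambda>h. der d G (\<sigma> s) (D h))) (at s)"
			by (rule has_derivative_transform_within_open[OF _ oJ sJ]) (simp add: chart_inv_left[OF d(1)])
		have eq: "der d G (\<sigma> s) (D h) = h *. der d G (\<sigma> s) (D 1)" for h
		proof -
			have "D h = D (h *. 1)" by simp
			also have "\<dots> = h *. D 1" by (rule linear_scale[OF has_derivative_linear[OF D]])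
			finally have "der d G (\<sigma> s) (D h) = der d G (\<sigma> s) (h *. D 1)" by (rule arg_cong)
			also have "\<dots> = h *. der d G (\<sigma> s) (D 1)" by (rule linear_scale[OF chart_deriv_linear[OF G c]])
			finally show ?thesis .
		qed
		show ?thesis unfolding has_vector_derivative_def by (rule has_derivative_eq_rhs[OF 1]) (rule ext, rule eq)
	qed
	thus ?thesis by (intro exI[of _ "D 1"] allI impI)
qed

lemma circle_deriv: "(circle has_vector_derivative - sin (t + t0) *. e1 + cos (t + t0) *. e2) (at t)"
proof -
	have c: "((\<lambda>t. cos (t + t0)) has_vector_derivative - sin (t + t0)) (at t)"
		and s: "((\<lambda>t. sin (t + t0)) has_vector_derivative cos (t + t0)) (at t)"
		unfolding has_real_derivative_iff_has_vector_derivative[symmetric]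
		by (auto intro!: derivative_eq_intros)
	have "((\<lambda>t. cos (t + t0) *. e1 + sin (t + t0) *. e2) has_vector_derivative
			(cos (t + t0) *. 0 + - sin (t + t0) *. e1) + (sin (t + t0) *. 0 + cos (t + t0) *. e2)) (at t)"
		by (intro has_vector_derivative_add has_vector_derivative_scaleR has_vector_derivative_const)
			(simp_all add: c s has_real_derivative_iff_has_vector_derivative)
	thus ?thesis unfolding circle_def by (simp only: scaleR_zero_right add_0_left)
qed

lemma circle_deriv_nz: "- sin (t + t0) *. e1 + cos (t + t0) *. e2 \<noteq> 0"
proof
	assume z: "- sin (t + t0) *. e1 + cos (t + t0) *. e2 = 0"
	have "(- sin (t + t0) *. e1 + cos (t + t0) *. e2) \<bullet> e1 = - sin (t + t0)"
		"(- sin (t + t0) *. e1 + cos (t + t0) *. e2) \<bullet> e2 = cos (t + t0)"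
		using unit by (simp_all add: inner_diff_left inner_add_left inner_commute[of e2 e1])
	hence "sin (t + t0) = 0" "cos (t + t0) = 0" unfolding z by simp_all
	thus False using sin_cos_squared_add[of "t + t0"] by simp
qed

text \<open>The angle moves with non-zero velocity, so \<open>w\<close> is non-zero. Differentiating
  the orthogonality of velocity and normal expresses the curvature numerator as minus the definite
  form at \<open>w\<close>.\<close>

lemma curvature_nonzero:
	"vector_derivative (f \<circ> \<sigma>) (at s) \<noteq> 0" "plane_curvature (f \<circ> \<sigma>) (\<nu> \<circ> \<sigma>) s \<noteq> 0"
proof -
	let ?\<beta> = "f \<circ> \<sigma>"
	let ?\<beta>' = "\<lambda>u. vector_derivative ?\<beta> (at u)"
	have vel: "\<exists>d w. d \<in> charts_at S (\<sigma> u) \<and> ?\<beta>' u = der d f (\<sigma> u) w \<and> - sin (u + t0) *. e1 + cos (u + t0) *. e2 = der d \<nu> (\<sigma> u) w" for u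
	proof -
		obtain d where d: "d \<in> charts_at S (\<sigma> u)" using ex_chart[OF sigma_topspace[of u]] by blast
		from ex_velocity[OF d] obtain w where w: "\<forall>G :: 's => real ^ 'n. cr_fun r S G --> ((\<lambda>t. G (\<sigma> t)) has_vector_derivative der d G (\<sigma> u) w) (at u)"
			by (rule exE)
		have "?\<beta>' u = der d f (\<sigma> u) w"
			unfolding o_def by (rule vector_derivative_at[OF mp[OF spec[OF w] f]])
		moreover have "(circle has_vector_derivative der d \<nu> (\<sigma> u) w) (at u)"
			using mp[OF spec[OF w] nu] unfolding nu_circle .
		from vector_derivative_unique_at[OF circle_deriv this]
		have "- sin (u + t0) *. e1 + cos (u + t0) *. e2 = der d \<nu> (\<sigma> u) w" .
		ultimately show ?thesis using d by (intro exI[of _ d] exI[of _ w] conjI)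
	qed
	from vel[of s] obtain d w where d: "d \<in> charts_at S (\<sigma> s)" "?\<beta>' s = der d f (\<sigma> s) w"
		"- sin (s + t0) *. e1 + cos (s + t0) *. e2 = der d \<nu> (\<sigma> s) w" by (elim exE conjE)
	have w: "w \<noteq> 0" using circle_deriv_nz[of s] d(3) linear_0[OF dnu_linear[OF d(1)]] by auto
	thus nz: "?\<beta>' s \<noteq> 0" using immersed[OF d(1)] d(2) by auto
	have orth: "?\<beta>' u \<bullet> circle u = 0" for u
	proof -
		from vel[of u] obtain d w where "d \<in> charts_at S (\<sigma> u)" "?\<beta>' u = der d f (\<sigma> u) w" by (elim exE conjE)
		thus ?thesis using tangent[of d "\<sigma> u" w] by (simp add: nu_circle)
	qed
	have C2: "Ck_on (Suc (Suc 0)) ?\<beta> UNIV" unfolding o_def by (rule Cr_on_imp_Ck[OF Cr_compose_sigma[OF f]])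
	hence C1: "Ck_on (Suc 0) (\<lambda>u. Df ?\<beta> u 1) UNIV" unfolding Ck_on.simps(2)[of "Suc 0"] by (elim conjE allE)
	have fr: "?\<beta>' u = Df ?\<beta> u 1" for u
	proof -
		have D: "(?\<beta> has_derivative Df ?\<beta> u) (at u)" by (rule Ck_on_SucE[OF C2 UNIV_I])
		have eq: "Df ?\<beta> u h = h *. Df ?\<beta> u 1" for h
		proof -
			have "Df ?\<beta> u h = Df ?\<beta> u (h *. 1)" by simp
			also have "\<dots> = h *. Df ?\<beta> u 1" by (rule linear_scale[OF has_derivative_linear[OF D]])
			finally show ?thesis .
		qed
		have "(?\<beta> has_vector_derivative Df ?\<beta> u 1) (at u)"
			unfolding has_vector_derivative_def by (rule has_derivative_eq_rhs[OF D]) (rule ext, rule eq)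
		thus ?thesis by (rule vector_derivative_at)
	qed
	have "?\<beta>' differentiable (at s)"
		unfolding fr differentiable_def by (rule exI[of _ "Df (\<lambda>u. Df ?\<beta> u 1) s"]) (rule Ck_on_SucE[OF C1 UNIV_I])
	hence b2: "(?\<beta>' has_vector_derivative vector_derivative ?\<beta>' (at s)) (at s)"
		by (simp only: vector_derivative_works)
	let ?b = "vector_derivative ?\<beta>' (at s)" and ?c = "- sin (s + t0) *. e1 + cos (s + t0) *. e2"
	have "((\<lambda>u. ?\<beta>' u \<bullet> circle u) has_derivative (\<lambda>h. ?\<beta>' s \<bullet> (h *. ?c) + (h *. ?b) \<bullet> circle s)) (at s)"
		by (rule has_derivative_inner[OF b2[unfolded has_vector_derivative_def] circle_deriv[unfolded has_vector_derivative_def]])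
	moreover have "((\<lambda>u. ?\<beta>' u \<bullet> circle u) has_derivative (\<lambda>h. 0)) (at s)" unfolding orth by (rule has_derivative_const)
	ultimately have "(\<lambda>h. ?\<beta>' s \<bullet> (h *. ?c) + (h *. ?b) \<bullet> circle s) = (\<lambda>h. 0)" by (rule has_derivative_unique)
	from fun_cong[OF this, of 1] have "?b \<bullet> circle s = - (?\<beta>' s \<bullet> ?c)" by simp
	also have "?\<beta>' s \<bullet> ?c = der d f (\<sigma> s) w \<bullet> der d \<nu> (\<sigma> s) w" unfolding d(2,3) ..
	finally have eq: "?b \<bullet> circle s = - (der d f (\<sigma> s) w \<bullet> der d \<nu> (\<sigma> s) w)" .
	from definite obtain \<tau> where \<tau>: "\<forall>x. \<forall>c\<in>charts_at S x. \<forall>u. u \<noteq> 0 --> 0 < \<tau> * sff c x u"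
		by (elim exE conjE)
	have "0 < \<tau> * (der d f (\<sigma> s) w \<bullet> der d \<nu> (\<sigma> s) w)"
		by (rule mp[OF spec[OF bspec[OF spec[OF \<tau>] d(1)]] w])
	hence "?b \<bullet> circle s \<noteq> 0" unfolding eq by auto
	with nz show "plane_curvature ?\<beta> (\<nu> \<circ> \<sigma>) s \<noteq> 0"
		by (simp add: plane_curvature_def nu_circle)
qed

lemma curve: "closed_locally_convex_regular_curve r S f \<nu>"
	unfolding closed_locally_convex_regular_curve_def
proof (intro exI[of _ \<sigma>] exI[of _ "2 * pi * real wind"] conjI allI)
	have inv: "chart_inv (UNIV, id) = (id :: 'z => 'z)" by (simp add: chart_inv_def fun_eq_iff inv_id)
	show "0 < 2 * pi * real wind" using wind(1) by simp
	show "range \<sigma> = pts S" by (rule range_sigma)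
	show "\<sigma> s = \<sigma> u \<longleftrightarrow> (\<exists>k::int. u = s + of_int k * (2 * pi * real wind))" for s u by (rule sigma_eq_iff)
	show "Cr_map r (flat :: (real, real) mfd) S \<sigma>"
		unfolding Cr_map_def
	proof (intro conjI ballI)
		show "continuous_map (mtop (flat :: (real, real) mfd)) (mtop S) \<sigma>" using sigma_cont by (simp add: flat_def)
		fix c d assume c: "c \<in> charts (flat :: (real, real) mfd)" and d: "d \<in> charts S"
		have c: "c = (UNIV, id)" using c by (simp add: flat_def)
		have "snd c ` (fst c \<inter> \<sigma> -` fst d) = {t. \<sigma> t \<in> fst d}" unfolding c by auto
		moreover have "snd d \<circ> \<sigma> \<circ> chart_inv c = (\<lambda>t. snd d (\<sigma> t))" unfolding c inv by (simp add: o_def)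
		ultimately show "Cr_on r (snd d \<circ> \<sigma> \<circ> chart_inv c) (snd c ` (fst c \<inter> \<sigma> -` fst d))"
			using Cr_chart_sigma[OF d] by simp
	qed
	have Cf: "Cr_on r (f \<circ> \<sigma>) UNIV" using Cr_compose_sigma[OF f] by (simp add: o_def)
	show "Cr_map r flat flat (f \<circ> \<sigma>)"
		unfolding Cr_map_def flat_def using Cf Cr_on_continuous[OF Cf]
		by (simp add: inv continuous_map_iff_continuous2)
qed (rule curvature_nonzero)+

end

text \<open>The parametrization \<sigma> is the lift of the unit circle through the Gauss map,
  starting at any point.\<close>

lemma (in compact_hypersurface) closed_curve:
	assumes n2: "CARD('n) = 2"
	shows "closed_locally_convex_regular_curve r S f \<nu>"
proof -
	from ex_plane_basis[OF n2] obtain e1 e2 :: "real ^ 'n" where e: "e1 \<bullet> e1 = 1" "e2 \<bullet> e2 = 1" "e1 \<bullet> e2 = 0"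
		and basis: "\<forall>q. q = (q \<bullet> e1) *. e1 + (q \<bullet> e2) *. e2" by (elim exE conjE)
	obtain x0 where x0: "x0 \<in> pts S" using nonempty by blast
	have nx: "\<nu> x0 = (\<nu> x0 \<bullet> e1) *. e1 + (\<nu> x0 \<bullet> e2) *. e2" by (rule spec[OF basis])
	have "\<nu> x0 \<bullet> \<nu> x0 = ((\<nu> x0 \<bullet> e1) *. e1 + (\<nu> x0 \<bullet> e2) *. e2) \<bullet> ((\<nu> x0 \<bullet> e1) *. e1 + (\<nu> x0 \<bullet> e2) *. e2)"
		by (rule arg_cong2[of _ _ _ _ inner]; rule nx)
	also have "\<dots> = (\<nu> x0 \<bullet> e1)\<^sup>2 + (\<nu> x0 \<bullet> e2)\<^sup>2"
		using e by (simp add: inner_add_left inner_add_right inner_commute[of e2 e1] power2_eq_square)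
	finally have "(\<nu> x0 \<bullet> e1)\<^sup>2 + (\<nu> x0 \<bullet> e2)\<^sup>2 = 1" using norm_nu[OF x0] by (simp add: dot_square_norm)
	then obtain t0 where t0: "\<nu> x0 \<bullet> e1 = cos t0" "\<nu> x0 \<bullet> e2 = sin t0" by (rule sincos_total_2pi)
	let ?\<gamma> = "\<lambda>t. cos (t + t0) *. e1 + sin (t + t0) *. e2"
	have "continuous_on UNIV ?\<gamma>" by (intro continuous_intros)
	moreover have "?\<gamma> t \<in> sphere 0 1" for t
	proof -
		have "?\<gamma> t \<bullet> ?\<gamma> t = (cos (t + t0))\<^sup>2 + (sin (t + t0))\<^sup>2"
			using e by (simp add: inner_add_left inner_add_right inner_commute[of e2 e1] power2_eq_square)
		thus ?thesis by (simp add: norm_eq_sqrt_inner)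
	qed
	moreover have "\<nu> x0 = ?\<gamma> 0" using nx t0 by simp
	ultimately have "\<exists>L. continuous_map euclidean (mtop S) L \<and> (\<forall>t. \<nu> (L t) = ?\<gamma> t) \<and> L 0 = x0"
		by (intro compact_local_homeo.path_lifting[OF nu_local_homeo _ _ x0])
	then obtain \<sigma> where \<sigma>: "continuous_map euclidean (mtop S) \<sigma>" "\<forall>t. \<nu> (\<sigma> t) = ?\<gamma> t" by (elim exE conjE)
	have "closed_curve r S f \<nu> \<kappa>0 e1 e2 t0 \<sigma>"
		by (intro closed_curve.intro[OF compact_hypersurface_axioms] closed_curve_axioms.intro e spec[OF basis] \<sigma>(1) spec[OF \<sigma>(2)])
	thus ?thesis by (rule closed_curve.curve)
qed

section \<open>Null wave fronts\<close>

text \<open>The inverse of the passage from a covector to \<open>xi_hat\<close>. As a linear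
  isomorphism onto the dual it also defines one of the affine charts of the projective
  space.\<close>

definition lorentz_dual :: "real \<times> 'b::euclidean_space => (real \<times> 'b) \<Rightarrow>\<^sub>L real" where
	"lorentz_dual w = blinfun_inner_right (- fst w, snd w)"

lemma lorentz_dual_apply: "blinfun_apply (lorentz_dual w) x = lorentz w x"
	by (simp add: lorentz_dual_def lorentz_def inner_prod_def)

lemma lorentz_dual_linear: "linear (lorentz_dual :: real \<times> 'b::euclidean_space => _)"
proof (rule linearI)
	fix v w :: "real \<times> 'b" and a :: real
	show "lorentz_dual (v + w) = lorentz_dual v + lorentz_dual w"
		by (rule blinfun_eqI) (simp add: lorentz_dual_apply lorentz_def plus_blinfun.rep_eq algebra_simps inner_add_left)
	show "lorentz_dual (a *. v) = a *. lorentz_dual v"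
		by (rule blinfun_eqI) (simp add: lorentz_dual_apply lorentz_def scaleR_blinfun.rep_eq algebra_simps)
qed

lemma lorentz_dual_inj:
	assumes "lorentz_dual v = lorentz_dual w"
	shows "v = w"
proof -
	have eq: "lorentz v x = lorentz w x" for x
		using arg_cong[OF assms, of "\<lambda>B. blinfun_apply B x"] by (simp add: lorentz_dual_apply)
	have "fst v = fst w" using eq[of "(1, 0)"] by (simp add: lorentz_def)
	moreover have "snd v \<bullet> y = snd w \<bullet> y" for y using eq[of "(0, y)"] by (simp add: lorentz_def)
	hence "snd v = snd w" by (metis vector_eq_rdot)
	ultimately show ?thesis by (rule prod_eqI)
qed

lemma lorentz_dual_bij: "bij (lorentz_dual :: real \<times> 'b::euclidean_space => _)"
proof (rule bijI)
	show "inj (lorentz_dual :: real \<times> 'b => _)" by (rule injI) (rule lorentz_dual_inj)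
	show "surj (lorentz_dual :: real \<times> 'b => _)"
	proof (rule surjI[of _ "\<lambda>B. let z = (\<Sum>b\<in>Basis. blinfun_apply B b *. b) in (- fst z, snd z)"])
		fix B :: "(real \<times> 'b) \<Rightarrow>\<^sub>L real"
		define z where "z = (\<Sum>b\<in>Basis. blinfun_apply B b *. b)"
		have "z \<bullet> x = blinfun_apply B x" for x
		proof -
			have "z \<bullet> x = (\<Sum>b\<in>Basis. (x \<bullet> b) * blinfun_apply B b)"
				unfolding z_def inner_sum_left by (intro sum.cong refl) (simp add: inner_commute mult.commute)
			also have "\<dots> = blinfun_apply B x"
				using linear_euclidean_expand[of "blinfun_apply B" x] blinfun.bounded_linear_right[of B]
				by (simp add: linear_conv_bounded_linear)
			finally show ?thesis .
		qed
		hence "lorentz_dual (- fst z, snd z) = B"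
			by (intro blinfun_eqI) (simp add: lorentz_dual_def)
		thus "lorentz_dual (let z = \<Sum>b\<in>Basis. blinfun_apply B b *. b in (- fst z, snd z)) = B"
			unfolding z_def Let_def .
	qed
qed

lemma affine_point_inj:
	assumes L: "linear L" "bij L" and eq: "affine_point L y = affine_point L z"
	shows "y = z"
proof -
	have "L (1, y) \<in> span {L (1, z)}" using eq span_base[of "L (1, y)" "{L (1, y)}"] by (simp add: affine_point_def)
	then obtain a where "L (1, y) = a *. L (1, z)" unfolding span_singleton by blast
	also have "\<dots> = L (a *. (1, z))" by (rule linear_scale[OF L(1), symmetric])
	finally have "(1 :: real, y) = a *. (1, z)" by (rule injD[OF bij_is_inj[OF L(2)]])
	thus ?thesis by simp
qed

lemma xi_hat_dual: "lorentz_dual (xi_hat \<alpha> p) = \<alpha> p"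
proof -
	obtain w where w: "\<alpha> p = lorentz_dual w" using bij_is_surj[OF lorentz_dual_bij] by (rule surjE)
	have "xi_hat \<alpha> p = w"
		unfolding xi_hat_def
	proof (rule the_equality)
		show "\<forall>x. lorentz w x = blinfun_apply (\<alpha> p) x" by (simp add: w lorentz_dual_apply)
		fix v assume v: "\<forall>x. lorentz v x = blinfun_apply (\<alpha> p) x"
		have "lorentz_dual v = lorentz_dual w"
		proof (rule blinfun_eqI)
			fix x show "blinfun_apply (lorentz_dual v) x = blinfun_apply (lorentz_dual w) x"
				unfolding w[symmetric] lorentz_dual_apply[of v] by (rule spec[OF v])
		qed
		thus "v = w" by (rule lorentz_dual_inj)
	qed
	thus ?thesis by (simp add: w)
qed

lemma light_likeD:
	assumes "light_like w"
	shows "fst w \<noteq> 0" "norm (snd w /\<^sub>R fst w) = 1"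
proof -
	have eq: "snd w \<bullet> snd w = fst w * fst w" using assms by (simp add: light_like_def lorentz_def)
	show f: "fst w \<noteq> 0"
	proof
		assume "fst w = 0"
		with eq have "snd w = 0" by simp
		with \<open>fst w = 0\<close> assms show False by (simp add: light_like_def prod_eq_iff)
	qed
	have "norm (snd w) = \<bar>fst w\<bar>" using eq by (simp add: norm_eq_sqrt_inner)
	thus "norm (snd w /\<^sub>R fst w) = 1" using f by simp
qed

lemma xi_hat_E_eq:
	assumes l: "light_like (xi_hat \<alpha> p)"
	shows "xi_hat_E \<alpha> p = (1, snd (xi_hat \<alpha> p) /\<^sub>R fst (xi_hat \<alpha> p))"
proof -
	define w where "w = xi_hat \<alpha> p"
	have f: "fst w \<noteq> 0" and n: "norm (snd w /\<^sub>R fst w) = 1" using light_likeD[OF l] by (simp_all add: w_def)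
	let ?e = "(1 :: real, snd w /\<^sub>R fst w)"
	have norm_e: "norm ?e = sqrt 2" using n by (simp add: norm_Pair)
	have ae: "a *. w = (a * fst w) *. ?e" for a using f by (simp add: prod_eq_iff)
	show ?thesis
		unfolding xi_hat_E_def w_def[symmetric]
	proof (rule the_equality, intro conjI)
		show "\<exists>a. ?e = a *. w" by (rule exI[of _ "inverse (fst w)"]) (use f in \<open>simp add: prod_eq_iff\<close>)
		show "0 < fst ?e" by simp
		show "norm ?e = sqrt 2" by (rule norm_e)
		fix v assume v: "(\<exists>a. v = a *. w) \<and> 0 < fst v \<and> norm v = sqrt 2"
		then obtain a where a: "v = a *. w" by blast
		have ve: "v = (a * fst w) *. ?e" unfolding a by (rule ae)
		have "0 < a * fst w" using v unfolding a by simp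
		moreover have "\<bar>a * fst w\<bar> * sqrt 2 = sqrt 2" using v unfolding ve norm_scaleR norm_e by blast
		ultimately have "a * fst w = 1" by simp
		thus "v = ?e" unfolding ve by simp
	qed
qed

locale complete_null_front = cr_manifold r M
	for r :: regularity and M :: "('m, real ^ 'n) mfd" +
	fixes F :: "'m => real \<times> (real ^ 'n)" and \<alpha> :: "'m => (real \<times> (real ^ 'n)) \<Rightarrow>\<^sub>L real"
	assumes card_n: "2 \<le> CARD('n)" and front: "null_wave_front r M F \<alpha>" and complete: "complete_front r M F \<alpha>"
begin

text \<open>A light-like vector has non-zero time component, so the whole lift stays in the single
  affine chart given by \<open>lorentz_dual\<close>, and the normal is its coordinate there.
  Smoothness and the immersion property then come directly from the lift.\<close>

definition normal :: "'m => real ^ 'n" where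
	"normal p = inv (affine_point lorentz_dual) (span {\<alpha> p})"

lemma wave: "wave_front r M F \<alpha>" and light: "p \<in> pts M ==> light_like (xi_hat \<alpha> p)"
	using front by (simp_all add: null_wave_front_def)

lemma cr_F: "cr_fun r M F"
	using wave by (simp add: wave_front_def Cr_map_flat_iff)

lemma normal_eq:
	assumes p: "p \<in> pts M"
	shows "normal p = snd (xi_hat \<alpha> p) /\<^sub>R fst (xi_hat \<alpha> p)" "span {\<alpha> p} = affine_point lorentz_dual (normal p)"
proof -
	define w where "w = xi_hat \<alpha> p"
	have f: "fst w \<noteq> 0" using light_likeD[OF light[OF p]] by (simp add: w_def)
	let ?e = "(1, snd w /\<^sub>R fst w)"
	have "w = fst w *. ?e" using f by (simp add: prod_eq_iff)
	hence "\<alpha> p = fst w *. lorentz_dual ?e"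
		using xi_hat_dual[of \<alpha> p] linear_scale[OF lorentz_dual_linear, of "fst w" ?e] by (simp add: w_def)
	hence sp: "span {\<alpha> p} = affine_point lorentz_dual (snd w /\<^sub>R fst w)"
		unfolding affine_point_def using span_image_scale[of "{lorentz_dual ?e}" "\<lambda>_. fst w"] f by simp
	have "inj (affine_point (lorentz_dual :: real \<times> (real ^ 'n) => _))"
		by (rule injI) (rule affine_point_inj[OF lorentz_dual_linear lorentz_dual_bij])
	from inv_f_f[OF this] have "normal p = snd w /\<^sub>R fst w" unfolding normal_def sp .
	thus "normal p = snd (xi_hat \<alpha> p) /\<^sub>R fst (xi_hat \<alpha> p)" "span {\<alpha> p} = affine_point lorentz_dual (normal p)"
		using sp by (simp_all add: w_def)
qed

lemma norm_normal: "p \<in> pts M ==> norm (normal p) = 1"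
	using normal_eq(1) light_likeD(2)[OF light] by simp

lemma xi_hat_E_normal: "p \<in> pts M ==> xi_hat_E \<alpha> p = (1, normal p)"
	using xi_hat_E_eq[OF light] normal_eq(1) by simp

abbreviation lift_chart where
	"lift_chart \<equiv> (UNIV \<times> range (affine_point lorentz_dual), map_prod id (inv (affine_point lorentz_dual)))
		 :: ((real \<times> (real ^ 'n)) \<times> ((real \<times> (real ^ 'n)) \<Rightarrow>\<^sub>L real) set, (real \<times> (real ^ 'n)) \<times> (real ^ 'n)) chart"

lemma lift_chart: "lift_chart \<in> charts (mfd_prod flat proj_space)"
proof -
	have "(UNIV, id) \<in> charts (flat :: (real \<times> (real ^ 'n), _) mfd)" by (simp add: flat_def)
	moreover have "(range (affine_point lorentz_dual), inv (affine_point lorentz_dual))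
			\<in> charts (proj_space :: (((real \<times> (real ^ 'n)) \<Rightarrow>\<^sub>L real) set, real ^ 'n) mfd)"
		using lorentz_dual_linear lorentz_dual_bij unfolding proj_space_def mfd.simps by blast
	ultimately show ?thesis unfolding mfd_prod_def mfd.simps by blast
qed

lemma lift_immersion:
	"Cr_immersion r M (mfd_prod flat (proj_space :: (((real \<times> (real ^ 'n)) \<Rightarrow>\<^sub>L real) set, real ^ 'n) mfd)) (\<lambda>p. (F p, span {\<alpha> p}))"
	using wave unfolding wave_front_def by blast

lemma lift_chart_comp: "snd lift_chart \<circ> (\<lambda>p. (F p, span {\<alpha> p})) = (\<lambda>p. (F p, normal p))"
	by (simp add: fun_eq_iff normal_def)

lemma cr_lift: "cr_fun r M (\<lambda>p. (F p, normal p))"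
	unfolding cr_fun_def
proof
	fix c assume c: "c \<in> charts M"
	have "Cr_on r (snd lift_chart \<circ> (\<lambda>p. (F p, span {\<alpha> p})) \<circ> chart_inv c)
			(snd c ` (fst c \<inter> (\<lambda>p. (F p, span {\<alpha> p})) -` fst lift_chart))"
		using lift_immersion c lift_chart unfolding Cr_immersion_def Cr_map_def by blast
	moreover have "fst c \<inter> (\<lambda>p. (F p, span {\<alpha> p})) -` fst lift_chart = fst c"
		using normal_eq(2) chart_subset[OF c] by auto
	ultimately show "Cr_on r ((\<lambda>p. (F p, normal p)) \<circ> chart_inv c) (cod c)"
		unfolding lift_chart_comp by simp
qed

lemma cr_normal: "cr_fun r M normal"
	using cr_fun_linear[OF cr_lift bounded_linear_snd] by simp

lemma lift_immersed:
	assumes c: "c \<in> charts_at M p" and z: "der c F p u = 0" "der c normal p u = 0"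
	shows "u = 0"
proof -
	have p: "p \<in> pts M" by (rule charts_at_topspace[OF c])
	have "lift_chart \<in> charts_at (mfd_prod flat proj_space) (F p, span {\<alpha> p})"
		unfolding charts_at_def using lift_chart normal_eq(2)[OF p] by simp
	moreover have "immersion_at M (mfd_prod flat (proj_space :: (((real \<times> (real ^ 'n)) \<Rightarrow>\<^sub>L real) set, real ^ 'n) mfd)) (\<lambda>p. (F p, span {\<alpha> p})) p"
		using lift_immersion p unfolding Cr_immersion_def by blast
	ultimately have "inj_on (differential M (snd lift_chart \<circ> (\<lambda>p. (F p, span {\<alpha> p}))) p) (tangent_space M p)"
		unfolding immersion_at_def by (rule bspec[rotated])
	hence "inj (der c (\<lambda>p. (F p, normal p)) p)"
		unfolding lift_chart_comp inj_on_differential_iff[OF cr_lift c] .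
	moreover have "der c (\<lambda>p. (F p, normal p)) p = (\<lambda>u. (der c F p u, der c normal p u))"
		by (rule chart_deriv_eqI[of "\<lambda>p. (F p, normal p)" c _ p])
			(rule has_derivative_Pair[OF chart_deriv_works[OF cr_F c] chart_deriv_works[OF cr_normal c]])
	moreover have "linear (der c (\<lambda>p. (F p, normal p)) p)" by (rule chart_deriv_linear[OF cr_lift c])
	ultimately show ?thesis using z linear_injective_0[of "der c (\<lambda>p. (F p, normal p)) p"] by (simp add: zero_prod_def)
qed

lemma contact:
	assumes c: "c \<in> charts_at M p"
	shows "fst (der c F p u) = normal p \<bullet> snd (der c F p u)"
proof -
	have p: "p \<in> pts M" by (rule charts_at_topspace[OF c])
	define w where "w = xi_hat \<alpha> p"
	have f: "fst w \<noteq> 0" using light_likeD[OF light[OF p]] by (simp add: w_def)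
	obtain v where v: "v \<in> tangent_space M p" "v c = u" using ex_tangent[OF c] by blast
	have "blinfun_apply (\<alpha> p) (differential M F p v) = 0" using wave p v(1) unfolding wave_front_def by blast
	hence "lorentz w (der c F p u) = 0"
		unfolding differential_chart[OF cr_F v(1) c] v(2) using lorentz_dual_apply[of w] xi_hat_dual[of \<alpha> p] by (simp add: w_def)
	hence "fst w * fst (der c F p u) = snd w \<bullet> snd (der c F p u)" by (simp add: lorentz_def)
	thus ?thesis unfolding normal_eq(1)[OF p] w_def[symmetric] using f by (simp add: field_simps)
qed

lemma ex_null_field:
	"\<exists>\<xi>. E_normalized_null_field r M F \<alpha> \<xi> \<and> (\<forall>p\<in>pts M. \<exists>\<gamma>. integral_curve M \<xi> UNIV \<gamma> \<and> p \<in> range \<gamma>)"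
	using complete unfolding complete_front_def L_complete_def by blast

text \<open>The velocity of the image curve has time component 1, so the curve runs along its
  light-like line with time as parameter; its constant velocity is (1, normal).\<close>

lemma null_curve:
	assumes \<xi>: "E_normalized_null_field r M F \<alpha> \<xi>" and \<gamma>: "integral_curve M \<xi> UNIV \<gamma>"
	shows "continuous_map euclidean (mtop M) \<gamma>" "F (\<gamma> s) = F (\<gamma> 0) + s *. (1, normal (\<gamma> 0))" "normal (\<gamma> s) = normal (\<gamma> 0)"
proof -
	show cont: "continuous_map euclidean (mtop M) \<gamma>" using \<gamma> by (simp add: integral_curve_def)
	have top: "\<gamma> s \<in> pts M" for s using continuous_map_image_subset_topspace[OF cont] by auto
	have vel: "((\<lambda>s. F (\<gamma> s)) has_vector_derivative (1, normal (\<gamma> s))) (at s)" for s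
	proof -
		obtain c where c: "c \<in> charts_at M (\<gamma> s)" using ex_chart[OF top[of s]] by blast
		have c': "c \<in> charts M" "\<gamma> s \<in> fst c" using charts_atD[OF c] by blast+
		have "\<xi> (\<gamma> s) \<in> tangent_space M (\<gamma> s)" "differential M F (\<gamma> s) (\<xi> (\<gamma> s)) = xi_hat_E \<alpha> (\<gamma> s)"
			using \<xi> top[of s] by (simp_all add: E_normalized_null_field_def Cr_vector_field_def)
		hence dF: "der c F (\<gamma> s) (\<xi> (\<gamma> s) c) = (1, normal (\<gamma> s))"
			using differential_chart[OF cr_F _ c] xi_hat_E_normal[OF top[of s]] by simp
		have "((\<lambda>s. snd c (\<gamma> s)) has_vector_derivative \<xi> (\<gamma> s) c) (at s)"
			using \<gamma> c unfolding integral_curve_def o_def by blast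
		from has_derivative_compose[OF this[unfolded has_vector_derivative_def] chart_deriv_works[OF cr_F c]]
		have "((\<lambda>t. F (chart_inv c (snd c (\<gamma> t)))) has_derivative (\<lambda>h. der c F (\<gamma> s) (h *. \<xi> (\<gamma> s) c))) (at s)" .
		moreover have "openin euclideanreal {t \<in> topspace euclideanreal. \<gamma> t \<in> fst c}"
			by (rule openin_continuous_map_preimage[OF cont chart_openin[OF c'(1)]])
		hence "open {t. \<gamma> t \<in> fst c}" by simp
		ultimately have "((\<lambda>t. F (\<gamma> t)) has_derivative (\<lambda>h. der c F (\<gamma> s) (h *. \<xi> (\<gamma> s) c))) (at s)"
			by (rule has_derivative_transform_within_open) (use c' in simp_all)
		thus ?thesis
			unfolding has_vector_derivative_def linear_scale[OF chart_deriv_linear[OF cr_F c]] dF .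
	qed
	have "\<exists>l. light_like_line l \<and> F ` \<gamma> ` UNIV \<subseteq> l" using \<xi> \<gamma> unfolding E_normalized_null_field_def by blast
	then obtain q v where v: "light_like v" "F ` \<gamma> ` UNIV \<subseteq> {q + s *. v | s. True}"
		unfolding light_like_line_def by blast
	have fv: "fst v \<noteq> 0" by (rule light_likeD(1)[OF v(1)])
	let ?T = "\<lambda>s. fst (F (\<gamma> s))"
	have T: "?T s = ?T 0 + s" for s
	proof -
		have "((\<lambda>s. ?T s - s) has_real_derivative 0) (at s)" for s
		proof -
			have "((\<lambda>s. ?T s) has_derivative (\<lambda>h. fst (h *. (1, normal (\<gamma> s))))) (at s)"
				by (rule has_derivative_fst[OF vel[unfolded has_vector_derivative_def]])
			from has_derivative_diff[OF this has_derivative_ident]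
			show ?thesis unfolding has_field_derivative_def by (rule has_derivative_eq_rhs) (simp add: fun_eq_iff)
		qed
		from DERIV_const_ratio_const[of "0::real" s "\<lambda>s. ?T s - s" 0] this show ?thesis
			by (cases "s = 0") auto
	qed
	have line: "F (\<gamma> s) = F (\<gamma> 0) + s *. (v /\<^sub>R fst v)" for s
	proof -
		have "F (\<gamma> s) \<in> {q + s *. v | s. True}" "F (\<gamma> 0) \<in> {q + s *. v | s. True}" using v(2) by blast+
		then obtain a b where ab: "F (\<gamma> s) = q + a *. v" "F (\<gamma> 0) = q + b *. v" by blast
		have "(a - b) * fst v = s" using T[of s] unfolding ab by (simp add: algebra_simps)
		hence "a - b = s * inverse (fst v)" using fv by (simp add: field_simps)
		hence "s *. (v /\<^sub>R fst v) = (a - b) *. v" by simp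
		thus ?thesis unfolding ab by (simp add: algebra_simps)
	qed
	\<comment> \<open>The image curve is now known to be affine; its velocity is compared with the one
	  computed from the null field.\<close>
	have dir: "(1, normal (\<gamma> s)) = v /\<^sub>R fst v" for s
	proof -
		have "((\<lambda>s. F (\<gamma> 0) + s *. (v /\<^sub>R fst v)) has_vector_derivative 0 + 1 *. (v /\<^sub>R fst v)) (at s)"
			by (intro has_vector_derivative_add_const[THEN iffD2] derivative_intros) (auto intro!: derivative_eq_intros simp: has_vector_derivative_def)
		moreover have "(\<lambda>s. F (\<gamma> s)) = (\<lambda>s. F (\<gamma> 0) + s *. (v /\<^sub>R fst v))" using line by (rule ext)
		ultimately show ?thesis using vector_derivative_unique_at[OF vel[of s]] by simp
	qed
	show "F (\<gamma> s) = F (\<gamma> 0) + s *. (1, normal (\<gamma> 0))" unfolding dir by (rule line)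
	have "(1::real, normal (\<gamma> s)) = (1, normal (\<gamma> 0))" unfolding dir ..
	thus "normal (\<gamma> s) = normal (\<gamma> 0)" by simp
qed

lemma integral_curve_shift:
	assumes "integral_curve M \<xi> UNIV \<gamma>"
	shows "integral_curve M \<xi> UNIV (\<lambda>s. \<gamma> (s + a))"
proof -
	have \<gamma>: "continuous_map euclidean (mtop M) \<gamma>"
		"\<And>s c. c \<in> charts_at M (\<gamma> s) ==> ((\<lambda>s. snd c (\<gamma> s)) has_vector_derivative \<xi> (\<gamma> s) c) (at s)"
		using assms by (simp_all add: integral_curve_def o_def)
	have "continuous_map euclideanreal euclideanreal (\<lambda>s. s + a)" by (simp add: continuous_map_iff_continuous2 continuous_intros)
	from continuous_map_compose[OF this \<gamma>(1)] have "continuous_map euclidean (mtop M) (\<lambda>s. \<gamma> (s + a))" unfolding o_def .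
	moreover have "((\<lambda>s. snd c (\<gamma> (s + a))) has_vector_derivative \<xi> (\<gamma> (s + a)) c) (at s)" if "c \<in> charts_at M (\<gamma> (s + a))" for s c
	proof -
		have "((\<lambda>s. s + a) has_derivative (\<lambda>h. h)) (at s)" by (auto intro!: derivative_eq_intros)
		from has_derivative_compose[OF this \<gamma>(2)[OF that, unfolded has_vector_derivative_def]]
		show ?thesis unfolding has_vector_derivative_def .
	qed
	ultimately show ?thesis by (simp add: integral_curve_def o_def is_interval_univ)
qed

lemma ex_curve:
	assumes p: "p \<in> pts M"
	shows "\<exists>\<xi> \<gamma>. E_normalized_null_field r M F \<alpha> \<xi> \<and> integral_curve M \<xi> UNIV \<gamma> \<and> \<gamma> 0 = p"
proof -
	from ex_null_field obtain \<xi> where \<xi>: "E_normalized_null_field r M F \<alpha> \<xi>"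
		"\<forall>p\<in>pts M. \<exists>\<gamma>. integral_curve M \<xi> UNIV \<gamma> \<and> p \<in> range \<gamma>" by (elim exE conjE)
	from bspec[OF \<xi>(2) p] obtain \<gamma> where \<gamma>: "integral_curve M \<xi> UNIV \<gamma>" "p \<in> range \<gamma>" by (elim exE conjE)
	from \<gamma>(2) obtain a where a: "p = \<gamma> a" by (rule rangeE)
	show ?thesis
		by (rule exI[of _ \<xi>], rule exI[of _ "\<lambda>s. \<gamma> (s + a)"], intro conjI \<xi>(1) integral_curve_shift \<gamma>(1)) (simp add: a)
qed

text \<open>The direction is the null field itself: the normal is constant along its integral
  curves, so the derivative of the normal annihilates it.\<close>

lemma ex_direction:
	assumes c: "c \<in> charts_at M p"
	shows "\<exists>X. der c F p X = (1, normal p) \<and> der c normal p X = 0"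
proof -
	have p: "p \<in> pts M" by (rule charts_at_topspace[OF c])
	note c' = charts_atD[OF c]
	from ex_curve[OF p] obtain \<xi> \<gamma> where \<xi>: "E_normalized_null_field r M F \<alpha> \<xi>" and \<gamma>: "integral_curve M \<xi> UNIV \<gamma>" "\<gamma> 0 = p"
		by (elim exE conjE)
	note nc = null_curve[OF \<xi> \<gamma>(1)]
	have "\<xi> p \<in> tangent_space M p" "differential M F p (\<xi> p) = xi_hat_E \<alpha> p"
		using \<xi> p by (simp_all add: E_normalized_null_field_def Cr_vector_field_def)
	hence dF: "der c F p (\<xi> p c) = (1, normal p)"
		using differential_chart[OF cr_F _ c] xi_hat_E_normal[OF p] by simp
	have c0: "c \<in> charts_at M (\<gamma> 0)" using c \<gamma>(2) by simp
	have "((\<lambda>s. snd c (\<gamma> s)) has_vector_derivative \<xi> (\<gamma> 0) c) (at 0)"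
		using \<gamma>(1) c0 unfolding integral_curve_def o_def by blast
	from has_derivative_compose[OF this[unfolded has_vector_derivative_def] chart_deriv_works[OF cr_normal c0]]
	have "((\<lambda>t. normal (chart_inv c (snd c (\<gamma> t)))) has_derivative (\<lambda>h. der c normal (\<gamma> 0) (h *. \<xi> (\<gamma> 0) c))) (at 0)" .
	moreover have "openin euclideanreal {t \<in> topspace euclideanreal. \<gamma> t \<in> fst c}"
		by (rule openin_continuous_map_preimage[OF nc(1) chart_openin[OF c'(1)]])
	hence "open {t. \<gamma> t \<in> fst c}" by simp
	ultimately have "((\<lambda>t. normal (\<gamma> 0)) has_derivative (\<lambda>h. der c normal (\<gamma> 0) (h *. \<xi> (\<gamma> 0) c))) (at 0)"
	proof (rule has_derivative_transform_within_open)
		show "0 \<in> {t. \<gamma> t \<in> fst c}" using c'(2) \<gamma>(2) by simp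
		fix t assume "t \<in> {t. \<gamma> t \<in> fst c}"
		thus "normal (chart_inv c (snd c (\<gamma> t))) = normal (\<gamma> 0)"
			using chart_inv_left[OF c'(1)] nc(3) by simp
	qed
	from has_derivative_unique[OF this has_derivative_const]
	have "(\<lambda>h. der c normal (\<gamma> 0) (h *. \<xi> (\<gamma> 0) c)) = (\<lambda>h. 0)" .
	from fun_cong[OF this, of 1] have "der c normal p (\<xi> p c) = 0" using \<gamma>(2) by simp
	with dF show ?thesis by (intro exI[of _ "\<xi> p c"] conjI)
qed

lemma null_front:
	assumes "CARD('k::finite) = CARD('n) - 1"
	shows "null_front TYPE('k) r M F normal"
proof (rule null_front.intro[OF cr_manifold_axioms null_front_axioms.intro])
	show "2 \<le> CARD('n)" "CARD('k) = CARD('n) - 1" by (rule card_n, rule assms)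
	show "cr_fun r M F" "cr_fun r M normal" by (rule cr_F, rule cr_normal)
	show "norm (normal p) = 1" if "p \<in> pts M" for p by (rule norm_normal[OF that])
	show "fst (der c F p u) = normal p \<bullet> snd (der c F p u)" if "c \<in> charts_at M p" for c p u
		by (rule contact[OF that])
	show "u = 0" if "c \<in> charts_at M p" "der c F p u = 0" "der c normal p u = 0" for c p u
		by (rule lift_immersed[OF that])
	show "\<exists>X. der c F p X = (1, normal p) \<and> der c normal p X = 0" if "c \<in> charts_at M p" for c p
		by (rule ex_direction[OF that])
	fix p assume p: "p \<in> pts M"
	from ex_curve[OF p] obtain \<xi> \<gamma> where \<xi>: "E_normalized_null_field r M F \<alpha> \<xi>" and \<gamma>: "integral_curve M \<xi> UNIV \<gamma>" "\<gamma> 0 = p"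
		by (elim exE conjE)
	note nc = null_curve[OF \<xi> \<gamma>(1), unfolded \<gamma>(2)]
	show "\<exists>\<gamma>. \<gamma> 0 = p \<and> continuous_map euclidean (mtop M) \<gamma> \<and> (\<forall>s. F (\<gamma> s) = F p + s *. (1, normal p)) \<and> (\<forall>s. normal (\<gamma> s) = normal p)"
		by (rule exI[of _ \<gamma>]) (intro conjI allI \<gamma>(2) nc)
qed

end

lemma (in hypersurface) unit_normal_nu: "unit_normal r S f \<nu>"
	unfolding unit_normal_def
proof (intro conjI ballI)
	show "Cr_map r S flat \<nu>" by (rule Cr_map_flat_iff[THEN iffD2, OF nu])
	fix x assume x: "x \<in> pts S"
	show "norm (\<nu> x) = 1" by (rule norm_nu[OF x])
	fix v assume v: "v \<in> tangent_space S x"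
	obtain c where c: "c \<in> charts_at S x" using ex_chart[OF x] by blast
	show "differential S f x v \<bullet> \<nu> x = 0" unfolding differential_chart[OF f v c] by (rule tangent[OF c])
qed

lemma (in compact_hypersurface) principal_curvature_sign:
	"(\<forall>x\<in>pts S. \<forall>\<kappa>. principal_curvature S f \<nu> x \<kappa> --> 0 < \<kappa>) \<or>
	 (\<forall>x\<in>pts S. \<forall>\<kappa>. principal_curvature S f \<nu> x \<kappa> --> \<kappa> < 0)"
proof -
	from definite obtain s where s: "\<forall>x. \<forall>c\<in>charts_at S x. \<forall>u. u \<noteq> 0 --> 0 < s * sff c x u"
		by (elim exE conjE)
	\<comment> \<open>A principal curvature satisfies d\<nu> v = - \<kappa> df v, so \<open>s\<close>
	  times the form at \<open>v\<close> is \<open>- (s * \<kappa>)\<close> times the squared length of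
	  df v.\<close>
	have neg: "s * \<kappa> < 0" if x: "x \<in> pts S" and pc: "principal_curvature S f \<nu> x \<kappa>" for x \<kappa>
	proof -
		from pc obtain v where v: "v \<in> tangent_space S x" "v \<noteq> (\<lambda>_. 0)" "- differential S \<nu> x v = \<kappa> *. differential S f x v"
			unfolding principal_curvature_def by (elim bexE conjE)
		obtain c where c: "c \<in> charts_at S x" using ex_chart[OF x] by blast
		let ?A = "der c f x (v c)"
		have "v c \<noteq> 0" using tangent_zero[OF v(1) c] v(2) by blast
		hence "0 < s * (?A \<bullet> der c \<nu> x (v c))" using s c by blast
		moreover have "- der c \<nu> x (v c) = \<kappa> *. ?A"
			using v(3) unfolding differential_chart[OF f v(1) c] differential_chart[OF nu v(1) c] .
		hence "der c \<nu> x (v c) = - (\<kappa> *. ?A)" by (metis minus_minus)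
		ultimately have "0 < - (s * \<kappa>) * (?A \<bullet> ?A)" by simp
		moreover have "0 \<le> ?A \<bullet> ?A" by simp
		ultimately have "0 < - (s * \<kappa>)" by (metis mult_nonpos_nonneg not_le)
		thus ?thesis by simp
	qed
	show ?thesis
	proof (cases "s > 0")
		case True
		hence "\<forall>x\<in>pts S. \<forall>\<kappa>. principal_curvature S f \<nu> x \<kappa> --> \<kappa> < 0"
			using neg by (auto simp: mult_less_0_iff)
		thus ?thesis ..
	next
		case False
		hence "\<forall>x\<in>pts S. \<forall>\<kappa>. principal_curvature S f \<nu> x \<kappa> --> 0 < \<kappa>"
			using neg by (auto simp: mult_less_0_iff)
		thus ?thesis ..
	qed
qed

theorem theorem4p4:
	fixes r :: regularity
		and M :: "('m, real ^ 'n) mfd"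
		and F :: "'m \<Rightarrow> real \<times> (real ^ 'n)"
		and \<alpha> :: "'m \<Rightarrow> (real \<times> (real ^ 'n)) \<Rightarrow>\<^sub>L real"
	assumes "2 \<le> CARD('n)"
		and "CARD('k) = CARD('n) - 1"
		and "Cr_manifold r M"
		and "null_wave_front r M F \<alpha>"
		and "complete_front r M F \<alpha>"
	shows "\<exists>c. ((\<forall>p\<in>topspace (mtop M). fst (F p) = 0 \<longrightarrow> p \<notin> singular_set M F) \<longrightarrow> c = 0) \<and>
		 (\<exists>(S :: ('m, real ^ 'k) mfd) f \<nu>.
				Cr_manifold r S \<and> compact_space (mtop S) \<and>
				Cr_immersion r S flat f \<and> unit_normal r S f \<nu> \<and>
				reparametrized_as r M (\<lambda>p. F p - (c, 0)) S (normal_form f \<nu>) \<and>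
				((\<forall>x\<in>topspace (mtop S). \<forall>\<kappa>. principal_curvature S f \<nu> x \<kappa> \<longrightarrow> 0 < \<kappa>) \<or>
				 (\<forall>x\<in>topspace (mtop S). \<forall>\<kappa>. principal_curvature S f \<nu> x \<kappa> \<longrightarrow> \<kappa> < 0)) \<and>
				(3 \<le> CARD('n) \<longrightarrow> compact_convex_hypersurface r S f) \<and>
				(CARD('n) = 2 \<longrightarrow> closed_locally_convex_regular_curve r S f \<nu>))"
proof -
	interpret cnf: complete_null_front r M F \<alpha>
		by (intro complete_null_front.intro cr_manifold.intro complete_null_front_axioms.intro assms)
	interpret nf: null_front r M F cnf.normal "TYPE('k)" by (rule cnf.null_front[OF assms(2)])
	have sing: "singular_set M F \<noteq> {}" "compactin (mtop M) (singular_set M F)"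
		using assms(5) by (simp_all add: complete_front_def)
	from nf.ex_regular_slice[OF sing(2)] obtain a where
		a: "(\<forall>p\<in>pts M. nf.T p = 0 --> p \<notin> singular_set M F) --> a = 0" and reg: "nf.slc a \<inter> singular_set M F = {}"
		by (elim exE conjE)
	let ?S = "nf.slice a" and ?f = "\<lambda>p. snd (F p)"
	have hs: "hypersurface r ?S ?f cnf.normal" by (rule nf.slice_hypersurface[OF reg])
	have slc: "nf.slc a = nf.proj a ` singular_set M F" by (rule nf.slc_eq_proj_singular[OF reg sing])
	have "compactin (mtop M) (nf.slc a)" unfolding slc by (rule image_compactin[OF sing(2) nf.proj_continuous])
	hence comp: "compact_space (mtop ?S)" unfolding nf.slice_def mfd.simps by (rule compact_space_subtopology)
	have ne: "topspace (mtop ?S) \<noteq> {}" unfolding nf.slice_topspace slc using sing(1) by blast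
	from nf.principal_gap[OF sing(2), of a] obtain \<kappa>0 where \<kappa>0: "\<kappa>0 > 0" and gap: "\<forall>x. \<forall>d\<in>charts_at ?S x. \<forall>u \<kappa>. u \<noteq> 0 --> \<kappa> \<noteq> 0 -->
		der d cnf.normal x u = \<kappa> *. der d ?f x u --> \<kappa>0 \<le> \<bar>\<kappa>\<bar>" by (elim exE conjE)
	interpret ch: compact_hypersurface r ?S ?f cnf.normal \<kappa>0
	proof (rule compact_hypersurface.intro[OF hs compact_hypersurface_axioms.intro[OF comp ne \<kappa>0]])
		fix d x u \<kappa>
		assume "d \<in> charts_at ?S x" "u \<noteq> 0" "\<kappa> \<noteq> 0" "der d cnf.normal x u = \<kappa> *. der d ?f x u"
		thus "\<kappa>0 \<le> \<bar>\<kappa>\<bar>" using bspec[OF spec[OF gap]] by blast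
	qed
	show ?thesis
	proof (rule exI[of _ a], rule conjI, rule a[unfolded nf.T_def],
			rule exI[of _ ?S], rule exI[of _ ?f], rule exI[of _ cnf.normal], intro conjI impI)
		show "Cr_manifold r ?S" by (rule nf.slice_manifold)
		show "compact_space (mtop ?S)" by (rule comp)
		show "Cr_immersion r ?S flat ?f" by (rule ch.Cr_immersion_f)
		show "unit_normal r ?S ?f cnf.normal" by (rule ch.unit_normal_nu)
		show "reparametrized_as r M (\<lambda>p. F p - (a, 0)) ?S (normal_form ?f cnf.normal)" by (rule nf.nform_reparametrization)
		show "(\<forall>x\<in>topspace (mtop ?S). \<forall>\<kappa>. principal_curvature ?S ?f cnf.normal x \<kappa> --> 0 < \<kappa>) \<or>
				 (\<forall>x\<in>topspace (mtop ?S). \<forall>\<kappa>. principal_curvature ?S ?f cnf.normal x \<kappa> --> \<kappa> < 0)" by (rule ch.principal_curvature_sign)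
		show "compact_convex_hypersurface r ?S ?f" if "3 \<le> CARD('n)"
			by (rule convex_hypersurface.convex[OF convex_hypersurface.intro[OF ch.compact_hypersurface_axioms convex_hypersurface_axioms.intro[OF that]]])
		show "closed_locally_convex_regular_curve r ?S ?f cnf.normal" if "CARD('n) = 2" by (rule ch.closed_curve[OF that])
	qed
qed

end
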